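(* Let $R=R(X_\ell,S)$ be a simply laced extended affine root system of type $X_\ell$ and nullity $\nu$ with extended affine Weyl group $\mathcal W$. Let $A=(a_{i,j})_{1\le i,j\le \ell}$ be the Cartan matrix of type $X_\ell$, $a_{i,j}=(\alpha_i,\alpha_j)$, and for $1\le r<s\le\nu$ let $n(r,s)=\min\{n\in\mathbb N=\{1,2,\dots\}: c_{r,s}^n\in F(S)\}$. (a) If $$( * )\qquad F(S)\text{ is generated by the elements } c_{r,s}^{\,n(r,s)},\quad 1\le r<s\le\nu,$$ then $\mathcal W$ is isomorphic to the group $\widehat{\mathcal W}$ defined by generators $x_i$ ($1\le i\le\ell$), $y_{i,r}$ ($1\le i\le\ell$, $1\le r\le\nu$), $z_{r,s}$ ($1\le r<s\le\nu$) and the relations (for all admissible indices) $$x_i^2=1,\qquad (x_ix_j)^{a_{i,j}^2+2}=1\ (i\ne j),\qquad x_iy_{j,r}x_i=y_{j,r}y_{i,r}^{-a_{i,j}},$$ $$[z_{r,s},z_{r',s'}]=1,\quad [y_{i,r},z_{r',s'}]=1,\quad [y_{i,r},y_{j,r}]=1,$$ $$[y_{i,r},y_{j,s}]=z_{r,s}^{\,a_{i,j}n(r,s)^{-1}}\quad(1\le r<s\le\nu).$$ (b) If $\ell>1$, then $n(r,s)=1$ for all $r,s$; in particular $( * )$ holds. (c) If $\ell=1$ and $\nu\le 3$, then $( * )$ is automatically satisfied, the presentation reduces to generators $x$, $y_r$ ($1\le r\le \nu$), $z_{r,s}$ ($1\le r<s\le\nu$) and relations $$x^2=1,\quad xy_rx=y_r^{-1},\quad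 [z_{r,s},z_{r',s'}]=1,\quad [y_r,z_{r',s'}]=1,\quad [y_r,y_s]=z_{r,s}^{\,2n(r,s)^{-1}}\ (1\le r<s\le\nu),$$ and the integers $n(r,s)$ are given explicitly, depending on $m=\mathrm{ind}(S)$, as follows: for $\nu=0$ ($m=0$) and $\nu=1$ ($m=1$) there are none; for $\nu=2$: $n(1,2)=2$ if $m=2$, and $n(1,2)=1$ if $m=3$; for $\nu=3$: $(n(1,2),n(1,3),n(2,3))=(2,2,2)$ if $m=3$, $(2,2,1)$ if $m=4$, $(2,1,1)$ if $m=5$, $(1,1,1)$ if $m=6$ or $m=7$.
   Context: Commutators: $[x,y]=x^{-1}y^{-1}xy$. Extended affine root systems. Let $V$ be a nontrivial finite-dimensional real vector space with a positive semidefinite symmetric bilinear form $(\cdot,\cdot)$ with radical $V^0$; for nonisotropic $\alpha$ put $\alpha^\vee=2\alpha/(\alpha,\alpha)$, and for $A\subseteq V$ let $A^\times=\{\alpha\in A:(\alpha,\alpha)\neq0\}$. A subset $R\subseteq V$ is an extended affine root system if: $0\in R$; $-R=R$; $R$ spans $V$; $\alpha\in R^\times\Rightarrow 2\alpha\notin R$; $R$ is discrete; for $\alpha\in R^\times,\beta\in R$ there are integers $d,u\ge0$ such that, for $n\in\mathbb Z$, $\beta+n\alpha\in R\iff -d\le n\le u$, and $(\beta,\alpha^\vee)=d-u$; $R$ is not a union of two nonempty mutually orthogonal subsets $R_1,R_2$; for each isotropic $\sigma\in R$ there is $\alpha\in R^\times$ with $\alpha+\sigma\in R$. Nullity: $\nu=\dim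 V^0$; rank: $\ell=\dim V/V^0$; the type is that of the image of $R$ in $V/V^0$, an irreducible finite root system (with $0$ included). $R$ is simply laced if its type $X_\ell$ is $A_\ell$, $D_\ell$, $E_6$, $E_7$ or $E_8$. A semilattice in $V^0$ is a discrete spanning subset $S$ with $0\in S$ and $S\pm2S\subseteq S$; it is a lattice if $S\pm S\subseteq S$. By known structure theory, for $R$ simply laced one can fix a complement $\dot V$ of $V^0$ in $V$ such that $\dot R=\{\dot\alpha\in\dot V:\dot\alpha+\sigma\in R\text{ for some }\sigma\in V^0\}$ is a finite root system of type $X_\ell$ (with $0$) in $\dot V$ and $R=R(X_\ell,S)=(S+S)\cup(\dot R+S)$ with $S$ a semilattice in $V^0$; if $\ell>1$, $S$ is a lattice. Fix a fundamental system $\alpha_1,\dots,\alpha_\ell$ of $\dot R$, with $(\alpha_i,\alpha_i)=2$, and a $\mathbb Z$-basis $B=\{\sigma_1,\dots,\sigma_\nu\}\subseteq S$ of the lattice $\Lambda$ generated by $S$. Supporting class: for $\sigma\in\Lambda$ let $\mathrm{supp}(\sigma)\subseteq\{1,\dots,\nu\}$ be the set of $r$ for which the coefficient of $\sigma_r$ in $\sigma$ is odd, and $\mathrm{supp}(S)=\{\mathrm{supp}(\sigma):\sigma\in S\}$. Then $S=\biguplus_{J\in\mathrm{supp}(S)}(\sum_{r\in J}\sigma_r+2\Lambda)$, and the index is $\mathrm{ind}(S)=|\mathrm{supp}(S)|-1$. Weyl group: $\tilde V=V\oplus(V^0)^*$, with the form extended from $V$ by $(\dot V,(V^0)^* )=((V^0)^*,(V^0)^*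 )=0$ and $(\sigma_r,\lambda_s)=\delta_{r,s}$, where $\lambda_1,\dots,\lambda_\nu$ is a basis of $(V^0)^*$. For $\alpha\in V^\times$, $w_\alpha(u)=u-(u,\alpha^\vee)\alpha$ ($u\in\tilde V$). The extended affine Weyl group is $\mathcal W=\langle w_\alpha:\alpha\in R^\times\rangle\le GL(\tilde V)$. For $\alpha\in V,\sigma\in V^0$ put $T_\alpha^\sigma(u)=u-(\sigma,u)\alpha+(\alpha,u)\sigma-\frac{(\alpha,\alpha)}2(\sigma,u)\sigma$ and $c_{r,s}=T_{\sigma_r}^{\sigma_s}$. The $c_{r,s}$ ($r<s$) freely generate a free abelian group $C$. For $J\subseteq\{1,\dots,\nu\}$ put $z_J=\prod_{r,s\in J,\,r<s}c_{r,s}$ if $J\in\mathrm{supp}(S)$ (empty product $=1$); $z_J=c_{r,s}^2$ if $J=\{r,s\}\notin\mathrm{supp}(S)$, $r<s$; and $z_J=1$ otherwise. Put $F(S)=\langle z_J:J\subseteq\{1,\dots,\nu\}\rangle\le C$. It is known that $n(r,s)$ divides every $a_{i,j}$. Background on semilattices of rank $\nu\le3$: semilattices $S,S'$ in $V^0$ are similar if $\psi(S)=S'+\sigma'$ for some $\psi\in GL(V^0)$ and $\sigma'\in S'$. Up to similarity, the semilattices of rank $\le3$ have the following supporting classes, according to $m=\mathrm{ind}(S)$. $\nu=0$: $\{\emptyset\}$ ($m=0$). $\nu=1$: $\{\emptyset,\{1\}\}$ ($m=1$). $\nu=2$: $\{\emptyset,\{1\},\{2\}\}$ ($m=2$); $\{\emptyset,\{1\},\{2\},\{1,2\}\}$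 ($m=3$). $\nu=3$: $\{\emptyset,\{1\},\{2\},\{3\}\}$ ($m=3$); this together with $\{2,3\}$ ($m=4$); together with $\{1,3\},\{2,3\}$ ($m=5$); together with $\{1,2\},\{1,3\},\{2,3\}$ ($m=6$); all subsets of $\{1,2,3\}$ ($m=7$).
   Formalization: Relations [x_i,z_{r,s}]=1 are added in (a),(c) when ℓ=1 and some n(r,s)=1, where the printed ones fail; in (c), ( * ) and the n(r,s) values are claimed for choices with supp(S) as listed (every R has one); irreducibility concerns nonisotropic roots. *)

theory Defs
  imports "HOL-Analysis.Analysis" "HOL-Algebra.Bij" "HOL-Algebra.Generated_Groups"
    "HOL-Algebra.FiniteProduct"
begin

section \<open>Semidefinite forms and finite root systems\<close>

text \<open>The space \<open>V\<close> is a type of class \<open>euclidean_space\<close>, i.e. an arbitrary nontrivial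
  finite-dimensional real vector space. Its inner product is used for the topology only;
  the semidefinite form \<open>b\<close> is unrelated to it.\<close>

definition psd_form :: "('v::euclidean_space \<Rightarrow> 'v \<Rightarrow> real) \<Rightarrow> bool" where
  "psd_form b \<longleftrightarrow> bilinear b \<and> (\<forall>x y. b x y = b y x) \<and> (\<forall>x. 0 \<le> b x x)"

definition form_radical :: "('v::euclidean_space \<Rightarrow> 'v \<Rightarrow> real) \<Rightarrow> 'v set" where
  "form_radical b = {x. \<forall>y. b x y = 0}"

definition nullity :: "('v::euclidean_space \<Rightarrow> 'v \<Rightarrow> real) \<Rightarrow> nat" where
  "nullity b = dim (form_radical b)"

definition nonisotropic :: "('v::euclidean_space \<Rightarrow> 'v \<Rightarrow> real) \<Rightarrow> 'v set \<Rightarrow> 'v set" where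
  "nonisotropic b A = {\<alpha> \<in> A. b \<alpha> \<alpha> \<noteq> 0}"

definition coroot :: "('v::euclidean_space \<Rightarrow> 'v \<Rightarrow> real) \<Rightarrow> 'v \<Rightarrow> 'v" where
  "coroot b \<alpha> = (2 / b \<alpha> \<alpha>) *\<^sub>R \<alpha>"

definition finite_root_system ::
    "('v::euclidean_space \<Rightarrow> 'v \<Rightarrow> real) \<Rightarrow> 'v set \<Rightarrow> 'v set \<Rightarrow> bool" where
  "finite_root_system b U \<Phi> \<longleftrightarrow>
     (\<forall>x\<in>U. x \<noteq> 0 \<longrightarrow> 0 < b x x) \<and>
     finite \<Phi> \<and> 0 \<in> \<Phi> \<and> span \<Phi> = U \<and>
     (\<forall>\<alpha>\<in>\<Phi> - {0}. \<forall>\<beta>\<in>\<Phi>. \<beta> - b \<beta> (coroot b \<alpha>) *\<^sub>R \<alpha> \<in> \<Phi> \<and> b \<beta> (coroot b \<alpha>) \<in> \<int>) \<and>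
     (\<forall>\<alpha>\<in>\<Phi> - {0}. \<forall>t. t *\<^sub>R \<alpha> \<in> \<Phi> - {0} \<longrightarrow> t = 1 \<or> t = -1)"

definition fundamental_system :: "'v::euclidean_space set \<Rightarrow> nat \<Rightarrow> (nat \<Rightarrow> 'v) \<Rightarrow> bool" where
  "fundamental_system \<Phi> l \<alpha> \<longleftrightarrow>
     inj_on \<alpha> {1..l} \<and> \<alpha> ` {1..l} \<subseteq> \<Phi> \<and> independent (\<alpha> ` {1..l}) \<and>
     (\<forall>\<beta>\<in>\<Phi>. \<exists>k :: nat \<Rightarrow> int. \<beta> = (\<Sum>i\<in>{1..l}. of_int (k i) *\<^sub>R \<alpha> i) \<and>
        ((\<forall>i\<in>{1..l}. 0 \<le> k i) \<or> (\<forall>i\<in>{1..l}. k i \<le> 0)))"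

datatype ade_type = TypeA nat | TypeD nat | TypeE nat

fun ade_rank :: "ade_type \<Rightarrow> nat" where
  "ade_rank (TypeA l) = l"
| "ade_rank (TypeD l) = l"
| "ade_rank (TypeE l) = l"

fun valid_ade :: "ade_type \<Rightarrow> bool" where
  "valid_ade (TypeA l) \<longleftrightarrow> l \<ge> 1"
| "valid_ade (TypeD l) \<longleftrightarrow> l \<ge> 4"
| "valid_ade (TypeE l) \<longleftrightarrow> l \<in> {6, 7, 8}"

text \<open>Edges \<open>{i, j}\<close>, \<open>i < j\<close>, of the Dynkin diagrams in Bourbaki's numbering.\<close>

fun dynkin_edge :: "ade_type \<Rightarrow> nat \<Rightarrow> nat \<Rightarrow> bool" where
  "dynkin_edge (TypeA l) i j \<longleftrightarrow> j = i + 1"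
| "dynkin_edge (TypeD l) i j \<longleftrightarrow> (j = i + 1 \<and> j < l) \<or> (i = l - 2 \<and> j = l)"
| "dynkin_edge (TypeE l) i j \<longleftrightarrow> (i, j) = (1, 3) \<or> (i, j) = (2, 4) \<or> (3 \<le> i \<and> j = i + 1)"

definition ade_cartan :: "ade_type \<Rightarrow> nat \<Rightarrow> nat \<Rightarrow> int" where
  "ade_cartan X i j =
     (if i = j then 2 else if dynkin_edge X i j \<or> dynkin_edge X j i then -1 else 0)"

definition root_system_of_type ::
    "('v::euclidean_space \<Rightarrow> 'v \<Rightarrow> real) \<Rightarrow> 'v set \<Rightarrow> 'v set \<Rightarrow> ade_type \<Rightarrow> bool" where
  "root_system_of_type b U \<Phi> X \<longleftrightarrow> valid_ade X \<and> finite_root_system b U \<Phi> \<and>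
     (\<exists>\<beta>. fundamental_system \<Phi> (ade_rank X) \<beta> \<and>
        (\<forall>i\<in>{1..ade_rank X}. \<forall>j\<in>{1..ade_rank X}.
           b (\<beta> i) (coroot b (\<beta> j)) = of_int (ade_cartan X i j)))"

section \<open>Extended affine root systems and semilattices\<close>

text \<open>Irreducibility is about the nonisotropic roots: \<open>R\<close> itself is always the union of the
  mutually orthogonal sets \<open>{0}\<close> and \<open>R\<close>.\<close>

definition ears :: "('v::euclidean_space \<Rightarrow> 'v \<Rightarrow> real) \<Rightarrow> 'v set \<Rightarrow> bool" where
  "ears b R \<longleftrightarrow> psd_form b \<and>
     0 \<in> R \<and> uminus ` R = R \<and> span R = UNIV \<and>
     (\<forall>\<alpha>\<in>nonisotropic b R. 2 *\<^sub>R \<alpha> \<notin> R) \<and>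
     discrete R \<and>
     (\<forall>\<alpha>\<in>nonisotropic b R. \<forall>\<beta>\<in>R. \<exists>d u :: nat.
        (\<forall>n :: int. \<beta> + of_int n *\<^sub>R \<alpha> \<in> R \<longleftrightarrow> - int d \<le> n \<and> n \<le> int u) \<and>
        b \<beta> (coroot b \<alpha>) = real d - real u) \<and>
     \<not> (\<exists>R1 R2. R1 \<noteq> {} \<and> R2 \<noteq> {} \<and> nonisotropic b R = R1 \<union> R2 \<and>
          (\<forall>x\<in>R1. \<forall>y\<in>R2. b x y = 0)) \<and>
     (\<forall>\<sigma>\<in>R. b \<sigma> \<sigma> = 0 \<longrightarrow> (\<exists>\<alpha>\<in>nonisotropic b R. \<alpha> + \<sigma> \<in> R))"

definition semilattice_in :: "'v::euclidean_space set \<Rightarrow> 'v set \<Rightarrow> bool" where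
  "semilattice_in U S \<longleftrightarrow> span S = U \<and> discrete S \<and> 0 \<in> S \<and>
     (\<forall>s\<in>S. \<forall>t\<in>S. s + 2 *\<^sub>R t \<in> S \<and> s - 2 *\<^sub>R t \<in> S)"

definition similar_in :: "'v::euclidean_space set \<Rightarrow> 'v set \<Rightarrow> 'v set \<Rightarrow> bool" where
  "similar_in U S S' \<longleftrightarrow>
     (\<exists>\<psi>. linear \<psi> \<and> bij_betw \<psi> U U \<and> (\<exists>\<tau>\<in>S'. \<psi> ` S = (\<lambda>s. s + \<tau>) ` S'))"

definition int_span :: "'v::euclidean_space set \<Rightarrow> 'v set" where
  "int_span A = {\<Sum>x\<in>F. of_int (k x) *\<^sub>R x | F (k :: 'v \<Rightarrow> int). finite F \<and> F \<subseteq> A}"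

definition int_basis :: "'v::euclidean_space set \<Rightarrow> nat \<Rightarrow> (nat \<Rightarrow> 'v) \<Rightarrow> bool" where
  "int_basis L n \<sigma> \<longleftrightarrow>
     L = {\<Sum>r\<in>{1..n}. of_int (k r) *\<^sub>R \<sigma> r | k :: nat \<Rightarrow> int. True} \<and>
     (\<forall>k :: nat \<Rightarrow> int. (\<Sum>r\<in>{1..n}. of_int (k r) *\<^sub>R \<sigma> r) = 0 \<longrightarrow> (\<forall>r\<in>{1..n}. k r = 0))"

definition finite_part ::
    "('v::euclidean_space \<Rightarrow> 'v \<Rightarrow> real) \<Rightarrow> 'v set \<Rightarrow> 'v set \<Rightarrow> 'v set" where
  "finite_part b Vd R = {\<alpha> \<in> Vd. \<exists>\<sigma>\<in>form_radical b. \<alpha> + \<sigma> \<in> R}"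

text \<open>\<open>R = R(X, S)\<close> together with all the choices made: the complement \<open>Vd\<close> of the radical,
  the semilattice \<open>S\<close>, the fundamental system \<open>\<alpha>\<close> and the lattice basis \<open>\<sigma>\<close>.\<close>

definition simply_laced_data ::
    "('v::euclidean_space \<Rightarrow> 'v \<Rightarrow> real) \<Rightarrow> 'v set \<Rightarrow> 'v set \<Rightarrow> 'v set \<Rightarrow> ade_type \<Rightarrow>
     (nat \<Rightarrow> 'v) \<Rightarrow> (nat \<Rightarrow> 'v) \<Rightarrow> bool" where
  "simply_laced_data b R Vd S X \<alpha> \<sigma> \<longleftrightarrow>
     ears b R \<and>
     subspace Vd \<and> Vd \<inter> form_radical b = {0} \<and> {x + y | x y. x \<in> Vd \<and> y \<in> form_radical b} = UNIV \<and>
     root_system_of_type b Vd (finite_part b Vd R) X \<and>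
     semilattice_in (form_radical b) S \<and>
     R = {s + t | s t. s \<in> S \<and> t \<in> S} \<union> {\<beta> + s | \<beta> s. \<beta> \<in> finite_part b Vd R \<and> s \<in> S} \<and>
     fundamental_system (finite_part b Vd R) (ade_rank X) \<alpha> \<and>
     (\<forall>i\<in>{1..ade_rank X}. b (\<alpha> i) (\<alpha> i) = 2) \<and>
     \<sigma> ` {1..nullity b} \<subseteq> S \<and> int_basis (int_span S) (nullity b) \<sigma>"

definition supp :: "nat \<Rightarrow> (nat \<Rightarrow> 'v::euclidean_space) \<Rightarrow> 'v \<Rightarrow> nat set" where
  "supp n \<sigma> x =
     {r \<in> {1..n}. \<exists>k :: nat \<Rightarrow> int. x = (\<Sum>i\<in>{1..n}. of_int (k i) *\<^sub>R \<sigma> i) \<and> odd (k r)}"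

definition supp_class :: "nat \<Rightarrow> (nat \<Rightarrow> 'v::euclidean_space) \<Rightarrow> 'v set \<Rightarrow> nat set set" where
  "supp_class n \<sigma> S = supp n \<sigma> ` S"

definition sl_index :: "nat \<Rightarrow> (nat \<Rightarrow> 'v::euclidean_space) \<Rightarrow> 'v set \<Rightarrow> nat" where
  "sl_index n \<sigma> S = card (supp_class n \<sigma> S) - 1"

section \<open>The extended affine Weyl group\<close>

text \<open>\<open>V \<oplus> (V\<^sup>0)\<^sup>*\<close>: an element of \<open>(V\<^sup>0)\<^sup>*\<close> is represented by its extension to \<open>V\<close> that vanishes
  on the complement \<open>Vd\<close>. With this convention the extended form is the natural pairing, and
  the \<open>\<lambda>\<^sub>s\<close> are the functionals dual to the \<open>\<sigma>\<^sub>r\<close>.\<close>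

definition ext_space :: "'v::euclidean_space set \<Rightarrow> ('v \<times> ('v \<Rightarrow>\<^sub>L real)) set" where
  "ext_space Vd = {u. \<forall>x\<in>Vd. blinfun_apply (snd u) x = 0}"

definition ext_form :: "('v::euclidean_space \<Rightarrow> 'v \<Rightarrow> real) \<Rightarrow>
    'v \<times> ('v \<Rightarrow>\<^sub>L real) \<Rightarrow> 'v \<times> ('v \<Rightarrow>\<^sub>L real) \<Rightarrow> real" where
  "ext_form b u w = b (fst u) (fst w) + blinfun_apply (snd u) (fst w) + blinfun_apply (snd w) (fst u)"

definition GL :: "'a::real_vector set \<Rightarrow> ('a \<Rightarrow> 'a) monoid" where
  "GL U = (BijGroup U)\<lparr>carrier := {g \<in> Bij U.
     (\<forall>x\<in>U. \<forall>y\<in>U. g (x + y) = g x + g y) \<and> (\<forall>t. \<forall>x\<in>U. g (t *\<^sub>R x) = t *\<^sub>R g x)}\<rparr>"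

definition refl_map :: "('v::euclidean_space \<Rightarrow> 'v \<Rightarrow> real) \<Rightarrow> 'v \<Rightarrow>
    'v \<times> ('v \<Rightarrow>\<^sub>L real) \<Rightarrow> 'v \<times> ('v \<Rightarrow>\<^sub>L real)" where
  "refl_map b \<alpha> u = u - ext_form b u (coroot b \<alpha>, 0) *\<^sub>R (\<alpha>, 0)"

definition weyl_group :: "('v::euclidean_space \<Rightarrow> 'v \<Rightarrow> real) \<Rightarrow> 'v set \<Rightarrow> 'v set \<Rightarrow>
    ('v \<times> ('v \<Rightarrow>\<^sub>L real) \<Rightarrow> 'v \<times> ('v \<Rightarrow>\<^sub>L real)) monoid" where
  "weyl_group b Vd R = subgroup_generated (GL (ext_space Vd))
     ((\<lambda>\<alpha>. restrict (refl_map b \<alpha>) (ext_space Vd)) ` nonisotropic b R)"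

definition T_map :: "('v::euclidean_space \<Rightarrow> 'v \<Rightarrow> real) \<Rightarrow> 'v \<Rightarrow> 'v \<Rightarrow>
    'v \<times> ('v \<Rightarrow>\<^sub>L real) \<Rightarrow> 'v \<times> ('v \<Rightarrow>\<^sub>L real)" where
  "T_map b \<alpha> \<sigma> u = u - ext_form b (\<sigma>, 0) u *\<^sub>R (\<alpha>, 0) + ext_form b (\<alpha>, 0) u *\<^sub>R (\<sigma>, 0)
     - (b \<alpha> \<alpha> / 2 * ext_form b (\<sigma>, 0) u) *\<^sub>R (\<sigma>, 0)"

definition index_pairs :: "nat \<Rightarrow> (nat \<times> nat) set" where
  "index_pairs n = {(r, s). 1 \<le> r \<and> r < s \<and> s \<le> n}"

definition c_elem :: "('v::euclidean_space \<Rightarrow> 'v \<Rightarrow> real) \<Rightarrow> 'v set \<Rightarrow> (nat \<Rightarrow> 'v) \<Rightarrow> nat \<Rightarrow> nat \<Rightarrow>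
    'v \<times> ('v \<Rightarrow>\<^sub>L real) \<Rightarrow> 'v \<times> ('v \<Rightarrow>\<^sub>L real)" where
  "c_elem b Vd \<sigma> r s = restrict (T_map b (\<sigma> r) (\<sigma> s)) (ext_space Vd)"

definition C_group :: "('v::euclidean_space \<Rightarrow> 'v \<Rightarrow> real) \<Rightarrow> 'v set \<Rightarrow> (nat \<Rightarrow> 'v) \<Rightarrow>
    ('v \<times> ('v \<Rightarrow>\<^sub>L real) \<Rightarrow> 'v \<times> ('v \<Rightarrow>\<^sub>L real)) monoid" where
  "C_group b Vd \<sigma> = subgroup_generated (GL (ext_space Vd))
     ((\<lambda>(r, s). c_elem b Vd \<sigma> r s) ` index_pairs (nullity b))"

definition z_elem :: "('v::euclidean_space \<Rightarrow> 'v \<Rightarrow> real) \<Rightarrow> 'v set \<Rightarrow> 'v set \<Rightarrow> (nat \<Rightarrow> 'v) \<Rightarrow>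
    nat set \<Rightarrow> 'v \<times> ('v \<Rightarrow>\<^sub>L real) \<Rightarrow> 'v \<times> ('v \<Rightarrow>\<^sub>L real)" where
  "z_elem b Vd S \<sigma> J =
     (if J \<in> supp_class (nullity b) \<sigma> S
      then finprod (C_group b Vd \<sigma>) (\<lambda>(r, s). c_elem b Vd \<sigma> r s) {(r, s). r \<in> J \<and> s \<in> J \<and> r < s}
      else if card J = 2 then c_elem b Vd \<sigma> (Min J) (Max J) [^]\<^bsub>C_group b Vd \<sigma>\<^esub> (2 :: nat)
      else \<one>\<^bsub>C_group b Vd \<sigma>\<^esub>)"

definition F_group :: "('v::euclidean_space \<Rightarrow> 'v \<Rightarrow> real) \<Rightarrow> 'v set \<Rightarrow> 'v set \<Rightarrow> (nat \<Rightarrow> 'v) \<Rightarrow>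
    ('v \<times> ('v \<Rightarrow>\<^sub>L real) \<Rightarrow> 'v \<times> ('v \<Rightarrow>\<^sub>L real)) set" where
  "F_group b Vd S \<sigma> = generate (C_group b Vd \<sigma>) (z_elem b Vd S \<sigma> ` Pow {1..nullity b})"

definition n_exp :: "('v::euclidean_space \<Rightarrow> 'v \<Rightarrow> real) \<Rightarrow> 'v set \<Rightarrow> 'v set \<Rightarrow> (nat \<Rightarrow> 'v) \<Rightarrow>
    nat \<Rightarrow> nat \<Rightarrow> nat" where
  "n_exp b Vd S \<sigma> r s =
     (LEAST n. 1 \<le> n \<and> c_elem b Vd \<sigma> r s [^]\<^bsub>C_group b Vd \<sigma>\<^esub> n \<in> F_group b Vd S \<sigma>)"

definition star_condition ::
    "('v::euclidean_space \<Rightarrow> 'v \<Rightarrow> real) \<Rightarrow> 'v set \<Rightarrow> 'v set \<Rightarrow> (nat \<Rightarrow> 'v) \<Rightarrow> bool" where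
  "star_condition b Vd S \<sigma> \<longleftrightarrow> F_group b Vd S \<sigma> = generate (C_group b Vd \<sigma>)
     ((\<lambda>(r, s). c_elem b Vd \<sigma> r s [^]\<^bsub>C_group b Vd \<sigma>\<^esub> n_exp b Vd S \<sigma> r s) ` index_pairs (nullity b))"

section \<open>Groups given by generators and relations\<close>

text \<open>A word is a list of letters \<open>(g, e)\<close>, standing for \<open>g\<close> if \<open>e\<close> holds and for its inverse
  otherwise; a relation is a pair of words.\<close>

type_synonym 'g word = "('g \<times> bool) list"

definition words :: "'g set \<Rightarrow> 'g word set" where
  "words X = {w. fst ` set w \<subseteq> X}"

inductive word_step :: "'g set \<Rightarrow> ('g word \<times> 'g word) set \<Rightarrow> 'g word \<Rightarrow> 'g word \<Rightarrow> bool"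
  for X rels where
  cancel: "g \<in> X \<Longrightarrow> word_step X rels (u @ [(g, e), (g, \<not> e)] @ v) (u @ v)"
| relation: "(l, r) \<in> rels \<Longrightarrow> word_step X rels (u @ l @ v) (u @ r @ v)"

definition word_rel :: "'g set \<Rightarrow> ('g word \<times> 'g word) set \<Rightarrow> ('g word \<times> 'g word) set" where
  "word_rel X rels = {(u, v). u \<in> words X \<and> v \<in> words X \<and> equivclp (word_step X rels) u v}"

definition presented_group :: "'g set \<Rightarrow> ('g word \<times> 'g word) set \<Rightarrow> 'g word set monoid" where
  "presented_group X rels = \<lparr>carrier = words X // word_rel X rels,
     mult = (\<lambda>A B. \<Union>u\<in>A. \<Union>v\<in>B. word_rel X rels `` {u @ v}),
     one = word_rel X rels `` {[]}\<rparr>"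

definition winv :: "'g word \<Rightarrow> 'g word" where
  "winv w = map (\<lambda>(g, e). (g, \<not> e)) (rev w)"

definition wpow :: "'g word \<Rightarrow> int \<Rightarrow> 'g word" where
  "wpow w k = (if 0 \<le> k then concat (replicate (nat k) w) else concat (replicate (nat (- k)) (winv w)))"

definition wcomm :: "'g word \<Rightarrow> 'g word \<Rightarrow> 'g word" where
  "wcomm u v = winv u @ winv v @ u @ v"

section \<open>The presentations\<close>

datatype weyl_gen = GenX nat | GenY nat nat | GenZ nat nat

abbreviation "wx i \<equiv> [(GenX i, True)]"
abbreviation "wy i r \<equiv> [(GenY i r, True)]"
abbreviation "wz r s \<equiv> [(GenZ r s, True)]"

definition weyl_gens :: "nat \<Rightarrow> nat \<Rightarrow> weyl_gen set" where
  "weyl_gens l n = {GenX i | i. i \<in> {1..l}} \<union> {GenY i r | i r. i \<in> {1..l} \<and> r \<in> {1..n}} \<union>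
     {GenZ r s | r s. (r, s) \<in> index_pairs n}"

text \<open>The division in the last exponent is exact, as \<open>N r s\<close> divides every \<open>a i j\<close> in the
  presentations considered.\<close>

definition weyl_rels :: "nat \<Rightarrow> nat \<Rightarrow> (nat \<Rightarrow> nat \<Rightarrow> int) \<Rightarrow> (nat \<Rightarrow> nat \<Rightarrow> nat) \<Rightarrow>
    (weyl_gen word \<times> weyl_gen word) set" where
  "weyl_rels l n a N =
     {(wpow (wx i) 2, []) | i. i \<in> {1..l}} \<union>
     {(wpow (wx i @ wx j) ((a i j)\<^sup>2 + 2), []) | i j. i \<in> {1..l} \<and> j \<in> {1..l} \<and> i \<noteq> j} \<union>
     {(wx i @ wy j r @ wx i, wy j r @ wpow (wy i r) (- a i j)) | i j r.
        i \<in> {1..l} \<and> j \<in> {1..l} \<and> r \<in> {1..n}} \<union>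
     {(wcomm (wz r s) (wz r' s'), []) | r s r' s'.
        (r, s) \<in> index_pairs n \<and> (r', s') \<in> index_pairs n} \<union>
     {(wcomm (wy i r) (wz r' s'), []) | i r r' s'.
        i \<in> {1..l} \<and> r \<in> {1..n} \<and> (r', s') \<in> index_pairs n} \<union>
     {(wcomm (wy i r) (wy j r), []) | i j r. i \<in> {1..l} \<and> j \<in> {1..l} \<and> r \<in> {1..n}} \<union>
     {(wcomm (wy i r) (wy j s), wpow (wz r s) (a i j div int (N r s))) | i j r s.
        i \<in> {1..l} \<and> j \<in> {1..l} \<and> (r, s) \<in> index_pairs n}"

text \<open>The relations \<open>[x\<^sub>i, z\<^sub>r\<^sub>s] = 1\<close>. They follow from the previous ones if the rank is greater
  than 1 or all \<open>N r s\<close> are 2, because every \<open>z\<^sub>r\<^sub>s\<close> then is, up to inversion, a commutator of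
  two of the \<open>y\<^sub>i\<^sub>r\<close>. In rank 1 with some \<open>N r s = 1\<close> they do not follow, and without them the
  presented group is not isomorphic to the Weyl group: in nullity 2 its Hirsch length is 4
  instead of 3.\<close>

definition xz_rels :: "nat \<Rightarrow> nat \<Rightarrow> (weyl_gen word \<times> weyl_gen word) set" where
  "xz_rels l n = {(wcomm (wx i) (wz r s), []) | i r s. i \<in> {1..l} \<and> (r, s) \<in> index_pairs n}"

datatype rank1_gen = GenX1 | GenY1 nat | GenZ1 nat nat

abbreviation "wx1 \<equiv> [(GenX1, True)]"
abbreviation "wy1 r \<equiv> [(GenY1 r, True)]"
abbreviation "wz1 r s \<equiv> [(GenZ1 r s, True)]"

definition rank1_gens :: "nat \<Rightarrow> rank1_gen set" where
  "rank1_gens n = {GenX1} \<union> {GenY1 r | r. r \<in> {1..n}} \<union> {GenZ1 r s | r s. (r, s) \<in> index_pairs n}"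

definition rank1_rels ::
    "nat \<Rightarrow> (nat \<Rightarrow> nat \<Rightarrow> nat) \<Rightarrow> (rank1_gen word \<times> rank1_gen word) set" where
  "rank1_rels n N =
     {(wpow wx1 2, [])} \<union>
     {(wx1 @ wy1 r @ wx1, winv (wy1 r)) | r. r \<in> {1..n}} \<union>
     {(wcomm (wz1 r s) (wz1 r' s'), []) | r s r' s'.
        (r, s) \<in> index_pairs n \<and> (r', s') \<in> index_pairs n} \<union>
     {(wcomm (wy1 r) (wz1 r' s'), []) | r r' s'. r \<in> {1..n} \<and> (r', s') \<in> index_pairs n} \<union>
     {(wcomm (wy1 r) (wy1 s), wpow (wz1 r s) (2 div int (N r s))) | r s. (r, s) \<in> index_pairs n}"

definition rank1_xz_rels :: "nat \<Rightarrow> (rank1_gen word \<times> rank1_gen word) set" where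
  "rank1_xz_rels n = {(wcomm wx1 (wz1 r s), []) | r s. (r, s) \<in> index_pairs n}"

section \<open>Semilattices of rank at most 3\<close>

text \<open>The supporting classes of the representatives, up to similarity, of the semilattices of
  rank \<open>n\<close> and index \<open>m\<close> (none for other values of \<open>n\<close> and \<open>m\<close>).\<close>

definition standard_supp_class :: "nat \<Rightarrow> nat \<Rightarrow> nat set set \<Rightarrow> bool" where
  "standard_supp_class n m D \<longleftrightarrow> (n, m, D) \<in>
     {(0, 0, {{}}),
      (1, 1, {{}, {1}}),
      (2, 2, {{}, {1}, {2}}),
      (2, 3, {{}, {1}, {2}, {1, 2}}),
      (3, 3, {{}, {1}, {2}, {3}}),
      (3, 4, {{}, {1}, {2}, {3}, {2, 3}}),
      (3, 5, {{}, {1}, {2}, {3}, {1, 3}, {2, 3}}),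
      (3, 6, {{}, {1}, {2}, {3}, {1, 2}, {1, 3}, {2, 3}}),
      (3, 7, Pow {1, 2, 3})}"

text \<open>The values of \<open>n(r, s)\<close> for \<open>r < s\<close> in nullity \<open>n\<close> and index \<open>m\<close>.\<close>

definition n_table :: "nat \<Rightarrow> nat \<Rightarrow> nat \<Rightarrow> nat \<Rightarrow> nat" where
  "n_table n m r s =
     (if n = 2 then (if m = 2 then 2 else 1)
      else if m = 3 then 2
      else if m = 4 then (if (r, s) = (2, 3) then 1 else 2)
      else if m = 5 then (if (r, s) = (1, 2) then 2 else 1)
      else 1)"

end

theory Submission
  imports Defs
begin

text \<open>
  For a root \<open>\<alpha>\<close> of the finite part and \<open>\<sigma> \<in> S\<close> the product of the reflections in \<open>\<alpha> + \<sigma>\<close> and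
  \<open>\<alpha>\<close> is, up to inversion, the unipotent map \<open>T\<^sub>\<alpha>\<^sup>\<sigma>\<close>. The Weyl group is therefore generated by the finite
  Weyl group and by translations along the \<open>\<alpha>\<^sub>i\<close>. Such translations multiply like elements of a Heisenberg
  group: a translation part, which is additive, is extended by a central part in the free abelian group on the
  \<open>c\<^sub>r\<^sub>s\<close>, and the commutator of the translations for \<open>(\<alpha>\<^sub>i, \<sigma>\<^sub>r)\<close> and \<open>(\<alpha>\<^sub>j, \<sigma>\<^sub>s)\<close> is a
  power of \<open>c\<^sub>r\<^sub>s\<close> with exponent \<open>\<plusminus>(\<alpha>\<^sub>i, \<alpha>\<^sub>j)\<close>. Expanding \<open>T\<^sub>\<alpha>\<^sup>\<sigma>\<close> for
  \<open>\<sigma> \<equiv> \<Sum>\<^sub>r\<^sub>\<in>\<^sub>J \<sigma>\<^sub>r\<close> into these basic translations leaves over exactly the central element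
  \<open>z\<^sub>J\<close>, up to the elements already present. So the central part of the Weyl group is \<open>F(S)\<close>, and under \<open>(*)\<close>
  it is free abelian on the \<open>c\<^sub>r\<^sub>s\<^sup>n\<^sup>(\<^sup>r\<^sup>,\<^sup>s\<^sup>)\<close>, the images of the \<open>z\<^sub>r\<^sub>s\<close>.

  The generators thus satisfy the relations, and the presented group maps onto the Weyl group. For
  injectivity, the relations allow every word to be written as a word in the \<open>x\<^sub>i\<close>, times a product of powers of
  the \<open>y\<^sub>i\<^sub>r\<close>, times a product of powers of the \<open>z\<^sub>r\<^sub>s\<close>. If such a normal form maps to the identity, the image of its
  first factor is trivial in the finite Weyl group, hence that factor is trivial by the Coxeter presentation of this group
  (the exchange condition, proved through positive roots), and the exponents of the other two factors vanish by linear
  independence of the \<open>\<alpha>\<^sub>i\<close>, of the \<open>\<sigma>\<^sub>r\<close> and of the \<open>c\<^sub>r\<^sub>s\<close>. The Weyl group acts on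
  \<open>V \<oplus> (V\<^sup>0)\<^sup>*\<close>; the computation takes place in \<open>V \<oplus> V\<^sup>*\<close>, on which its generators act as well, and is
  transported back by restriction.

  If the rank is greater than 1, two simple roots with pairing \<open>-1\<close> exist, and reflecting \<open>\<alpha>\<^sub>j + \<sigma>\<^sub>s\<close> in
  \<open>\<alpha>\<^sub>i + \<sigma>\<^sub>r\<close> shows \<open>\<sigma>\<^sub>r + \<sigma>\<^sub>s \<in> S\<close>; so all \<open>n(r, s)\<close> are 1. In general every
  \<open>n(r, s)\<close> is 1 or 2, and \<open>(*)\<close> follows as soon as, for \<open>J\<close> in the supporting class, all pairs in \<open>J\<close> are in it,
  with \<open>n(r, s) = 1\<close> exactly for the pairs in the class. In rank 1 and nullity at most 3, a change of the origin of \<open>S\<close> and of the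
  basis of the lattice acts on the supporting class by an affine bijection modulo 2, which brings it into one of the
  nine standard forms. As the abstract Weyl group depends only on the root system, this gives the explicit presentations.
\<close>

section \<open>Groups given by generators and relations\<close>

lemma word_step_context:
  assumes "word_step X rels u v"
  shows "word_step X rels (p @ u @ q) (p @ v @ q)"
  using assms
proof cases
  case (cancel g u' e v')
  then show ?thesis
    using word_step.cancel[of g X rels "p @ u'" e "v' @ q"] by simp
next
  case (relation l r u' v')
  then show ?thesis
    using word_step.relation[of l r rels X "p @ u'" "v' @ q"] by simp
qed

lemma equivclp_word_step_context:
  assumes "equivclp (word_step X rels) u v"
  shows "equivclp (word_step X rels) (p @ u @ q) (p @ v @ q)"
  using assms
proof (induction rule: equivclp_induct)
  case base
  then show ?case by simp
next
  case (step y z)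
  then have "equivclp (word_step X rels) (p @ y @ q) (p @ z @ q)"
    using word_step_context by (metis equivclp_sym r_into_equivclp)
  then show ?case using step.IH by (rule equivclp_trans[rotated])
qed

lemma equivclp_word_step_append:
  assumes "equivclp (word_step X rels) u u'" "equivclp (word_step X rels) v v'"
  shows "equivclp (word_step X rels) (u @ v) (u' @ v')"
  using equivclp_word_step_context[OF assms(1), of "[]" v]
    equivclp_word_step_context[OF assms(2), of u' "[]"]
  by (auto intro: equivclp_trans)

lemma words_append [simp]: "u @ v \<in> words X \<longleftrightarrow> u \<in> words X \<and> v \<in> words X"
  by (auto simp: words_def)

lemma words_Nil [simp]: "[] \<in> words X"
  by (simp add: words_def)

lemma words_Cons [simp]: "(g, e) # w \<in> words X \<longleftrightarrow> g \<in> X \<and> w \<in> words X"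
  by (auto simp: words_def)

lemma words_winv [simp]: "winv w \<in> words X \<longleftrightarrow> w \<in> words X"
  by (force simp: words_def winv_def image_iff)

lemma winv_Cons: "winv ((g, e) # w) = winv w @ [(g, \<not> e)]"
  by (simp add: winv_def)

lemma winv_append: "winv (u @ v) = winv v @ winv u"
  by (simp add: winv_def)

lemma words_wcomm [simp]: "wcomm u v \<in> words X \<longleftrightarrow> u \<in> words X \<and> v \<in> words X"
  by (auto simp: wcomm_def)

lemma words_concat_replicate: "w \<in> words X \<Longrightarrow> concat (replicate n w) \<in> words X"
  by (induction n) auto

lemma words_wpow: "w \<in> words X \<Longrightarrow> wpow w k \<in> words X"
  by (simp add: wpow_def words_concat_replicate)

lemma equiv_word_rel: "equiv (words X) (word_rel X rels)"
proof (rule equivI)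
  show "refl_on (words X) (word_rel X rels)"
    by (auto simp: refl_on_def word_rel_def)
  show "sym (word_rel X rels)"
    by (auto simp: sym_def word_rel_def intro: equivclp_sym)
  show "trans (word_rel X rels)"
    by (auto simp: trans_def word_rel_def intro: equivclp_trans)
  show "word_rel X rels \<subseteq> words X \<times> words X"
    by (auto simp: word_rel_def)
qed

definition word_class :: "'g set \<Rightarrow> ('g word \<times> 'g word) set \<Rightarrow> 'g word \<Rightarrow> 'g word set" where
  "word_class X rels w = word_rel X rels `` {w}"

lemma word_class_eq_iff:
  assumes "u \<in> words X" "v \<in> words X"
  shows "word_class X rels u = word_class X rels v \<longleftrightarrow> equivclp (word_step X rels) u v"
  using eq_equiv_class_iff[OF equiv_word_rel assms] assms
  by (simp add: word_class_def word_rel_def)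

lemma carrier_presented_group: "carrier (presented_group X rels) = word_class X rels ` words X"
  by (auto simp: presented_group_def word_class_def quotient_def)

lemma one_presented_group: "\<one>\<^bsub>presented_group X rels\<^esub> = word_class X rels []"
  by (simp add: presented_group_def word_class_def)

lemma mult_presented_group:
  assumes "u \<in> words X" "v \<in> words X"
  shows "word_class X rels u \<otimes>\<^bsub>presented_group X rels\<^esub> word_class X rels v = word_class X rels (u @ v)"
proof -
  have "word_class X rels (u' @ v') = word_class X rels (u @ v)"
    if "u' \<in> word_class X rels u" "v' \<in> word_class X rels v" for u' v'
  proof (subst word_class_eq_iff)
    show "equivclp (word_step X rels) (u' @ v') (u @ v)"
      using that by (intro equivclp_word_step_append)
        (auto simp: word_class_def word_rel_def intro: equivclp_sym)
  qed (use that assms in \<open>auto simp: word_class_def word_rel_def\<close>)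
  then have "(\<Union>u'\<in>word_class X rels u. \<Union>v'\<in>word_class X rels v. word_class X rels (u' @ v'))
      = (\<Union>u'\<in>word_class X rels u. \<Union>v'\<in>word_class X rels v. word_class X rels (u @ v))"
    by (intro SUP_cong refl)
  also have "u \<in> word_class X rels u" "v \<in> word_class X rels v"
    using assms by (auto simp: word_class_def word_rel_def)
  then have "(\<Union>u'\<in>word_class X rels u. \<Union>v'\<in>word_class X rels v. word_class X rels (u @ v))
      = word_class X rels (u @ v)"
    by auto
  finally show ?thesis
    by (simp add: presented_group_def word_class_def)
qed

lemma winv_right:
  "w \<in> words X \<Longrightarrow> equivclp (word_step X rels) (w @ winv w) []"
proof (induction w)
  case Nil
  then show ?case by (simp add: winv_def)
next
  case (Cons a w)
  obtain g e where a: "a = (g, e)" by fastforce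
  with Cons have g: "g \<in> X" and w: "equivclp (word_step X rels) (w @ winv w) []" by auto
  have "equivclp (word_step X rels) ([(g, e)] @ (w @ winv w) @ [(g, \<not> e)]) ([(g, e)] @ [] @ [(g, \<not> e)])"
    by (rule equivclp_word_step_context[OF w])
  moreover have "equivclp (word_step X rels) [(g, e), (g, \<not> e)] []"
    using word_step.cancel[OF g, of rels "[]" e "[]"] by (simp add: r_into_equivclp)
  ultimately show ?case by (auto simp: a winv_Cons intro: equivclp_trans)
qed

lemma winv_winv [simp]: "winv (winv w) = w"
  by (simp add: winv_def rev_map o_def case_prod_unfold)

lemma winv_left: "w \<in> words X \<Longrightarrow> equivclp (word_step X rels) (winv w @ w) []"
  using winv_right[of "winv w" X rels] by simp

lemma group_presented_group: "group (presented_group X rels)"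
proof (rule groupI)
  let ?P = "presented_group X rels"
  show "\<exists>y\<in>carrier ?P. y \<otimes>\<^bsub>?P\<^esub> x = \<one>\<^bsub>?P\<^esub>" if x: "x \<in> carrier ?P" for x
  proof -
    obtain w where w: "w \<in> words X" "x = word_class X rels w"
      using x by (auto simp: carrier_presented_group)
    show ?thesis
      by (rule bexI[of _ "word_class X rels (winv w)"])
        (use w winv_left in \<open>auto simp: carrier_presented_group mult_presented_group
          one_presented_group word_class_eq_iff\<close>)
  qed
qed (auto simp: carrier_presented_group mult_presented_group one_presented_group)

definition word_value :: "('a, 'c) monoid_scheme \<Rightarrow> ('g \<Rightarrow> 'a) \<Rightarrow> 'g word \<Rightarrow> 'a" where
  "word_value G f w = foldr (\<lambda>(g, e) p. (if e then f g else inv\<^bsub>G\<^esub> f g) \<otimes>\<^bsub>G\<^esub> p) w \<one>\<^bsub>G\<^esub>"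

context group begin

lemma word_value_Nil [simp]: "word_value G f [] = \<one>"
  by (simp add: word_value_def)

lemma word_value_Cons [simp]:
  "word_value G f ((g, e) # w) = (if e then f g else inv f g) \<otimes> word_value G f w"
  by (simp add: word_value_def)

lemma word_value_closed [intro, simp]:
  assumes "f \<in> X \<rightarrow> carrier G" shows "w \<in> words X \<Longrightarrow> word_value G f w \<in> carrier G"
proof (induction w)
  case (Cons a w)
  then show ?case using assms by (cases a) (auto simp: Pi_iff)
qed simp

lemma word_value_append:
  assumes "f \<in> X \<rightarrow> carrier G" "v \<in> words X"
  shows "u \<in> words X \<Longrightarrow> word_value G f (u @ v) = word_value G f u \<otimes> word_value G f v"
proof (induction u)
  case Nil
  then show ?case using word_value_closed[OF assms] by simp
next
  case (Cons a u)
  then show ?case using assms word_value_closed[OF assms] word_value_closed[OF assms(1), of u]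
    by (cases a) (auto simp: Pi_iff m_assoc)
qed

lemma word_value_winv:
  assumes "f \<in> X \<rightarrow> carrier G"
  shows "w \<in> words X \<Longrightarrow> word_value G f (winv w) = inv word_value G f w"
proof (induction w)
  case Nil
  then show ?case by (simp add: winv_def)
next
  case (Cons a w)
  then show ?case using assms word_value_closed[OF assms, of w]
    by (cases a) (auto simp: Pi_iff winv_Cons word_value_append[OF assms] inv_mult_group)
qed

lemma word_value_replicate:
  assumes "f \<in> X \<rightarrow> carrier G" "w \<in> words X"
  shows "word_value G f (concat (replicate n w)) = word_value G f w [^] n"
proof (induction n)
  case (Suc n)
  have "word_value G f (concat (replicate (Suc n) w)) = word_value G f w \<otimes> word_value G f w [^] n"
    using Suc assms by (simp add: word_value_append[OF assms(1)] words_concat_replicate)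
  then show ?case
    using nat_pow_Suc2[OF word_value_closed[OF assms], of n] by simp
qed simp

lemma word_value_wpow:
  assumes "f \<in> X \<rightarrow> carrier G" "w \<in> words X"
  shows "word_value G f (wpow w k) = word_value G f w [^] k"
proof (cases "0 \<le> k")
  case True
  then have "word_value G f (wpow w k) = word_value G f w [^] nat k"
    by (simp only: wpow_def if_True word_value_replicate[OF assms])
  then show ?thesis using True by (metis int_pow_int nat_0_le)
next
  case False
  have w: "winv w \<in> words X" using assms(2) by simp
  have "word_value G f (wpow w k) = word_value G f (winv w) [^] nat (- k)"
    using False by (simp only: wpow_def if_False word_value_replicate[OF assms(1) w])
  also have "\<dots> = inv (word_value G f w [^] nat (- k))"
    using word_value_closed[OF assms] by (simp only: word_value_winv[OF assms] nat_pow_inv)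
  also have "\<dots> = word_value G f w [^] k"
    using False by (simp only: int_pow_def2[of _ _ k]) simp
  finally show ?thesis .
qed

lemma word_value_wcomm:
  assumes "f \<in> X \<rightarrow> carrier G" "u \<in> words X" "v \<in> words X"
  shows "word_value G f (wcomm u v) =
    inv word_value G f u \<otimes> inv word_value G f v \<otimes> word_value G f u \<otimes> word_value G f v"
  using assms word_value_closed[OF assms(1)]
  by (simp add: wcomm_def word_value_append[OF assms(1)] word_value_winv[OF assms(1)] m_assoc)

lemma word_value_step:
  fixes f :: "'g \<Rightarrow> 'a"
  assumes f: "range f \<subseteq> carrier G" and rels: "\<forall>(l, r)\<in>rels. word_value G f l = word_value G f r"
    and "word_step X rels u v"
  shows "word_value G f u = word_value G f v"
proof -
  have f': "f \<in> UNIV \<rightarrow> carrier G" using f by auto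
  have w: "w \<in> words UNIV" for w :: "'g word" by (simp add: words_def)
  have c: "f g \<in> carrier G" for g using f by auto
  have vc: "word_value G f w \<in> carrier G" for w
    using word_value_closed[OF f' w] .
  note app = word_value_append[OF f' w w]
  show ?thesis using assms(3)
  proof cases
    case (cancel g u' e v')
    then show ?thesis
      using c vc by (cases e) (simp_all add: app m_assoc[symmetric])
  next
    case (relation l r u' v')
    then show ?thesis using rels by (auto simp: app)
  qed
qed

text \<open>The universal property of a presentation. Letters outside \<open>X\<close> get the value
  \<open>\<one>\<close>, so that every word has a value and no step can leave the carrier.\<close>

lemma presented_group_hom:
  assumes f: "f \<in> X \<rightarrow> carrier G" and rels: "rels \<subseteq> words X \<times> words X"
    "\<forall>(l, r)\<in>rels. word_value G f l = word_value G f r"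
  obtains h where "h \<in> hom (presented_group X rels) G"
    "\<And>w. w \<in> words X \<Longrightarrow> h (word_class X rels w) = word_value G f w"
proof -
  define f' where "f' g = (if g \<in> X then f g else \<one>)" for g
  have ff': "word_value G f w = word_value G f' w" if "w \<in> words X" for w
    using that by (induction w) (auto simp: f'_def)
  have f'c: "range f' \<subseteq> carrier G" using f by (auto simp: f'_def)
  have rels': "\<forall>(l, r)\<in>rels. word_value G f' l = word_value G f' r"
  proof clarify
    fix l r assume lr: "(l, r) \<in> rels"
    then have "l \<in> words X" "r \<in> words X" using rels(1) by auto
    then show "word_value G f' l = word_value G f' r" using rels(2) lr ff' by fastforce
  qed
  have eq: "word_value G f' u = word_value G f' v" if "equivclp (word_step X rels) u v" for u v
    using that
  proof (induction rule: equivclp_induct)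
    case (step y z)
    then show ?case using word_value_step[OF f'c rels'] by metis
  qed simp
  define h where "h A = word_value G f' (SOME w. w \<in> words X \<and> A = word_class X rels w)" for A
  have h: "h (word_class X rels w) = word_value G f w" if w: "w \<in> words X" for w
  proof -
    define w' where "w' = (SOME w'. w' \<in> words X \<and> word_class X rels w = word_class X rels w')"
    have "w' \<in> words X \<and> word_class X rels w = word_class X rels w'"
      unfolding w'_def by (rule someI[of _ w]) (use w in auto)
    then have "equivclp (word_step X rels) w' w" using w by (metis word_class_eq_iff)
    then show ?thesis using eq ff'[OF w] by (simp add: h_def w'_def)
  qed
  have "h \<in> hom (presented_group X rels) G"
    by (rule homI) (auto simp: carrier_presented_group h mult_presented_group
        word_value_append[OF f] intro: word_value_closed[OF f])
  then show thesis using h that by blast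
qed

end

definition letter_class :: "'g set \<Rightarrow> ('g word \<times> 'g word) set \<Rightarrow> 'g \<Rightarrow> 'g word set" where
  "letter_class X rels g = word_class X rels [(g, True)]"

lemma letter_class_closed [simp]:
  "g \<in> X \<Longrightarrow> letter_class X rels g \<in> carrier (presented_group X rels)"
  by (auto simp: letter_class_def carrier_presented_group)

lemma inv_letter_class:
  assumes "g \<in> X"
  shows "inv\<^bsub>presented_group X rels\<^esub> letter_class X rels g = word_class X rels [(g, False)]"
proof -
  interpret P: group "presented_group X rels" by (rule group_presented_group)
  have "equivclp (word_step X rels) [(g, False), (g, True)] []"
    using winv_left[of "[(g, True)]" X rels] assms by (simp add: winv_def)
  then show ?thesis
    using assms by (intro P.inv_equality)
      (auto simp: letter_class_def mult_presented_group one_presented_group word_class_eq_iff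
        carrier_presented_group)
qed

lemma word_class_eq_word_value:
  "w \<in> words X \<Longrightarrow> word_class X rels w = word_value (presented_group X rels) (letter_class X rels) w"
proof (induction w)
  case Nil
  then show ?case by (simp add: word_value_def one_presented_group)
next
  case (Cons a w)
  interpret P: group "presented_group X rels" by (rule group_presented_group)
  obtain g e where a: "a = (g, e)" by fastforce
  then have g: "g \<in> X" and w: "w \<in> words X" using Cons.prems by auto
  have "word_class X rels (a # w) =
      word_class X rels [(g, e)] \<otimes>\<^bsub>presented_group X rels\<^esub> word_class X rels w"
    using g w by (simp add: mult_presented_group a)
  also have "word_class X rels [(g, e)] = (if e then letter_class X rels g
      else inv\<^bsub>presented_group X rels\<^esub> letter_class X rels g)"
    using inv_letter_class[OF g, of rels] by (auto simp: letter_class_def)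
  finally show ?case using Cons w by (simp add: a)
qed

lemma presented_group_relation:
  assumes "rels \<subseteq> words X \<times> words X" "(l, r) \<in> rels"
  shows "word_value (presented_group X rels) (letter_class X rels) l =
    word_value (presented_group X rels) (letter_class X rels) r"
proof -
  have "l \<in> words X" "r \<in> words X" using assms by auto
  moreover have "equivclp (word_step X rels) l r"
    using word_step.relation[OF assms(2), of X "[]" "[]"] by (simp add: r_into_equivclp)
  ultimately show ?thesis
    by (simp add: word_class_eq_word_value[symmetric] word_class_eq_iff)
qed

lemma presented_group_generated:
  "generate (presented_group X rels) (letter_class X rels ` X) = carrier (presented_group X rels)"
proof
  interpret P: group "presented_group X rels" by (rule group_presented_group)
  show "generate (presented_group X rels) (letter_class X rels ` X) \<subseteq> carrier (presented_group X rels)"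
    by (rule P.generate_incl) auto
  have "word_class X rels w \<in> generate (presented_group X rels) (letter_class X rels ` X)"
    if "w \<in> words X" for w
    using that
  proof (induction w)
    case Nil
    then show ?case using generate.one by (simp add: one_presented_group[symmetric])
  next
    case (Cons a w)
    obtain g e where a: "a = (g, e)" by fastforce
    with Cons.prems have g: "g \<in> X" and w: "w \<in> words X" by auto
    have "word_class X rels (a # w) =
        word_class X rels [(g, e)] \<otimes>\<^bsub>presented_group X rels\<^esub> word_class X rels w"
      using g w by (simp add: mult_presented_group a)
    moreover have "word_class X rels [(g, e)] \<in> generate (presented_group X rels) (letter_class X rels ` X)"
      using g inv_letter_class[OF g, of rels]
      by (cases e) (auto intro!: generate.incl generate.inv simp: letter_class_def simp flip: inv_letter_class)
    ultimately show ?case using Cons.IH[OF w] by (auto intro: generate.eng)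
  qed
  then show "carrier (presented_group X rels) \<subseteq> generate (presented_group X rels) (letter_class X rels ` X)"
    by (auto simp: carrier_presented_group)
qed

section \<open>Normal forms in the presented group\<close>

definition ordered_product :: "('a, 'c) monoid_scheme \<Rightarrow> ('i \<Rightarrow> 'a) \<Rightarrow> ('i \<Rightarrow> int) \<Rightarrow> 'i list \<Rightarrow> 'a" where
  "ordered_product G g m js = foldr (\<lambda>j p. (g j [^]\<^bsub>G\<^esub> m j) \<otimes>\<^bsub>G\<^esub> p) js \<one>\<^bsub>G\<^esub>"

definition letter_product :: "('a, 'c) monoid_scheme \<Rightarrow> ('i \<Rightarrow> 'a) \<Rightarrow> 'i list \<Rightarrow> 'a" where
  "letter_product G x js = foldr (\<lambda>j p. x j \<otimes>\<^bsub>G\<^esub> p) js \<one>\<^bsub>G\<^esub>"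

lemma ordered_product_Nil [simp]: "ordered_product G g m [] = \<one>\<^bsub>G\<^esub>"
  by (simp add: ordered_product_def)

lemma ordered_product_Cons [simp]:
  "ordered_product G g m (j # js) = (g j [^]\<^bsub>G\<^esub> m j) \<otimes>\<^bsub>G\<^esub> ordered_product G g m js"
  by (simp add: ordered_product_def)

lemma letter_product_Nil [simp]: "letter_product G x [] = \<one>\<^bsub>G\<^esub>"
  by (simp add: letter_product_def)

lemma letter_product_Cons [simp]:
  "letter_product G x (j # js) = x j \<otimes>\<^bsub>G\<^esub> letter_product G x js"
  by (simp add: letter_product_def)

context group begin

lemma ordered_product_closed [intro, simp]:
  "g \<in> set js \<rightarrow> carrier G \<Longrightarrow> ordered_product G g m js \<in> carrier G"
  by (induction js) auto

lemma letter_product_closed [intro, simp]: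
  "x \<in> set js \<rightarrow> carrier G \<Longrightarrow> letter_product G x js \<in> carrier G"
  by (induction js) auto

lemma letter_product_append:
  "x \<in> set (is @ js) \<rightarrow> carrier G \<Longrightarrow>
    letter_product G x (is @ js) = letter_product G x is \<otimes> letter_product G x js"
  by (induction "is") (auto simp: m_assoc)

lemma ordered_product_zero:
  "g \<in> set js \<rightarrow> carrier G \<Longrightarrow> \<forall>j\<in>set js. m j = 0 \<Longrightarrow> ordered_product G g m js = \<one>"
  by (induction js) auto

lemma ordered_product_cong:
  "\<forall>j\<in>set js. m j = m' j \<Longrightarrow> ordered_product G g m js = ordered_product G g m' js"
  by (induction js) auto

lemma commutator_eq_iff:
  assumes "u \<in> carrier G" "v \<in> carrier G" "c \<in> carrier G"
  shows "inv u \<otimes> inv v \<otimes> u \<otimes> v = c \<longleftrightarrow> u \<otimes> v = v \<otimes> u \<otimes> c"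
proof -
  have "v \<otimes> u \<otimes> (inv u \<otimes> inv v \<otimes> u \<otimes> v) = u \<otimes> v"
    using assms by (simp add: m_assoc[symmetric] inv_solve_right')
  moreover have "inv u \<otimes> inv v \<otimes> u \<otimes> v \<in> carrier G" "v \<otimes> u \<in> carrier G"
    using assms by auto
  ultimately show ?thesis using assms by (metis Units_eq Units_l_cancel)
qed

lemma subgroup_commuting_modulo:
  assumes C: "subgroup C G" "\<And>c u. c \<in> C \<Longrightarrow> u \<in> carrier G \<Longrightarrow> c \<otimes> u = u \<otimes> c"
    and h: "h \<in> carrier G"
  shows "subgroup {u \<in> carrier G. \<exists>c\<in>C. u \<otimes> h = h \<otimes> u \<otimes> c} G"
proof (rule subgroupI)
  have Cc: "c \<in> carrier G" if "c \<in> C" for c using C(1) that by (rule subgroup.mem_carrier)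
  have "\<one> \<in> {u \<in> carrier G. \<exists>c\<in>C. u \<otimes> h = h \<otimes> u \<otimes> c}"
    using subgroup.one_closed[OF C(1)] h by force
  then show "{u \<in> carrier G. \<exists>c\<in>C. u \<otimes> h = h \<otimes> u \<otimes> c} \<noteq> {}" by blast
  fix u assume "u \<in> {u \<in> carrier G. \<exists>c\<in>C. u \<otimes> h = h \<otimes> u \<otimes> c}"
  then obtain c where u: "u \<in> carrier G" and c: "c \<in> C" and uh: "u \<otimes> h = h \<otimes> u \<otimes> c" by auto
  have "h \<otimes> inv u = inv u \<otimes> (u \<otimes> h) \<otimes> inv u"
    using u h by (simp add: m_assoc[symmetric])
  also have "\<dots> = inv u \<otimes> h \<otimes> (u \<otimes> (c \<otimes> inv u))"
    using u h Cc[OF c] by (simp add: uh m_assoc)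
  also have "c \<otimes> inv u = inv u \<otimes> c" using C(2)[OF c] u by simp
  also have "u \<otimes> (inv u \<otimes> c) = c" using u Cc[OF c] by (simp add: m_assoc[symmetric])
  finally have "inv u \<otimes> h = h \<otimes> inv u \<otimes> inv c"
    using u h Cc[OF c] by (simp add: m_assoc)
  then show "inv u \<in> {u \<in> carrier G. \<exists>c\<in>C. u \<otimes> h = h \<otimes> u \<otimes> c}"
    using u subgroup.m_inv_closed[OF C(1) c] by blast
  fix v assume "v \<in> {u \<in> carrier G. \<exists>c\<in>C. u \<otimes> h = h \<otimes> u \<otimes> c}"
  then obtain d where v: "v \<in> carrier G" and d: "d \<in> C" and vh: "v \<otimes> h = h \<otimes> v \<otimes> d" by auto
  have "u \<otimes> v \<otimes> h = (u \<otimes> h) \<otimes> v \<otimes> d"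
    using u v h Cc[OF d] by (simp add: m_assoc vh)
  also have "\<dots> = h \<otimes> u \<otimes> (c \<otimes> v) \<otimes> d"
    using u v h Cc[OF d] Cc[OF c] by (simp add: uh m_assoc)
  also have "\<dots> = h \<otimes> (u \<otimes> v) \<otimes> (c \<otimes> d)"
    using u v h Cc[OF d] Cc[OF c] by (simp add: C(2)[OF c v] m_assoc)
  finally show "u \<otimes> v \<in> {u \<in> carrier G. \<exists>c\<in>C. u \<otimes> h = h \<otimes> u \<otimes> c}"
    using u v subgroup.m_closed[OF C(1) c d] by blast
qed auto

lemma commuting_modulo_sym:
  assumes "subgroup C G" "u \<in> carrier G" "v \<in> carrier G" "\<exists>c\<in>C. u \<otimes> v = v \<otimes> u \<otimes> c"
  shows "\<exists>c\<in>C. v \<otimes> u = u \<otimes> v \<otimes> c"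
proof -
  obtain c where c: "c \<in> C" "u \<otimes> v = v \<otimes> u \<otimes> c" using assms(4) by blast
  then have "c \<in> carrier G" using assms(1) subgroup.mem_carrier by metis
  then have "v \<otimes> u = u \<otimes> v \<otimes> inv c" using assms(2,3) c(2) by (simp add: m_assoc)
  then show ?thesis using subgroup.m_inv_closed[OF assms(1) c(1)] by blast
qed

lemma commuting_modulo_powers:
  assumes C: "subgroup C G" "\<And>c u. c \<in> C \<Longrightarrow> u \<in> carrier G \<Longrightarrow> c \<otimes> u = u \<otimes> c"
    and uv: "u \<in> carrier G" "v \<in> carrier G" "\<exists>c\<in>C. u \<otimes> v = v \<otimes> u \<otimes> c"
  shows "\<exists>c\<in>C. u [^] (p::int) \<otimes> v [^] (q::int) = v [^] q \<otimes> u [^] p \<otimes> c"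
proof -
  have pow: "\<exists>c\<in>C. u [^] (p::int) \<otimes> v = v \<otimes> u [^] p \<otimes> c"
    if "u \<in> carrier G" "v \<in> carrier G" "\<exists>c\<in>C. u \<otimes> v = v \<otimes> u \<otimes> c" for u v p
    using subgroup_int_pow_closed[OF subgroup_commuting_modulo[OF C that(2)], of u p] that by blast
  have "\<exists>c\<in>C. v \<otimes> u [^] p = u [^] p \<otimes> v \<otimes> c"
    by (rule commuting_modulo_sym[OF C(1)]) (use uv pow in auto)
  then have "\<exists>c\<in>C. v [^] q \<otimes> u [^] p = u [^] p \<otimes> v [^] q \<otimes> c"
    by (rule pow[rotated 2]) (use uv in auto)
  then show ?thesis by (rule commuting_modulo_sym[OF C(1), rotated 2]) (use uv in auto)
qed

lemma ordered_product_mult_power: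
  assumes C: "subgroup C G" "\<And>c u. c \<in> C \<Longrightarrow> u \<in> carrier G \<Longrightarrow> c \<otimes> u = u \<otimes> c"
    and g: "g \<in> J \<rightarrow> carrier G"
    and comm: "\<And>i j. i \<in> J \<Longrightarrow> j \<in> J \<Longrightarrow> \<exists>c\<in>C. g i \<otimes> g j = g j \<otimes> g i \<otimes> c"
    and "distinct js" "set js \<subseteq> J" "i \<in> set js"
  shows "\<exists>c\<in>C. ordered_product G g m js \<otimes> g i [^] (q::int)
    = ordered_product G g (m(i := m i + q)) js \<otimes> c"
  using assms(5-7)
proof (induction js)
  case (Cons j js)
  have Cc: "c \<in> carrier G" if "c \<in> C" for c using C(1) that by (rule subgroup.mem_carrier)
  have gc: "g \<in> set js \<rightarrow> carrier G" "g j \<in> carrier G" "g i \<in> carrier G" "i \<in> J"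
    using g Cons.prems by (auto simp: Pi_iff)
  note closed = ordered_product_closed[OF gc(1), of m] gc
  show ?case
  proof (cases "i = j")
    case True
    have "\<exists>c\<in>C. ordered_product G g m js \<otimes> g i [^] q = g i [^] q \<otimes> ordered_product G g m js \<otimes> c"
      using Cons.prems(2) gc(1)
    proof (induction js)
      case Nil
      then show ?case using subgroup.one_closed[OF C(1)] gc by force
    next
      case (Cons k ks)
      then have k: "k \<in> J" "g k \<in> carrier G" "g \<in> set ks \<rightarrow> carrier G" by auto
      obtain c where c: "c \<in> C"
        "ordered_product G g m ks \<otimes> g i [^] q = g i [^] q \<otimes> ordered_product G g m ks \<otimes> c"
        using Cons by auto
      obtain d where d: "d \<in> C" "g k [^] m k \<otimes> g i [^] q = g i [^] q \<otimes> g k [^] m k \<otimes> d"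
        using commuting_modulo_powers[OF C k(2) gc(3) comm[OF k(1) gc(4)]] by blast
      have cl: "c \<in> carrier G" "d \<in> carrier G" "ordered_product G g m ks \<in> carrier G"
        "g k [^] m k \<in> carrier G" "g i [^] q \<in> carrier G"
        using c d Cc k gc by auto
      let ?O = "ordered_product G g m ks"
      have "g k [^] m k \<otimes> ?O \<otimes> g i [^] q = (g k [^] m k \<otimes> g i [^] q) \<otimes> ?O \<otimes> c"
        using cl by (simp add: m_assoc c(2))
      also have "\<dots> = g i [^] q \<otimes> g k [^] m k \<otimes> (d \<otimes> ?O) \<otimes> c"
        using cl by (simp add: m_assoc d(2))
      also have "\<dots> = g i [^] q \<otimes> (g k [^] m k \<otimes> ?O) \<otimes> (d \<otimes> c)"
        using cl by (simp add: m_assoc C(2)[OF d(1)])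
      finally show ?case using subgroup.m_closed[OF C(1) d(1) c(1)] by auto
    qed
    then obtain c where c: "c \<in> C"
      "ordered_product G g m js \<otimes> g i [^] q = g i [^] q \<otimes> ordered_product G g m js \<otimes> c" by blast
    have "ordered_product G g (m(i := m i + q)) js = ordered_product G g m js"
      by (rule ordered_product_cong) (use Cons.prems True in auto)
    then have "ordered_product G g m (j # js) \<otimes> g i [^] q =
        ordered_product G g (m(i := m i + q)) (j # js) \<otimes> c"
      using closed Cc[OF c(1)] True c(2) by (simp add: m_assoc int_pow_mult)
    then show ?thesis by (rule bexI[OF _ c(1)])
  next
    case False
    then obtain c where c: "c \<in> C" "ordered_product G g m js \<otimes> g i [^] q
        = ordered_product G g (m(i := m i + q)) js \<otimes> c"
      using Cons by (auto simp del: fun_upd_apply)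
    then have "ordered_product G g m (j # js) \<otimes> g i [^] q =
        ordered_product G g (m(i := m i + q)) (j # js) \<otimes> c"
      using closed(1) ordered_product_closed[OF gc(1), of "m(i := m i + q)"] gc Cc[OF c(1)] False c(2)
      by (simp add: m_assoc del: fun_upd_apply) (simp add: m_assoc)
    then show ?thesis by (rule bexI[OF _ c(1)])
  qed
qed simp

lemma generate_ordered_product:
  assumes C: "subgroup C G" "\<And>c u. c \<in> C \<Longrightarrow> u \<in> carrier G \<Longrightarrow> c \<otimes> u = u \<otimes> c"
    and g: "g \<in> set js \<rightarrow> carrier G"
    and comm: "\<And>i j. i \<in> set js \<Longrightarrow> j \<in> set js \<Longrightarrow> \<exists>c\<in>C. g i \<otimes> g j = g j \<otimes> g i \<otimes> c"
    and js: "distinct js" and h: "h \<in> generate G (g ` set js \<union> C)"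
  shows "\<exists>m. \<exists>c\<in>C. h = ordered_product G g m js \<otimes> c"
proof -
  have Cc: "c \<in> carrier G" if "c \<in> C" for c using C(1) that by (rule subgroup.mem_carrier)
  have sub: "g ` set js \<union> C \<subseteq> carrier G" using g Cc by auto
  note closed = ordered_product_closed[OF g]
  have C_right: "\<exists>m. \<exists>c\<in>C. ordered_product G g m' js \<otimes> c' \<otimes> h = ordered_product G g m js \<otimes> c"
    if "c' \<in> C" "h \<in> C" for m' c' h
  proof -
    have "ordered_product G g m' js \<otimes> c' \<otimes> h = ordered_product G g m' js \<otimes> (c' \<otimes> h)"
      using closed Cc that by (simp add: m_assoc)
    moreover have "c' \<otimes> h \<in> C" using subgroup.m_closed[OF C(1)] that by auto
    ultimately show ?thesis by (intro exI[of _ m'] bexI[of _ "c' \<otimes> h"])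
  qed
  have g_right: "\<exists>m. \<exists>c\<in>C. ordered_product G g m' js \<otimes> c' \<otimes> g i [^] (q::int) = ordered_product G g m js \<otimes> c"
    if c': "c' \<in> C" and i: "i \<in> set js" for m' c' i q
  proof -
    obtain d where d: "d \<in> C" "ordered_product G g m' js \<otimes> g i [^] q =
        ordered_product G g (m'(i := m' i + q)) js \<otimes> d"
      using ordered_product_mult_power[OF C g comm js _ i] by blast
    have gi: "g i [^] q \<in> carrier G" using g i by auto
    have "ordered_product G g m' js \<otimes> c' \<otimes> g i [^] q = ordered_product G g m' js \<otimes> (g i [^] q \<otimes> c')"
      using closed Cc[OF c'] gi C(2)[OF c' gi] by (simp add: m_assoc)
    also have "\<dots> = ordered_product G g (m'(i := m' i + q)) js \<otimes> (d \<otimes> c')"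
      using closed[of m'] closed[of "m'(i := m' i + q)"] Cc[OF c'] Cc[OF d(1)] gi d(2)
      by (simp add: m_assoc[symmetric])
    finally show ?thesis using subgroup.m_closed[OF C(1) d(1) c'] by (intro exI bexI)
  qed
  have *: "\<exists>m. \<exists>c\<in>C. ordered_product G g m' js \<otimes> c' \<otimes> h = ordered_product G g m js \<otimes> c"
    if "h \<in> generate G (g ` set js \<union> C)" "c' \<in> C" for m' c' h
    using that
  proof (induction h arbitrary: m' c' rule: generate.induct)
    case one
    then show ?case using closed Cc by (intro exI[of _ m'] bexI[of _ c']) auto
  next
    case (incl h)
    show ?case
    proof (cases "h \<in> C")
      case True
      then show ?thesis using C_right[OF incl(2)] by simp
    next
      case False
      then obtain i where i: "i \<in> set js" "h = g i" using incl by auto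
      then have "h = g i [^] (1 :: int)" using g by (auto simp: Pi_iff)
      then show ?thesis using g_right[OF incl(2) i(1)] by simp
    qed
  next
    case (inv h)
    show ?case
    proof (cases "h \<in> C")
      case True
      then show ?thesis using C_right[OF inv(2)] subgroup.m_inv_closed[OF C(1)] by auto
    next
      case False
      then obtain i where i: "i \<in> set js" "h = g i" using inv by auto
      then have "inv h = g i [^] (-1 :: int)" using g by (auto simp: Pi_iff int_pow_neg)
      then show ?thesis using g_right[OF inv(2) i(1)] by simp
    qed
  next
    case (eng h1 h2)
    have h: "h1 \<in> carrier G" "h2 \<in> carrier G"
      using eng(1,2) generate_in_carrier[OF sub] by auto
    obtain m1 where "\<exists>c\<in>C. ordered_product G g m' js \<otimes> c' \<otimes> h1 = ordered_product G g m1 js \<otimes> c"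
      using eng.IH(1)[OF eng.prems, of m'] by (rule exE)
    then obtain c1 where 1: "c1 \<in> C"
      "ordered_product G g m' js \<otimes> c' \<otimes> h1 = ordered_product G g m1 js \<otimes> c1" by (rule bexE)
    have "ordered_product G g m' js \<otimes> c' \<in> carrier G"
      by (intro m_closed closed Cc eng.prems)
    then have "ordered_product G g m' js \<otimes> c' \<otimes> (h1 \<otimes> h2) = ordered_product G g m' js \<otimes> c' \<otimes> h1 \<otimes> h2"
      by (rule m_assoc[OF _ h, symmetric])
    also have "\<dots> = ordered_product G g m1 js \<otimes> c1 \<otimes> h2"
      by (rule arg_cong[OF 1(2)])
    finally show ?case using eng.IH(2)[OF 1(1), of m1] by (simp only:)
  qed
  have "h \<in> carrier G"
    using h by (rule generate_in_carrier[OF sub])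
  then show ?thesis
    using *[OF h subgroup.one_closed[OF C(1)], of "\<lambda>_. 0"] g by (simp add: ordered_product_zero)
qed

end

text \<open>The relations of the presentation, read in an arbitrary group. The relations between
  \<open>x\<close> and \<open>z\<close> are kept apart, because they follow from the others in most cases.\<close>

locale weyl_relations = group G for G (structure) +
  fixes l \<nu> :: nat and a :: "nat \<Rightarrow> nat \<Rightarrow> int" and N :: "nat \<Rightarrow> nat \<Rightarrow> nat"
    and x :: "nat \<Rightarrow> 'a" and y :: "nat \<Rightarrow> nat \<Rightarrow> 'a" and z :: "nat \<Rightarrow> nat \<Rightarrow> 'a"
  assumes x_closed [simp, intro]: "i \<in> {1..l} \<Longrightarrow> x i \<in> carrier G"
    and y_closed [simp, intro]: "i \<in> {1..l} \<Longrightarrow> r \<in> {1..\<nu>} \<Longrightarrow> y i r \<in> carrier G"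
    and z_closed [simp, intro]: "(r, s) \<in> index_pairs \<nu> \<Longrightarrow> z r s \<in> carrier G"
    and x_square: "i \<in> {1..l} \<Longrightarrow> x i \<otimes> x i = \<one>"
    and x_braid: "i \<in> {1..l} \<Longrightarrow> j \<in> {1..l} \<Longrightarrow> i \<noteq> j \<Longrightarrow> (x i \<otimes> x j) [^] ((a i j)\<^sup>2 + 2) = \<one>"
    and x_y_x: "i \<in> {1..l} \<Longrightarrow> j \<in> {1..l} \<Longrightarrow> r \<in> {1..\<nu>} \<Longrightarrow>
      x i \<otimes> y j r \<otimes> x i = y j r \<otimes> y i r [^] (- a i j)"
    and z_z: "(r, s) \<in> index_pairs \<nu> \<Longrightarrow> (r', s') \<in> index_pairs \<nu> \<Longrightarrow>
      z r s \<otimes> z r' s' = z r' s' \<otimes> z r s"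
    and y_z: "i \<in> {1..l} \<Longrightarrow> r \<in> {1..\<nu>} \<Longrightarrow> (r', s') \<in> index_pairs \<nu> \<Longrightarrow>
      y i r \<otimes> z r' s' = z r' s' \<otimes> y i r"
    and y_y_same: "i \<in> {1..l} \<Longrightarrow> j \<in> {1..l} \<Longrightarrow> r \<in> {1..\<nu>} \<Longrightarrow> y i r \<otimes> y j r = y j r \<otimes> y i r"
    and y_y: "i \<in> {1..l} \<Longrightarrow> j \<in> {1..l} \<Longrightarrow> (r, s) \<in> index_pairs \<nu> \<Longrightarrow>
      y i r \<otimes> y j s = y j s \<otimes> y i r \<otimes> z r s [^] (a i j div int (N r s))"

locale central_weyl_relations = weyl_relations +
  assumes x_z: "i \<in> {1..l} \<Longrightarrow> (r, s) \<in> index_pairs \<nu> \<Longrightarrow> x i \<otimes> z r s = z r s \<otimes> x i"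
    and generated: "generate G (x ` {1..l} \<union> case_prod y ` ({1..l} \<times> {1..\<nu>}) \<union>
      case_prod z ` index_pairs \<nu>) = carrier G"

lemma finite_index_pairs [simp]: "finite (index_pairs \<nu>)"
  by (rule finite_subset[of _ "{1..\<nu>} \<times> {1..\<nu>}"]) (auto simp: index_pairs_def)

definition y_indices :: "nat \<Rightarrow> nat \<Rightarrow> (nat \<times> nat) list" where
  "y_indices l \<nu> = List.product [1..<Suc l] [1..<Suc \<nu>]"

definition z_indices :: "nat \<Rightarrow> (nat \<times> nat) list" where
  "z_indices \<nu> = filter (\<lambda>(r, s). r < s) (List.product [1..<Suc \<nu>] [1..<Suc \<nu>])"

lemma set_y_indices [simp]: "set (y_indices l \<nu>) = {1..l} \<times> {1..\<nu>}"
  by (auto simp: y_indices_def)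

lemma set_z_indices [simp]: "set (z_indices \<nu>) = index_pairs \<nu>"
  by (auto simp: z_indices_def index_pairs_def)

lemma distinct_indices [simp]: "distinct (y_indices l \<nu>)" "distinct (z_indices \<nu>)"
  by (simp_all add: y_indices_def z_indices_def distinct_product)

context central_weyl_relations begin

abbreviation "Z_group \<equiv> generate G (case_prod z ` index_pairs \<nu>)"

lemma Z_group_subgroup: "subgroup Z_group G"
  by (rule generate_is_subgroup) auto

lemma Z_group_central:
  assumes "c \<in> Z_group" "u \<in> carrier G" shows "c \<otimes> u = u \<otimes> c"
proof -
  have zu: "z r s \<otimes> u = u \<otimes> z r s" if rs: "(r, s) \<in> index_pairs \<nu>" for r s
  proof -
    have sub: "subgroup {u \<in> carrier G. \<exists>c\<in>{\<one>}. u \<otimes> z r s = z r s \<otimes> u \<otimes> c} G"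
      by (rule subgroup_commuting_modulo) (use rs triv_subgroup in auto)
    have "generate G (x ` {1..l} \<union> case_prod y ` ({1..l} \<times> {1..\<nu>}) \<union> case_prod z ` index_pairs \<nu>)
        \<subseteq> {u \<in> carrier G. \<exists>c\<in>{\<one>}. u \<otimes> z r s = z r s \<otimes> u \<otimes> c}"
      by (rule generate_subgroup_incl[OF _ sub]) (use rs x_z y_z z_z in auto)
    then show ?thesis using assms(2) rs unfolding generated by auto
  qed
  have sub: "subgroup {c \<in> carrier G. \<exists>d\<in>{\<one>}. c \<otimes> u = u \<otimes> c \<otimes> d} G"
    by (rule subgroup_commuting_modulo) (use assms triv_subgroup in auto)
  have "Z_group \<subseteq> {c \<in> carrier G. \<exists>d\<in>{\<one>}. c \<otimes> u = u \<otimes> c \<otimes> d}"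
    by (rule generate_subgroup_incl[OF _ sub]) (use zu assms in auto)
  then show ?thesis using assms by auto
qed

lemma y_commute_modulo_Z:
  assumes "p \<in> {1..l} \<times> {1..\<nu>}" "q \<in> {1..l} \<times> {1..\<nu>}"
  shows "\<exists>c\<in>Z_group. case_prod y p \<otimes> case_prod y q = case_prod y q \<otimes> case_prod y p \<otimes> c"
proof -
  obtain i r j s where pq: "p = (i, r)" "q = (j, s)" by fastforce
  have less: "\<exists>c\<in>Z_group. y i r \<otimes> y j s = y j s \<otimes> y i r \<otimes> c"
    if "i \<in> {1..l}" "j \<in> {1..l}" "(r, s) \<in> index_pairs \<nu>" for i j r s
  proof -
    have "z r s \<in> Z_group" using that(3) by (force intro: generate.incl)
    then show ?thesis
      using y_y[OF that] subgroup_int_pow_closed[OF Z_group_subgroup] by blast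
  qed
  consider "r = s" | "(r, s) \<in> index_pairs \<nu>" | "(s, r) \<in> index_pairs \<nu>"
    using assms by (force simp: pq index_pairs_def)
  then show ?thesis
  proof cases
    case 1
    then show ?thesis using assms y_y_same[of i j r] generate.one
      by (auto simp: pq intro!: bexI[of _ \<one>])
  next
    case 2
    then show ?thesis using assms less by (auto simp: pq)
  next
    case 3
    have "\<exists>c\<in>Z_group. y i r \<otimes> y j s = y j s \<otimes> y i r \<otimes> c"
      by (rule commuting_modulo_sym[OF Z_group_subgroup]) (use assms less 3 in \<open>auto simp: pq\<close>)
    then show ?thesis by (simp add: pq)
  qed
qed

abbreviation "YZ_group \<equiv> generate G (case_prod y ` ({1..l} \<times> {1..\<nu>}) \<union> Z_group)"

lemma Z_normal_form:
  assumes "h \<in> Z_group"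
  shows "\<exists>k. h = ordered_product G (case_prod z) k (z_indices \<nu>)"
proof -
  have "h \<in> generate G (case_prod z ` set (z_indices \<nu>) \<union> {\<one>})"
    using assms mono_generate[of "case_prod z ` index_pairs \<nu>" "case_prod z ` index_pairs \<nu> \<union> {\<one>}"]
    by auto
  then have "\<exists>k. \<exists>c\<in>{\<one>}. h = ordered_product G (case_prod z) k (z_indices \<nu>) \<otimes> c"
    by (intro generate_ordered_product) (use triv_subgroup z_z in auto)
  moreover have "ordered_product G (case_prod z) k (z_indices \<nu>) \<in> carrier G" for k
    by (rule ordered_product_closed) auto
  ultimately show ?thesis by auto
qed

lemma YZ_normal_form:
  assumes "h \<in> YZ_group"
  shows "\<exists>m k. h = ordered_product G (case_prod y) m (y_indices l \<nu>) \<otimes>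
    ordered_product G (case_prod z) k (z_indices \<nu>)"
proof -
  have "\<exists>m. \<exists>c\<in>Z_group. h = ordered_product G (case_prod y) m (y_indices l \<nu>) \<otimes> c"
    by (intro generate_ordered_product Z_group_subgroup Z_group_central)
      (use assms y_commute_modulo_Z in auto)
  then show ?thesis using Z_normal_form by blast
qed

lemma YZ_subset: "case_prod y ` ({1..l} \<times> {1..\<nu>}) \<union> Z_group \<subseteq> carrier G"
  using subgroup.subset[OF Z_group_subgroup] by auto

lemma YZ_group_subgroup: "subgroup YZ_group G"
  by (rule generate_is_subgroup[OF YZ_subset])

lemma x_normalizes:
  assumes i: "i \<in> {1..l}" and "h \<in> YZ_group"
  shows "x i \<otimes> h \<otimes> x i \<in> YZ_group"
  using assms(2)
proof (induction h rule: generate.induct)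
  case one
  then show ?case using x_square[OF i] i generate.one by simp
next
  case (incl h)
  then consider j r where "j \<in> {1..l}" "r \<in> {1..\<nu>}" "h = y j r" | "h \<in> Z_group" by auto
  then show ?case
  proof cases
    case 1
    have "y j r \<in> YZ_group" "y i r \<in> YZ_group" using 1 i by (auto intro!: generate.incl)
    then show ?thesis
      using x_y_x[OF i 1(1,2)] 1(3) subgroup.m_closed[OF YZ_group_subgroup]
        subgroup_int_pow_closed[OF YZ_group_subgroup] by simp
  next
    case 2
    then have "x i \<otimes> h \<otimes> x i = h"
      using i Z_group_central[of h "x i"] x_square[OF i] subgroup.mem_carrier[OF Z_group_subgroup, of h]
      by (simp add: m_assoc flip: Z_group_central)
    then show ?thesis using 2 by (auto intro: generate.incl)
  qed
next
  case (inv h)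
  have hc: "h \<in> carrier G" using inv YZ_subset by blast
  have xx: "inv x i = x i" using inv_equality x_square i by auto
  from inv consider j r where "j \<in> {1..l}" "r \<in> {1..\<nu>}" "h = y j r" | "h \<in> Z_group" by auto
  then have "x i \<otimes> h \<otimes> x i \<in> YZ_group"
  proof cases
    case 1
    have "y j r \<in> YZ_group" "y i r \<in> YZ_group" using 1 i by (auto intro!: generate.incl)
    then show ?thesis
      using x_y_x[OF i 1(1,2)] 1(3) subgroup.m_closed[OF YZ_group_subgroup]
        subgroup_int_pow_closed[OF YZ_group_subgroup] by simp
  next
    case 2
    then have "x i \<otimes> h \<otimes> x i = h"
      using i Z_group_central[of h "x i"] x_square[OF i] hc
      by (simp add: m_assoc flip: Z_group_central)
    then show ?thesis using 2 by (auto intro: generate.incl)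
  qed
  then have "inv (x i \<otimes> h \<otimes> x i) \<in> YZ_group"
    by (rule subgroup.m_inv_closed[OF YZ_group_subgroup])
  then show ?case using hc i by (simp add: inv_mult_group xx m_assoc)
next
  case (eng h1 h2)
  have h: "h1 \<in> carrier G" "h2 \<in> carrier G"
    using eng generate_in_carrier[OF YZ_subset] by auto
  have "x i \<otimes> (h1 \<otimes> h2) \<otimes> x i = x i \<otimes> h1 \<otimes> (x i \<otimes> x i) \<otimes> h2 \<otimes> x i"
    using i h by (simp only: x_square[OF i] r_one m_closed x_closed) (simp add: m_assoc)
  also have "\<dots> = (x i \<otimes> h1 \<otimes> x i) \<otimes> (x i \<otimes> h2 \<otimes> x i)"
    using i h by (simp add: m_assoc)
  finally show ?case using subgroup.m_closed[OF YZ_group_subgroup eng.IH] by simp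
qed

lemma move_letters_left:
  assumes "set is \<subseteq> {1..l}" "h \<in> YZ_group"
  shows "\<exists>h'\<in>YZ_group. h \<otimes> letter_product G x is = letter_product G x is \<otimes> h'"
  using assms
proof (induction "is" arbitrary: h)
  case Nil
  then show ?case using generate_in_carrier[OF YZ_subset] by auto
next
  case (Cons i js)
  then have i: "i \<in> {1..l}" and js: "x \<in> set js \<rightarrow> carrier G" "set js \<subseteq> {1..l}" by auto
  have h: "h \<in> carrier G" using Cons.prems generate_in_carrier[OF YZ_subset] by auto
  obtain h' where h': "h' \<in> YZ_group"
      "(x i \<otimes> h \<otimes> x i) \<otimes> letter_product G x js = letter_product G x js \<otimes> h'"
    using Cons.IH[OF js(2) x_normalizes[OF i Cons.prems(2)]] by blast
  have h'c: "h' \<in> carrier G" using h' generate_in_carrier[OF YZ_subset] by auto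
  have "h \<otimes> letter_product G x (i # js) = (x i \<otimes> x i) \<otimes> h \<otimes> x i \<otimes> letter_product G x js"
    using i h js by (simp add: x_square[OF i] m_assoc)
  also have "\<dots> = x i \<otimes> ((x i \<otimes> h \<otimes> x i) \<otimes> letter_product G x js)"
    using i h js by (simp add: m_assoc)
  also have "\<dots> = letter_product G x (i # js) \<otimes> h'"
    using i h js h'c by (simp only: h'(2)) (simp add: m_assoc)
  finally show ?case using h'(1) by blast
qed

lemma letters_times_YZ:
  assumes "h \<in> carrier G"
  shows "\<exists>js h'. set js \<subseteq> {1..l} \<and> h' \<in> YZ_group \<and> h = letter_product G x js \<otimes> h'"
proof -
  have x_letters: "x \<in> set js \<rightarrow> carrier G" if "set js \<subseteq> {1..l}" for js using that by auto
  have YZc: "h \<in> carrier G" if "h \<in> YZ_group" for h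
    using generate_in_carrier[OF YZ_subset that] .
  have base: "\<exists>js h'. set js \<subseteq> {1..l} \<and> h' \<in> YZ_group \<and> h = letter_product G x js \<otimes> h'"
    if "h \<in> YZ_group" for h
    using that YZc[OF that] by (intro exI[of _ "[]"] exI[of _ h]) auto
  have base_x: "\<exists>js h'. set js \<subseteq> {1..l} \<and> h' \<in> YZ_group \<and> x i = letter_product G x js \<otimes> h'"
    if "i \<in> {1..l}" for i
    using that by (intro exI[of _ "[i]"] exI[of _ \<one>]) (auto intro: generate.one)
  have "h \<in> generate G (x ` {1..l} \<union> case_prod y ` ({1..l} \<times> {1..\<nu>}) \<union> case_prod z ` index_pairs \<nu>)"
    using assms generated by simp
  then show ?thesis
  proof (induction h rule: generate.induct)
    case one
    then show ?case by (rule base[OF generate.one])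
  next
    case (incl h)
    then consider "h \<in> x ` {1..l}" | "h \<in> case_prod y ` ({1..l} \<times> {1..\<nu>}) \<union> Z_group"
      by (auto intro: generate.incl)
    then show ?case using base_x base[OF generate.incl] by cases auto
  next
    case (inv h)
    then consider "h \<in> x ` {1..l}" | "h \<in> case_prod y ` ({1..l} \<times> {1..\<nu>}) \<union> Z_group"
      by (auto intro: generate.incl)
    then show ?case
    proof cases
      case 1
      then obtain i where i: "i \<in> {1..l}" "h = x i" by auto
      then have "inv h = x i" using inv_equality x_square by auto
      then show ?thesis using base_x i by auto
    next
      case 2
      then show ?thesis by (intro base generate.inv)
    qed
  next
    case (eng h1 h2)
    obtain js1 n1 where 1: "set js1 \<subseteq> {1..l}" "n1 \<in> YZ_group" "h1 = letter_product G x js1 \<otimes> n1"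
      using eng.IH(1) by blast
    obtain js2 n2 where 2: "set js2 \<subseteq> {1..l}" "n2 \<in> YZ_group" "h2 = letter_product G x js2 \<otimes> n2"
      using eng.IH(2) by blast
    obtain n3 where 3: "n3 \<in> YZ_group" "n1 \<otimes> letter_product G x js2 = letter_product G x js2 \<otimes> n3"
      using move_letters_left[OF 2(1) 1(2)] by blast
    note c = YZc[OF 1(2)] YZc[OF 2(2)] YZc[OF 3(1)] letter_product_closed[OF x_letters[OF 1(1)]]
      letter_product_closed[OF x_letters[OF 2(1)]]
    have "h1 \<otimes> h2 = letter_product G x js1 \<otimes> (n1 \<otimes> letter_product G x js2) \<otimes> n2"
      using c by (simp add: 1(3) 2(3) m_assoc)
    also have "\<dots> = letter_product G x (js1 @ js2) \<otimes> (n3 \<otimes> n2)"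
      using c x_letters[of "js1 @ js2"] 1(1) 2(1) by (simp add: 3(2) letter_product_append m_assoc)
    finally show ?case
      using 1(1) 2(1) subgroup.m_closed[OF YZ_group_subgroup 3(1) 2(2)]
      by (intro exI[of _ "js1 @ js2"] exI[of _ "n3 \<otimes> n2"]) auto
  qed
qed

theorem normal_form:
  assumes "h \<in> carrier G"
  obtains js m k where "set js \<subseteq> {1..l}"
    "h = letter_product G x js \<otimes> (ordered_product G (case_prod y) m (y_indices l \<nu>) \<otimes>
      ordered_product G (case_prod z) k (z_indices \<nu>))"
  using letters_times_YZ[OF assms] YZ_normal_form by metis

end

context group begin

text \<open>For fixed \<open>w\<close>, the exponent \<open>n\<close> in \<open>[u, v] = w\<^sup>n\<close> is bimultiplicative in those \<open>u\<close> and \<open>v\<close>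
  which commute with \<open>w\<close>.\<close>

definition commutator_exponent :: "'a \<Rightarrow> 'a \<Rightarrow> 'a \<Rightarrow> int \<Rightarrow> bool" where
  "commutator_exponent w u v n \<longleftrightarrow> w \<in> carrier G \<and> u \<in> carrier G \<and> v \<in> carrier G \<and>
     u \<otimes> w = w \<otimes> u \<and> v \<otimes> w = w \<otimes> v \<and> u \<otimes> v = v \<otimes> u \<otimes> w [^] n"

lemma power_commute:
  assumes "u \<in> carrier G" "w \<in> carrier G" "u \<otimes> w = w \<otimes> u"
  shows "u \<otimes> w [^] (n::int) = w [^] n \<otimes> u"
proof -
  have "\<exists>c\<in>{\<one>}. u [^] (1::int) \<otimes> w [^] n = w [^] n \<otimes> u [^] (1::int) \<otimes> c"
    by (rule commuting_modulo_powers) (use assms triv_subgroup in auto)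
  then show ?thesis using assms by simp
qed

lemma commutator_exponent_mult_left:
  assumes "commutator_exponent w u v m" "commutator_exponent w u' v n"
  shows "commutator_exponent w (u \<otimes> u') v (m + n)"
proof -
  have c: "w \<in> carrier G" "u \<in> carrier G" "u' \<in> carrier G" "v \<in> carrier G"
    and uw: "u \<otimes> w = w \<otimes> u" "u' \<otimes> w = w \<otimes> u'" "v \<otimes> w = w \<otimes> v"
    and uv: "u \<otimes> v = v \<otimes> u \<otimes> w [^] m" "u' \<otimes> v = v \<otimes> u' \<otimes> w [^] n"
    using assms by (auto simp: commutator_exponent_def)
  have "u \<otimes> u' \<otimes> v = (u \<otimes> v) \<otimes> u' \<otimes> w [^] n"
    using c by (simp add: m_assoc uv(2))
  also have "\<dots> = v \<otimes> u \<otimes> (w [^] m \<otimes> u') \<otimes> w [^] n"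
    using c by (simp add: m_assoc uv(1))
  also have "\<dots> = v \<otimes> u \<otimes> (u' \<otimes> w [^] m) \<otimes> w [^] n"
    using power_commute[OF c(3,1) uw(2)] by simp
  also have "\<dots> = v \<otimes> (u \<otimes> u') \<otimes> w [^] (m + n)"
    using c by (simp add: m_assoc int_pow_mult)
  finally show ?thesis
    using c uw by (simp add: commutator_exponent_def m_assoc) (simp add: m_assoc[symmetric])
qed

lemma commutator_exponent_sym:
  assumes "commutator_exponent w u v n" shows "commutator_exponent w v u (- n)"
  using assms by (auto simp: commutator_exponent_def int_pow_neg m_assoc)

lemma commutator_exponent_mult_right:
  assumes "commutator_exponent w u v m" "commutator_exponent w u v' n"
  shows "commutator_exponent w u (v \<otimes> v') (m + n)"
  using commutator_exponent_sym[OF commutator_exponent_mult_left[OF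
      commutator_exponent_sym[OF assms(1)] commutator_exponent_sym[OF assms(2)]]]
  by (simp add: add.commute)

lemma commutator_exponent_inv_left:
  assumes "commutator_exponent w u v n" shows "commutator_exponent w (inv u) v (- n)"
proof -
  have c: "w \<in> carrier G" "u \<in> carrier G" "v \<in> carrier G"
    and uw: "u \<otimes> w = w \<otimes> u" "v \<otimes> w = w \<otimes> v" and uv: "u \<otimes> v = v \<otimes> u \<otimes> w [^] n"
    using assms by (auto simp: commutator_exponent_def)
  have iu: "inv u \<otimes> w = w \<otimes> inv u"
    using c uw by (metis inv_solve_left inv_solve_right m_assoc m_closed inv_closed)
  have "v \<otimes> inv u = inv u \<otimes> (u \<otimes> v) \<otimes> inv u"
    using c by (simp add: m_assoc[symmetric])
  also have "\<dots> = inv u \<otimes> v \<otimes> u \<otimes> (w [^] n \<otimes> inv u)"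
    using c by (simp add: uv m_assoc)
  also have "w [^] n \<otimes> inv u = inv u \<otimes> w [^] n"
    using power_commute[OF _ c(1) iu] c by simp
  also have "inv u \<otimes> v \<otimes> u \<otimes> (inv u \<otimes> w [^] n) = inv u \<otimes> v \<otimes> w [^] n"
    using c by (simp add: m_assoc) (simp add: m_assoc[symmetric])
  finally have "inv u \<otimes> v = v \<otimes> inv u \<otimes> w [^] (- n)"
    using c by (simp add: m_assoc int_pow_neg)
  then show ?thesis using c uw iu by (simp add: commutator_exponent_def)
qed

lemma commutator_exponent_power_left:
  assumes "commutator_exponent w u v n" shows "commutator_exponent w (u [^] (p::int)) v (p * n)"
proof -
  have c: "w \<in> carrier G" "u \<in> carrier G" "v \<in> carrier G" "v \<otimes> w = w \<otimes> v"
    using assms by (auto simp: commutator_exponent_def)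
  have nat: "commutator_exponent w (u [^] int k) v (int k * n)" for k
  proof (induction k)
    case 0
    then show ?case using c by (simp add: commutator_exponent_def)
  next
    case (Suc k)
    have "u [^] int (Suc k) = u [^] int k \<otimes> u"
      using c by (simp add: int_pow_int del: of_nat_Suc)
    then show ?case
      using commutator_exponent_mult_left[OF Suc assms] by (simp add: algebra_simps)
  qed
  show ?thesis
  proof (cases "0 \<le> p")
    case True
    then show ?thesis using nat[of "nat p"] by simp
  next
    case False
    then show ?thesis
      using commutator_exponent_inv_left[OF nat[of "nat (- p)"]] c by (simp add: int_pow_neg)
  qed
qed

lemma commutator_exponent_power_right:
  assumes "commutator_exponent w u v n" shows "commutator_exponent w u (v [^] (q::int)) (q * n)"
  using commutator_exponent_sym[OF commutator_exponent_power_left[OF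
      commutator_exponent_sym[OF assms], of q]] by simp

end

text \<open>Conjugation by \<open>x\<^sub>k\<close> acts on the \<open>y\<close>'s as the \<open>k\<close>-th simple reflection, which preserves the
  form \<open>a\<close>; hence it fixes every commutator \<open>[y\<^sub>i\<^sub>r, y\<^sub>j\<^sub>s]\<close>. As soon as one of these commutators is
  \<open>z\<^sub>r\<^sub>s\<close> or its inverse, \<open>x\<^sub>k\<close> commutes with \<open>z\<^sub>r\<^sub>s\<close>.\<close>

lemma (in weyl_relations) x_z_if_unit_commutator:
  assumes a_sym: "\<And>i j. i \<in> {1..l} \<Longrightarrow> j \<in> {1..l} \<Longrightarrow> a i j = a j i"
    and a_diag: "\<And>i. i \<in> {1..l} \<Longrightarrow> a i i = 2"
    and N_dvd: "\<And>i j. i \<in> {1..l} \<Longrightarrow> j \<in> {1..l} \<Longrightarrow> int (N r s) dvd a i j"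
    and ij: "i \<in> {1..l}" "j \<in> {1..l}" "\<bar>a i j div int (N r s)\<bar> = 1"
    and k: "k \<in> {1..l}" and rs: "(r, s) \<in> index_pairs \<nu>"
  shows "x k \<otimes> z r s = z r s \<otimes> x k"
proof -
  let ?n = "int (N r s)" and ?w = "z r s"
  define p q where "p = - a k i" and "q = - a k j"
  have r: "r \<in> {1..\<nu>}" and s: "s \<in> {1..\<nu>}" using rs by (auto simp: index_pairs_def)
  have n0: "?n \<noteq> 0"
  proof
    assume "?n = 0"
    then have "a i j div ?n = 0" by simp
    then show False using ij(3) by simp
  qed
  have ce: "commutator_exponent ?w (y i r) (y j s) (a i j div ?n)"
    if "i \<in> {1..l}" "j \<in> {1..l}" for i j
    using that rs r s y_y[OF that rs] y_z[OF that(1) r rs] y_z[OF that(2) s rs]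
    by (simp add: commutator_exponent_def)
  have c1: "commutator_exponent ?w (y i r \<otimes> y k r [^] p) (y j s) (a i j div ?n + p * (a k j div ?n))"
    by (intro commutator_exponent_mult_left commutator_exponent_power_left ce ij k)
  have c2: "commutator_exponent ?w (y i r \<otimes> y k r [^] p) (y k s [^] q)
      (q * (a i k div ?n + p * (a k k div ?n)))"
    by (intro commutator_exponent_power_right commutator_exponent_mult_left
        commutator_exponent_power_left ce ij k)
  have "?n * (a i j div ?n + p * (a k j div ?n) + q * (a i k div ?n + p * (a k k div ?n))) =
      a i j + p * a k j + q * (a i k + p * a k k)"
    using N_dvd[OF ij(1,2)] N_dvd[OF k ij(2)] N_dvd[OF ij(1) k] N_dvd[OF k k] n0
    by (auto simp: dvd_def algebra_simps)
  also have "\<dots> = a i j"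
    using a_sym[OF ij(1) k] a_diag[OF k] by (simp add: p_def q_def algebra_simps)
  also have "\<dots> = ?n * (a i j div ?n)"
    using N_dvd[OF ij(1,2)] by simp
  finally have exponent: "a i j div ?n + p * (a k j div ?n) + q * (a i k div ?n + p * (a k k div ?n))
      = a i j div ?n"
    using n0 by simp
  define e where "e = a i j div ?n"
  define u v where "u = y i r" and "v = y j s"
  have uv: "u \<in> carrier G" "v \<in> carrier G" using ij r s by (auto simp: u_def v_def)
  have xk: "x k \<in> carrier G" and w: "?w \<in> carrier G" using k rs by auto
  have xx: "x k \<otimes> (x k \<otimes> h) = h" if "h \<in> carrier G" for h
    using that xk x_square[OF k] by (simp add: m_assoc[symmetric])
  let ?c = "\<lambda>h. x k \<otimes> h \<otimes> x k"
  have conj_mult: "?c (h \<otimes> h') = ?c h \<otimes> ?c h'" if "h \<in> carrier G" "h' \<in> carrier G" for h h'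
    using that xk by (simp add: m_assoc xx)
  have "commutator_exponent ?w (?c u) (?c v) e"
    using commutator_exponent_mult_right[OF c1 c2, unfolded exponent]
    unfolding p_def q_def e_def u_def v_def x_y_x[OF k ij(1) r] x_y_x[OF k ij(2) s] .
  then have "?c u \<otimes> ?c v = ?c v \<otimes> ?c u \<otimes> ?w [^] e"
    by (simp add: commutator_exponent_def)
  moreover have "u \<otimes> v = v \<otimes> u \<otimes> ?w [^] e"
    using ce[OF ij(1,2)] by (simp add: commutator_exponent_def u_def v_def e_def)
  then have "?c u \<otimes> ?c v = ?c v \<otimes> ?c u \<otimes> ?c (?w [^] e)"
    using uv w by (simp flip: conj_mult)
  ultimately have "?c (?w [^] e) = ?w [^] e"
    using uv w xk by (metis Units_eq Units_l_cancel m_closed int_pow_closed)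
  then have e: "x k \<otimes> ?w [^] e = ?w [^] e \<otimes> x k"
    using w xk xx by (metis int_pow_closed m_assoc m_closed)
  have "e = 1 \<or> e = - 1" using ij(3) by (auto simp: e_def)
  then have "?w = (?w [^] e) [^] e" using w by (auto simp: int_pow_pow)
  then show ?thesis using power_commute[OF xk _ e, of e] w by auto
qed

section \<open>The two presentations\<close>

lemma weyl_rels_words: "weyl_rels l \<nu> a N \<subseteq> words (weyl_gens l \<nu>) \<times> words (weyl_gens l \<nu>)"
  by (auto simp: weyl_rels_def weyl_gens_def index_pairs_def intro!: words_wpow)

lemma xz_rels_words: "xz_rels l \<nu> \<subseteq> words (weyl_gens l \<nu>) \<times> words (weyl_gens l \<nu>)"
  by (auto simp: xz_rels_def weyl_gens_def)

lemma rank1_rels_words: "rank1_rels \<nu> N \<subseteq> words (rank1_gens \<nu>) \<times> words (rank1_gens \<nu>)"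
  by (auto simp: rank1_rels_def rank1_gens_def index_pairs_def intro!: words_wpow)

lemma rank1_xz_rels_words: "rank1_xz_rels \<nu> \<subseteq> words (rank1_gens \<nu>) \<times> words (rank1_gens \<nu>)"
  by (auto simp: rank1_xz_rels_def rank1_gens_def)

lemma Ball_weyl_rels:
  "(\<forall>p\<in>weyl_rels l \<nu> a N. Q p) \<longleftrightarrow>
     (\<forall>i\<in>{1..l}. Q (wpow (wx i) 2, [])) \<and>
     (\<forall>i\<in>{1..l}. \<forall>j\<in>{1..l}. i \<noteq> j \<longrightarrow> Q (wpow (wx i @ wx j) ((a i j)\<^sup>2 + 2), [])) \<and>
     (\<forall>i\<in>{1..l}. \<forall>j\<in>{1..l}. \<forall>r\<in>{1..\<nu>}. Q (wx i @ wy j r @ wx i, wy j r @ wpow (wy i r) (- a i j))) \<and>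
     (\<forall>(r, s)\<in>index_pairs \<nu>. \<forall>(r', s')\<in>index_pairs \<nu>. Q (wcomm (wz r s) (wz r' s'), [])) \<and>
     (\<forall>i\<in>{1..l}. \<forall>r\<in>{1..\<nu>}. \<forall>(r', s')\<in>index_pairs \<nu>. Q (wcomm (wy i r) (wz r' s'), [])) \<and>
     (\<forall>i\<in>{1..l}. \<forall>j\<in>{1..l}. \<forall>r\<in>{1..\<nu>}. Q (wcomm (wy i r) (wy j r), [])) \<and>
     (\<forall>i\<in>{1..l}. \<forall>j\<in>{1..l}. \<forall>(r, s)\<in>index_pairs \<nu>.
        Q (wcomm (wy i r) (wy j s), wpow (wz r s) (a i j div int (N r s))))"
  unfolding weyl_rels_def ball_Un conj_assoc by (intro arg_cong2[where f="(\<and>)"]) fast+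

context group begin

lemma weyl_relations_iff:
  assumes f: "f \<in> weyl_gens l \<nu> \<rightarrow> carrier G"
  shows "(\<forall>p\<in>weyl_rels l \<nu> a N. word_value G f (fst p) = word_value G f (snd p)) \<longleftrightarrow>
    weyl_relations G l \<nu> a N (\<lambda>i. f (GenX i)) (\<lambda>i r. f (GenY i r)) (\<lambda>r s. f (GenZ r s))"
proof -
  have X: "GenX i \<in> weyl_gens l \<nu>" "f (GenX i) \<in> carrier G" if "i \<in> {1..l}" for i
    using that f by (auto simp: weyl_gens_def)
  have Y: "GenY i r \<in> weyl_gens l \<nu>" "f (GenY i r) \<in> carrier G" if "i \<in> {1..l}" "r \<in> {1..\<nu>}" for i r
    using that f by (auto simp: weyl_gens_def)
  have Z: "GenZ r s \<in> weyl_gens l \<nu>" "f (GenZ r s) \<in> carrier G" if "(r, s) \<in> index_pairs \<nu>" for r s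
    using that f by (auto simp: weyl_gens_def)
  have rs: "r \<in> {1..\<nu>}" "s \<in> {1..\<nu>}" if "(r, s) \<in> index_pairs \<nu>" for r s
    using that by (auto simp: index_pairs_def)
  have x2: "word_value G f (wpow (wx i) 2) = f (GenX i) \<otimes> f (GenX i)" if "i \<in> {1..l}" for i
    using X[OF that] int_pow_mult[of "f (GenX i)" 1 1] by (simp add: word_value_wpow[OF f])
  have w: "word_value G f (wx i) = f (GenX i)" if "i \<in> {1..l}" for i using X[OF that] by simp
  have xx: "word_value G f (wpow (wx i @ wx j) e) = (f (GenX i) \<otimes> f (GenX j)) [^] e"
    if "i \<in> {1..l}" "j \<in> {1..l}" for i j e
    using X[OF that(1)] X[OF that(2)] by (simp add: word_value_wpow[OF f])
  have xyx: "word_value G f (wx i @ wy j r @ wx i) = f (GenX i) \<otimes> f (GenY j r) \<otimes> f (GenX i)"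
      "word_value G f (wy j r @ wpow (wy i r) e) = f (GenY j r) \<otimes> f (GenY i r) [^] e"
    if "i \<in> {1..l}" "j \<in> {1..l}" "r \<in> {1..\<nu>}" for i j r e
    using X[OF that(1)] Y[OF that(2,3)] Y[OF that(1,3)]
    by (simp_all add: word_value_wpow[OF f] m_assoc)
  have comm: "word_value G f (wcomm [(g, True)] [(h, True)]) = c \<longleftrightarrow> f g \<otimes> f h = f h \<otimes> f g \<otimes> c"
    if "g \<in> weyl_gens l \<nu>" "h \<in> weyl_gens l \<nu>" "c \<in> carrier G" for g h c
  proof -
    have "f g \<in> carrier G" "f h \<in> carrier G" using f that by auto
    then show ?thesis using that commutator_eq_iff[of "f g" "f h" c]
      by (simp add: word_value_wcomm[OF f])
  qed
  have zp: "word_value G f (wpow (wz r s) e) = f (GenZ r s) [^] e" if "(r, s) \<in> index_pairs \<nu>" for r s e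
    using Z[OF that] by (simp add: word_value_wpow[OF f])
  have zz: "word_value G f (wcomm (wz r s) (wz r' s')) = \<one> \<longleftrightarrow>
      f (GenZ r s) \<otimes> f (GenZ r' s') = f (GenZ r' s') \<otimes> f (GenZ r s)"
    if "(r, s) \<in> index_pairs \<nu>" "(r', s') \<in> index_pairs \<nu>" for r s r' s'
    using comm[OF Z(1)[OF that(1)] Z(1)[OF that(2)], of \<one>] Z[OF that(1)] Z[OF that(2)] by simp
  have yz: "word_value G f (wcomm (wy i r) (wz r' s')) = \<one> \<longleftrightarrow>
      f (GenY i r) \<otimes> f (GenZ r' s') = f (GenZ r' s') \<otimes> f (GenY i r)"
    if "i \<in> {1..l}" "r \<in> {1..\<nu>}" "(r', s') \<in> index_pairs \<nu>" for i r r' s'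
    using comm[OF Y(1)[OF that(1,2)] Z(1)[OF that(3)], of \<one>] Y[OF that(1,2)] Z[OF that(3)] by simp
  have yy0: "word_value G f (wcomm (wy i r) (wy j r)) = \<one> \<longleftrightarrow>
      f (GenY i r) \<otimes> f (GenY j r) = f (GenY j r) \<otimes> f (GenY i r)"
    if "i \<in> {1..l}" "j \<in> {1..l}" "r \<in> {1..\<nu>}" for i j r
    using comm[OF Y(1)[OF that(1,3)] Y(1)[OF that(2,3)], of \<one>] Y[OF that(1,3)] Y[OF that(2,3)] by simp
  have yy: "word_value G f (wcomm (wy i r) (wy j s)) = word_value G f (wpow (wz r s) e) \<longleftrightarrow>
      f (GenY i r) \<otimes> f (GenY j s) = f (GenY j s) \<otimes> f (GenY i r) \<otimes> f (GenZ r s) [^] e"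
    if "i \<in> {1..l}" "j \<in> {1..l}" "(r, s) \<in> index_pairs \<nu>" for i j r s e
    unfolding zp[OF that(3)] using that rs[OF that(3)] Z[OF that(3)] by (intro comm Y) auto
  have eqs: "(\<forall>p\<in>weyl_rels l \<nu> a N. word_value G f (fst p) = word_value G f (snd p)) \<longleftrightarrow>
     (\<forall>i\<in>{1..l}. f (GenX i) \<otimes> f (GenX i) = \<one>) \<and>
     (\<forall>i\<in>{1..l}. \<forall>j\<in>{1..l}. i \<noteq> j \<longrightarrow> (f (GenX i) \<otimes> f (GenX j)) [^] ((a i j)\<^sup>2 + 2) = \<one>) \<and>
     (\<forall>i\<in>{1..l}. \<forall>j\<in>{1..l}. \<forall>r\<in>{1..\<nu>}. f (GenX i) \<otimes> f (GenY j r) \<otimes> f (GenX i) =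
        f (GenY j r) \<otimes> f (GenY i r) [^] (- a i j)) \<and>
     (\<forall>(r, s)\<in>index_pairs \<nu>. \<forall>(r', s')\<in>index_pairs \<nu>. f (GenZ r s) \<otimes> f (GenZ r' s') =
        f (GenZ r' s') \<otimes> f (GenZ r s)) \<and>
     (\<forall>i\<in>{1..l}. \<forall>r\<in>{1..\<nu>}. \<forall>(r', s')\<in>index_pairs \<nu>. f (GenY i r) \<otimes> f (GenZ r' s') =
        f (GenZ r' s') \<otimes> f (GenY i r)) \<and>
     (\<forall>i\<in>{1..l}. \<forall>j\<in>{1..l}. \<forall>r\<in>{1..\<nu>}. f (GenY i r) \<otimes> f (GenY j r) = f (GenY j r) \<otimes> f (GenY i r)) \<and>
     (\<forall>i\<in>{1..l}. \<forall>j\<in>{1..l}. \<forall>(r, s)\<in>index_pairs \<nu>.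
        f (GenY i r) \<otimes> f (GenY j s) =
        f (GenY j s) \<otimes> f (GenY i r) \<otimes> f (GenZ r s) [^] (a i j div int (N r s)))"
    unfolding Ball_weyl_rels fst_conv snd_conv
  proof (intro conj_cong ball_cong refl imp_cong, goal_cases)
    case (4 p)
    then show ?case by (cases p) (auto simp: zz)
  next
    case (5 i r p)
    then show ?case by (cases p) (auto simp: yz)
  next
    case (7 i j p)
    then show ?case by (cases p) (auto simp: yy)
  qed (simp_all only: x2 xx xyx yy0 word_value_Nil)
  show ?thesis
  proof
    assume "\<forall>p\<in>weyl_rels l \<nu> a N. word_value G f (fst p) = word_value G f (snd p)"
    note R = this[unfolded eqs]
    note R1 = R[THEN conjunct1]
    note R2 = R[THEN conjunct2, THEN conjunct1]
    note R3 = R[THEN conjunct2, THEN conjunct2, THEN conjunct1]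
    note R4 = R[THEN conjunct2, THEN conjunct2, THEN conjunct2, THEN conjunct1]
    note R5 = R[THEN conjunct2, THEN conjunct2, THEN conjunct2, THEN conjunct2, THEN conjunct1]
    note R6 = R[THEN conjunct2, THEN conjunct2, THEN conjunct2, THEN conjunct2, THEN conjunct2, THEN conjunct1]
    note R7 = R[THEN conjunct2, THEN conjunct2, THEN conjunct2, THEN conjunct2, THEN conjunct2, THEN conjunct2]
    show "weyl_relations G l \<nu> a N (\<lambda>i. f (GenX i)) (\<lambda>i r. f (GenY i r)) (\<lambda>r s. f (GenZ r s))"
    proof (unfold_locales, goal_cases)
      case 1 then show ?case by (rule X(2))
    next
      case 2 then show ?case by (rule Y(2))
    next
      case 3 then show ?case by (rule Z(2))
    next
      case 4 then show ?case using R1 by blast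
    next
      case 5 then show ?case using R2 by blast
    next
      case 6 then show ?case using R3 by blast
    next
      case 7 then show ?case using R4 by blast
    next
      case 8 then show ?case using R5 by blast
    next
      case 9 then show ?case using R6 by blast
    next
      case 10 then show ?case using R7 by blast
    qed
  next
    assume "weyl_relations G l \<nu> a N (\<lambda>i. f (GenX i)) (\<lambda>i r. f (GenY i r)) (\<lambda>r s. f (GenZ r s))"
    then interpret R: weyl_relations G l \<nu> a N "\<lambda>i. f (GenX i)" "\<lambda>i r. f (GenY i r)" "\<lambda>r s. f (GenZ r s)" .
    show "\<forall>p\<in>weyl_rels l \<nu> a N. word_value G f (fst p) = word_value G f (snd p)"
      unfolding eqs
    proof (intro conjI, goal_cases)
      case 1 then show ?case using R.x_square by blast
    next
      case 2 then show ?case using R.x_braid by blast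
    next
      case 3 then show ?case using R.x_y_x by blast
    next
      case 4 then show ?case using R.z_z by blast
    next
      case 5 then show ?case using R.y_z by blast
    next
      case 6 then show ?case using R.y_y_same by blast
    next
      case 7 then show ?case using R.y_y by blast
    qed
  qed
qed

lemma xz_rels_iff:
  assumes f: "f \<in> weyl_gens l \<nu> \<rightarrow> carrier G"
  shows "(\<forall>p\<in>xz_rels l \<nu>. word_value G f (fst p) = word_value G f (snd p)) \<longleftrightarrow>
    (\<forall>i\<in>{1..l}. \<forall>(r, s)\<in>index_pairs \<nu>. f (GenX i) \<otimes> f (GenZ r s) = f (GenZ r s) \<otimes> f (GenX i))"
proof -
  have "word_value G f (wcomm (wx i) (wz r s)) = \<one> \<longleftrightarrow> f (GenX i) \<otimes> f (GenZ r s) = f (GenZ r s) \<otimes> f (GenX i)"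
    if "i \<in> {1..l}" "(r, s) \<in> index_pairs \<nu>" for i r s
  proof -
    have "GenX i \<in> weyl_gens l \<nu>" "GenZ r s \<in> weyl_gens l \<nu>"
      using that by (auto simp: weyl_gens_def)
    moreover from this have "f (GenX i) \<in> carrier G" "f (GenZ r s) \<in> carrier G" using f by auto
    ultimately show ?thesis
      using commutator_eq_iff[of "f (GenX i)" "f (GenZ r s)" \<one>] by (simp add: word_value_wcomm[OF f])
  qed
  then show ?thesis unfolding xz_rels_def by fastforce
qed

end

section \<open>The Coxeter presentation of a simply laced finite Weyl group\<close>

declare One_nat_def [simp del]

locale simple_system =
  fixes b :: "'v::euclidean_space \<Rightarrow> 'v \<Rightarrow> real" and Vd \<Phi> :: "'v set" and l :: nat and \<alpha> :: "nat \<Rightarrow> 'v"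
  assumes bilinear_form: "bilinear b" and form_sym: "b v w = b w v"
    and root_system: "finite_root_system b Vd \<Phi>"
    and fundamental: "fundamental_system \<Phi> l \<alpha>"
    and simple_norm: "i \<in> {1..l} \<Longrightarrow> b (\<alpha> i) (\<alpha> i) = 2"
begin

lemmas form_simps = bilinear_ladd[OF bilinear_form] bilinear_radd[OF bilinear_form]
  bilinear_lsub[OF bilinear_form] bilinear_rsub[OF bilinear_form]
  bilinear_lneg[OF bilinear_form] bilinear_rneg[OF bilinear_form]
  bilinear_lzero[OF bilinear_form] bilinear_rzero[OF bilinear_form]
  bilinear_lmul[OF bilinear_form] bilinear_rmul[OF bilinear_form]

lemma form_sum_left: "b (\<Sum>i\<in>I. f i) v = (\<Sum>i\<in>I. b (f i) v)"
  using linear_sum[of "\<lambda>u. b u v"] bilinear_form by (simp add: bilinear_def)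

lemma form_sum_right: "b v (\<Sum>i\<in>I. f i) = (\<Sum>i\<in>I. b v (f i))"
  using linear_sum[of "\<lambda>u. b v u"] bilinear_form by (simp add: bilinear_def)

lemma root_in_space: "\<beta> \<in> \<Phi> \<Longrightarrow> \<beta> \<in> Vd"
  using root_system span_base by (auto simp: finite_root_system_def)

lemma subspace_Vd: "subspace Vd"
  using root_system by (auto simp: finite_root_system_def)

lemma form_pos: "v \<in> Vd \<Longrightarrow> v \<noteq> 0 \<Longrightarrow> 0 < b v v"
  using root_system by (auto simp: finite_root_system_def)

lemma simple_root: "i \<in> {1..l} \<Longrightarrow> \<alpha> i \<in> \<Phi>"
  using fundamental by (auto simp: fundamental_system_def)

lemma simple_inj: "inj_on \<alpha> {1..l}"
  using fundamental by (simp add: fundamental_system_def)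

lemma simple_nonzero: "i \<in> {1..l} \<Longrightarrow> \<alpha> i \<noteq> 0"
  using simple_norm[of i] by (auto simp: form_simps)

lemma simple_coroot: "i \<in> {1..l} \<Longrightarrow> coroot b (\<alpha> i) = \<alpha> i"
  by (simp add: coroot_def simple_norm)

definition reflection :: "nat \<Rightarrow> 'v \<Rightarrow> 'v" where
  "reflection i v = v - b v (\<alpha> i) *\<^sub>R \<alpha> i"

lemma root_reflection:
  "\<beta> \<in> \<Phi> \<Longrightarrow> \<gamma> \<in> \<Phi> \<Longrightarrow> \<gamma> \<noteq> 0 \<Longrightarrow>
    \<beta> - b \<beta> (coroot b \<gamma>) *\<^sub>R \<gamma> \<in> \<Phi> \<and> b \<beta> (coroot b \<gamma>) \<in> \<int>"
  using root_system by (auto simp: finite_root_system_def)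

lemma reflection_root: "i \<in> {1..l} \<Longrightarrow> \<beta> \<in> \<Phi> \<Longrightarrow> reflection i \<beta> \<in> \<Phi>"
  using root_reflection[of \<beta> "\<alpha> i"] simple_root simple_nonzero simple_coroot
  by (simp add: reflection_def)

lemma root_int: "i \<in> {1..l} \<Longrightarrow> \<beta> \<in> \<Phi> \<Longrightarrow> b \<beta> (\<alpha> i) \<in> \<int>"
  using root_reflection[of \<beta> "\<alpha> i"] simple_root simple_nonzero simple_coroot by simp

lemma reflection_simple: "i \<in> {1..l} \<Longrightarrow> reflection i (\<alpha> i) = - \<alpha> i"
  by (simp add: reflection_def simple_norm scaleR_2)

lemma reflection_form: "i \<in> {1..l} \<Longrightarrow> b (reflection i v) (reflection i w) = b v w"
  by (simp add: reflection_def form_simps simple_norm form_sym[of "\<alpha> i" w] algebra_simps)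

lemma reflection_reflection: "i \<in> {1..l} \<Longrightarrow> reflection i (reflection i v) = v"
  by (simp add: reflection_def form_simps simple_norm scaleR_diff_left)

lemma linear_reflection: "linear (reflection i)"
  by (rule linearI) (simp_all add: reflection_def form_simps algebra_simps)

lemma root_minus: "\<beta> \<in> \<Phi> \<Longrightarrow> - \<beta> \<in> \<Phi>"
proof (cases "\<beta> = 0")
  case False
  assume \<beta>: "\<beta> \<in> \<Phi>"
  then have "\<beta> - b \<beta> (coroot b \<beta>) *\<^sub>R \<beta> \<in> \<Phi>"
    using root_system False by (auto simp: finite_root_system_def)
  moreover have "b \<beta> (coroot b \<beta>) = 2"
    using form_pos[OF root_in_space[OF \<beta>] False] by (simp add: coroot_def form_simps)
  ultimately show ?thesis by (simp add: scaleR_2)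
qed simp

lemma root_multiple: "\<beta> \<in> \<Phi> \<Longrightarrow> \<beta> \<noteq> 0 \<Longrightarrow> t *\<^sub>R \<beta> \<in> \<Phi> \<Longrightarrow> t \<noteq> 0 \<Longrightarrow> t = 1 \<or> t = - 1"
  using root_system by (auto simp: finite_root_system_def)

abbreviation combination :: "(nat \<Rightarrow> real) \<Rightarrow> 'v" where
  "combination c \<equiv> \<Sum>i\<in>{1..l}. c i *\<^sub>R \<alpha> i"

lemma combination_zero:
  assumes "combination c = 0" "i \<in> {1..l}" shows "c i = 0"
proof -
  have inj: "inj_on \<alpha> {1..l}" and ind: "independent (\<alpha> ` {1..l})"
    using fundamental by (auto simp: fundamental_system_def)
  have "(\<Sum>v\<in>\<alpha> ` {1..l}. c (the_inv_into {1..l} \<alpha> v) *\<^sub>R v) = combination c"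
    by (subst sum.reindex[OF inj]) (auto intro!: sum.cong simp: the_inv_into_f_f[OF inj])
  then have "c (the_inv_into {1..l} \<alpha> (\<alpha> i)) = 0"
    using assms independentD[OF ind, of "\<alpha> ` {1..l}" "\<lambda>v. c (the_inv_into {1..l} \<alpha> v)"] by auto
  then show ?thesis using the_inv_into_f_f[OF inj assms(2)] by simp
qed

lemma combination_eqD:
  assumes "combination c = combination d" "i \<in> {1..l}" shows "c i = d i"
  using combination_zero[of "\<lambda>i. c i - d i", OF _ assms(2)] assms(1)
  by (simp add: scaleR_diff_left sum_subtractf)

lemma simple_combination: "i \<in> {1..l} \<Longrightarrow> \<alpha> i = combination (\<lambda>j. if j = i then 1 else 0)"
  by (simp add: if_distrib[of "\<lambda>t. t *\<^sub>R _"] sum.delta cong: if_cong)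

lemma combination_add_simple:
  "i \<in> {1..l} \<Longrightarrow> combination c + t *\<^sub>R \<alpha> i = combination (c(i := c i + t))"
  by (simp add: sum.remove[of "{1..l}" i] scaleR_add_left)

definition positive_root :: "nat \<Rightarrow> 'v \<Rightarrow> bool" where
  "positive_root n \<beta> \<longleftrightarrow> \<beta> \<in> \<Phi> \<and> \<beta> \<noteq> 0 \<and>
     (\<exists>k :: nat \<Rightarrow> nat. \<beta> = combination (\<lambda>i. real (k i)) \<and> (\<Sum>i\<in>{1..l}. k i) = n)"

lemma positive_root_cases:
  assumes "\<beta> \<in> \<Phi>" "\<beta> \<noteq> 0"
  shows "(\<exists>n. positive_root n \<beta>) \<or> (\<exists>n. positive_root n (- \<beta>))"
proof -
  obtain k :: "nat \<Rightarrow> int" where k: "\<beta> = combination (\<lambda>i. of_int (k i))"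
    "(\<forall>i\<in>{1..l}. 0 \<le> k i) \<or> (\<forall>i\<in>{1..l}. k i \<le> 0)"
    using fundamental assms(1) unfolding fundamental_system_def by metis
  from k(2) show ?thesis
  proof
    assume "\<forall>i\<in>{1..l}. 0 \<le> k i"
    then have "\<beta> = combination (\<lambda>i. real (nat (k i)))"
      unfolding k(1) by (intro sum.cong) auto
    then show ?thesis using assms by (auto simp: positive_root_def)
  next
    assume "\<forall>i\<in>{1..l}. k i \<le> 0"
    then have "- \<beta> = combination (\<lambda>i. real (nat (- k i)))"
      unfolding k(1) by (subst sum_negf[symmetric], intro sum.cong) auto
    then have "positive_root (\<Sum>i\<in>{1..l}. nat (- k i)) (- \<beta>)"
      unfolding positive_root_def using assms root_minus[OF assms(1)]
      by (intro conjI exI[of _ "\<lambda>i. nat (- k i)"]) auto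
    then show ?thesis by blast
  qed
qed

lemma not_positive_and_negative: "positive_root n \<beta> \<Longrightarrow> \<not> positive_root m (- \<beta>)"
proof
  assume "positive_root n \<beta>" "positive_root m (- \<beta>)"
  then obtain k k' :: "nat \<Rightarrow> nat" where k: "\<beta> \<noteq> 0" "\<beta> = combination (\<lambda>i. real (k i))"
    "- \<beta> = combination (\<lambda>i. real (k' i))"
    unfolding positive_root_def by blast
  have "combination (\<lambda>i. real (k i) + real (k' i)) = \<beta> + - \<beta>"
    unfolding k(2)[symmetric] k(3) by (subst k(2)) (simp add: scaleR_add_left sum.distrib)
  then have "combination (\<lambda>i. real (k i) + real (k' i)) = 0" by simp
  then have "k i = 0" if "i \<in> {1..l}" for i
    using combination_zero[of "\<lambda>i. real (k i) + real (k' i)" i] that by simp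
  then have "\<beta> = 0" unfolding k(2) by (intro sum.neutral) auto
  then show False using k(1) by simp
qed

lemma simple_positive: "i \<in> {1..l} \<Longrightarrow> positive_root 1 (\<alpha> i)"
  unfolding positive_root_def
  by (intro conjI exI[of _ "\<lambda>j. if j = i then 1 else 0"] simple_root simple_nonzero)
    (use simple_combination[of i] in \<open>auto simp: if_distrib[of real] cong: if_cong\<close>)

text \<open>A simple reflection permutes the positive roots other than its own simple root, because it
  changes only one coefficient.\<close>

lemma positive_root_reflection:
  assumes "positive_root n \<beta>" "i \<in> {1..l}" "\<beta> \<noteq> \<alpha> i"
  shows "\<exists>m. positive_root m (reflection i \<beta>) \<and> int m = int n - \<lfloor>b \<beta> (\<alpha> i)\<rfloor>"
proof -
  obtain k :: "nat \<Rightarrow> nat" where k: "\<beta> = combination (\<lambda>i. real (k i))" "(\<Sum>i\<in>{1..l}. k i) = n"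
    and \<beta>: "\<beta> \<in> \<Phi>" "\<beta> \<noteq> 0"
    using assms by (auto simp: positive_root_def)
  have "\<exists>j\<in>{1..l} - {i}. k j \<noteq> 0"
  proof (rule ccontr)
    assume "\<not> ?thesis"
    then have *: "\<beta> = real (k i) *\<^sub>R \<alpha> i"
      using assms(2) by (simp add: k(1) sum.remove[of "{1..l}" i])
    then have "real (k i) = 1 \<or> real (k i) = - 1"
      using \<beta> root_multiple[OF simple_root simple_nonzero, of i "real (k i)"] assms(2) by auto
    then show False using * assms(3) by auto
  qed
  then obtain j where j: "j \<in> {1..l}" "j \<noteq> i" "k j \<noteq> 0" by blast
  obtain c where c: "b \<beta> (\<alpha> i) = of_int c"
    using root_int[OF assms(2) \<beta>(1)] by (auto elim: Ints_cases)
  let ?k = "(\<lambda>i. int (k i))(i := int (k i) - c)"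
  have refl: "reflection i \<beta> = combination (\<lambda>i. of_int (?k i))"
    using combination_add_simple[OF assms(2), of "\<lambda>i. real (k i)" "- of_int c"]
    unfolding k(1)[symmetric]
    by (simp add: reflection_def c fun_upd_def if_distrib[of real_of_int] cong: if_cong)
  have r: "reflection i \<beta> \<in> \<Phi>" using reflection_root assms(2) \<beta>(1) .
  then obtain k' :: "nat \<Rightarrow> int" where k': "reflection i \<beta> = combination (\<lambda>i. of_int (k' i))"
    "(\<forall>i\<in>{1..l}. 0 \<le> k' i) \<or> (\<forall>i\<in>{1..l}. k' i \<le> 0)"
    using fundamental unfolding fundamental_system_def by metis
  have eq: "k' p = ?k p" if "p \<in> {1..l}" for p
    using combination_eqD[of "\<lambda>i. of_int (k' i)" "\<lambda>i. of_int (?k i)" p] refl k'(1) that by simp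
  have "k' j > 0" using eq[OF j(1)] j by simp
  then have pos: "\<forall>p\<in>{1..l}. 0 \<le> ?k p" using k'(2) eq j(1) by (metis not_less)
  have pos_root: "positive_root (\<Sum>p\<in>{1..l}. nat (?k p)) (reflection i \<beta>)"
    unfolding positive_root_def
  proof (intro conjI exI[of _ "\<lambda>p. nat (?k p)"] r)
    show "reflection i \<beta> = combination (\<lambda>p. real (nat (?k p)))"
      unfolding refl using pos by (intro sum.cong) auto
    show "reflection i \<beta> \<noteq> 0"
      using reflection_reflection[OF assms(2), of \<beta>] \<beta>(2) linear_0[OF linear_reflection, of i] by metis
  qed simp
  have "int (\<Sum>p\<in>{1..l}. nat (?k p)) = (\<Sum>p\<in>{1..l}. ?k p)"
    using pos by simp
  also have "\<dots> = (\<Sum>p\<in>{1..l}. int (k p)) - c"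
    using assms(2) by (simp add: sum.remove[of "{1..l}" i])
  finally have "int (\<Sum>p\<in>{1..l}. nat (?k p)) = int n - c"
    by (simp add: k(2)[symmetric])
  with pos_root show ?thesis using c by auto
qed

lemma positive_root_pairing:
  assumes "positive_root n \<beta>"
  shows "\<exists>i\<in>{1..l}. b \<beta> (\<alpha> i) > 0"
proof (rule ccontr)
  assume "\<not> ?thesis"
  then have neg: "\<forall>i\<in>{1..l}. b \<beta> (\<alpha> i) \<le> 0" by auto
  obtain k :: "nat \<Rightarrow> nat" where k: "\<beta> = combination (\<lambda>i. real (k i))"
    and \<beta>: "\<beta> \<in> \<Phi>" "\<beta> \<noteq> 0"
    using assms by (auto simp: positive_root_def)
  have "b \<beta> \<beta> = (\<Sum>i\<in>{1..l}. real (k i) * b \<beta> (\<alpha> i))"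
    by (subst (2) k) (simp add: form_sum_right form_simps)
  also have "\<dots> \<le> 0" by (intro sum_nonpos mult_nonneg_nonpos) (use neg in auto)
  finally show False using form_pos[OF root_in_space[OF \<beta>(1)] \<beta>(2)] by simp
qed

definition act :: "nat list \<Rightarrow> 'v \<Rightarrow> 'v" where
  "act js v = foldr reflection js v"

lemma act_Nil [simp]: "act [] v = v" by (simp add: act_def)

lemma act_Cons [simp]: "act (j # js) v = reflection j (act js v)" by (simp add: act_def)

lemma act_append: "act (is @ js) v = act is (act js v)" by (simp add: act_def)

lemma act_form: "set js \<subseteq> {1..l} \<Longrightarrow> b (act js v) (act js w) = b v w"
  by (induction js) (auto simp: reflection_form)

lemma act_root: "set js \<subseteq> {1..l} \<Longrightarrow> \<beta> \<in> \<Phi> \<Longrightarrow> act js \<beta> \<in> \<Phi>"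
  by (induction js) (auto intro: reflection_root)

lemma linear_act: "linear (act js)"
  by (induction js) (auto simp: act_def id_def[symmetric] linear_id
      intro: linear_compose[OF _ linear_reflection, unfolded o_def])

lemma positive_root_orbit:
  "positive_root n \<beta> \<Longrightarrow> \<exists>js i. set js \<subseteq> {1..l} \<and> i \<in> {1..l} \<and> \<beta> = act js (\<alpha> i)"
proof (induction n arbitrary: \<beta> rule: less_induct)
  case (less n)
  show ?case
  proof (cases "\<exists>i\<in>{1..l}. \<beta> = \<alpha> i")
    case True
    then show ?thesis by (metis act_Nil empty_set empty_subsetI)
  next
    case False
    obtain i where i: "i \<in> {1..l}" "b \<beta> (\<alpha> i) > 0" using positive_root_pairing[OF less.prems] by auto
    obtain m where m: "positive_root m (reflection i \<beta>)" "int m = int n - \<lfloor>b \<beta> (\<alpha> i)\<rfloor>"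
      using positive_root_reflection[OF less.prems i(1)] False i by auto
    have "b \<beta> (\<alpha> i) \<in> \<int>" using root_int[OF i(1)] less.prems by (auto simp: positive_root_def)
    then have "m < n" using m(2) i(2) by (auto elim!: Ints_cases)
    then obtain js j where "set js \<subseteq> {1..l}" "j \<in> {1..l}" "reflection i \<beta> = act js (\<alpha> j)"
      using less.IH m(1) by blast
    then show ?thesis
      using i(1) reflection_reflection[OF i(1), of \<beta>]
      by (intro exI[of _ "i # js"] exI[of _ j]) auto
  qed
qed

lemma root_orbit:
  assumes "\<beta> \<in> \<Phi>" "\<beta> \<noteq> 0"
  shows "\<exists>js i. set js \<subseteq> {1..l} \<and> i \<in> {1..l} \<and> \<beta> = act js (\<alpha> i)"
proof -
  from positive_root_cases[OF assms] consider n where "positive_root n \<beta>" | n where "positive_root n (- \<beta>)"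
    by blast
  then show ?thesis
  proof cases
    case 1
    then show ?thesis by (rule positive_root_orbit)
  next
    case 2
    then obtain js i where js: "set js \<subseteq> {1..l}" "i \<in> {1..l}" "- \<beta> = act js (\<alpha> i)"
      using positive_root_orbit by blast
    have "act (js @ [i]) (\<alpha> i) = - act js (\<alpha> i)"
      using js(2) linear_neg[OF linear_act] by (simp add: act_append reflection_simple)
    then have "\<beta> = act (js @ [i]) (\<alpha> i)" unfolding js(3)[symmetric] by simp
    then show ?thesis using js by (intro exI[of _ "js @ [i]"] exI[of _ i]) auto
  qed
qed

lemma root_norm: "\<beta> \<in> \<Phi> \<Longrightarrow> \<beta> \<noteq> 0 \<Longrightarrow> b \<beta> \<beta> = 2"
  using root_orbit act_form simple_norm by metis

lemma root_pairing_cases: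
  assumes "\<beta> \<in> \<Phi>" "\<beta> \<noteq> 0" "i \<in> {1..l}"
  shows "\<beta> = \<alpha> i \<or> \<beta> = - \<alpha> i \<or> b \<beta> (\<alpha> i) \<in> {-1, 0, 1}"
proof -
  obtain c where c: "b \<beta> (\<alpha> i) = of_int c"
    using root_int[OF assms(3,1)] by (auto elim: Ints_cases)
  have V: "\<beta> \<in> Vd" "\<alpha> i \<in> Vd" using assms root_in_space simple_root by auto
  have m: "b (\<beta> - \<alpha> i) (\<beta> - \<alpha> i) = 4 - 2 * of_int c"
    using root_norm[OF assms(1,2)] simple_norm[OF assms(3)] c form_sym[of "\<alpha> i" \<beta>]
    by (simp add: form_simps)
  have p: "b (\<beta> + \<alpha> i) (\<beta> + \<alpha> i) = 4 + 2 * of_int c"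
    using root_norm[OF assms(1,2)] simple_norm[OF assms(3)] c form_sym[of "\<alpha> i" \<beta>]
    by (simp add: form_simps)
  have "c < 2" if "\<beta> \<noteq> \<alpha> i"
    using form_pos[of "\<beta> - \<alpha> i"] that m V subspace_diff[OF subspace_Vd V] by simp
  moreover have "c > - 2" if "\<beta> \<noteq> - \<alpha> i"
    using form_pos[of "\<beta> + \<alpha> i"] that p V subspace_add[OF subspace_Vd V] by (simp add: add_eq_0_iff2)
  ultimately have "\<beta> = \<alpha> i \<or> \<beta> = - \<alpha> i \<or> c = -1 \<or> c = 0 \<or> c = 1" by linarith
  then show ?thesis using c by auto
qed

lemma positive_root_pairing_cases:
  assumes "positive_root n \<beta>" "i \<in> {1..l}" "\<beta> \<noteq> \<alpha> i"
  shows "b \<beta> (\<alpha> i) \<in> {-1, 0, 1}"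
proof -
  have "\<beta> \<noteq> - \<alpha> i"
    using not_positive_and_negative[OF assms(1)] simple_positive[OF assms(2)] by auto
  then show ?thesis
    using root_pairing_cases[of \<beta> i] assms by (auto simp: positive_root_def)
qed

lemma simple_pairing_cases:
  assumes "i \<in> {1..l}" "j \<in> {1..l}" "i \<noteq> j"
  shows "b (\<alpha> i) (\<alpha> j) \<in> {-1, 0}"
proof -
  have ne: "\<alpha> i \<noteq> \<alpha> j"
    using assms inj_onD[OF simple_inj] by blast
  have "b (\<alpha> i) (\<alpha> j) \<noteq> 1"
  proof
    assume "b (\<alpha> i) (\<alpha> j) = 1"
    then obtain m where m: "positive_root m (reflection j (\<alpha> i))" "m = 0"
      using positive_root_reflection[OF simple_positive[OF assms(1)] assms(2) ne] by auto
    then show False by (auto simp: positive_root_def)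
  qed
  then show ?thesis
    using positive_root_pairing_cases[OF simple_positive[OF assms(1)] assms(2) ne] by auto
qed

lemma positive_root_down:
  assumes "positive_root n \<beta>" "i \<in> {1..l}" "b \<beta> (\<alpha> i) = 1"
  shows "positive_root (n - 1) (\<beta> - \<alpha> i)" "0 < n"
proof -
  have "\<beta> \<noteq> \<alpha> i" using assms simple_norm by auto
  then obtain m where "positive_root m (reflection i \<beta>)" "int m = int n - 1"
    using positive_root_reflection[OF assms(1,2)] assms(3) by auto
  moreover from this have "m = n - 1" by simp
  ultimately show "positive_root (n - 1) (\<beta> - \<alpha> i)" "0 < n"
    using assms(3) by (simp_all add: reflection_def)
qed

lemma positive_root_up:
  assumes "positive_root n \<beta>" "i \<in> {1..l}" "b \<beta> (\<alpha> i) = - 1"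
  shows "positive_root (n + 1) (\<beta> + \<alpha> i)"
proof -
  have "\<beta> \<noteq> \<alpha> i" using assms simple_norm by auto
  then obtain m where "positive_root m (reflection i \<beta>)" "int m = int n + 1"
    using positive_root_reflection[OF assms(1,2)] assms(3) by (auto simp: floor_minus)
  moreover from this have "m = n + 1" by simp
  ultimately show ?thesis using assms(3) by (simp add: reflection_def)
qed

end

locale simple_system_group = simple_system b Vd \<Phi> l \<alpha> + group G
  for b :: "'v::euclidean_space \<Rightarrow> 'v \<Rightarrow> real" and Vd \<Phi> and l and \<alpha>
    and G :: "('a, 'c) monoid_scheme" (structure) +
  fixes x :: "nat \<Rightarrow> 'a"
  assumes x_closed [simp, intro]: "i \<in> {1..l} \<Longrightarrow> x i \<in> carrier G"
    and x_square: "i \<in> {1..l} \<Longrightarrow> x i \<otimes> x i = \<one>"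
    and x_commute: "i \<in> {1..l} \<Longrightarrow> j \<in> {1..l} \<Longrightarrow> b (\<alpha> i) (\<alpha> j) = 0 \<Longrightarrow> x i \<otimes> x j = x j \<otimes> x i"
    and x_braid: "i \<in> {1..l} \<Longrightarrow> j \<in> {1..l} \<Longrightarrow> b (\<alpha> i) (\<alpha> j) = - 1 \<Longrightarrow>
      x i \<otimes> x j \<otimes> x i = x j \<otimes> x i \<otimes> x j"
begin

lemma x_cancel [simp]: "i \<in> {1..l} \<Longrightarrow> h \<in> carrier G \<Longrightarrow> x i \<otimes> (x i \<otimes> h) = h"
  by (simp add: m_assoc[symmetric] x_square)

text \<open>\<open>represents \<beta> g\<close> says that \<open>g\<close> is a candidate for the reflection in the positive root \<open>\<beta>\<close>,
  obtained by climbing from a simple root to \<open>\<beta>\<close>, one simple root at a time. The point is that \<open>g\<close>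
  does not depend on the path, which uses nothing but the commutation and braid relations.\<close>

inductive represents :: "'v \<Rightarrow> 'a \<Rightarrow> bool" where
  simple: "i \<in> {1..l} \<Longrightarrow> represents (\<alpha> i) (x i)"
| up: "represents \<beta> g \<Longrightarrow> i \<in> {1..l} \<Longrightarrow> b \<beta> (\<alpha> i) = - 1 \<Longrightarrow> represents (\<beta> + \<alpha> i) (x i \<otimes> g \<otimes> x i)"

lemma represents_closed: "represents \<beta> g \<Longrightarrow> g \<in> carrier G"
  by (induction rule: represents.induct) auto

lemma represents_positive: "represents \<beta> g \<Longrightarrow> \<exists>n. positive_root n \<beta>"
  by (induction rule: represents.induct) (use simple_positive positive_root_up in blast)+

lemma represents_down:
  assumes "represents (\<beta> - \<alpha> i) g" "i \<in> {1..l}" "b \<beta> (\<alpha> i) = 1"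
  shows "represents \<beta> (x i \<otimes> g \<otimes> x i)"
  using up[OF assms(1,2)] assms(2,3) simple_norm[OF assms(2)] by (simp add: form_simps)

lemma represents_cases:
  assumes "represents \<beta> g"
  obtains i where "i \<in> {1..l}" "\<beta> = \<alpha> i" "g = x i"
  | i h where "i \<in> {1..l}" "b \<beta> (\<alpha> i) = 1" "represents (\<beta> - \<alpha> i) h" "g = x i \<otimes> h \<otimes> x i"
  using assms
proof (cases rule: represents.cases)
  case (up \<beta>' h i)
  then show ?thesis using that(2)[of i h] simple_norm[of i] by (simp add: form_simps)
qed (use that in blast)

lemma represents_unique_exists:
  assumes "positive_root n \<beta>"
  shows "(\<exists>g. represents \<beta> g) \<and> (\<forall>g g'. represents \<beta> g \<longrightarrow> represents \<beta> g' \<longrightarrow> g = g') \<and>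
    (\<forall>g i. represents \<beta> g \<longrightarrow> i \<in> {1..l} \<longrightarrow> b \<beta> (\<alpha> i) = 0 \<longrightarrow> x i \<otimes> g = g \<otimes> x i)"
  using assms
proof (induction n arbitrary: \<beta> rule: less_induct)
  case (less n)
  have ex: "\<exists>g. represents \<gamma> g" if "positive_root m \<gamma>" "m < n" for m \<gamma>
    using less.IH that by blast
  have uniq: "g = g'" if "positive_root m \<gamma>" "m < n" "represents \<gamma> g" "represents \<gamma> g'" for m \<gamma> g g'
    using less.IH that by blast
  have comm: "x i \<otimes> g = g \<otimes> x i"
    if "positive_root m \<gamma>" "m < n" "represents \<gamma> g" "i \<in> {1..l}" "b \<gamma> (\<alpha> i) = 0" for m \<gamma> g i
    using less.IH that by blast
  have down: "positive_root (n - 1) (\<beta> - \<alpha> i)" "n - 1 < n" if "i \<in> {1..l}" "b \<beta> (\<alpha> i) = 1" for i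
    using positive_root_down[OF less.prems that] by auto
  have down2: "positive_root (n - 1 - 1) (\<beta> - \<alpha> i - \<alpha> j)" "n - 1 - 1 < n"
    if "i \<in> {1..l}" "b \<beta> (\<alpha> i) = 1" "j \<in> {1..l}" "b (\<beta> - \<alpha> i) (\<alpha> j) = 1" for i j
    using positive_root_down[OF down(1)[OF that(1,2)] that(3,4)] by auto
  have paths: "x i \<otimes> g1 \<otimes> x i = x j \<otimes> g2 \<otimes> x j"
    if i: "i \<in> {1..l}" "b \<beta> (\<alpha> i) = 1" "represents (\<beta> - \<alpha> i) g1"
      and j: "j \<in> {1..l}" "b \<beta> (\<alpha> j) = 1" "represents (\<beta> - \<alpha> j) g2" for i j g1 g2
  proof (cases "i = j")
    case True
    then show ?thesis using uniq[OF down[OF i(1,2)]] i j by auto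
  next
    case False
    note g = represents_closed[OF i(3)] represents_closed[OF j(3)]
    from simple_pairing_cases[OF i(1) j(1) False] consider "b (\<alpha> i) (\<alpha> j) = 0" | "b (\<alpha> i) (\<alpha> j) = - 1"
      by auto
    then show ?thesis
    proof cases
      case 1
      have ij: "b (\<beta> - \<alpha> i) (\<alpha> j) = 1" "b (\<beta> - \<alpha> j) (\<alpha> i) = 1"
        using i j 1 form_sym[of "\<alpha> j" "\<alpha> i"] by (simp_all add: form_simps)
      obtain h where h: "represents (\<beta> - \<alpha> i - \<alpha> j) h"
        using ex[OF down2[OF i(1,2) j(1) ij(1)]] by blast
      then have h': "represents (\<beta> - \<alpha> j - \<alpha> i) h" by (simp add: algebra_simps)
      have "g1 = x j \<otimes> h \<otimes> x j"
        by (rule uniq[OF down[OF i(1,2)] i(3) represents_down[OF h j(1) ij(1)]])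
      moreover have "g2 = x i \<otimes> h \<otimes> x i"
        by (rule uniq[OF down[OF j(1,2)] j(3) represents_down[OF h' i(1) ij(2)]])
      moreover have "x i \<otimes> x j \<otimes> h \<otimes> (x j \<otimes> x i) = x j \<otimes> x i \<otimes> h \<otimes> (x i \<otimes> x j)"
        using x_commute[OF i(1) j(1) 1] by simp
      ultimately show ?thesis
        using i j represents_closed[OF h] by (simp add: m_assoc)
    next
      case 2
      have ij: "b (\<beta> - \<alpha> i) (\<alpha> j) = 2" "b (\<beta> - \<alpha> j) (\<alpha> i) = 2"
        using i j 2 form_sym[of "\<alpha> j" "\<alpha> i"] by (simp_all add: form_simps)
      have eq: "\<beta> - \<alpha> i = \<alpha> j" "\<beta> - \<alpha> j = \<alpha> i"
        using positive_root_pairing_cases[OF down(1)[OF i(1,2)] j(1)]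
          positive_root_pairing_cases[OF down(1)[OF j(1,2)] i(1)] ij by auto
      have "g1 = x j" "g2 = x i"
        using uniq[OF down[OF i(1,2)] i(3)] uniq[OF down[OF j(1,2)] j(3)] simple[OF j(1)] simple[OF i(1)]
        by (simp_all add: eq)
      then show ?thesis using x_braid[OF i(1) j(1) 2] by simp
    qed
  qed
  have not_simple: "b \<beta> (\<alpha> i) = 1 \<Longrightarrow> i \<in> {1..l} \<Longrightarrow> j \<in> {1..l} \<Longrightarrow> \<beta> \<noteq> \<alpha> j" for i j
    using simple_pairing_cases[of j i] simple_norm[of i] by (cases "i = j") auto
  have exists: "\<exists>g. represents \<beta> g"
  proof -
    obtain i where i: "i \<in> {1..l}" "b \<beta> (\<alpha> i) > 0" using positive_root_pairing[OF less.prems] by auto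
    show ?thesis
    proof (cases "\<beta> = \<alpha> i")
      case True
      then show ?thesis using simple[OF i(1)] by blast
    next
      case False
      then have "b \<beta> (\<alpha> i) = 1"
        using positive_root_pairing_cases[OF less.prems i(1)] i(2) by auto
      then show ?thesis using ex[OF down[OF i(1)]] represents_down i(1) by blast
    qed
  qed
  have unique: "g = g'" if "represents \<beta> g" "represents \<beta> g'" for g g'
    using that(1)
  proof (cases rule: represents_cases)
    case i: (1 i)
    show ?thesis using that(2)
    proof (cases rule: represents_cases)
      case j: (1 j)
      have "i = j" using i j inj_onD[OF simple_inj, of i j] by simp
      then show ?thesis using i j by simp
    next
      case (2 j h)
      then show ?thesis using not_simple i by blast
    qed
  next
    case i: (2 i h)
    show ?thesis using that(2)
    proof (cases rule: represents_cases)
      case (1 j)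
      then show ?thesis using not_simple i by blast
    next
      case j: (2 j h')
      show ?thesis using paths[OF i(1,2,3) j(1,2,3)] i(4) j(4) by simp
    qed
  qed
  have "x i \<otimes> g = g \<otimes> x i" if g: "represents \<beta> g" and i: "i \<in> {1..l}" "b \<beta> (\<alpha> i) = 0" for g i
    using g
  proof (cases rule: represents_cases)
    case (1 j)
    then show ?thesis using x_commute[of i j] i form_sym[of "\<alpha> j" "\<alpha> i"] by auto
  next
    case j: (2 j h)
    note h = represents_closed[OF j(3)]
    have "i \<noteq> j" using i j by auto
    from simple_pairing_cases[OF i(1) j(1) this] consider "b (\<alpha> i) (\<alpha> j) = 0" | "b (\<alpha> i) (\<alpha> j) = - 1"
      by auto
    then show ?thesis
    proof cases
      case 1
      then have "b (\<beta> - \<alpha> j) (\<alpha> i) = 0" using i form_sym[of "\<alpha> j" "\<alpha> i"] by (simp add: form_simps)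
      then have hi: "x i \<otimes> h = h \<otimes> x i" using comm[OF down[OF j(1,2)] j(3) i(1)] by simp
      have ij: "x i \<otimes> x j = x j \<otimes> x i" by (rule x_commute[OF i(1) j(1) 1])
      have "x i \<otimes> g = (x i \<otimes> x j) \<otimes> h \<otimes> x j" using i j h by (simp add: m_assoc)
      also have "\<dots> = x j \<otimes> (x i \<otimes> h) \<otimes> x j" using i j h by (simp add: ij m_assoc)
      also have "\<dots> = x j \<otimes> h \<otimes> (x i \<otimes> x j)" using i j h by (simp add: hi m_assoc)
      also have "\<dots> = g \<otimes> x i" using i j h by (simp add: ij m_assoc)
      finally show ?thesis .
    next
      case 2
      have ji: "b (\<alpha> j) (\<alpha> i) = - 1" using 2 form_sym by simp
      have bi: "b (\<beta> - \<alpha> j) (\<alpha> i) = 1" using i ji by (simp add: form_simps)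
      obtain u where u: "represents (\<beta> - \<alpha> j - \<alpha> i) u"
        using ex[OF down2[OF j(1,2) i(1) bi]] by blast
      note uc = represents_closed[OF u]
      have h_u: "h = x i \<otimes> u \<otimes> x i"
        by (rule uniq[OF down[OF j(1,2)] j(3) represents_down[OF u i(1) bi]])
      have "b (\<beta> - \<alpha> j - \<alpha> i) (\<alpha> j) = 0" using i j 2 simple_norm[OF j(1)] by (simp add: form_simps)
      then have uj: "x j \<otimes> u = u \<otimes> x j"
        using comm[OF down2[OF j(1,2) i(1) bi] u j(1)] by simp
      have braid: "x i \<otimes> x j \<otimes> x i = x j \<otimes> x i \<otimes> x j" by (rule x_braid[OF i(1) j(1) 2])
      have "x i \<otimes> g = (x i \<otimes> x j \<otimes> x i) \<otimes> u \<otimes> x i \<otimes> x j"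
        using i j uc by (simp add: h_u m_assoc)
      also have "\<dots> = x j \<otimes> x i \<otimes> (x j \<otimes> u) \<otimes> x i \<otimes> x j"
        using i j uc by (simp add: braid m_assoc)
      also have "\<dots> = x j \<otimes> x i \<otimes> u \<otimes> (x j \<otimes> x i \<otimes> x j)"
        using i j uc by (simp add: uj m_assoc)
      also have "\<dots> = g \<otimes> x i"
        using i j uc by (simp add: braid[symmetric] h_u m_assoc)
      finally show ?thesis .
    qed
  qed
  then show ?case using exists unique by blast
qed

lemma represents_unique: "represents \<beta> g \<Longrightarrow> represents \<beta> g' \<Longrightarrow> g = g'"
  using represents_unique_exists represents_positive by meson

lemma represents_reflection:
  assumes "represents \<beta> g" "i \<in> {1..l}" "\<beta> \<noteq> \<alpha> i"
  shows "represents (reflection i \<beta>) (x i \<otimes> g \<otimes> x i)"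
proof -
  note g = represents_closed[OF assms(1)]
  obtain n where n: "positive_root n \<beta>" using represents_positive[OF assms(1)] by blast
  from positive_root_pairing_cases[OF n assms(2,3)]
  consider "b \<beta> (\<alpha> i) = -1" | "b \<beta> (\<alpha> i) = 0" | "b \<beta> (\<alpha> i) = 1" by auto
  then show ?thesis
  proof cases
    case 1
    then show ?thesis using up[OF assms(1,2)] by (simp add: reflection_def)
  next
    case 2
    then have "x i \<otimes> g = g \<otimes> x i" using represents_unique_exists[OF n] assms by blast
    then show ?thesis using 2 assms g by (simp add: reflection_def m_assoc x_square)
  next
    case 3
    obtain h where h: "represents (\<beta> - \<alpha> i) h"
      using represents_unique_exists[OF positive_root_down(1)[OF n assms(2) 3]] by blast
    then have "g = x i \<otimes> h \<otimes> x i"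
      using represents_unique_exists[OF n] assms(1) represents_down[OF h assms(2) 3] by blast
    then have "x i \<otimes> g \<otimes> x i = h"
      using assms(2) represents_closed[OF h] by (simp add: m_assoc x_square)
    then show ?thesis using h 3 by (simp add: reflection_def)
  qed
qed

lemma represents_along_word:
  assumes "represents \<beta> g" "set js \<subseteq> {1..l}"
  shows "represents (act js \<beta>) (letter_product G x js \<otimes> g \<otimes> inv letter_product G x js) \<or>
    (\<exists>p i q. js = p @ i # q \<and> act q \<beta> = \<alpha> i \<and>
       represents (\<alpha> i) (letter_product G x q \<otimes> g \<otimes> inv letter_product G x q))"
  using assms(2)
proof (induction js)
  case Nil
  then show ?case using assms(1) represents_closed[OF assms(1)] by simp
next
  case (Cons j js)
  note g = represents_closed[OF assms(1)]
  have j: "j \<in> {1..l}" and xs: "x \<in> set js \<rightarrow> carrier G" using Cons.prems by auto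
  note X = letter_product_closed[OF xs]
  have inv: "inv x j = x j" using inv_equality x_square[OF j] j by auto
  show ?case
  proof (cases "represents (act js \<beta>) (letter_product G x js \<otimes> g \<otimes> inv letter_product G x js)")
    case True
    show ?thesis
    proof (cases "act js \<beta> = \<alpha> j")
      case eq: True
      show ?thesis
        by (rule disjI2, rule exI[of _ "[]"], rule exI[of _ j], rule exI[of _ js]) (use True eq in simp)
    next
      case False
      have "x j \<otimes> (letter_product G x js \<otimes> g \<otimes> inv letter_product G x js) \<otimes> x j =
          letter_product G x (j # js) \<otimes> g \<otimes> inv letter_product G x (j # js)"
        using X g j by (simp add: inv_mult_group inv m_assoc)
      then show ?thesis using represents_reflection[OF True j False] by simp
    qed
  next
    case False
    then obtain p i q where "js = p @ i # q" "act q \<beta> = \<alpha> i"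
      "represents (\<alpha> i) (letter_product G x q \<otimes> g \<otimes> inv letter_product G x q)"
      using Cons by auto
    then show ?thesis
      by (intro disjI2 exI[of _ "j # p"] exI[of _ i] exI[of _ q]) simp
  qed
qed

text \<open>The exchange condition: a word that makes \<open>\<alpha>\<^sub>j\<close> negative passes through a simple root just
  before, and the letter responsible can be dropped against a final \<open>x\<^sub>j\<close>.\<close>

lemma exchange:
  assumes js: "set js \<subseteq> {1..l}" and j: "j \<in> {1..l}" and neg: "act js (\<alpha> j) = - \<alpha> j"
  shows "\<exists>js'. set js' \<subseteq> {1..l} \<and> length js' < length js \<and>
    letter_product G x js \<otimes> x j = letter_product G x js' \<and> (\<forall>v. act js (reflection j v) = act js' v)"
proof -
  have "\<not> represents (act js (\<alpha> j)) g" for g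
    using represents_positive[of "act js (\<alpha> j)" g] not_positive_and_negative simple_positive[OF j]
    unfolding neg by blast
  then have "\<exists>p i q. js = p @ i # q \<and> act q (\<alpha> j) = \<alpha> i \<and>
      represents (\<alpha> i) (letter_product G x q \<otimes> x j \<otimes> inv letter_product G x q)"
    using represents_along_word[OF simple[OF j] js] by (simp only: simp_thms)
  then obtain p i q where piq: "js = p @ i # q" "act q (\<alpha> j) = \<alpha> i"
      "represents (\<alpha> i) (letter_product G x q \<otimes> x j \<otimes> inv letter_product G x q)"
    by (elim exE conjE)
  have i: "i \<in> {1..l}" and pq: "set p \<subseteq> {1..l}" "set q \<subseteq> {1..l}"
    and px: "x \<in> set p \<rightarrow> carrier G" and qx: "x \<in> set q \<rightarrow> carrier G" using js piq(1) by auto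
  note X = letter_product_closed[OF px] letter_product_closed[OF qx]
  have "letter_product G x q \<otimes> x j \<otimes> inv letter_product G x q = x i"
    by (rule represents_unique[OF piq(3) simple[OF i]])
  then have "x i \<otimes> letter_product G x q =
      letter_product G x q \<otimes> x j \<otimes> inv letter_product G x q \<otimes> letter_product G x q" by simp
  also have "\<dots> = letter_product G x q \<otimes> x j" using X j by (simp add: m_assoc)
  finally have pass: "letter_product G x q \<otimes> x j = x i \<otimes> letter_product G x q" by simp
  have "letter_product G x js \<otimes> x j = letter_product G x p \<otimes> (x i \<otimes> (letter_product G x q \<otimes> x j))"
    using X i j px qx letter_product_append[of x p "i # q"] by (simp add: piq(1) m_assoc)
  also have "\<dots> = letter_product G x (p @ q)"
    using X i px qx letter_product_append[of x p q] by (simp add: pass)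
  finally have "letter_product G x js \<otimes> x j = letter_product G x (p @ q)" .
  moreover have "act js (reflection j v) = act (p @ q) v" for v
  proof -
    have "act q (reflection j v) = reflection i (act q v)"
      using linear_diff[OF linear_act[of q]] linear_scale[OF linear_act[of q]] act_form[OF pq(2), of v "\<alpha> j"]
      by (simp add: reflection_def piq(2))
    then show ?thesis by (simp add: piq(1) act_append reflection_reflection[OF i])
  qed
  ultimately show ?thesis using pq piq(1) by (intro exI[of _ "p @ q"]) auto
qed

theorem trivial_word:
  assumes "set js \<subseteq> {1..l}" "\<And>v. v \<in> Vd \<Longrightarrow> act js v = v"
  shows "letter_product G x js = \<one>"
  using assms
proof (induction "length js" arbitrary: js rule: less_induct)
  case less
  show ?case
  proof (cases js rule: rev_cases)
    case (snoc js0 j)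
    have j: "j \<in> {1..l}" and js0: "set js0 \<subseteq> {1..l}" "x \<in> set (js0 @ [j]) \<rightarrow> carrier G"
      using less.prems(1) snoc by auto
    have "act js (\<alpha> j) = \<alpha> j" using less.prems(2) j simple_root root_in_space by auto
    then have "act js0 (\<alpha> j) = - \<alpha> j"
      using linear_neg[OF linear_act[of js0]] j
      by (simp add: snoc act_append reflection_simple) (metis minus_minus)
    from exchange[OF js0(1) j this] obtain js' where js': "set js' \<subseteq> {1..l}" "length js' < length js0"
        "letter_product G x js0 \<otimes> x j = letter_product G x js'" "\<forall>v. act js0 (reflection j v) = act js' v"
      by blast
    have "letter_product G x js = letter_product G x js'"
      using js'(3) letter_product_append[OF js0(2)] j by (simp add: snoc)
    also have "\<dots> = \<one>"
      using less.hyps[of js'] js' less.prems(2) by (simp add: snoc act_append)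
    finally show ?thesis .
  qed simp
qed

end

lemma Ball_rank1_rels:
  "(\<forall>p\<in>rank1_rels \<nu> N. Q p) \<longleftrightarrow>
     Q (wpow wx1 2, []) \<and>
     (\<forall>r\<in>{1..\<nu>}. Q (wx1 @ wy1 r @ wx1, winv (wy1 r))) \<and>
     (\<forall>(r, s)\<in>index_pairs \<nu>. \<forall>(r', s')\<in>index_pairs \<nu>. Q (wcomm (wz1 r s) (wz1 r' s'), [])) \<and>
     (\<forall>r\<in>{1..\<nu>}. \<forall>(r', s')\<in>index_pairs \<nu>. Q (wcomm (wy1 r) (wz1 r' s'), [])) \<and>
     (\<forall>(r, s)\<in>index_pairs \<nu>. Q (wcomm (wy1 r) (wy1 s), wpow (wz1 r s) (2 div int (N r s))))"
  unfolding rank1_rels_def ball_Un conj_assoc by (intro arg_cong2[where f="(\<and>)"]) fast+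

context group begin

text \<open>In rank 1 the relation \<open>x y\<^sub>r x = y\<^sub>r\<^sup>-\<^sup>1\<close> is the relation \<open>x y\<^sub>r x = y\<^sub>r y\<^sub>r\<^sup>-\<^sup>2\<close> of the
  general presentation, so that both presentations give the same relations among group elements.\<close>

lemma rank1_relations_iff:
  assumes f: "f \<in> rank1_gens \<nu> \<rightarrow> carrier G" and a: "a 1 1 = 2"
  shows "(\<forall>p\<in>rank1_rels \<nu> N. word_value G f (fst p) = word_value G f (snd p)) \<longleftrightarrow>
    weyl_relations G 1 \<nu> a N (\<lambda>i. f GenX1) (\<lambda>i r. f (GenY1 r)) (\<lambda>r s. f (GenZ1 r s))"
proof -
  have X: "GenX1 \<in> rank1_gens \<nu>" "f GenX1 \<in> carrier G"
    using f by (auto simp: rank1_gens_def)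
  have Y: "GenY1 r \<in> rank1_gens \<nu>" "f (GenY1 r) \<in> carrier G" if "r \<in> {1..\<nu>}" for r
    using that f by (auto simp: rank1_gens_def)
  have Z: "GenZ1 r s \<in> rank1_gens \<nu>" "f (GenZ1 r s) \<in> carrier G" if "(r, s) \<in> index_pairs \<nu>" for r s
    using that f by (auto simp: rank1_gens_def)
  have rs: "r \<in> {1..\<nu>}" "s \<in> {1..\<nu>}" if "(r, s) \<in> index_pairs \<nu>" for r s
    using that by (auto simp: index_pairs_def)
  have x2: "word_value G f (wpow wx1 2) = f GenX1 \<otimes> f GenX1"
    using X int_pow_mult[of "f GenX1" 1 1] by (simp add: word_value_wpow[OF f])
  have yinv: "f (GenY1 r) \<otimes> f (GenY1 r) [^] (- 2 :: int) = inv f (GenY1 r)" if "r \<in> {1..\<nu>}" for r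
    using Y[OF that] int_pow_mult[of "f (GenY1 r)" 1 "- 2"] by (simp add: int_pow_neg)
  have xyx: "word_value G f (wx1 @ wy1 r @ wx1) = f GenX1 \<otimes> f (GenY1 r) \<otimes> f GenX1"
      "word_value G f (winv (wy1 r)) = f (GenY1 r) \<otimes> f (GenY1 r) [^] (- 2 :: int)"
    if "r \<in> {1..\<nu>}" for r
    using X Y[OF that] by (simp_all add: word_value_winv[OF f] m_assoc yinv[OF that])
  have comm: "word_value G f (wcomm [(g, True)] [(h, True)]) = c \<longleftrightarrow> f g \<otimes> f h = f h \<otimes> f g \<otimes> c"
    if "g \<in> rank1_gens \<nu>" "h \<in> rank1_gens \<nu>" "c \<in> carrier G" for g h c
  proof -
    have "f g \<in> carrier G" "f h \<in> carrier G" using f that by auto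
    then show ?thesis using that commutator_eq_iff[of "f g" "f h" c]
      by (simp add: word_value_wcomm[OF f])
  qed
  have zp: "word_value G f (wpow (wz1 r s) e) = f (GenZ1 r s) [^] e" if "(r, s) \<in> index_pairs \<nu>" for r s e
    using Z[OF that] by (simp add: word_value_wpow[OF f])
  have zz: "word_value G f (wcomm (wz1 r s) (wz1 r' s')) = \<one> \<longleftrightarrow>
      f (GenZ1 r s) \<otimes> f (GenZ1 r' s') = f (GenZ1 r' s') \<otimes> f (GenZ1 r s)"
    if "(r, s) \<in> index_pairs \<nu>" "(r', s') \<in> index_pairs \<nu>" for r s r' s'
    using comm[OF Z(1)[OF that(1)] Z(1)[OF that(2)], of \<one>] Z[OF that(1)] Z[OF that(2)] by simp
  have yz: "word_value G f (wcomm (wy1 r) (wz1 r' s')) = \<one> \<longleftrightarrow>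
      f (GenY1 r) \<otimes> f (GenZ1 r' s') = f (GenZ1 r' s') \<otimes> f (GenY1 r)"
    if "r \<in> {1..\<nu>}" "(r', s') \<in> index_pairs \<nu>" for r r' s'
    using comm[OF Y(1)[OF that(1)] Z(1)[OF that(2)], of \<one>] Y[OF that(1)] Z[OF that(2)] by simp
  have yy: "word_value G f (wcomm (wy1 r) (wy1 s)) = word_value G f (wpow (wz1 r s) e) \<longleftrightarrow>
      f (GenY1 r) \<otimes> f (GenY1 s) = f (GenY1 s) \<otimes> f (GenY1 r) \<otimes> f (GenZ1 r s) [^] e"
    if "(r, s) \<in> index_pairs \<nu>" for r s e
    unfolding zp[OF that] using that rs[OF that] Z[OF that] by (intro comm Y) auto
  have eqs: "(\<forall>p\<in>rank1_rels \<nu> N. word_value G f (fst p) = word_value G f (snd p)) \<longleftrightarrow>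
     f GenX1 \<otimes> f GenX1 = \<one> \<and>
     (\<forall>r\<in>{1..\<nu>}. f GenX1 \<otimes> f (GenY1 r) \<otimes> f GenX1 = f (GenY1 r) \<otimes> f (GenY1 r) [^] (- 2 :: int)) \<and>
     (\<forall>(r, s)\<in>index_pairs \<nu>. \<forall>(r', s')\<in>index_pairs \<nu>. f (GenZ1 r s) \<otimes> f (GenZ1 r' s') =
        f (GenZ1 r' s') \<otimes> f (GenZ1 r s)) \<and>
     (\<forall>r\<in>{1..\<nu>}. \<forall>(r', s')\<in>index_pairs \<nu>. f (GenY1 r) \<otimes> f (GenZ1 r' s') =
        f (GenZ1 r' s') \<otimes> f (GenY1 r)) \<and>
     (\<forall>(r, s)\<in>index_pairs \<nu>. f (GenY1 r) \<otimes> f (GenY1 s) =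
        f (GenY1 s) \<otimes> f (GenY1 r) \<otimes> f (GenZ1 r s) [^] (2 div int (N r s)))"
    unfolding Ball_rank1_rels fst_conv snd_conv
  proof (intro conj_cong ball_cong refl, goal_cases)
    case (3 p)
    then show ?case by (cases p) (auto simp: zz)
  next
    case (4 r p)
    then show ?case by (cases p) (auto simp: yz)
  next
    case (5 p)
    then show ?case by (cases p) (auto simp: yy)
  qed (simp_all only: x2 xyx word_value_Nil)
  have one: "i \<in> {1..1} \<longleftrightarrow> i = 1" for i :: nat by auto
  show ?thesis
  proof
    assume "\<forall>p\<in>rank1_rels \<nu> N. word_value G f (fst p) = word_value G f (snd p)"
    note R = this[unfolded eqs]
    note R1 = R[THEN conjunct1]
    note R2 = R[THEN conjunct2, THEN conjunct1]
    note R3 = R[THEN conjunct2, THEN conjunct2, THEN conjunct1]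
    note R4 = R[THEN conjunct2, THEN conjunct2, THEN conjunct2, THEN conjunct1]
    note R5 = R[THEN conjunct2, THEN conjunct2, THEN conjunct2, THEN conjunct2]
    show "weyl_relations G 1 \<nu> a N (\<lambda>i. f GenX1) (\<lambda>i r. f (GenY1 r)) (\<lambda>r s. f (GenZ1 r s))"
    proof (unfold_locales, goal_cases)
      case 1 then show ?case using X by blast
    next
      case 2 then show ?case using Y by blast
    next
      case 3 then show ?case by (rule Z(2))
    next
      case 4 then show ?case using R1 by blast
    next
      case 5 then show ?case unfolding one by blast
    next
      case (6 i j r)
      then show ?case using R2 a unfolding one by simp
    next
      case 7 then show ?case using R3 by blast
    next
      case 8 then show ?case using R4 by blast
    next
      case 9 then show ?case by simp
    next
      case (10 i j r s)
      then show ?case using R5 a unfolding one by auto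
    qed
  next
    assume "weyl_relations G 1 \<nu> a N (\<lambda>i. f GenX1) (\<lambda>i r. f (GenY1 r)) (\<lambda>r s. f (GenZ1 r s))"
    then interpret R: weyl_relations G 1 \<nu> a N "\<lambda>i. f GenX1" "\<lambda>i r. f (GenY1 r)" "\<lambda>r s. f (GenZ1 r s)" .
    show "\<forall>p\<in>rank1_rels \<nu> N. word_value G f (fst p) = word_value G f (snd p)"
      unfolding eqs
    proof (intro conjI, goal_cases)
      case 1 then show ?case using R.x_square unfolding one by blast
    next
      case 2 then show ?case using R.x_y_x[of 1 1] a unfolding one by simp
    next
      case 3 then show ?case using R.z_z by blast
    next
      case 4 then show ?case using R.y_z unfolding one by blast
    next
      case 5 then show ?case using R.y_y[of 1 1] a unfolding one by auto
    qed
  qed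
qed

lemma rank1_xz_rels_iff:
  assumes f: "f \<in> rank1_gens \<nu> \<rightarrow> carrier G"
  shows "(\<forall>p\<in>rank1_xz_rels \<nu>. word_value G f (fst p) = word_value G f (snd p)) \<longleftrightarrow>
    (\<forall>(r, s)\<in>index_pairs \<nu>. f GenX1 \<otimes> f (GenZ1 r s) = f (GenZ1 r s) \<otimes> f GenX1)"
proof -
  have "word_value G f (wcomm wx1 (wz1 r s)) = \<one> \<longleftrightarrow> f GenX1 \<otimes> f (GenZ1 r s) = f (GenZ1 r s) \<otimes> f GenX1"
    if "(r, s) \<in> index_pairs \<nu>" for r s
  proof -
    have "GenX1 \<in> rank1_gens \<nu>" "GenZ1 r s \<in> rank1_gens \<nu>"
      using that by (auto simp: rank1_gens_def)
    moreover from this have "f GenX1 \<in> carrier G" "f (GenZ1 r s) \<in> carrier G" using f by auto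
    ultimately show ?thesis
      using commutator_eq_iff[of "f GenX1" "f (GenZ1 r s)" \<one>] by (simp add: word_value_wcomm[OF f])
  qed
  then show ?thesis unfolding rank1_xz_rels_def by fastforce
qed

end

section \<open>Homomorphisms out of the presented groups\<close>

lemma (in group) square_commute_iff:
  assumes "u \<in> carrier G" "v \<in> carrier G" "u \<otimes> u = \<one>" "v \<otimes> v = \<one>"
  shows "(u \<otimes> v) [^] (2::int) = \<one> \<longleftrightarrow> u \<otimes> v = v \<otimes> u"
    and "(u \<otimes> v) [^] (3::int) = \<one> \<longleftrightarrow> u \<otimes> v \<otimes> u = v \<otimes> u \<otimes> v"
proof -
  have iu: "inv u = u" and iv: "inv v = v" using assms inv_equality by auto
  have uv: "u \<otimes> v \<in> carrier G" "inv (u \<otimes> v) = v \<otimes> u" using assms by (auto simp: inv_mult_group iu iv)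
  have 2: "(u \<otimes> v) [^] (2::int) = (u \<otimes> v) \<otimes> (u \<otimes> v)"
    using int_pow_mult[OF uv(1), of 1 1] uv by simp
  have 3: "(u \<otimes> v) [^] (3::int) = (u \<otimes> v) \<otimes> (u \<otimes> v) \<otimes> (u \<otimes> v)"
    using int_pow_mult[OF uv(1), of 2 1] uv by (simp add: 2)
  show "(u \<otimes> v) [^] (2::int) = \<one> \<longleftrightarrow> u \<otimes> v = v \<otimes> u"
  proof
    assume "(u \<otimes> v) [^] (2::int) = \<one>"
    then have "inv (u \<otimes> v) = u \<otimes> v" using uv by (intro inv_equality) (auto simp: 2)
    then show "u \<otimes> v = v \<otimes> u" using uv by simp
  next
    assume "u \<otimes> v = v \<otimes> u"
    then have "(u \<otimes> v) [^] (2::int) = u \<otimes> v \<otimes> inv (u \<otimes> v)" unfolding 2 uv(2) by simp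
    also have "\<dots> = \<one>" by (rule r_inv[OF uv(1)])
    finally show "(u \<otimes> v) [^] (2::int) = \<one>" .
  qed
  have vuv: "v \<otimes> u \<otimes> v \<in> carrier G" "inv (v \<otimes> u \<otimes> v) = v \<otimes> u \<otimes> v"
    using assms by (auto simp: inv_mult_group iu iv m_assoc)
  have 33: "(u \<otimes> v) [^] (3::int) = (u \<otimes> v \<otimes> u) \<otimes> (v \<otimes> u \<otimes> v)"
    unfolding 3 using assms by (simp add: m_assoc)
  show "(u \<otimes> v) [^] (3::int) = \<one> \<longleftrightarrow> u \<otimes> v \<otimes> u = v \<otimes> u \<otimes> v"
  proof
    assume "(u \<otimes> v) [^] (3::int) = \<one>"
    then have "inv (v \<otimes> u \<otimes> v) = u \<otimes> v \<otimes> u"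
      using assms by (intro inv_equality) (auto simp: 33)
    then show "u \<otimes> v \<otimes> u = v \<otimes> u \<otimes> v" using vuv by simp
  next
    assume "u \<otimes> v \<otimes> u = v \<otimes> u \<otimes> v"
    then have "(u \<otimes> v) [^] (3::int) = (v \<otimes> u \<otimes> v) \<otimes> inv (v \<otimes> u \<otimes> v)"
      unfolding 33 vuv(2) by simp
    also have "\<dots> = \<one>" by (rule r_inv[OF vuv(1)])
    finally show "(u \<otimes> v) [^] (3::int) = \<one>" .
  qed
qed

lemma (in group_hom) hom_letter_product:
  "x \<in> set js \<rightarrow> carrier G \<Longrightarrow> h (letter_product G x js) = letter_product H (\<lambda>j. h (x j)) js"
  by (induction js) auto

lemma (in group_hom) hom_ordered_product:
  "g \<in> set js \<rightarrow> carrier G \<Longrightarrow> h (ordered_product G g m js) = ordered_product H (\<lambda>j. h (g j)) m js"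
  by (induction js) (auto simp: hom_int_pow)

text \<open>The elements \<open>x\<close>, \<open>y\<close>, \<open>z\<close> of the target must be so independent that a normal form is
  trivial only if its exponents are all \<open>0\<close> and its word in the \<open>x\<close>'s is trivial already in the
  source; for the Weyl group the latter is the Coxeter presentation.\<close>

lemma (in central_weyl_relations) inj_on_if_normal_forms_faithful:
  assumes H: "group H" and h: "h \<in> hom G H"
    and kernel: "\<And>js m k. set js \<subseteq> {1..l} \<Longrightarrow>
      letter_product H (\<lambda>i. h (x i)) js \<otimes>\<^bsub>H\<^esub> (ordered_product H (\<lambda>(i, r). h (y i r)) m (y_indices l \<nu>) \<otimes>\<^bsub>H\<^esub>
        ordered_product H (\<lambda>(r, s). h (z r s)) k (z_indices \<nu>)) = \<one>\<^bsub>H\<^esub> \<Longrightarrow>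
      letter_product G x js = \<one> \<and> (\<forall>p\<in>{1..l} \<times> {1..\<nu>}. m p = 0) \<and> (\<forall>p\<in>index_pairs \<nu>. k p = 0)"
  shows "inj_on h (carrier G)"
proof -
  interpret h: group_hom G H h
    by (intro group_hom.intro group_hom_axioms.intro is_group H h)
  have "g = \<one>" if g: "g \<in> carrier G" "h g = \<one>\<^bsub>H\<^esub>" for g
  proof -
    obtain js m k where js: "set js \<subseteq> {1..l}"
      and nf: "g = letter_product G x js \<otimes> (ordered_product G (case_prod y) m (y_indices l \<nu>) \<otimes>
        ordered_product G (case_prod z) k (z_indices \<nu>))"
      using normal_form[OF g(1)] by blast
    have c: "x \<in> set js \<rightarrow> carrier G" "case_prod y \<in> set (y_indices l \<nu>) \<rightarrow> carrier G"
      "case_prod z \<in> set (z_indices \<nu>) \<rightarrow> carrier G"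
      using js by auto
    have "h g = letter_product H (\<lambda>i. h (x i)) js \<otimes>\<^bsub>H\<^esub>
        (ordered_product H (\<lambda>p. h (case_prod y p)) m (y_indices l \<nu>) \<otimes>\<^bsub>H\<^esub>
        ordered_product H (\<lambda>p. h (case_prod z p)) k (z_indices \<nu>))"
      unfolding nf using letter_product_closed[OF c(1)] ordered_product_closed[OF c(2)]
        ordered_product_closed[OF c(3)]
      by (simp add: h.hom_letter_product[OF c(1)] h.hom_ordered_product[OF c(2)]
          h.hom_ordered_product[OF c(3)])
    also have "(\<lambda>p. h (case_prod y p)) = (\<lambda>(i, r). h (y i r))" by auto
    also have "(\<lambda>p. h (case_prod z p)) = (\<lambda>(r, s). h (z r s))" by auto
    finally have "letter_product H (\<lambda>i. h (x i)) js \<otimes>\<^bsub>H\<^esub>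
        (ordered_product H (\<lambda>(i, r). h (y i r)) m (y_indices l \<nu>) \<otimes>\<^bsub>H\<^esub>
        ordered_product H (\<lambda>(r, s). h (z r s)) k (z_indices \<nu>)) = \<one>\<^bsub>H\<^esub>" using g(2) by simp
    note K = kernel[OF js this]
    have "ordered_product G (case_prod y) m (y_indices l \<nu>) = \<one>"
      by (rule ordered_product_zero[OF c(2)]) (use K in simp)
    moreover have "ordered_product G (case_prod z) k (z_indices \<nu>) = \<one>"
      by (rule ordered_product_zero[OF c(3)]) (use K in simp)
    ultimately show ?thesis unfolding nf using K by simp
  qed
  then show ?thesis by (simp add: h.inj_on_one_iff)
qed

section \<open>The Heisenberg part of the Weyl group\<close>

definition bijection_group :: "('e \<Rightarrow> 'e) monoid" where
  "bijection_group = \<lparr>carrier = {f. bij f}, mult = (\<circ>), one = id\<rparr>"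

lemma bijection_group_simps [simp]:
  "carrier bijection_group = {f. bij f}" "f \<otimes>\<^bsub>bijection_group\<^esub> g = f \<circ> g"
  "\<one>\<^bsub>bijection_group\<^esub> = id"
  by (simp_all add: bijection_group_def)

lemma group_bijection_group: "group bijection_group"
proof (rule groupI)
  fix f :: "'e \<Rightarrow> 'e" assume "f \<in> carrier bijection_group"
  then show "\<exists>g\<in>carrier bijection_group. g \<otimes>\<^bsub>bijection_group\<^esub> f = \<one>\<^bsub>bijection_group\<^esub>"
    by (intro bexI[of _ "inv_into UNIV f"]) (auto simp: bij_imp_bij_inv bij_is_inj)
qed (auto simp: bij_comp comp_assoc)

locale ears_frame = simple_system b Vd \<Phi> l \<alpha>
  for b :: "'v::euclidean_space \<Rightarrow> 'v \<Rightarrow> real" and Vd \<Phi> and l and \<alpha> +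
  fixes \<sigma> :: "nat \<Rightarrow> 'v" and \<nu> :: nat
  assumes radical: "r \<in> {1..\<nu>} \<Longrightarrow> b (\<sigma> r) v = 0"
    and independent_radical: "(\<Sum>r\<in>{1..\<nu>}. c r *\<^sub>R \<sigma> r) = 0 \<Longrightarrow> r \<in> {1..\<nu>} \<Longrightarrow> c r = 0"
    and complement: "\<exists>p\<in>Vd. \<forall>w. b (v - p) w = 0"
begin

lemma radical' [simp]: "r \<in> {1..\<nu>} \<Longrightarrow> b v (\<sigma> r) = 0" "r \<in> {1..\<nu>} \<Longrightarrow> b (\<sigma> r) v = 0"
  using radical form_sym by auto

definition pairing :: "'v \<Rightarrow> 'v \<times> ('v \<Rightarrow>\<^sub>L real) \<Rightarrow> real" where
  "pairing v u = b v (fst u) + snd u v"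

lemma pairing_simps [simp]:
  "pairing (v + w) u = pairing v u + pairing w u" "pairing (v - w) u = pairing v u - pairing w u"
  "pairing (- v) u = - pairing v u" "pairing (t *\<^sub>R v) u = t * pairing v u" "pairing 0 u = 0"
  by (simp_all add: pairing_def form_simps blinfun.bilinear_simps algebra_simps)

lemma pairing_sum: "pairing (\<Sum>i\<in>I. f i) u = (\<Sum>i\<in>I. pairing (f i) u)"
  by (simp add: pairing_def form_sum_left blinfun.sum_right sum.distrib)

lemma refl_map_eq: "b \<gamma> \<gamma> = 2 \<Longrightarrow> refl_map b \<gamma> u = (fst u - pairing \<gamma> u *\<^sub>R \<gamma>, snd u)"
  by (simp add: refl_map_def ext_form_def coroot_def pairing_def form_sym[of "fst u"] prod_eq_iff)

text \<open>\<open>heis a M\<close> is unipotent: \<open>a\<close> is the tensor \<open>\<Sum>\<^sub>r a\<^sub>r \<otimes> \<sigma>\<^sub>r\<close> by which it moves \<open>V\<close> along the radical,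
  and \<open>M\<close> is the matrix of its part from \<open>(V\<^sup>0)\<^sup>*\<close> to \<open>V\<^sup>0\<close>. It is an isometry only if the symmetric
  part of \<open>M\<close> is determined by \<open>a\<close>; leaving \<open>M\<close> free makes the product formula polynomial
  without denominators.\<close>

definition heis :: "(nat \<Rightarrow> 'v) \<Rightarrow> (nat \<Rightarrow> nat \<Rightarrow> real) \<Rightarrow> 'v \<times> ('v \<Rightarrow>\<^sub>L real) \<Rightarrow> 'v \<times> ('v \<Rightarrow>\<^sub>L real)" where
  "heis a M u = (fst u - (\<Sum>r\<in>{1..\<nu>}. snd u (\<sigma> r) *\<^sub>R a r) + (\<Sum>r\<in>{1..\<nu>}. pairing (a r) u *\<^sub>R \<sigma> r) +
     (\<Sum>r\<in>{1..\<nu>}. \<Sum>s\<in>{1..\<nu>}. (M r s * snd u (\<sigma> r)) *\<^sub>R \<sigma> s), snd u)"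

lemma snd_heis [simp]: "snd (heis a M u) = snd u"
  by (simp add: heis_def)

lemma heis_cong:
  assumes "\<And>r. r \<in> {1..\<nu>} \<Longrightarrow> a r = a' r" "\<And>r s. r \<in> {1..\<nu>} \<Longrightarrow> s \<in> {1..\<nu>} \<Longrightarrow> M r s = M' r s"
  shows "heis a M = heis a' M'"
proof
  fix u :: "'v \<times> ('v \<Rightarrow>\<^sub>L real)"
  have "(\<Sum>r\<in>{1..\<nu>}. snd u (\<sigma> r) *\<^sub>R a r) = (\<Sum>r\<in>{1..\<nu>}. snd u (\<sigma> r) *\<^sub>R a' r)"
    "(\<Sum>r\<in>{1..\<nu>}. pairing (a r) u *\<^sub>R \<sigma> r) = (\<Sum>r\<in>{1..\<nu>}. pairing (a' r) u *\<^sub>R \<sigma> r)"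
    "(\<Sum>r\<in>{1..\<nu>}. \<Sum>s\<in>{1..\<nu>}. (M r s * snd u (\<sigma> r)) *\<^sub>R \<sigma> s) =
      (\<Sum>r\<in>{1..\<nu>}. \<Sum>s\<in>{1..\<nu>}. (M' r s * snd u (\<sigma> r)) *\<^sub>R \<sigma> s)"
    by (intro sum.cong refl; simp add: assms)+
  then show "heis a M u = heis a' M' u" by (simp only: heis_def)
qed

lemma heis_zero [simp]: "heis (\<lambda>_. 0) (\<lambda>_ _. 0) = id"
  by (rule ext) (simp add: heis_def)

lemma pairing_heis:
  "pairing v (heis a M u) = pairing v u - (\<Sum>r\<in>{1..\<nu>}. snd u (\<sigma> r) * b v (a r))"
  by (simp add: pairing_def heis_def form_simps form_sum_right)

lemma heis_compose:
  "heis a M \<circ> heis a' M' = heis (\<lambda>r. a r + a' r) (\<lambda>r s. M r s + M' r s - b (a s) (a' r))"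
proof
  fix u :: "'v \<times> ('v \<Rightarrow>\<^sub>L real)"
  let ?f = "snd u"
  have "(\<Sum>s\<in>{1..\<nu>}. pairing (a s) (heis a' M' u) *\<^sub>R \<sigma> s) =
      (\<Sum>s\<in>{1..\<nu>}. pairing (a s) u *\<^sub>R \<sigma> s) -
      (\<Sum>s\<in>{1..\<nu>}. \<Sum>r\<in>{1..\<nu>}. (b (a s) (a' r) * ?f (\<sigma> r)) *\<^sub>R \<sigma> s)"
    by (simp add: pairing_heis scaleR_diff_left sum_subtractf scaleR_sum_left mult.commute)
  also have "(\<Sum>s\<in>{1..\<nu>}. \<Sum>r\<in>{1..\<nu>}. (b (a s) (a' r) * ?f (\<sigma> r)) *\<^sub>R \<sigma> s) =
      (\<Sum>r\<in>{1..\<nu>}. \<Sum>s\<in>{1..\<nu>}. (b (a s) (a' r) * ?f (\<sigma> r)) *\<^sub>R \<sigma> s)"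
    by (rule sum.swap)
  finally have *: "(\<Sum>s\<in>{1..\<nu>}. pairing (a s) (heis a' M' u) *\<^sub>R \<sigma> s) =
      (\<Sum>s\<in>{1..\<nu>}. pairing (a s) u *\<^sub>R \<sigma> s) -
      (\<Sum>r\<in>{1..\<nu>}. \<Sum>s\<in>{1..\<nu>}. (b (a s) (a' r) * ?f (\<sigma> r)) *\<^sub>R \<sigma> s)" .
  have "fst (heis a M (heis a' M' u)) =
      fst (heis a' M' u) - (\<Sum>r\<in>{1..\<nu>}. ?f (\<sigma> r) *\<^sub>R a r) +
      (\<Sum>s\<in>{1..\<nu>}. pairing (a s) (heis a' M' u) *\<^sub>R \<sigma> s) +
      (\<Sum>r\<in>{1..\<nu>}. \<Sum>s\<in>{1..\<nu>}. (M r s * ?f (\<sigma> r)) *\<^sub>R \<sigma> s)"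
    by (subst heis_def) simp
  also have "\<dots> = fst (heis (\<lambda>r. a r + a' r) (\<lambda>r s. M r s + M' r s - b (a s) (a' r)) u)"
    unfolding * by (simp add: heis_def scaleR_add_left scaleR_add_right scaleR_diff_left
        sum.distrib sum_subtractf distrib_right left_diff_distrib)
  finally show "(heis a M \<circ> heis a' M') u =
      heis (\<lambda>r. a r + a' r) (\<lambda>r s. M r s + M' r s - b (a s) (a' r)) u"
    by (simp add: prod_eq_iff)
qed

lemma bij_heis [simp]: "bij (heis a M)"
proof (rule o_bij)
  let ?g = "heis (\<lambda>r. - a r) (\<lambda>r s. - M r s - b (a s) (a r))"
  show "?g \<circ> heis a M = id" "heis a M \<circ> ?g = id"
    by (simp_all add: heis_compose form_simps)
qed

lemma heis_Pair_zero:
  "heis a M (v, 0) = (v + (\<Sum>r\<in>{1..\<nu>}. b (a r) v *\<^sub>R \<sigma> r), 0)"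
  by (simp add: heis_def pairing_def)

lemma bij_refl_map: "b \<gamma> \<gamma> = 2 \<Longrightarrow> bij (refl_map b \<gamma>)"
  by (rule involuntory_imp_bij)
    (simp add: refl_map_eq prod_eq_iff pairing_def form_simps scaleR_diff_left algebra_simps)

lemma refl_map_square: "b \<gamma> \<gamma> = 2 \<Longrightarrow> refl_map b \<gamma> \<circ> refl_map b \<gamma> = id"
  by (rule ext)
    (simp add: refl_map_eq prod_eq_iff pairing_def form_simps scaleR_diff_left algebra_simps)

lemma refl_map_conjugate:
  assumes "i \<in> {1..l}" "b \<gamma> \<gamma> = 2"
  shows "refl_map b (\<alpha> i) \<circ> refl_map b \<gamma> \<circ> refl_map b (\<alpha> i) = refl_map b (reflection i \<gamma>)"
proof
  fix u :: "'v \<times> ('v \<Rightarrow>\<^sub>L real)"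
  note n = simple_norm[OF assms(1)]
  have r: "b (reflection i \<gamma>) (reflection i \<gamma>) = 2" using reflection_form[OF assms(1)] assms(2) by simp
  let ?p = "pairing (\<alpha> i) u" and ?q = "pairing \<gamma> u" and ?c = "b \<gamma> (\<alpha> i)"
  have c: "b (\<alpha> i) \<gamma> = ?c" by (rule form_sym)
  have "pairing \<gamma> (fst u - ?p *\<^sub>R \<alpha> i, snd u) = ?q - ?p * ?c"
    by (simp add: pairing_def form_simps)
  moreover have "pairing (\<alpha> i) (fst u - ?p *\<^sub>R \<alpha> i - (?q - ?p * ?c) *\<^sub>R \<gamma>, snd u) =
      - ?p - (?q - ?p * ?c) * ?c"
    using n c by (simp add: pairing_def form_simps)
  moreover have "pairing (reflection i \<gamma>) u = ?q - ?c * ?p"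
    by (simp add: reflection_def)
  ultimately show "(refl_map b (\<alpha> i) \<circ> refl_map b \<gamma> \<circ> refl_map b (\<alpha> i)) u = refl_map b (reflection i \<gamma>) u"
    using assms(2) n r by (simp add: refl_map_eq) (simp add: reflection_def algebra_simps)
qed

lemma refl_map_heis_conjugate:
  assumes "i \<in> {1..l}"
  shows "refl_map b (\<alpha> i) \<circ> heis a M \<circ> refl_map b (\<alpha> i) = heis (\<lambda>r. reflection i (a r)) M"
proof
  fix u :: "'v \<times> ('v \<Rightarrow>\<^sub>L real)"
  note n = simple_norm[OF assms]
  let ?p = "pairing (\<alpha> i) u" and ?f = "snd u"
  let ?u = "(fst u - ?p *\<^sub>R \<alpha> i, snd u)"
  let ?C = "\<Sum>r\<in>{1..\<nu>}. ?f (\<sigma> r) * b (\<alpha> i) (a r)"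
  have pa: "pairing (a r) ?u = pairing (reflection i (a r)) u" for r
    by (simp add: reflection_def) (simp add: pairing_def form_simps algebra_simps)
  have "pairing (\<alpha> i) ?u = - ?p" using n by (simp add: pairing_def form_simps)
  then have p: "pairing (\<alpha> i) (heis a M ?u) = - ?p - ?C" by (simp add: pairing_heis)
  have "(\<Sum>r\<in>{1..\<nu>}. ?f (\<sigma> r) *\<^sub>R reflection i (a r)) = (\<Sum>r\<in>{1..\<nu>}. ?f (\<sigma> r) *\<^sub>R a r) - ?C *\<^sub>R \<alpha> i"
    by (simp add: reflection_def scaleR_diff_right sum_subtractf scaleR_sum_left form_sym[of "a _" "\<alpha> i"])
  then have main: "fst (heis a M ?u) - (- ?p - ?C) *\<^sub>R \<alpha> i = fst (heis (\<lambda>r. reflection i (a r)) M u)"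
    unfolding heis_def fst_conv snd_conv pa by (simp add: algebra_simps)
  have "(refl_map b (\<alpha> i) \<circ> heis a M \<circ> refl_map b (\<alpha> i)) u =
      (fst (heis a M ?u) - (- ?p - ?C) *\<^sub>R \<alpha> i, snd u)"
    by (simp only: o_apply refl_map_eq[OF n] p snd_heis snd_conv)
  then show "(refl_map b (\<alpha> i) \<circ> heis a M \<circ> refl_map b (\<alpha> i)) u = heis (\<lambda>r. reflection i (a r)) M u"
    unfolding main by (simp add: prod_eq_iff)
qed

definition translation :: "'v \<Rightarrow> (nat \<Rightarrow> real) \<Rightarrow> 'v \<times> ('v \<Rightarrow>\<^sub>L real) \<Rightarrow> 'v \<times> ('v \<Rightarrow>\<^sub>L real)" where
  "translation \<gamma> t = heis (\<lambda>r. t r *\<^sub>R \<gamma>) (\<lambda>r s. - (t r * t s))"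

definition alternating :: "(nat \<times> nat \<Rightarrow> real) \<Rightarrow> nat \<Rightarrow> nat \<Rightarrow> real" where
  "alternating k r s = (if r < s then k (r, s) else if s < r then - k (s, r) else 0)"

definition central :: "(nat \<times> nat \<Rightarrow> real) \<Rightarrow> 'v \<times> ('v \<Rightarrow>\<^sub>L real) \<Rightarrow> 'v \<times> ('v \<Rightarrow>\<^sub>L real)" where
  "central k = heis (\<lambda>_. 0) (alternating k)"

lemma bij_translation [simp]: "bij (translation \<gamma> t)" and bij_central [simp]: "bij (central k)"
  by (simp_all add: translation_def central_def)

lemma translation_zero [simp]: "translation \<gamma> (\<lambda>_. 0) = id"
  by (simp add: translation_def)

lemma alternating_zero: "alternating (\<lambda>_. 0) = (\<lambda>_ _. 0)"
  by (simp add: alternating_def fun_eq_iff)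

lemma alternating_add: "alternating (\<lambda>p. k p + k' p) = (\<lambda>r s. alternating k r s + alternating k' r s)"
  by (simp add: alternating_def fun_eq_iff)

lemma central_zero [simp]: "central (\<lambda>_. 0) = id"
  by (simp add: central_def alternating_zero)

lemma central_add: "central k \<circ> central k' = central (\<lambda>p. k p + k' p)"
  by (simp add: central_def heis_compose form_simps alternating_add)

lemma central_commute: "central k \<circ> heis a M = heis a M \<circ> central k"
  by (simp add: central_def heis_compose form_simps add.commute)

lemma central_cong: "(\<And>p. p \<in> index_pairs \<nu> \<Longrightarrow> k p = k' p) \<Longrightarrow> central k = central k'"
  unfolding central_def by (rule heis_cong) (auto simp: alternating_def index_pairs_def)

lemma translation_cong: "(\<And>r. r \<in> {1..\<nu>} \<Longrightarrow> t r = t' r) \<Longrightarrow> translation \<gamma> t = translation \<gamma> t'"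
  unfolding translation_def by (rule heis_cong) auto

lemma central_refl_map_commute:
  assumes "i \<in> {1..l}" shows "refl_map b (\<alpha> i) \<circ> central k = central k \<circ> refl_map b (\<alpha> i)"
proof -
  have "refl_map b (\<alpha> i) \<circ> central k \<circ> refl_map b (\<alpha> i) = central k"
    using refl_map_heis_conjugate[OF assms, of "\<lambda>_. 0" "alternating k"]
    by (simp add: central_def reflection_def form_simps)
  then have "refl_map b (\<alpha> i) \<circ> central k \<circ> (refl_map b (\<alpha> i) \<circ> refl_map b (\<alpha> i)) = central k \<circ> refl_map b (\<alpha> i)"
    by (metis comp_assoc)
  then show ?thesis using refl_map_square[OF simple_norm[OF assms]] by simp
qed

text \<open>Translations along one root commute up to a central element, because their matrices differ
  from that of the sum by an alternating one.\<close>

lemma translation_add: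
  assumes "b \<gamma> \<gamma> = 2"
  shows "translation \<gamma> t \<circ> translation \<gamma> t' =
    translation \<gamma> (\<lambda>r. t r + t' r) \<circ> central (\<lambda>(r, s). t r * t' s - t s * t' r)"
  unfolding translation_def central_def heis_compose
  by (rule heis_cong) (auto simp: alternating_def form_simps assms algebra_simps)

lemma translation_commutator:
  assumes "b \<gamma> \<delta> = c"
  shows "translation \<gamma> t \<circ> translation \<delta> t' =
    translation \<delta> t' \<circ> translation \<gamma> t \<circ> central (\<lambda>(r, s). c * (t r * t' s - t s * t' r))"
  unfolding translation_def central_def heis_compose
  by (rule heis_cong) (auto simp: alternating_def form_simps assms form_sym[of \<delta> \<gamma>] algebra_simps)

lemma refl_map_shifted:
  assumes "b \<gamma> \<gamma> = 2"
  shows "refl_map b (\<gamma> + (\<Sum>r\<in>{1..\<nu>}. t r *\<^sub>R \<sigma> r)) \<circ> refl_map b \<gamma> = translation \<gamma> t"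
proof
  fix u :: "'v \<times> ('v \<Rightarrow>\<^sub>L real)"
  let ?s = "\<Sum>r\<in>{1..\<nu>}. t r *\<^sub>R \<sigma> r"
  have s: "b ?s w = 0" "b w ?s = 0" for w
    by (simp_all add: form_sum_left form_sum_right form_simps)
  have n: "b (\<gamma> + ?s) (\<gamma> + ?s) = 2" using s assms by (simp add: form_simps)
  let ?p = "pairing \<gamma> u"
  have ps: "pairing ?s u = snd u ?s" by (simp add: pairing_def s)
  have fs: "snd u ?s = (\<Sum>r\<in>{1..\<nu>}. t r * snd u (\<sigma> r))"
    by (simp add: blinfun.sum_right blinfun.scaleR_right)
  have p1: "pairing (\<gamma> + ?s) (fst u - ?p *\<^sub>R \<gamma>, snd u) = - ?p + snd u ?s"
    using assms s by (simp add: pairing_def form_simps blinfun.add_right)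
  have "(\<Sum>r\<in>{1..\<nu>}. \<Sum>s\<in>{1..\<nu>}. (- (t r * t s) * snd u (\<sigma> r)) *\<^sub>R \<sigma> s) = - (snd u ?s *\<^sub>R ?s)"
    unfolding fs scaleR_sum_left
    by (simp add: scaleR_sum_right sum_negf mult_ac)
  moreover have "(\<Sum>r\<in>{1..\<nu>}. snd u (\<sigma> r) *\<^sub>R t r *\<^sub>R \<gamma>) = snd u ?s *\<^sub>R \<gamma>"
    unfolding fs scaleR_sum_left by (simp add: mult.commute)
  moreover have "(\<Sum>r\<in>{1..\<nu>}. pairing (t r *\<^sub>R \<gamma>) u *\<^sub>R \<sigma> r) = ?p *\<^sub>R ?s"
    by (simp add: scaleR_sum_right mult.commute)
  ultimately have T: "fst (translation \<gamma> t u) = fst u - snd u ?s *\<^sub>R \<gamma> + ?p *\<^sub>R ?s - snd u ?s *\<^sub>R ?s"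
    by (simp add: translation_def heis_def)
  have "(refl_map b (\<gamma> + ?s) \<circ> refl_map b \<gamma>) u =
      (fst u - ?p *\<^sub>R \<gamma> - (- ?p + snd u ?s) *\<^sub>R (\<gamma> + ?s), snd u)"
    by (simp only: o_apply refl_map_eq[OF assms] refl_map_eq[OF n] p1 fst_conv snd_conv)
  also have "\<dots> = translation \<gamma> t u"
    using T by (simp add: prod_eq_iff translation_def algebra_simps)
  finally show "(refl_map b (\<gamma> + ?s) \<circ> refl_map b \<gamma>) u = translation \<gamma> t u" .
qed

section \<open>Faithfulness\<close>

lemma span_simple: "span (\<alpha> ` {1..l}) = Vd"
proof
  show "span (\<alpha> ` {1..l}) \<subseteq> Vd"
    by (rule span_minimal) (use subspace_Vd root_in_space simple_root in auto)
  have "\<Phi> \<subseteq> span (\<alpha> ` {1..l})"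
  proof
    fix \<beta> assume "\<beta> \<in> \<Phi>"
    then obtain k :: "nat \<Rightarrow> int" where "\<beta> = (\<Sum>i\<in>{1..l}. of_int (k i) *\<^sub>R \<alpha> i)"
      using fundamental unfolding fundamental_system_def by metis
    then show "\<beta> \<in> span (\<alpha> ` {1..l})" by (simp only:) (intro span_sum span_scale span_base imageI)
  qed
  then show "Vd \<subseteq> span (\<alpha> ` {1..l})"
    using root_system span_mono[of \<Phi> "span (\<alpha> ` {1..l})"] by (auto simp: finite_root_system_def span_span)
qed

lemma orthogonal_zero:
  assumes "v \<in> Vd" "\<And>i. i \<in> {1..l} \<Longrightarrow> b v (\<alpha> i) = 0" shows "v = 0"
proof (rule ccontr)
  assume "v \<noteq> 0"
  have "subspace {w. b v w = 0}" by (auto simp: subspace_def form_simps)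
  then have "span (\<alpha> ` {1..l}) \<subseteq> {w. b v w = 0}" by (rule span_minimal[rotated]) (use assms in auto)
  then have "b v v = 0" using assms(1) span_simple by auto
  then show False using form_pos[OF assms(1) \<open>v \<noteq> 0\<close>] by simp
qed

text \<open>Every functional on \<open>V\<close> agrees on the complement of the radical with the form against a vector:
  the map \<open>x \<mapsto> \<Sum>\<^sub>i (x, \<alpha>\<^sub>i) \<alpha>\<^sub>i\<close> is injective on the complement, hence onto it.\<close>

lemma represent_functional:
  assumes "linear f" shows "\<exists>p\<in>Vd. \<forall>v\<in>Vd. b p v = (f v :: real)"
proof -
  let ?L = "\<lambda>x. \<Sum>i\<in>{1..l}. b x (\<alpha> i) *\<^sub>R \<alpha> i"
  have lin: "linear ?L"
    by (rule linearI) (simp_all add: form_simps scaleR_add_left sum.distrib scaleR_sum_right)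
  have sub: "?L ` Vd \<subseteq> Vd"
    unfolding span_simple[symmetric] by (intro image_subsetI span_sum span_scale span_base imageI)
  have inj: "inj_on ?L Vd"
  proof (rule linear_inj_on_iff_eq_0[OF lin subspace_Vd, THEN iffD2], intro ballI impI)
    fix x assume x: "x \<in> Vd" "?L x = 0"
    show "x = 0"
      by (rule orthogonal_zero[OF x(1)]) (rule combination_zero[of "\<lambda>i. b x (\<alpha> i)", OF x(2)])
  qed
  have "dim (?L ` Vd) = dim Vd"
    using dim_image_eq[OF lin, of Vd] inj subspace_Vd by (simp add: span_eq_iff[THEN iffD2])
  then have onto: "?L ` Vd = Vd"
    using subspace_dim_equal[OF linear_subspace_image[OF lin subspace_Vd] subspace_Vd sub] by simp
  have "(\<Sum>i\<in>{1..l}. f (\<alpha> i) *\<^sub>R \<alpha> i) \<in> Vd"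
    unfolding span_simple[symmetric] by (intro span_sum span_scale span_base imageI)
  then have "(\<Sum>i\<in>{1..l}. f (\<alpha> i) *\<^sub>R \<alpha> i) \<in> ?L ` Vd" unfolding onto .
  then obtain p where p: "(\<Sum>i\<in>{1..l}. f (\<alpha> i) *\<^sub>R \<alpha> i) = ?L p" "p \<in> Vd" by (rule imageE)
  have "b p (\<alpha> i) = f (\<alpha> i)" if "i \<in> {1..l}" for i
    using combination_eqD[OF p(1) that] by simp
  moreover have "subspace {v. b p v = f v}"
    using assms by (auto simp: subspace_def form_simps linear_0 linear_add linear_scale)
  ultimately have "span (\<alpha> ` {1..l}) \<subseteq> {v. b p v = f v}" by (intro span_minimal) auto
  then show ?thesis using p(2) span_simple by auto
qed

definition form_functional :: "'v \<Rightarrow> 'v \<Rightarrow>\<^sub>L real" where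
  "form_functional p = Blinfun (b p)"

lemma form_functional_apply [simp]: "form_functional p v = b p v"
proof -
  have "bounded_linear (b p)"
    using bilinear_form by (simp add: bilinear_def linear_conv_bounded_linear)
  then show ?thesis by (simp add: form_functional_def bounded_linear_Blinfun_apply)
qed

lemma dual_functional:
  "\<exists>f :: 'v \<Rightarrow>\<^sub>L real. (\<forall>r\<in>{1..\<nu>}. f (\<sigma> r) = c r) \<and> (\<forall>v\<in>Vd. f v = 0)"
proof -
  have inj: "inj_on \<sigma> {1..\<nu>}"
  proof (rule inj_onI, rule ccontr)
    fix r s assume rs: "r \<in> {1..\<nu>}" "s \<in> {1..\<nu>}" "\<sigma> r = \<sigma> s" "r \<noteq> s"
    have "(\<Sum>q\<in>{1..\<nu>}. (if q = r then 1 else if q = s then - 1 else 0) *\<^sub>R \<sigma> q) = \<sigma> r - \<sigma> s"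
      using rs by (simp add: if_distrib[of "\<lambda>t. t *\<^sub>R _"] sum.remove[of "{1..\<nu>}" r]
          sum.remove[of "{1..\<nu>} - {r}" s] sum.neutral)
    then show False
      using independent_radical[of "\<lambda>q. if q = r then 1 else if q = s then - 1 else 0" r] rs by simp
  qed
  have ind: "independent (\<sigma> ` {1..\<nu>})"
  proof (rule independent_if_scalars_zero)
    fix d v assume "(\<Sum>v\<in>\<sigma> ` {1..\<nu>}. d v *\<^sub>R v) = 0" "v \<in> \<sigma> ` {1..\<nu>}"
    then show "d v = 0"
      using independent_radical[of "\<lambda>r. d (\<sigma> r)"] by (auto simp: sum.reindex[OF inj])
  qed simp
  obtain g where g: "linear g" "\<forall>v\<in>\<sigma> ` {1..\<nu>}. g v = c (the_inv_into {1..\<nu>} \<sigma> v)"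
    using linear_independent_extend[OF ind, of "\<lambda>v. c (the_inv_into {1..\<nu>} \<sigma> v)"] by blast
  obtain p where p: "\<forall>v\<in>Vd. b p v = g v" using represent_functional[OF g(1)] by blast
  have "bounded_linear g" using g(1) by (simp add: linear_conv_bounded_linear)
  then have g_apply: "Blinfun g v = g v" for v by (simp add: bounded_linear_Blinfun_apply)
  show ?thesis
    by (rule exI[of _ "Blinfun g - form_functional p"])
      (use g(2) p in \<open>auto simp: blinfun.diff_left g_apply the_inv_into_f_f[OF inj]\<close>)
qed

lemma heis_matrix_zero:
  assumes "\<And>u. u \<in> ext_space Vd \<Longrightarrow> heis (\<lambda>_. 0) M u = u" "r \<in> {1..\<nu>}" "s \<in> {1..\<nu>}"
  shows "M r s = 0"
proof -
  obtain f :: "'v \<Rightarrow>\<^sub>L real" where f: "\<forall>q\<in>{1..\<nu>}. f (\<sigma> q) = (if q = r then 1 else 0)" "\<forall>v\<in>Vd. f v = 0"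
    using dual_functional[of "\<lambda>q. if q = r then 1 else 0"] by blast
  have "(0, f) \<in> ext_space Vd" using f by (simp add: ext_space_def)
  then have "heis (\<lambda>_. 0) M (0, f) = (0, f)" by (rule assms(1))
  then have "0 = (\<Sum>q\<in>{1..\<nu>}. \<Sum>s\<in>{1..\<nu>}. (M q s * f (\<sigma> q)) *\<^sub>R \<sigma> s)"
    by (simp add: heis_def prod_eq_iff)
  also have "\<dots> = (\<Sum>q\<in>{1..\<nu>}. if q = r then \<Sum>s\<in>{1..\<nu>}. M r s *\<^sub>R \<sigma> s else 0)"
    using f(1) by (intro sum.cong) auto
  also have "\<dots> = (\<Sum>s\<in>{1..\<nu>}. M r s *\<^sub>R \<sigma> s)" using assms(2) by simp
  finally show ?thesis using independent_radical[of "M r" s] assms(3) by simp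
qed

lemma word_heis_identity:
  assumes js: "set js \<subseteq> {1..l}"
    and id: "\<And>u. letter_product bijection_group (\<lambda>i. refl_map b (\<alpha> i)) js (heis a M u) = u"
    and a: "\<And>r. r \<in> {1..\<nu>} \<Longrightarrow> a r \<in> Vd"
  shows "\<And>v. v \<in> Vd \<Longrightarrow> act js v = v" "\<And>r. r \<in> {1..\<nu>} \<Longrightarrow> a r = 0"
proof -
  have word: "letter_product bijection_group (\<lambda>i. refl_map b (\<alpha> i)) js (v, 0) = (act js v, 0)" for v
    using js
  proof (induction js)
    case (Cons j js)
    then show ?case
      by (simp add: refl_map_eq simple_norm pairing_def reflection_def form_sym[of "\<alpha> j" "act js v"])
  qed simp
  have fixed: "act js q = q" if "\<forall>w. b q w = 0" for q
    using js by (induction js) (auto simp: reflection_def that)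
  have eq: "act js v + (\<Sum>r\<in>{1..\<nu>}. b (a r) v *\<^sub>R \<sigma> r) = v" for v
  proof -
    have rad: "\<forall>w. b (\<Sum>r\<in>{1..\<nu>}. b (a r) v *\<^sub>R \<sigma> r) w = 0"
      by (simp add: form_sum_left form_simps)
    show ?thesis
      using id[of "(v, 0)"] linear_add[OF linear_act[of js]] fixed[OF rad]
      by (simp add: heis_Pair_zero word)
  qed
  have act_space: "act js v \<in> Vd" if "v \<in> Vd" for v
    using js
  proof (induction js)
    case (Cons j js)
    then have "act js v \<in> Vd" "\<alpha> j \<in> Vd" using root_in_space simple_root by auto
    then show ?case
      by (simp add: reflection_def subspace_diff[OF subspace_Vd] subspace_scale[OF subspace_Vd])
  qed (simp add: that)
  have zero: "b (a r) v = 0" if "v \<in> Vd" "r \<in> {1..\<nu>}" for v r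
  proof -
    let ?s = "\<Sum>r\<in>{1..\<nu>}. b (a r) v *\<^sub>R \<sigma> r"
    have "?s = v - act js v" using eq[of v] by (simp add: algebra_simps)
    then have "?s \<in> Vd" using subspace_diff[OF subspace_Vd that(1) act_space[OF that(1)]] by simp
    moreover have "b ?s ?s = 0" by (simp add: form_sum_left form_simps)
    ultimately have "?s = 0" using form_pos[of ?s] by (metis less_irrefl)
    then show ?thesis using independent_radical[of "\<lambda>r. b (a r) v" r] that(2) by simp
  qed
  show "act js v = v" if "v \<in> Vd" for v
    using eq[of v] zero[OF that] by simp
  show "a r = 0" if "r \<in> {1..\<nu>}" for r
    using form_pos[OF a[OF that]] zero[OF a[OF that] that] by (metis less_irrefl)
qed

end

lemma (in group) int_pow_one_parameter:
  assumes "\<And>n::int. F n \<in> carrier G" "\<And>m n. F (m + n) = F m \<otimes> F n"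
  shows "F 1 [^] n = F n"
proof -
  have F0: "F 0 = \<one>"
    using assms(2)[of 0 0] assms(1)[of 0] by (metis add_0 l_cancel_one)
  have nat: "F 1 [^] int k = F (int k)" for k
  proof (induction k)
    case 0
    then show ?case using F0 by simp
  next
    case (Suc k)
    have "F 1 [^] int (Suc k) = F 1 [^] int k \<otimes> F 1"
      using assms(1) by (simp add: int_pow_int del: of_nat_Suc)
    then show ?case using Suc assms(2)[of "int k" 1] by (simp add: add.commute)
  qed
  show ?thesis
  proof (cases "0 \<le> n")
    case True
    then show ?thesis using nat[of "nat n"] by simp
  next
    case False
    have "F n = inv (F (- n))"
      using assms(2)[of n "- n"] F0 assms(1) inv_equality[of "F n" "F (- n)"] by simp
    also have "\<dots> = inv (F 1 [^] (- n))" using nat[of "nat (- n)"] False by simp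
    finally show ?thesis using assms(1) by (simp add: int_pow_neg)
  qed
qed

context ears_frame begin

abbreviation "Sym \<equiv> (bijection_group :: ('v \<times> ('v \<Rightarrow>\<^sub>L real) \<Rightarrow> _) monoid)"

definition X_map :: "nat \<Rightarrow> 'v \<times> ('v \<Rightarrow>\<^sub>L real) \<Rightarrow> 'v \<times> ('v \<Rightarrow>\<^sub>L real)" where
  "X_map i = refl_map b (\<alpha> i)"

definition Y_map :: "nat \<Rightarrow> nat \<Rightarrow> 'v \<times> ('v \<Rightarrow>\<^sub>L real) \<Rightarrow> 'v \<times> ('v \<Rightarrow>\<^sub>L real)" where
  "Y_map i r = translation (\<alpha> i) (\<lambda>q. if q = r then 1 else 0)"

definition Z_map :: "(nat \<Rightarrow> nat \<Rightarrow> nat) \<Rightarrow> nat \<Rightarrow> nat \<Rightarrow> 'v \<times> ('v \<Rightarrow>\<^sub>L real) \<Rightarrow> 'v \<times> ('v \<Rightarrow>\<^sub>L real)" where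
  "Z_map N r s = central (\<lambda>p. if p = (r, s) then real (N r s) else 0)"

lemma translation_pow:
  assumes "b \<gamma> \<gamma> = 2"
  shows "translation \<gamma> (\<lambda>q. if q = r then 1 else 0) [^]\<^bsub>Sym\<^esub> n =
    translation \<gamma> (\<lambda>q. if q = r then of_int n else 0)"
proof -
  have "translation \<gamma> (\<lambda>q. if q = r then of_int 1 else 0) [^]\<^bsub>Sym\<^esub> n =
      translation \<gamma> (\<lambda>q. if q = r then of_int n else 0)"
  proof (rule group.int_pow_one_parameter[OF group_bijection_group,
      where F = "\<lambda>n. translation \<gamma> (\<lambda>q. if q = r then of_int n else 0)"])
    fix m n :: int
    have "central (\<lambda>(q, s). (if q = r then of_int m else 0) * (if s = r then of_int n else 0) -
        (if s = r then of_int m else 0) * (if q = r then of_int n else 0)) = id"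
      using central_cong[of "\<lambda>(q, s). (if q = r then of_int m else 0) * (if s = r then of_int n else 0) -
        (if s = r then of_int m else 0) * (if q = r then of_int n else 0)" "\<lambda>_. 0"]
      by (auto simp: index_pairs_def)
    then show "translation \<gamma> (\<lambda>q. if q = r then of_int (m + n) else 0) =
        translation \<gamma> (\<lambda>q. if q = r then of_int m else 0) \<otimes>\<^bsub>Sym\<^esub>
        translation \<gamma> (\<lambda>q. if q = r then of_int n else 0)"
      by (auto simp: translation_add[OF assms] intro!: translation_cong)
  qed simp
  then show ?thesis by (simp only: of_int_1)
qed

lemma central_pow: "central k [^]\<^bsub>Sym\<^esub> (n :: int) = central (\<lambda>p. of_int n * k p)"
proof -
  have "central (\<lambda>p. of_int 1 * k p) [^]\<^bsub>Sym\<^esub> n = central (\<lambda>p. of_int n * k p)"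
    by (rule group.int_pow_one_parameter[OF group_bijection_group,
      where F = "\<lambda>n. central (\<lambda>p. of_int n * k p)"]) (simp_all add: central_add algebra_simps)
  then show ?thesis by (simp only: of_int_1 mult_1)
qed

lemma Y_map_pow:
  "i \<in> {1..l} \<Longrightarrow> Y_map i r [^]\<^bsub>Sym\<^esub> n = translation (\<alpha> i) (\<lambda>q. if q = r then of_int n else 0)"
  unfolding Y_map_def by (rule translation_pow[OF simple_norm])

lemma Z_map_pow: "Z_map N r s [^]\<^bsub>Sym\<^esub> (n :: int) = central (\<lambda>p. if p = (r, s) then of_int n * real (N r s) else 0)"
  unfolding Z_map_def central_pow by (rule central_cong) simp

lemma X_map_square: "i \<in> {1..l} \<Longrightarrow> X_map i \<circ> X_map i = id"
  unfolding X_map_def by (rule refl_map_square[OF simple_norm])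

lemma bij_maps [simp]: "i \<in> {1..l} \<Longrightarrow> bij (X_map i)" "bij (Y_map i r)" "bij (Z_map N r s)"
  by (simp_all add: X_map_def Y_map_def Z_map_def bij_refl_map simple_norm)

lemma X_map_braid:
  assumes "i \<in> {1..l}" "j \<in> {1..l}" "i \<noteq> j" "of_int e = b (\<alpha> i) (\<alpha> j)"
  shows "(X_map i \<circ> X_map j) [^]\<^bsub>Sym\<^esub> (e\<^sup>2 + 2) = id"
proof -
  interpret Sym: group Sym by (rule group_bijection_group)
  have closed: "X_map i \<in> carrier Sym" "X_map j \<in> carrier Sym"
    "X_map i \<otimes>\<^bsub>Sym\<^esub> X_map i = \<one>\<^bsub>Sym\<^esub>" "X_map j \<otimes>\<^bsub>Sym\<^esub> X_map j = \<one>\<^bsub>Sym\<^esub>"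
    using assms X_map_square by auto
  have conj: "X_map i \<circ> X_map j \<circ> X_map i = refl_map b (reflection i (\<alpha> j))"
    "X_map j \<circ> X_map i \<circ> X_map j = refl_map b (reflection j (\<alpha> i))"
    unfolding X_map_def using refl_map_conjugate simple_norm assms by auto
  have sym: "b (\<alpha> j) (\<alpha> i) = b (\<alpha> i) (\<alpha> j)" by (rule form_sym)
  from simple_pairing_cases[OF assms(1-3)] consider "e = 0" | "e = -1"
    using assms(4) by fastforce
  then show ?thesis
  proof cases
    case 1
    then have "X_map i \<circ> X_map j \<circ> X_map i = X_map j"
      using assms(4) sym unfolding conj by (simp add: reflection_def X_map_def)
    then have "X_map i \<circ> X_map j \<circ> X_map i \<circ> X_map i = X_map j \<circ> X_map i" by simp
    then have "X_map i \<circ> X_map j = X_map j \<circ> X_map i"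
      using X_map_square[OF assms(1)] by (simp add: comp_assoc)
    then show ?thesis using Sym.square_commute_iff(1)[OF closed] 1 by simp
  next
    case 2
    then have "X_map i \<circ> X_map j \<circ> X_map i = X_map j \<circ> X_map i \<circ> X_map j"
      using assms(4)[symmetric] sym unfolding conj by (simp add: reflection_def add.commute 2)
    then show ?thesis using Sym.square_commute_iff(2)[OF closed] 2 by simp
  qed
qed

lemma X_Y_X:
  assumes "i \<in> {1..l}" "j \<in> {1..l}" "of_int e = b (\<alpha> i) (\<alpha> j)"
  shows "X_map i \<circ> Y_map j r \<circ> X_map i = Y_map j r \<circ> Y_map i r [^]\<^bsub>Sym\<^esub> (- e)"
proof -
  have "X_map i \<circ> Y_map j r \<circ> X_map i =
      heis (\<lambda>q. reflection i ((if q = r then 1 else 0) *\<^sub>R \<alpha> j))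
        (\<lambda>q s. - ((if q = r then 1 else 0) * (if s = r then 1 else 0)))"
    unfolding X_map_def Y_map_def translation_def by (rule refl_map_heis_conjugate[OF assms(1)])
  also have "\<dots> = Y_map j r \<circ> translation (\<alpha> i) (\<lambda>q. if q = r then of_int (- e) else 0)"
    unfolding Y_map_def translation_def heis_compose
    by (rule heis_cong)
      (auto simp: reflection_def form_simps assms(3) form_sym[of "\<alpha> j" "\<alpha> i"] algebra_simps)
  finally show ?thesis using Y_map_pow[OF assms(1)] by simp
qed

lemma Y_Y_same: "Y_map i r \<circ> Y_map j r = Y_map j r \<circ> Y_map i r"
  unfolding Y_map_def translation_def heis_compose
  by (rule heis_cong) (auto simp: form_simps form_sym[of "\<alpha> j" "\<alpha> i"])

lemma Y_Y:
  assumes "(r, s) \<in> index_pairs \<nu>" "of_int e = b (\<alpha> i) (\<alpha> j)" "int (N r s) dvd e"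
  shows "Y_map i r \<circ> Y_map j s =
    Y_map j s \<circ> Y_map i r \<circ> Z_map N r s [^]\<^bsub>Sym\<^esub> (e div int (N r s))"
proof -
  have "of_int (e div int (N r s)) * real (N r s) = of_int e"
    using assms(3) by (metis dvd_div_mult_self of_int_mult of_int_of_nat_eq)
  then have "Z_map N r s [^]\<^bsub>Sym\<^esub> (e div int (N r s)) = central (\<lambda>p. if p = (r, s) then of_int e else 0)"
    by (simp add: Z_map_pow cong: if_cong)
  also have "\<dots> = central (\<lambda>(q, q'). of_int e * ((if q = r then 1 else 0) * (if q' = s then 1 else 0) -
      (if q' = r then 1 else 0) * (if q = s then 1 else 0)))"
    by (rule central_cong) (use assms(1) in \<open>auto simp: index_pairs_def split: if_splits\<close>)
  finally show ?thesis
    using translation_commutator[OF assms(2)[symmetric]] by (simp add: Y_map_def)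
qed

lemma weyl_relations_maps:
  assumes a: "\<And>i j. i \<in> {1..l} \<Longrightarrow> j \<in> {1..l} \<Longrightarrow> of_int (a i j) = b (\<alpha> i) (\<alpha> j)"
    and N: "\<And>i j r s. i \<in> {1..l} \<Longrightarrow> j \<in> {1..l} \<Longrightarrow> (r, s) \<in> index_pairs \<nu> \<Longrightarrow> int (N r s) dvd a i j"
  shows "weyl_relations Sym l \<nu> a N X_map Y_map (Z_map N)"
proof (intro weyl_relations.intro group_bijection_group weyl_relations_axioms.intro, goal_cases)
  case (4 i)
  then show ?case by (simp add: X_map_square)
next
  case (5 i j)
  then show ?case using X_map_braid a by simp
next
  case (6 i j r)
  then show ?case using X_Y_X a by simp
next
  case (7 r s r' s')
  then show ?case by (simp add: Z_map_def central_add add.commute)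
next
  case (8 i r r' s')
  then show ?case by (simp add: Z_map_def Y_map_def translation_def central_commute)
next
  case (9 i j r)
  then show ?case by (simp add: Y_Y_same)
next
  case (10 i j r s)
  then show ?case using Y_Y a N by simp
qed simp_all

lemma X_Z: "i \<in> {1..l} \<Longrightarrow> X_map i \<circ> Z_map N r s = Z_map N r s \<circ> X_map i"
  unfolding X_map_def Z_map_def by (rule central_refl_map_commute)

lemma ordered_product_Y:
  assumes "distinct ps" "set ps \<subseteq> {1..l} \<times> {1..\<nu>}"
  shows "\<exists>M. ordered_product Sym (\<lambda>(i, r). Y_map i r) m ps =
    heis (\<lambda>q. \<Sum>(i, r)\<in>{p \<in> set ps. snd p = q}. of_int (m (i, r)) *\<^sub>R \<alpha> i) M"
  using assms
proof (induction ps)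
  case Nil
  then show ?case using heis_zero by (auto intro!: exI[of _ "\<lambda>_ _. 0"])
next
  case (Cons p ps)
  obtain i r where p: "p = (i, r)" by fastforce
  obtain M where M: "ordered_product Sym (\<lambda>(i, r). Y_map i r) m ps =
      heis (\<lambda>q. \<Sum>(i, r)\<in>{p \<in> set ps. snd p = q}. of_int (m (i, r)) *\<^sub>R \<alpha> i) M"
    using Cons by auto
  have i: "i \<in> {1..l}" and notin: "(i, r) \<notin> set ps" using Cons.prems p by auto
  have "(if q = r then of_int (m (i, r)) else 0) *\<^sub>R \<alpha> i +
      (\<Sum>(i, r)\<in>{p \<in> set ps. snd p = q}. of_int (m (i, r)) *\<^sub>R \<alpha> i) =
      (\<Sum>(i, r)\<in>{p \<in> set ((i, r) # ps). snd p = q}. of_int (m (i, r)) *\<^sub>R \<alpha> i)" for q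
  proof -
    have "{p \<in> set ((i, r) # ps). snd p = q} =
        (if q = r then insert (i, r) {p \<in> set ps. snd p = q} else {p \<in> set ps. snd p = q})"
      by auto
    then show ?thesis using notin by simp
  qed
  then show ?case
    unfolding p using M by (simp add: Y_map_pow[OF i] translation_def heis_compose) blast
qed

lemma ordered_product_Z:
  assumes "distinct ps" "set ps \<subseteq> index_pairs \<nu>"
  shows "ordered_product Sym (\<lambda>(r, s). Z_map N r s) k ps =
    central (\<lambda>(r, s). if (r, s) \<in> set ps then of_int (k (r, s)) * real (N r s) else 0)"
  using assms
proof (induction ps)
  case (Cons p ps)
  obtain r s where p: "p = (r, s)" by fastforce
  then show ?case using Cons
    by (auto simp: Z_map_pow central_add intro!: central_cong)
qed (simp add: split_def)

lemma kernel_trivial: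
  assumes js: "set js \<subseteq> {1..l}" and N: "\<And>r s. (r, s) \<in> index_pairs \<nu> \<Longrightarrow> N r s \<noteq> 0"
    and id: "letter_product Sym X_map js \<circ> (ordered_product Sym (\<lambda>(i, r). Y_map i r) m (y_indices l \<nu>) \<circ>
      ordered_product Sym (\<lambda>(r, s). Z_map N r s) k (z_indices \<nu>)) = id"
    and G: "simple_system_group b Vd \<Phi> l \<alpha> G x"
  shows "letter_product G x js = \<one>\<^bsub>G\<^esub> \<and> (\<forall>p\<in>{1..l} \<times> {1..\<nu>}. m p = 0) \<and> (\<forall>p\<in>index_pairs \<nu>. k p = 0)"
proof -
  interpret G: simple_system_group b Vd \<Phi> l \<alpha> G x by (rule G)
  let ?a = "\<lambda>q. \<Sum>(i, r)\<in>{p \<in> {1..l} \<times> {1..\<nu>}. snd p = q}. of_int (m (i, r)) *\<^sub>R \<alpha> i"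
  let ?k = "\<lambda>(r, s). if (r, s) \<in> index_pairs \<nu> then of_int (k (r, s)) * real (N r s) else 0"
  obtain M where M: "ordered_product Sym (\<lambda>(i, r). Y_map i r) m (y_indices l \<nu>) = heis ?a M"
    using ordered_product_Y[of "y_indices l \<nu>" m] by auto
  have K: "ordered_product Sym (\<lambda>(r, s). Z_map N r s) k (z_indices \<nu>) = central ?k"
    using ordered_product_Z[of "z_indices \<nu>" N k] by simp
  have aV: "?a q \<in> Vd" for q
    by (rule subspace_sum[OF subspace_Vd])
      (auto intro!: subspace_scale[OF subspace_Vd] root_in_space[OF simple_root])
  have MK: "heis ?a M \<circ> central ?k = heis ?a (\<lambda>r s. M r s + alternating ?k r s)"
    by (simp add: central_def heis_compose form_simps)
  have X: "X_map = (\<lambda>i. refl_map b (\<alpha> i))" by (simp add: X_map_def fun_eq_iff)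
  have "letter_product Sym (\<lambda>i. refl_map b (\<alpha> i)) js (heis ?a (\<lambda>r s. M r s + alternating ?k r s) u) = u" for u
    using fun_cong[OF id[unfolded M K MK X], of u] by (simp only: o_apply id_apply)
  note W = word_heis_identity[OF js this aV]
  have a_sum: "?a q = combination (\<lambda>i. of_int (m (i, q)))" if "q \<in> {1..\<nu>}" for q
  proof -
    have "{p \<in> {1..l} \<times> {1..\<nu>}. snd p = q} = (\<lambda>i. (i, q)) ` {1..l}" using that by auto
    then show ?thesis by (simp add: sum.reindex inj_on_def)
  qed
  have m0: "m (i, q) = 0" if "i \<in> {1..l}" "q \<in> {1..\<nu>}" for i q
    using combination_zero[of "\<lambda>i. of_int (m (i, q))" i] W(2)[OF that(2)] a_sum[OF that(2)] that(1) by simp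
  have x1: "letter_product G x js = \<one>\<^bsub>G\<^esub>"
    by (rule G.trivial_word[OF js W(1)])
  interpret Sym: group Sym by (rule group_bijection_group)
  have "simple_system_group b Vd \<Phi> l \<alpha> Sym X_map"
  proof (intro simple_system_group.intro simple_system_axioms group_bijection_group
      simple_system_group_axioms.intro, goal_cases)
    case (3 i j)
    have "X_map i \<circ> X_map j \<circ> X_map i = X_map j"
      using 3 refl_map_conjugate[of i "\<alpha> j"] form_sym[of "\<alpha> j" "\<alpha> i"] simple_norm
      by (simp add: X_map_def reflection_def)
    then have "X_map i \<circ> X_map j \<circ> X_map i \<circ> X_map i = X_map j \<circ> X_map i" by simp
    then show ?case using X_map_square[OF 3(1)] by (simp add: comp_assoc)
  next
    case (4 i j)
    then show ?case
      using refl_map_conjugate[of i "\<alpha> j"] refl_map_conjugate[of j "\<alpha> i"] form_sym[of "\<alpha> j" "\<alpha> i"] simple_norm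
      by (simp add: X_map_def reflection_def add.commute)
  qed (simp_all add: X_map_square)
  then interpret S: simple_system_group b Vd \<Phi> l \<alpha> Sym X_map .
  have "letter_product Sym X_map js = id" using S.trivial_word[OF js W(1)] by simp
  moreover have "ordered_product Sym (\<lambda>(i, r). Y_map i r) m (y_indices l \<nu>) = id"
    using Sym.ordered_product_zero[of "\<lambda>(i, r). Y_map i r" "y_indices l \<nu>" m] m0
    by (fastforce simp: Pi_iff)
  ultimately have "central ?k = id" using id unfolding K by simp
  then have "heis (\<lambda>_. 0) (alternating ?k) u = u" for u unfolding central_def by simp
  then have "alternating ?k r s = 0" if "r \<in> {1..\<nu>}" "s \<in> {1..\<nu>}" for r s
    using heis_matrix_zero that by blast
  then have "k (r, s) = 0" if rs: "(r, s) \<in> index_pairs \<nu>" for r s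
  proof -
    have "alternating ?k r s = 0"
      by (rule \<open>\<And>s r. r \<in> {1..\<nu>} \<Longrightarrow> s \<in> {1..\<nu>} \<Longrightarrow> alternating ?k r s = 0\<close>)
        (use rs in \<open>auto simp: index_pairs_def\<close>)
    moreover have "r < s" using rs by (simp add: index_pairs_def)
    ultimately show ?thesis using rs N[OF rs] by (simp add: alternating_def)
  qed
  then show ?thesis using x1 m0 by auto
qed

lemma weyl_relations_simple_system:
  assumes "weyl_relations G l \<nu> a N x y z"
    and a: "\<And>i j. i \<in> {1..l} \<Longrightarrow> j \<in> {1..l} \<Longrightarrow> of_int (a i j) = b (\<alpha> i) (\<alpha> j)"
  shows "simple_system_group b Vd \<Phi> l \<alpha> G x"
proof -
  interpret G: weyl_relations G l \<nu> a N x y z by fact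
  show ?thesis
  proof (intro simple_system_group.intro simple_system_axioms G.is_group simple_system_group_axioms.intro,
      goal_cases)
    case (3 i j)
    then have "i \<noteq> j" "a i j = 0" using simple_norm[of i] a[of i j] by auto
    then show ?case
      using G.x_braid[OF 3(1,2)] G.square_commute_iff(1)[of "x i" "x j"] 3 G.x_square by simp
  next
    case (4 i j)
    then have "i \<noteq> j" "a i j = -1" using simple_norm[of i] a[of i j] by auto
    then show ?case
      using G.x_braid[OF 4(1,2)] G.square_commute_iff(2)[of "x i" "x j"] 4 G.x_square by simp
  qed (simp_all add: G.x_square)
qed

definition "map_generators N = X_map ` {1..l} \<union> case_prod Y_map ` ({1..l} \<times> {1..\<nu>}) \<union>
  case_prod (Z_map N) ` index_pairs \<nu>"

theorem iso_onto_generated: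
  assumes G: "central_weyl_relations G l \<nu> a N x y z"
    and a: "\<And>i j. i \<in> {1..l} \<Longrightarrow> j \<in> {1..l} \<Longrightarrow> of_int (a i j) = b (\<alpha> i) (\<alpha> j)"
    and N: "\<And>r s. (r, s) \<in> index_pairs \<nu> \<Longrightarrow> N r s \<noteq> 0"
    and h: "h \<in> hom G Sym" "\<And>i. i \<in> {1..l} \<Longrightarrow> h (x i) = X_map i"
      "\<And>i r. i \<in> {1..l} \<Longrightarrow> r \<in> {1..\<nu>} \<Longrightarrow> h (y i r) = Y_map i r"
      "\<And>r s. (r, s) \<in> index_pairs \<nu> \<Longrightarrow> h (z r s) = Z_map N r s"
  shows "h \<in> iso G (subgroup_generated Sym (map_generators N))"
proof -
  interpret G: central_weyl_relations G l \<nu> a N x y z by fact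
  interpret Sym: group Sym by (rule group_bijection_group)
  interpret h: group_hom G Sym h
    by (intro group_hom.intro group_hom_axioms.intro G.is_group group_bijection_group h)
  have S: "simple_system_group b Vd \<Phi> l \<alpha> G x"
    by (rule weyl_relations_simple_system[OF G.weyl_relations_axioms a])
  have inj: "inj_on h (carrier G)"
  proof (rule G.inj_on_if_normal_forms_faithful[OF group_bijection_group h(1)])
    fix js m k assume js: "set js \<subseteq> {1..l}"
      and id: "letter_product Sym (\<lambda>i. h (x i)) js \<otimes>\<^bsub>Sym\<^esub>
        (ordered_product Sym (\<lambda>(i, r). h (y i r)) m (y_indices l \<nu>) \<otimes>\<^bsub>Sym\<^esub>
        ordered_product Sym (\<lambda>(r, s). h (z r s)) k (z_indices \<nu>)) = \<one>\<^bsub>Sym\<^esub>"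
    have "letter_product Sym (\<lambda>i. h (x i)) js = letter_product Sym X_map js"
      using js by (induction js) (auto simp: h(2))
    moreover have "ordered_product Sym (\<lambda>(i, r). h (y i r)) m ps = ordered_product Sym (\<lambda>(i, r). Y_map i r) m ps"
      if "set ps \<subseteq> {1..l} \<times> {1..\<nu>}" for ps
      using that by (induction ps) (auto simp: h(3))
    moreover have "ordered_product Sym (\<lambda>(r, s). h (z r s)) k ps = ordered_product Sym (\<lambda>(r, s). Z_map N r s) k ps"
      if "set ps \<subseteq> index_pairs \<nu>" for ps
      using that by (induction ps) (auto simp: h(4))
    ultimately have "letter_product Sym X_map js \<circ>
        (ordered_product Sym (\<lambda>(i, r). Y_map i r) m (y_indices l \<nu>) \<circ>
        ordered_product Sym (\<lambda>(r, s). Z_map N r s) k (z_indices \<nu>)) = id"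
      using id by simp
    from kernel_trivial[OF js N this S]
    show "letter_product G x js = \<one>\<^bsub>G\<^esub> \<and> (\<forall>p\<in>{1..l} \<times> {1..\<nu>}. m p = 0) \<and> (\<forall>p\<in>index_pairs \<nu>. k p = 0)" .
  qed
  have "h ` carrier G = generate Sym (h ` (x ` {1..l} \<union> case_prod y ` ({1..l} \<times> {1..\<nu>}) \<union>
      case_prod z ` index_pairs \<nu>))"
    unfolding G.generated[symmetric] by (rule h.generate_img[symmetric]) auto
  also have "h ` (x ` {1..l} \<union> case_prod y ` ({1..l} \<times> {1..\<nu>}) \<union> case_prod z ` index_pairs \<nu>) = map_generators N"
  proof -
    have "h ` x ` {1..l} = X_map ` {1..l}"
      using h(2) by (force simp: image_image)
    moreover have "h ` case_prod y ` ({1..l} \<times> {1..\<nu>}) = case_prod Y_map ` ({1..l} \<times> {1..\<nu>})"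
      unfolding image_image by (rule image_cong) (auto simp: h(3))
    moreover have "h ` case_prod z ` index_pairs \<nu> = case_prod (Z_map N) ` index_pairs \<nu>"
      unfolding image_image by (rule image_cong) (auto simp: h(4))
    ultimately show ?thesis by (simp only: image_Un map_generators_def)
  qed
  finally have img: "h ` carrier G = carrier (subgroup_generated Sym (map_generators N))"
    unfolding carrier_subgroup_generated
    by (subst Int_absorb1) (auto simp: map_generators_def)
  have "h \<in> hom G (subgroup_generated Sym (map_generators N))"
    using h(1) img by (auto simp: hom_def)
  then show ?thesis using inj img by (auto simp: iso_def bij_betw_def)
qed

end

section \<open>Restriction to the extended space\<close>

lemma group_GL:
  fixes U :: "'a::real_vector set"
  assumes U: "subspace U" shows "group (GL U)"
proof -
  let ?H = "{g \<in> Bij U. (\<forall>x\<in>U. \<forall>y\<in>U. g (x + y) = g x + g y) \<and> (\<forall>t. \<forall>x\<in>U. g (t *\<^sub>R x) = t *\<^sub>R g x)}"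
  interpret B: group "BijGroup U" by (rule group_BijGroup)
  have maps: "g x \<in> U" if "g \<in> Bij U" "x \<in> U" for g x
    using Bij_imp_funcset[OF that(1)] that(2) by auto
  have mult: "g \<otimes>\<^bsub>BijGroup U\<^esub> h = compose U g h" if "g \<in> Bij U" "h \<in> Bij U" for g h
    using that by (simp add: BijGroup_def)
  have "subgroup ?H (BijGroup U)"
  proof (rule B.subgroupI)
    show "?H \<subseteq> carrier (BijGroup U)" by (auto simp: BijGroup_def)
    have "(\<lambda>x\<in>U. x) \<in> ?H"
      using subspace_add[OF U] subspace_scale[OF U] by (auto simp: id_Bij)
    then show "?H \<noteq> {}" by blast
  next
    fix g assume g: "g \<in> ?H"
    then have gB: "g \<in> Bij U" by simp
    have inv: "inv\<^bsub>BijGroup U\<^esub> g = (\<lambda>x\<in>U. inv_into U g x)" by (rule inv_BijGroup[OF gB])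
    have add: "inv_into U g (x + y) = inv_into U g x + inv_into U g y" if "x \<in> U" "y \<in> U" for x y
      by (rule Bij_inv_into_lemma[where g="(+)"]) (use g that subspace_add[OF U] in auto)
    have scale: "inv_into U g (t *\<^sub>R x) = t *\<^sub>R inv_into U g x" if "x \<in> U" for t x
    proof -
      let ?y = "inv_into U g x"
      have y: "?y \<in> U" "g ?y = x"
        using gB that by (auto simp: Bij_def bij_betw_def inv_into_into f_inv_into_f)
      have "g (t *\<^sub>R ?y) = t *\<^sub>R x" using g y by simp
      moreover have "inj_on g U" using gB by (auto simp: Bij_def bij_betw_def)
      ultimately show ?thesis using inv_into_f_eq subspace_scale[OF U y(1)] by metis
    qed
    show "inv\<^bsub>BijGroup U\<^esub> g \<in> ?H"
      unfolding inv using restrict_inv_into_Bij[OF gB] add scale subspace_add[OF U] subspace_scale[OF U]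
      by auto
    fix h assume h: "h \<in> ?H"
    then have hB: "h \<in> Bij U" by simp
    show "g \<otimes>\<^bsub>BijGroup U\<^esub> h \<in> ?H"
      unfolding mult[OF gB hB] using compose_Bij[OF gB hB] g h maps[OF hB] subspace_add[OF U] subspace_scale[OF U]
      by (simp add: compose_eq)
  qed
  then show ?thesis unfolding GL_def by (rule B.subgroup_imp_group)
qed

context ears_frame begin

abbreviation "Ext \<equiv> ext_space Vd"

lemma subspace_Ext: "subspace Ext"
  by (auto simp: subspace_def ext_space_def blinfun.bilinear_simps)

lemma group_GL_Ext: "group (GL Ext)"
  by (rule group_GL[OF subspace_Ext])

text \<open>The full space \<open>V \<oplus> V\<^sup>*\<close> is the direct sum of \<open>V \<oplus> (V\<^sup>0)\<^sup>*\<close> and of the vectors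
  \<open>(- p, (p, \<cdot>))\<close> with \<open>p\<close> in the complement of the radical. These are orthogonal to \<open>V\<close>, hence fixed
  by all reflections, so that restriction to the extended space loses nothing. On the full space no
  choice of a complement enters any more.\<close>

definition restrictable :: "('v \<times> ('v \<Rightarrow>\<^sub>L real) \<Rightarrow> 'v \<times> ('v \<Rightarrow>\<^sub>L real)) set" where
  "restrictable = {g. linear g \<and> bij g \<and> (\<forall>u. snd (g u) = snd u) \<and>
     (\<forall>p\<in>Vd. g (- p, form_functional p) = (- p, form_functional p))}"

lemma restrictableD:
  assumes "g \<in> restrictable"
  shows "linear g" "bij g" "snd (g u) = snd u" "p \<in> Vd \<Longrightarrow> g (- p, form_functional p) = (- p, form_functional p)"
  using assms unfolding restrictable_def by blast+

lemma ext_space_decompose: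
  obtains p where "p \<in> Vd" "u - (- p, form_functional p) \<in> Ext"
proof -
  have "linear (blinfun_apply (snd u))"
    by (rule bounded_linear.linear[OF blinfun.bounded_linear_right])
  then obtain p where "p \<in> Vd" "\<forall>v\<in>Vd. b p v = snd u v" using represent_functional by blast
  then show thesis using that[of p] by (simp add: ext_space_def blinfun.diff_left)
qed

lemma subgroup_restrictable: "subgroup restrictable Sym"
proof (rule group.subgroupI[OF group_bijection_group])
  interpret Sym: group Sym by (rule group_bijection_group)
  show "restrictable \<subseteq> carrier Sym" by (auto simp: restrictable_def)
  have "id \<in> restrictable" by (simp add: restrictable_def linear_id)
  then show "restrictable \<noteq> {}" by blast
  fix g assume g: "g \<in> restrictable"
  let ?h = "inv\<^bsub>Sym\<^esub> g"
  have gc: "g \<in> carrier Sym" and lin: "linear g" using g by (auto simp: restrictable_def)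
  have bijs: "bij g" "bij ?h" using gc Sym.inv_closed[OF gc] by auto
  have gh: "g (?h u) = u" and hg: "?h (g u) = u" for u
    using Sym.r_inv[OF gc] Sym.l_inv[OF gc] by (auto dest: fun_cong)
  have inj: "u = v" if "g u = g v" for u v using that hg by metis
  have "linear ?h"
    by (rule linearI; rule inj) (simp_all add: gh linear_add[OF lin] linear_scale[OF lin])
  moreover have "snd (?h u) = snd u" for u
  proof -
    have "snd (g (?h u)) = snd (?h u)" by (rule restrictableD(3)[OF g])
    then show ?thesis by (simp add: gh)
  qed
  moreover have "?h (- p, form_functional p) = (- p, form_functional p)" if "p \<in> Vd" for p
  proof -
    have "g (- p, form_functional p) = (- p, form_functional p)" by (rule restrictableD(4)[OF g that])
    then show ?thesis using hg by metis
  qed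
  ultimately show "?h \<in> restrictable" using bijs unfolding restrictable_def by blast
  fix h assume h: "h \<in> restrictable"
  have "linear (g \<circ> h)" "bij (g \<circ> h)"
    using restrictableD[OF g] restrictableD[OF h] by (auto intro: linear_compose bij_comp)
  moreover have "snd ((g \<circ> h) u) = snd u" for u
    using restrictableD(3)[OF g, of "h u"] restrictableD(3)[OF h, of u] by (simp only: o_apply)
  moreover have "(g \<circ> h) (- p, form_functional p) = (- p, form_functional p)" if "p \<in> Vd" for p
    using restrictableD(4)[OF g that] restrictableD(4)[OF h that] by (simp only: o_apply)
  ultimately show "g \<otimes>\<^bsub>Sym\<^esub> h \<in> restrictable"
    unfolding restrictable_def bijection_group_simps by blast
qed

definition to_Ext :: "('v \<times> ('v \<Rightarrow>\<^sub>L real) \<Rightarrow> 'v \<times> ('v \<Rightarrow>\<^sub>L real)) \<Rightarrow> 'v \<times> ('v \<Rightarrow>\<^sub>L real) \<Rightarrow> 'v \<times> ('v \<Rightarrow>\<^sub>L real)" where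
  "to_Ext g = restrict g Ext"

lemma restrictable_Ext_iff: "g \<in> restrictable \<Longrightarrow> g u \<in> Ext \<longleftrightarrow> u \<in> Ext"
  using restrictableD(3)[of g u] by (simp only: ext_space_def mem_Collect_eq)

lemma to_Ext_closed: "g \<in> restrictable \<Longrightarrow> to_Ext g \<in> carrier (GL Ext)"
proof -
  assume g: "g \<in> restrictable"
  then have bij: "bij g" and lin: "linear g" by (auto simp: restrictable_def)
  have "g ` Ext = Ext"
  proof
    show "Ext \<subseteq> g ` Ext"
    proof
      fix u assume u: "u \<in> Ext"
      obtain w where "u = g w" using bij by (metis bij_pointE)
      then show "u \<in> g ` Ext" using u restrictable_Ext_iff[OF g] by auto
    qed
  qed (use restrictable_Ext_iff[OF g] in auto)
  moreover have "inj_on g Ext" using bij by (auto simp: bij_def intro: inj_on_subset)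
  ultimately have "bij_betw (restrict g Ext) Ext Ext"
    by (simp add: bij_betw_def inj_on_restrict_eq)
  then show ?thesis
    using subspace_add[OF subspace_Ext] subspace_scale[OF subspace_Ext] linear_add[OF lin] linear_scale[OF lin]
    by (simp add: GL_def to_Ext_def Bij_def)
qed

lemma to_Ext_hom: "group_hom (Sym\<lparr>carrier := restrictable\<rparr>) (GL Ext) to_Ext"
proof (intro group_hom.intro group_hom_axioms.intro group_GL_Ext homI)
  show "group (Sym\<lparr>carrier := restrictable\<rparr>)"
    by (rule group.subgroup_imp_group[OF group_bijection_group subgroup_restrictable])
  show "to_Ext g \<in> carrier (GL Ext)" if "g \<in> carrier (Sym\<lparr>carrier := restrictable\<rparr>)" for g
    using to_Ext_closed that by simp
  fix g h assume gh: "g \<in> carrier (Sym\<lparr>carrier := restrictable\<rparr>)" "h \<in> carrier (Sym\<lparr>carrier := restrictable\<rparr>)"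
  then have "to_Ext g \<in> Bij Ext" "to_Ext h \<in> Bij Ext"
    using to_Ext_closed[of g] to_Ext_closed[of h] by (auto simp: GL_def)
  then have "to_Ext g \<otimes>\<^bsub>GL Ext\<^esub> to_Ext h = compose Ext (to_Ext g) (to_Ext h)"
    by (simp add: GL_def BijGroup_def)
  also have "\<dots> = to_Ext (g \<circ> h)"
    using gh restrictable_Ext_iff[of h] by (auto simp: to_Ext_def compose_def fun_eq_iff)
  finally show "to_Ext (g \<otimes>\<^bsub>Sym\<lparr>carrier := restrictable\<rparr>\<^esub> h) = to_Ext g \<otimes>\<^bsub>GL Ext\<^esub> to_Ext h" by simp
qed

lemma to_Ext_inj: "inj_on to_Ext restrictable"
proof (rule inj_onI, rule ext)
  fix g h u assume gh: "g \<in> restrictable" "h \<in> restrictable" "to_Ext g = to_Ext h"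
  obtain p where p: "p \<in> Vd" "u - (- p, form_functional p) \<in> Ext" by (rule ext_space_decompose)
  let ?q = "(- p, form_functional p)"
  have lin: "linear g" "linear h" using gh by (auto simp: restrictable_def)
  have q: "g ?q = ?q" "h ?q = ?q" using gh p(1) by (auto simp: restrictable_def)
  have e: "g (u - ?q) = h (u - ?q)"
    using fun_cong[OF gh(3), of "u - ?q"] p(2) by (simp only: to_Ext_def restrict_apply' if_True)
  have "g u = g (u - ?q) + g ?q" "h u = h (u - ?q) + h ?q"
    using linear_diff[OF lin(1), of u ?q] linear_diff[OF lin(2), of u ?q] by simp_all
  then show "g u = h u" by (simp only: e q)
qed

lemma generate_to_Ext:
  assumes "A \<subseteq> restrictable"
  shows "generate (GL Ext) (to_Ext ` A) = to_Ext ` generate Sym A"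
proof -
  interpret h: group_hom "Sym\<lparr>carrier := restrictable\<rparr>" "GL Ext" to_Ext by (rule to_Ext_hom)
  show ?thesis
    using h.generate_img[of A] assms
      group.generate_consistent[OF group_bijection_group assms subgroup_restrictable] by simp
qed

lemma iso_to_Ext:
  assumes "A \<subseteq> restrictable"
  shows "to_Ext \<in> iso (subgroup_generated Sym A) (subgroup_generated (GL Ext) (to_Ext ` A))"
proof -
  interpret h: group_hom "Sym\<lparr>carrier := restrictable\<rparr>" "GL Ext" to_Ext by (rule to_Ext_hom)
  have A: "A \<subseteq> carrier Sym" using assms by (auto simp: restrictable_def)
  have c: "carrier (subgroup_generated Sym A) = generate Sym A"
    using A by (simp add: carrier_subgroup_generated Int_absorb1)
  have d: "carrier (subgroup_generated (GL Ext) (to_Ext ` A)) = to_Ext ` generate Sym A"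
    using assms to_Ext_closed by (subst carrier_subgroup_generated, subst Int_absorb1)
      (auto simp: generate_to_Ext[OF assms])
  have sub: "generate Sym A \<subseteq> restrictable"
    by (rule group.generate_subgroup_incl[OF group_bijection_group assms subgroup_restrictable])
  have "to_Ext (g \<circ> h) = to_Ext g \<otimes>\<^bsub>GL Ext\<^esub> to_Ext h" if "g \<in> restrictable" "h \<in> restrictable" for g h
    using h.hom_mult[of g h] that by simp
  then have "to_Ext \<in> hom (subgroup_generated Sym A) (subgroup_generated (GL Ext) (to_Ext ` A))"
    using sub by (intro homI) (auto simp: c d)
  then show ?thesis
    using inj_on_subset[OF to_Ext_inj sub] by (auto simp: iso_def bij_betw_def c d)
qed

lemma refl_map_restrictable: "b \<gamma> \<gamma> = 2 \<Longrightarrow> refl_map b \<gamma> \<in> restrictable"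
  unfolding restrictable_def
proof (intro CollectI conjI allI ballI bij_refl_map)
  assume n: "b \<gamma> \<gamma> = 2"
  show "linear (refl_map b \<gamma>)"
    by (rule linearI) (simp_all add: refl_map_eq[OF n] prod_eq_iff pairing_def form_simps
        blinfun.bilinear_simps algebra_simps)
  show "snd (refl_map b \<gamma> u) = snd u" for u by (simp add: refl_map_eq[OF n])
  fix p
  have "pairing \<gamma> (- p, form_functional p) = 0" by (simp add: pairing_def form_simps form_sym[of \<gamma> p])
  then show "refl_map b \<gamma> (- p, form_functional p) = (- p, form_functional p)"
    by (simp add: refl_map_eq[OF n])
qed

lemma heis_zero_restrictable: "heis (\<lambda>_. 0) M \<in> restrictable"
  unfolding restrictable_def
proof (intro CollectI conjI allI ballI bij_heis snd_heis)
  show "linear (heis (\<lambda>_. 0) M)"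
    by (rule linearI) (simp_all add: heis_def prod_eq_iff blinfun.bilinear_simps algebra_simps
        sum.distrib scaleR_sum_right)
qed (simp add: heis_def)

section \<open>The central elements\<close>

text \<open>Integer exponents of the \<open>c\<^sub>r\<^sub>s\<close>, written additively.\<close>

definition exponent_group :: "(nat \<times> nat \<Rightarrow> int) monoid" where
  "exponent_group = \<lparr>carrier = UNIV, mult = (\<lambda>k k' p. k p + k' p), one = (\<lambda>_. 0)\<rparr>"

lemma exponent_group_simps [simp]:
  "carrier exponent_group = UNIV" "k \<otimes>\<^bsub>exponent_group\<^esub> k' = (\<lambda>p. k p + k' p)"
  "\<one>\<^bsub>exponent_group\<^esub> = (\<lambda>_. 0)"
  by (simp_all add: exponent_group_def)

lemma group_exponent_group: "group exponent_group"
proof (rule groupI)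
  fix k show "\<exists>k'\<in>carrier exponent_group. k' \<otimes>\<^bsub>exponent_group\<^esub> k = \<one>\<^bsub>exponent_group\<^esub>"
    by (intro bexI[of _ "\<lambda>p. - k p"]) auto
qed (auto simp: add_ac)

definition unit_exponent :: "nat \<Rightarrow> nat \<Rightarrow> int \<Rightarrow> nat \<times> nat \<Rightarrow> int" where
  "unit_exponent r s n p = (if p = (r, s) then n else 0)"

definition central_int :: "(nat \<times> nat \<Rightarrow> int) \<Rightarrow> 'v \<times> ('v \<Rightarrow>\<^sub>L real) \<Rightarrow> 'v \<times> ('v \<Rightarrow>\<^sub>L real)" where
  "central_int k = central (\<lambda>p. of_int (k p))"

lemma central_int_restrictable: "central_int k \<in> restrictable"
  unfolding central_int_def central_def by (rule heis_zero_restrictable)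

lemma central_int_add: "central_int k \<circ> central_int k' = central_int (\<lambda>p. k p + k' p)"
  by (simp add: central_int_def central_add)

lemma central_int_eqD:
  assumes "central_int k = central_int k'" "p \<in> index_pairs \<nu>"
  shows "k p = k' p"
proof -
  obtain r s where p: "p = (r, s)" by fastforce
  have rs: "r \<in> {1..\<nu>}" "s \<in> {1..\<nu>}" "r < s" using assms(2) by (auto simp: p index_pairs_def)
  have "central_int (\<lambda>p. k p + - k' p) = central_int k \<circ> central_int (\<lambda>p. - k' p)"
    by (simp add: central_int_add)
  also have "\<dots> = central_int (\<lambda>p. k' p + - k' p)"
    unfolding assms(1) by (simp add: central_int_add)
  also have "\<dots> = id" by (simp add: central_int_def)
  finally have "heis (\<lambda>_. 0) (alternating (\<lambda>p. of_int (k p + - k' p))) u = u" for u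
    unfolding central_int_def central_def by simp
  then have "alternating (\<lambda>p. of_int (k p + - k' p)) r s = 0" using heis_matrix_zero rs by blast
  then show ?thesis using rs by (simp add: alternating_def p)
qed

lemma central_int_cong: "(\<And>p. p \<in> index_pairs \<nu> \<Longrightarrow> k p = k' p) \<Longrightarrow> central_int k = central_int k'"
  unfolding central_int_def by (rule central_cong) simp

lemma T_map_eq: "r \<in> {1..\<nu>} \<Longrightarrow> s \<in> {1..\<nu>} \<Longrightarrow> r < s \<Longrightarrow>
    T_map b (\<sigma> r) (\<sigma> s) = central_int (unit_exponent r s 1)"
proof
  fix u :: "'v \<times> ('v \<Rightarrow>\<^sub>L real)" assume rs: "r \<in> {1..\<nu>}" "s \<in> {1..\<nu>}" "r < s"
  let ?M = "alternating (\<lambda>p. of_int (unit_exponent r s 1 p))" and ?f = "snd u"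
  have M: "?M q q' = (if q = r \<and> q' = s then 1 else if q = s \<and> q' = r then - 1 else 0)" for q q'
    using rs(3) by (auto simp: alternating_def unit_exponent_def)
  have "(\<Sum>q'\<in>{1..\<nu>}. (?M q q' * ?f (\<sigma> q)) *\<^sub>R \<sigma> q') =
      (if q = r then ?f (\<sigma> r) *\<^sub>R \<sigma> s else if q = s then - ?f (\<sigma> s) *\<^sub>R \<sigma> r else 0)" for q
  proof -
    consider "q = r" | "q = s" | "q \<noteq> r" "q \<noteq> s" by blast
    then show ?thesis
    proof cases
      case 1
      then have "(\<Sum>q'\<in>{1..\<nu>}. (?M q q' * ?f (\<sigma> q)) *\<^sub>R \<sigma> q') = (\<Sum>q'\<in>{1..\<nu>}. if q' = s then ?f (\<sigma> r) *\<^sub>R \<sigma> s else 0)"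
        using rs by (intro sum.cong) (auto simp: M)
      then show ?thesis using 1 rs by simp
    next
      case 2
      then have "(\<Sum>q'\<in>{1..\<nu>}. (?M q q' * ?f (\<sigma> q)) *\<^sub>R \<sigma> q') = (\<Sum>q'\<in>{1..\<nu>}. if q' = r then - ?f (\<sigma> s) *\<^sub>R \<sigma> r else 0)"
        using rs by (intro sum.cong) (auto simp: M)
      then show ?thesis using 2 rs by simp
    next
      case 3
      then show ?thesis by (simp add: M)
    qed
  qed
  then have "(\<Sum>q\<in>{1..\<nu>}. \<Sum>q'\<in>{1..\<nu>}. (?M q q' * ?f (\<sigma> q)) *\<^sub>R \<sigma> q') =
      (\<Sum>q\<in>{1..\<nu>}. (if q = r then ?f (\<sigma> r) *\<^sub>R \<sigma> s else 0) + (if q = s then - ?f (\<sigma> s) *\<^sub>R \<sigma> r else 0))"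
    using rs(3) by (intro sum.cong) auto
  also have "\<dots> = ?f (\<sigma> r) *\<^sub>R \<sigma> s - ?f (\<sigma> s) *\<^sub>R \<sigma> r"
    using rs by (simp add: sum.distrib)
  finally show "T_map b (\<sigma> r) (\<sigma> s) u = central_int (unit_exponent r s 1) u"
    using rs by (simp add: T_map_def ext_form_def central_int_def central_def heis_def prod_eq_iff)
qed

definition c_power :: "(nat \<times> nat \<Rightarrow> int) \<Rightarrow> 'v \<times> ('v \<Rightarrow>\<^sub>L real) \<Rightarrow> 'v \<times> ('v \<Rightarrow>\<^sub>L real)" where
  "c_power k = to_Ext (central_int k)"

lemma c_elem_eq: "(r, s) \<in> index_pairs \<nu> \<Longrightarrow> c_elem b Vd \<sigma> r s = c_power (unit_exponent r s 1)"
  using T_map_eq[of r s] by (simp add: c_elem_def c_power_def to_Ext_def index_pairs_def)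

lemma c_power_eq_iff: "c_power k = c_power k' \<longleftrightarrow> (\<forall>p\<in>index_pairs \<nu>. k p = k' p)"
proof
  assume "c_power k = c_power k'"
  then have "central_int k = central_int k'"
    using inj_onD[OF to_Ext_inj _ central_int_restrictable central_int_restrictable]
    by (simp add: c_power_def)
  then show "\<forall>p\<in>index_pairs \<nu>. k p = k' p" using central_int_eqD by blast
qed (auto simp: c_power_def intro!: arg_cong[where f=to_Ext] central_int_cong)

lemma c_power_mult: "c_power k \<otimes>\<^bsub>GL Ext\<^esub> c_power k' = c_power (\<lambda>p. k p + k' p)"
proof -
  interpret h: group_hom "Sym\<lparr>carrier := restrictable\<rparr>" "GL Ext" to_Ext by (rule to_Ext_hom)
  show ?thesis
    using h.hom_mult[of "central_int k" "central_int k'"] central_int_restrictable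
    by (simp add: c_power_def central_int_add)
qed

lemma c_power_zero: "c_power (\<lambda>_. 0) = \<one>\<^bsub>GL Ext\<^esub>"
proof -
  interpret h: group_hom "Sym\<lparr>carrier := restrictable\<rparr>" "GL Ext" to_Ext by (rule to_Ext_hom)
  show ?thesis using h.hom_one by (simp add: c_power_def central_int_def)
qed

lemma c_power_closed: "c_power k \<in> carrier (GL Ext)"
  unfolding c_power_def by (rule to_Ext_closed[OF central_int_restrictable])

lemma c_power_hom: "group_hom exponent_group (GL Ext) c_power"
  by (intro group_hom.intro group_hom_axioms.intro group_exponent_group group_GL_Ext homI)
    (auto simp: c_power_mult c_power_closed)

lemma unit_exponent_generate:
  "\<exists>k'\<in>generate exponent_group ((\<lambda>(r, s). unit_exponent r s 1) ` index_pairs \<nu>). \<forall>p\<in>index_pairs \<nu>. k' p = k p"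
proof -
  interpret E: group exponent_group by (rule group_exponent_group)
  let ?G = "generate exponent_group ((\<lambda>(r, s). unit_exponent r s 1) ` index_pairs \<nu>)"
  have sub: "subgroup ?G exponent_group" by (rule E.generate_is_subgroup) simp
  have unit: "unit_exponent r s n \<in> ?G" if "(r, s) \<in> index_pairs \<nu>" for r s n
  proof -
    have "unit_exponent r s 1 \<in> ?G" using that by (force intro: generate.incl)
    moreover have "unit_exponent r s 1 [^]\<^bsub>exponent_group\<^esub> n = unit_exponent r s n"
      by (rule E.int_pow_one_parameter) (auto simp: unit_exponent_def)
    ultimately show ?thesis using E.subgroup_int_pow_closed[OF sub] by metis
  qed
  have "\<exists>k'\<in>?G. \<forall>p. k' p = (if p \<in> Q then k p else 0)" if "finite Q" "Q \<subseteq> index_pairs \<nu>" for Q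
    using that
  proof (induction Q rule: finite_induct)
    case empty
    then show ?case using subgroup.one_closed[OF sub] by auto
  next
    case (insert q Q)
    then obtain k' where k': "k' \<in> ?G" "\<forall>p. k' p = (if p \<in> Q then k p else 0)" by auto
    obtain r s where q: "q = (r, s)" by fastforce
    then have "unit_exponent r s (k q) \<in> ?G" using unit insert.prems by auto
    then have "(\<lambda>p. k' p + unit_exponent r s (k q) p) \<in> ?G"
      using subgroup.m_closed[OF sub k'(1)] by fastforce
    then show ?case
      by (rule bexI[rotated]) (use insert.hyps k'(2) q in \<open>auto simp: unit_exponent_def\<close>)
  qed
  from this[OF finite_index_pairs subset_refl] obtain k'
    where k': "k' \<in> ?G" "\<forall>p. k' p = (if p \<in> index_pairs \<nu> then k p else 0)" by (rule bexE)
  have "k' p = k p" if "p \<in> index_pairs \<nu>" for p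
    using spec[OF k'(2), of p] that by (simp only: if_True)
  then show ?thesis using k'(1) by blast
qed

abbreviation "C \<equiv> C_group b Vd \<sigma>"

end

locale ears_frame_nullity = ears_frame b Vd \<Phi> l \<alpha> \<sigma> \<nu>
  for b :: "'v::euclidean_space \<Rightarrow> 'v \<Rightarrow> real" and Vd \<Phi> and l and \<alpha> and \<sigma> and \<nu> +
  assumes nullity: "nullity b = \<nu>"
begin

lemma carrier_C: "carrier C = range c_power"
proof -
  interpret h: group_hom exponent_group "GL Ext" c_power by (rule c_power_hom)
  have "(\<lambda>(r, s). c_elem b Vd \<sigma> r s) ` index_pairs \<nu> = c_power ` (\<lambda>(r, s). unit_exponent r s 1) ` index_pairs \<nu>"
    unfolding image_image by (rule image_cong) (auto simp: c_elem_eq)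
  moreover have "\<dots> \<subseteq> carrier (GL Ext)" using c_power_closed by auto
  ultimately have "carrier C = c_power ` generate exponent_group ((\<lambda>(r, s). unit_exponent r s 1) ` index_pairs \<nu>)"
    unfolding C_group_def nullity by (simp add: carrier_subgroup_generated Int_absorb1 h.generate_img)
  moreover have "c_power k \<in> c_power ` generate exponent_group ((\<lambda>(r, s). unit_exponent r s 1) ` index_pairs \<nu>)" for k
  proof -
    obtain k' where k': "k' \<in> generate exponent_group ((\<lambda>(r, s). unit_exponent r s 1) ` index_pairs \<nu>)"
      "\<forall>p\<in>index_pairs \<nu>. k' p = k p"
      using unit_exponent_generate[of k] by (rule bexE)
    have "c_power k = c_power k'" unfolding c_power_eq_iff using k'(2) by simp
    then show ?thesis using k'(1) by (rule image_eqI)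
  qed
  ultimately show ?thesis by auto
qed

lemma C_mult: "c_power k \<otimes>\<^bsub>C\<^esub> c_power k' = c_power (\<lambda>p. k p + k' p)"
  by (simp add: C_group_def c_power_mult)

lemma C_one: "\<one>\<^bsub>C\<^esub> = c_power (\<lambda>_. 0)"
  by (simp add: C_group_def c_power_zero)

lemma comm_group_C: "comm_group C"
proof -
  interpret group C
    unfolding C_group_def by (rule group.group_subgroup_generated[OF group_GL_Ext])
  show ?thesis by unfold_locales (auto simp: carrier_C C_mult add.commute)
qed

lemma c_power_hom_C: "group_hom exponent_group C c_power"
proof -
  interpret C: comm_group C by (rule comm_group_C)
  show ?thesis
    by (intro group_hom.intro group_hom_axioms.intro group_exponent_group C.is_group homI)
      (auto simp: C_mult carrier_C)
qed

lemma generate_C: "generate C (c_power ` K) = c_power ` generate exponent_group K"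
proof -
  interpret h: group_hom exponent_group C c_power by (rule c_power_hom_C)
  show ?thesis by (rule h.generate_img) simp
qed

lemma c_elem_pow: "(r, s) \<in> index_pairs \<nu> \<Longrightarrow> c_elem b Vd \<sigma> r s [^]\<^bsub>C\<^esub> (n :: nat) = c_power (unit_exponent r s (int n))"
proof (induction n)
  interpret C: comm_group C by (rule comm_group_C)
  case 0
  have "unit_exponent r s 0 = (\<lambda>_. 0)" by (auto simp: unit_exponent_def)
  then show ?case by (simp add: C_one)
next
  interpret C: comm_group C by (rule comm_group_C)
  case (Suc n)
  have "(\<lambda>p. unit_exponent r s (int n) p + unit_exponent r s 1 p) = unit_exponent r s (int (Suc n))"
    by (auto simp: unit_exponent_def)
  then show ?case using Suc by (simp add: c_elem_eq C_mult)
qed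

lemma finprod_c_elem:
  assumes "finite Q" "Q \<subseteq> index_pairs \<nu>"
  shows "finprod C (\<lambda>(r, s). c_elem b Vd \<sigma> r s) Q = c_power (\<lambda>p. if p \<in> Q then 1 else 0)"
  using assms
proof (induction Q rule: finite_induct)
  interpret C: comm_group C by (rule comm_group_C)
  case empty
  then show ?case by (simp add: C_one)
next
  interpret C: comm_group C by (rule comm_group_C)
  case (insert q Q)
  obtain r s where q: "q = (r, s)" by fastforce
  have "(\<lambda>(r, s). c_elem b Vd \<sigma> r s) \<in> insert q Q \<rightarrow> carrier C"
  proof
    fix q' assume "q' \<in> insert q Q"
    then have "q' \<in> index_pairs \<nu>" using insert.prems by auto
    then show "(case q' of (r, s) \<Rightarrow> c_elem b Vd \<sigma> r s) \<in> carrier C"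
      by (cases q') (simp add: c_elem_eq carrier_C)
  qed
  then have "finprod C (\<lambda>(r, s). c_elem b Vd \<sigma> r s) (insert q Q) =
      c_elem b Vd \<sigma> r s \<otimes>\<^bsub>C\<^esub> finprod C (\<lambda>(r, s). c_elem b Vd \<sigma> r s) Q"
    using insert.hyps q by (subst C.finprod_insert) (auto simp: Pi_iff)
  also have "\<dots> = c_power (\<lambda>p. unit_exponent r s 1 p + (if p \<in> Q then 1 else 0))"
    using insert q by (simp add: c_elem_eq C_mult)
  also have "(\<lambda>p. unit_exponent r s 1 p + (if p \<in> Q then 1 else 0)) = (\<lambda>p. if p \<in> insert q Q then 1 else 0)"
    using insert.hyps q by (auto simp: unit_exponent_def)
  finally show ?case .
qed

definition z_exponent :: "nat set set \<Rightarrow> nat set \<Rightarrow> nat \<times> nat \<Rightarrow> int" where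
  "z_exponent D J = (if J \<in> D then (\<lambda>(r, s). if r \<in> J \<and> s \<in> J \<and> r < s then 1 else 0)
     else if card J = 2 then unit_exponent (Min J) (Max J) 2 else (\<lambda>_. 0))"

lemma card_2_pair:
  assumes "card J = 2" "J \<subseteq> {1..\<nu>}"
  shows "(Min J, Max J) \<in> index_pairs \<nu>" "J = {Min J, Max J}"
proof -
  obtain r s where "J = {r, s}" "r \<noteq> s" using assms(1) by (auto simp: card_2_iff)
  then have *: "\<exists>r s. J = {r, s} \<and> r < s"
    by (metis insert_commute linorder_neqE_nat)
  then obtain r s where rs: "J = {r, s}" "r < s" by blast
  then have "Min J = r" "Max J = s" by auto
  then show "(Min J, Max J) \<in> index_pairs \<nu>" "J = {Min J, Max J}"
    using rs assms(2) by (auto simp: index_pairs_def)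
qed

lemma z_elem_eq:
  assumes "J \<subseteq> {1..\<nu>}"
  shows "z_elem b Vd S \<sigma> J = c_power (z_exponent (supp_class \<nu> \<sigma> S) J)"
proof -
  have sub: "{(r, s). r \<in> J \<and> s \<in> J \<and> r < s} \<subseteq> index_pairs \<nu>"
    using assms by (auto simp: index_pairs_def)
  have fin: "finite {(r, s). r \<in> J \<and> s \<in> J \<and> r < s}"
    by (rule finite_subset[OF sub]) simp
  have "(\<lambda>p. if p \<in> {(r, s). r \<in> J \<and> s \<in> J \<and> r < s} then 1 else (0 :: int)) =
      (\<lambda>(r, s). if r \<in> J \<and> s \<in> J \<and> r < s then 1 else 0)" by auto
  then show ?thesis
    using finprod_c_elem[OF fin sub] card_2_pair(1)[OF _ assms]
    by (auto simp: z_elem_def nullity z_exponent_def c_elem_pow C_one)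
qed

definition F_exponents :: "nat set set \<Rightarrow> (nat \<times> nat \<Rightarrow> int) set" where
  "F_exponents D = generate exponent_group (z_exponent D ` Pow {1..\<nu>})"

lemma F_group_eq: "F_group b Vd S \<sigma> = c_power ` F_exponents (supp_class \<nu> \<sigma> S)"
proof -
  have "z_elem b Vd S \<sigma> ` Pow {1..\<nu>} = c_power ` z_exponent (supp_class \<nu> \<sigma> S) ` Pow {1..\<nu>}"
    unfolding image_image by (rule image_cong) (auto simp: z_elem_eq)
  then show ?thesis by (simp add: F_group_def nullity F_exponents_def generate_C)
qed

lemma subgroup_F_exponents: "subgroup (F_exponents D) exponent_group"
  unfolding F_exponents_def by (rule group.generate_is_subgroup[OF group_exponent_group]) simp

lemma F_exponents_supported:
  assumes "k \<in> F_exponents D" "p \<notin> index_pairs \<nu>" shows "k p = 0"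
proof -
  interpret E: group exponent_group by (rule group_exponent_group)
  have sub: "subgroup {k. k p = 0} exponent_group"
  proof (rule E.subgroupI)
    fix k :: "nat \<times> nat \<Rightarrow> int" assume "k \<in> {k. k p = 0}"
    moreover have "inv\<^bsub>exponent_group\<^esub> k = (\<lambda>p. - k p)" by (rule E.inv_equality) auto
    ultimately show "inv\<^bsub>exponent_group\<^esub> k \<in> {k. k p = 0}" by simp
  qed auto
  have "z_exponent D J p = 0" if "J \<subseteq> {1..\<nu>}" for J
    using that assms(2) card_2_pair(1)[OF _ that]
    by (cases p) (auto simp: z_exponent_def unit_exponent_def index_pairs_def)
  then have "F_exponents D \<subseteq> {k. k p = 0}"
    unfolding F_exponents_def by (intro E.generate_subgroup_incl[OF _ sub]) auto
  then show ?thesis using assms(1) by auto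
qed

lemma c_power_in_F_group:
  assumes "(r, s) \<in> index_pairs \<nu>"
  shows "c_power (unit_exponent r s n) \<in> F_group b Vd S \<sigma> \<longleftrightarrow>
    unit_exponent r s n \<in> F_exponents (supp_class \<nu> \<sigma> S)"
proof
  assume "c_power (unit_exponent r s n) \<in> F_group b Vd S \<sigma>"
  then obtain k where k: "k \<in> F_exponents (supp_class \<nu> \<sigma> S)" "c_power (unit_exponent r s n) = c_power k"
    unfolding F_group_eq by auto
  have "unit_exponent r s n p = k p" for p
  proof (cases "p \<in> index_pairs \<nu>")
    case True
    then show ?thesis using k(2) by (simp add: c_power_eq_iff)
  next
    case False
    then show ?thesis using F_exponents_supported[OF k(1) False] assms by (auto simp: unit_exponent_def)
  qed
  then have "unit_exponent r s n = k" by auto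
  then show "unit_exponent r s n \<in> F_exponents (supp_class \<nu> \<sigma> S)" using k(1) by simp
qed (auto simp: F_group_eq)

lemma n_exp_eq:
  assumes rs: "(r, s) \<in> index_pairs \<nu>"
  shows "n_exp b Vd S \<sigma> r s = (LEAST n. 1 \<le> n \<and> unit_exponent r s (int n) \<in> F_exponents (supp_class \<nu> \<sigma> S))"
  unfolding n_exp_def by (simp add: c_elem_pow[OF rs] c_power_in_F_group[OF rs])

text \<open>\<open>c\<^sub>r\<^sub>s\<^sup>2\<close> always lies in \<open>F(S)\<close>: it is either \<open>z\<^sub>J\<close> or \<open>z\<^sub>J\<^sup>2\<close> for \<open>J = {r, s}\<close>.\<close>

lemma two_in_F_exponents:
  assumes rs: "(r, s) \<in> index_pairs \<nu>"
  shows "unit_exponent r s 2 \<in> F_exponents D" "{r, s} \<in> D \<Longrightarrow> unit_exponent r s 1 \<in> F_exponents D"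
proof -
  have lt: "r < s" and J: "{r, s} \<subseteq> {1..\<nu>}" using rs by (auto simp: index_pairs_def)
  have z: "z_exponent D {r, s} \<in> F_exponents D"
    unfolding F_exponents_def using J by (intro generate.incl) auto
  have "z_exponent D {r, s} = unit_exponent r s 1" if "{r, s} \<in> D"
    using that lt by (auto simp: z_exponent_def unit_exponent_def fun_eq_iff)
  then show 1: "unit_exponent r s 1 \<in> F_exponents D" if "{r, s} \<in> D" using that z by simp
  have "z_exponent D {r, s} = unit_exponent r s 2" if "{r, s} \<notin> D"
    using that lt by (auto simp: z_exponent_def)
  moreover have "(\<lambda>p. unit_exponent r s 1 p + unit_exponent r s 1 p) = unit_exponent r s 2"
    by (auto simp: unit_exponent_def)
  ultimately show "unit_exponent r s 2 \<in> F_exponents D"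
    using z 1 subgroup.m_closed[OF subgroup_F_exponents, of "unit_exponent r s 1" D "unit_exponent r s 1"]
    by (cases "{r, s} \<in> D") auto
qed

lemma n_exp_properties:
  assumes rs: "(r, s) \<in> index_pairs \<nu>"
  shows "n_exp b Vd S \<sigma> r s \<in> {1, 2}"
    and "unit_exponent r s (int (n_exp b Vd S \<sigma> r s)) \<in> F_exponents (supp_class \<nu> \<sigma> S)"
    and "n_exp b Vd S \<sigma> r s = 1 \<longleftrightarrow> unit_exponent r s 1 \<in> F_exponents (supp_class \<nu> \<sigma> S)"
proof -
  let ?P = "\<lambda>n::nat. 1 \<le> n \<and> unit_exponent r s (int n) \<in> F_exponents (supp_class \<nu> \<sigma> S)"
  have 2: "?P 2" using two_in_F_exponents(1)[OF rs] by simp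
  have L: "?P (Least ?P)" by (rule LeastI[of ?P, OF 2])
  have "Least ?P \<le> 2" by (rule Least_le[of ?P, OF 2])
  then show "n_exp b Vd S \<sigma> r s \<in> {1, 2}" unfolding n_exp_eq[OF rs] using L by auto
  show "unit_exponent r s (int (n_exp b Vd S \<sigma> r s)) \<in> F_exponents (supp_class \<nu> \<sigma> S)"
    unfolding n_exp_eq[OF rs] using L by blast
  show "n_exp b Vd S \<sigma> r s = 1 \<longleftrightarrow> unit_exponent r s 1 \<in> F_exponents (supp_class \<nu> \<sigma> S)"
  proof
    assume "n_exp b Vd S \<sigma> r s = 1"
    then show "unit_exponent r s 1 \<in> F_exponents (supp_class \<nu> \<sigma> S)"
      using L unfolding n_exp_eq[OF rs] by simp
  next
    assume "unit_exponent r s 1 \<in> F_exponents (supp_class \<nu> \<sigma> S)"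
    then have "Least ?P \<le> 1" by (intro Least_le) simp
    then show "n_exp b Vd S \<sigma> r s = 1" unfolding n_exp_eq[OF rs] using L by auto
  qed
qed

lemma star_condition_eq:
  "star_condition b Vd S \<sigma> \<longleftrightarrow> c_power ` F_exponents (supp_class \<nu> \<sigma> S) =
    c_power ` generate exponent_group ((\<lambda>(r, s). unit_exponent r s (int (n_exp b Vd S \<sigma> r s))) ` index_pairs \<nu>)"
proof -
  have "(\<lambda>(r, s). c_elem b Vd \<sigma> r s [^]\<^bsub>C\<^esub> n_exp b Vd S \<sigma> r s) ` index_pairs \<nu> =
      c_power ` (\<lambda>(r, s). unit_exponent r s (int (n_exp b Vd S \<sigma> r s))) ` index_pairs \<nu>"
    unfolding image_image by (rule image_cong) (auto simp: c_elem_pow)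
  then show ?thesis by (simp add: star_condition_def nullity F_group_eq generate_C)
qed

text \<open>If no \<open>J \<in> supp S\<close> with three elements or more contains a pair outside \<open>supp S\<close>, then every
  \<open>z\<^sub>J\<close> is a product of the elements \<open>z\<^sub>r\<^sub>s\<close>, so that \<open>F(S)\<close> is generated by powers of the \<open>c\<^sub>r\<^sub>s\<close>.\<close>

lemma star_condition_if_pairs:
  assumes D: "\<And>J r s. J \<in> supp_class \<nu> \<sigma> S \<Longrightarrow> r \<in> J \<Longrightarrow> s \<in> J \<Longrightarrow> r < s \<Longrightarrow> {r, s} \<in> supp_class \<nu> \<sigma> S"
  shows "star_condition b Vd S \<sigma>"
    and "(r, s) \<in> index_pairs \<nu> \<Longrightarrow> n_exp b Vd S \<sigma> r s = (if {r, s} \<in> supp_class \<nu> \<sigma> S then 1 else 2)"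
proof -
  interpret E: group exponent_group by (rule group_exponent_group)
  let ?D = "supp_class \<nu> \<sigma> S"
  have even_sub: "subgroup {k. even (k p)} exponent_group" for p :: "nat \<times> nat"
  proof (rule E.subgroupI)
    fix k :: "nat \<times> nat \<Rightarrow> int" assume "k \<in> {k. even (k p)}"
    moreover have "inv\<^bsub>exponent_group\<^esub> k = (\<lambda>p. - k p)" by (rule E.inv_equality) auto
    ultimately show "inv\<^bsub>exponent_group\<^esub> k \<in> {k. even (k p)}" by simp
  next
    have "(\<lambda>_. 0) \<in> {k :: nat \<times> nat \<Rightarrow> int. even (k p)}" by simp
    then show "{k :: nat \<times> nat \<Rightarrow> int. even (k p)} \<noteq> {}" by blast
  qed auto
  have n: "n_exp b Vd S \<sigma> r s = (if {r, s} \<in> ?D then 1 else 2)" if rs: "(r, s) \<in> index_pairs \<nu>" for r s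
  proof (cases "{r, s} \<in> ?D")
    case True
    then show ?thesis using n_exp_properties(3)[OF rs] two_in_F_exponents(2)[OF rs True] by simp
  next
    case False
    have lt: "r < s" using rs by (simp add: index_pairs_def)
    have "even (z_exponent ?D J (r, s))" for J
      using D[of J r s] False lt by (auto simp: z_exponent_def unit_exponent_def)
    then have "F_exponents ?D \<subseteq> {k. even (k (r, s))}"
      unfolding F_exponents_def by (intro E.generate_subgroup_incl[OF _ even_sub]) auto
    moreover have "unit_exponent r s 1 \<notin> {k. even (k (r, s))}" by (simp add: unit_exponent_def)
    ultimately have "n_exp b Vd S \<sigma> r s \<noteq> 1" using n_exp_properties(3)[OF rs] by blast
    then show ?thesis using n_exp_properties(1)[OF rs, of S] False by simp
  qed
  then show "(r, s) \<in> index_pairs \<nu> \<Longrightarrow> n_exp b Vd S \<sigma> r s = (if {r, s} \<in> ?D then 1 else 2)" .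
  let ?u = "\<lambda>(r, s). unit_exponent r s (int (n_exp b Vd S \<sigma> r s))"
  let ?G = "generate exponent_group (?u ` index_pairs \<nu>)"
  have subG: "subgroup ?G exponent_group" by (rule E.generate_is_subgroup) simp
  have unit: "unit_exponent r s (int (n_exp b Vd S \<sigma> r s)) \<in> ?G" if "(r, s) \<in> index_pairs \<nu>" for r s
    using that by (force intro: generate.incl)
  have "z_exponent ?D J \<in> ?G" if J: "J \<subseteq> {1..\<nu>}" for J
  proof (cases "J \<in> ?D")
    case True
    have sums: "(\<lambda>p. if p \<in> Q then 1 else 0) \<in> ?G"
      if "finite Q" "Q \<subseteq> {(r, s). r \<in> J \<and> s \<in> J \<and> r < s}" for Q
      using that
    proof (induction Q rule: finite_induct)
      case empty
      then show ?case using subgroup.one_closed[OF subG] by simp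
    next
      case (insert q Q)
      obtain r s where q: "q = (r, s)" by fastforce
      then have rs: "r \<in> J" "s \<in> J" "r < s" using insert.prems by auto
      have p: "(r, s) \<in> index_pairs \<nu>" using rs J by (auto simp: index_pairs_def)
      have "unit_exponent r s 1 \<in> ?G" using unit[OF p] n[OF p] D[OF True rs] by simp
      moreover have "(\<lambda>p. if p \<in> Q then 1 else 0) \<in> ?G" using insert by auto
      ultimately have "(\<lambda>p. unit_exponent r s 1 p + (if p \<in> Q then 1 else 0)) \<in> ?G"
        using subgroup.m_closed[OF subG] by fastforce
      also have "(\<lambda>p. unit_exponent r s 1 p + (if p \<in> Q then 1 else 0)) = (\<lambda>p. if p \<in> insert q Q then 1 else 0)"
        using insert.hyps q by (auto simp: unit_exponent_def)
      finally show ?case .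
    qed
    have fin: "finite {(r, s). r \<in> J \<and> s \<in> J \<and> r < s}"
      by (rule finite_subset[of _ "{1..\<nu>} \<times> {1..\<nu>}"]) (use J in auto)
    have "z_exponent ?D J = (\<lambda>p. if p \<in> {(r, s). r \<in> J \<and> s \<in> J \<and> r < s} then 1 else 0)"
      using True by (auto simp: z_exponent_def)
    then show ?thesis using sums[OF fin subset_refl] by (simp only:)
  next
    case False
    show ?thesis
    proof (cases "card J = 2")
      case True
      note pair = card_2_pair[OF True J]
      have "n_exp b Vd S \<sigma> (Min J) (Max J) = 2" using n[OF pair(1)] pair(2) False by simp
      then show ?thesis using unit[OF pair(1)] True False by (simp add: z_exponent_def)
    next
      case not2: False
      then show ?thesis using False subgroup.one_closed[OF subG] by (simp add: z_exponent_def)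
    qed
  qed
  then have "F_exponents ?D \<subseteq> ?G"
    unfolding F_exponents_def by (intro E.generate_subgroup_incl[OF _ subG]) auto
  moreover have "?G \<subseteq> F_exponents ?D"
    by (intro E.generate_subgroup_incl[OF _ subgroup_F_exponents]) (use n_exp_properties(2) in auto)
  ultimately show "star_condition b Vd S \<sigma>" unfolding star_condition_eq by auto
qed

end

section \<open>Generation of the Weyl group\<close>

locale simply_laced_frame = ears_frame_nullity b Vd \<Phi> l \<alpha> \<sigma> \<nu>
  for b :: "'v::euclidean_space \<Rightarrow> 'v \<Rightarrow> real" and Vd \<Phi> and l and \<alpha> and \<sigma> and \<nu> +
  fixes S R :: "'v set"
  assumes S_radical: "s \<in> S \<Longrightarrow> b s v = 0"
    and zero_S: "0 \<in> S"
    and S_shift: "s \<in> S \<Longrightarrow> t \<in> S \<Longrightarrow> s + 2 *\<^sub>R t \<in> S" "s \<in> S \<Longrightarrow> t \<in> S \<Longrightarrow> s - 2 *\<^sub>R t \<in> S"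
    and sigma_S: "r \<in> {1..\<nu>} \<Longrightarrow> \<sigma> r \<in> S"
    and S_int: "s \<in> S \<Longrightarrow> \<exists>k :: nat \<Rightarrow> int. s = (\<Sum>r\<in>{1..\<nu>}. of_int (k r) *\<^sub>R \<sigma> r)"
    and rank_pos: "1 \<le> l"
    and nonisotropic_R: "nonisotropic b R = {\<beta> + s | \<beta> s. \<beta> \<in> \<Phi> \<and> \<beta> \<noteq> 0 \<and> s \<in> S}"
begin

definition lattice_point :: "(nat \<Rightarrow> int) \<Rightarrow> 'v" where
  "lattice_point k = (\<Sum>r\<in>{1..\<nu>}. of_int (k r) *\<^sub>R \<sigma> r)"

lemma lattice_point_eq_iff: "lattice_point k = lattice_point k' \<longleftrightarrow> (\<forall>r\<in>{1..\<nu>}. k r = k' r)"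
proof
  assume "lattice_point k = lattice_point k'"
  then have "(\<Sum>r\<in>{1..\<nu>}. (of_int (k r) - of_int (k' r)) *\<^sub>R \<sigma> r) = 0"
    by (simp add: lattice_point_def scaleR_diff_left sum_subtractf)
  then have "real_of_int (k r) - of_int (k' r) = 0" if "r \<in> {1..\<nu>}" for r
    using independent_radical[of "\<lambda>r. of_int (k r) - of_int (k' r)" r] that by blast
  then show "\<forall>r\<in>{1..\<nu>}. k r = k' r" by simp
qed (simp add: lattice_point_def)

lemma supp_lattice_point: "supp \<nu> \<sigma> (lattice_point k) = {r \<in> {1..\<nu>}. odd (k r)}"
proof -
  have "(\<exists>k'. lattice_point k = lattice_point k' \<and> odd (k' r)) \<longleftrightarrow> odd (k r)" if "r \<in> {1..\<nu>}" for r
    using that by (auto simp: lattice_point_eq_iff)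
  then show ?thesis unfolding supp_def lattice_point_def[symmetric] by auto
qed

lemma S_even_shift:
  assumes "s \<in> S" shows "s + lattice_point (\<lambda>r. 2 * k r) \<in> S"
proof -
  have one: "s + of_int (2 * n) *\<^sub>R \<sigma> r \<in> S" if "s \<in> S" "r \<in> {1..\<nu>}" for s n r
  proof (induction n rule: int_induct[where k=0])
    case base
    then show ?case using that by simp
  next
    case (step1 i)
    then show ?case using S_shift(1)[OF step1(2) sigma_S[OF that(2)]] by (simp add: algebra_simps)
  next
    case (step2 i)
    then show ?case using S_shift(2)[OF step2(2) sigma_S[OF that(2)]] by (simp add: algebra_simps)
  qed
  have "s + (\<Sum>r\<in>Q. of_int (2 * k r) *\<^sub>R \<sigma> r) \<in> S" if "finite Q" "Q \<subseteq> {1..\<nu>}" for Q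
    using that
  proof (induction Q rule: finite_induct)
    case empty
    then show ?case using assms by simp
  next
    case (insert q Q)
    then have "s + (\<Sum>r\<in>Q. of_int (2 * k r) *\<^sub>R \<sigma> r) + of_int (2 * k q) *\<^sub>R \<sigma> q \<in> S"
      by (intro one) auto
    then show ?case using insert.hyps by (simp add: add_ac)
  qed
  then show ?thesis unfolding lattice_point_def by blast
qed

abbreviation "D \<equiv> supp_class \<nu> \<sigma> S"

lemma lattice_point_in_S_iff: "lattice_point k \<in> S \<longleftrightarrow> {r \<in> {1..\<nu>}. odd (k r)} \<in> D"
proof
  assume "lattice_point k \<in> S"
  then show "{r \<in> {1..\<nu>}. odd (k r)} \<in> D"
    unfolding supp_class_def supp_lattice_point[symmetric] by (rule imageI)
next
  assume "{r \<in> {1..\<nu>}. odd (k r)} \<in> D"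
  then obtain s where s: "s \<in> S" "supp \<nu> \<sigma> s = {r \<in> {1..\<nu>}. odd (k r)}" by (auto simp: supp_class_def)
  obtain k' where k': "s = lattice_point k'" using S_int[OF s(1)] by (auto simp: lattice_point_def)
  have even: "even (k r - k' r)" if "r \<in> {1..\<nu>}" for r
    using s(2) that unfolding k' supp_lattice_point by auto
  have "lattice_point k' + lattice_point (\<lambda>r. 2 * ((k r - k' r) div 2)) =
      lattice_point (\<lambda>r. k' r + 2 * ((k r - k' r) div 2))"
    by (simp add: lattice_point_def scaleR_add_left sum.distrib)
  also have "\<dots> = lattice_point k" unfolding lattice_point_eq_iff using even by simp
  finally show "lattice_point k \<in> S" using S_even_shift[OF s(1), of "\<lambda>r. (k r - k' r) div 2"] k' by simp
qed

lemma D_subset: "J \<in> D \<Longrightarrow> J \<subseteq> {1..\<nu>}"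
  by (auto simp: supp_class_def supp_def)

lemma in_D_iff: "J \<subseteq> {1..\<nu>} \<Longrightarrow> J \<in> D \<longleftrightarrow> (\<Sum>r\<in>J. \<sigma> r) \<in> S"
proof -
  assume J: "J \<subseteq> {1..\<nu>}"
  have "lattice_point (\<lambda>r. if r \<in> J then 1 else 0) = (\<Sum>r\<in>{1..\<nu>} \<inter> J. \<sigma> r)"
    by (simp add: lattice_point_def if_distrib[of of_int] if_distrib[of "\<lambda>t. t *\<^sub>R _"] sum.inter_restrict cong: if_cong)
  moreover have "{1..\<nu>} \<inter> J = J" "{r \<in> {1..\<nu>}. odd (if r \<in> J then 1 else 0 :: int)} = J" using J by auto
  ultimately show ?thesis using lattice_point_in_S_iff[of "\<lambda>r. if r \<in> J then 1 else 0"] by simp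
qed

lemma shifted_root_norm: "\<beta> \<in> \<Phi> \<Longrightarrow> \<beta> \<noteq> 0 \<Longrightarrow> s \<in> S \<Longrightarrow> b (\<beta> + s) (\<beta> + s) = 2"
  using root_norm S_radical form_sym[of \<beta> s] by (simp add: form_simps)

lemma nonisotropic_norm: "\<gamma> \<in> nonisotropic b R \<Longrightarrow> b \<gamma> \<gamma> = 2"
  using shifted_root_norm unfolding nonisotropic_R by auto

abbreviation "weyl_full \<equiv> generate Sym (refl_map b ` nonisotropic b R)"

lemma weyl_full_subgroup: "subgroup weyl_full Sym"
  by (rule group.generate_is_subgroup[OF group_bijection_group]) (auto simp: bij_refl_map nonisotropic_norm)

lemma refl_map_in_weyl_full: "i \<in> {1..l} \<Longrightarrow> s \<in> S \<Longrightarrow> refl_map b (\<alpha> i + s) \<in> weyl_full"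
  using simple_root simple_nonzero by (intro generate.incl imageI) (auto simp: nonisotropic_R)

lemma translation_refl_map:
  assumes "i \<in> {1..l}"
  shows "refl_map b (\<alpha> i + lattice_point t) \<circ> refl_map b (\<alpha> i) = translation (\<alpha> i) (\<lambda>r. of_int (t r))"
  unfolding lattice_point_def by (rule refl_map_shifted[OF simple_norm[OF assms]])

lemma translation_in_weyl_full:
  assumes "i \<in> {1..l}" "lattice_point t \<in> S"
  shows "translation (\<alpha> i) (\<lambda>r. of_int (t r)) \<in> weyl_full"
  using subgroup.m_closed[OF weyl_full_subgroup refl_map_in_weyl_full[OF assms]
      refl_map_in_weyl_full[OF assms(1) zero_S]]
  by (simp add: translation_refl_map[OF assms(1)])

text \<open>Multiplying the translations along the \<open>\<sigma>\<^sub>r\<close> one after the other gives the translation along their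
  sum only up to the central element with the exponents \<open>t\<^sub>r t\<^sub>s\<close>. For \<open>t = 1\<^sub>J\<close> this is \<open>z\<^sub>J\<close>, and in
  general it is congruent to \<open>z\<^sub>J\<close> modulo 2, where \<open>J\<close> is the set of indices with \<open>t\<^sub>r\<close> odd.\<close>

lemma central_int_zero [simp]: "central_int (\<lambda>_. 0) = id"
  by (simp add: central_int_def)

lemma translation_product:
  assumes H: "subgroup H Sym" and i: "i \<in> {1..l}"
    and steps: "\<And>r. r \<in> {1..\<nu>} \<Longrightarrow> translation (\<alpha> i) (\<lambda>q. if q = r then of_int (t r) else 0) \<in> H"
  shows "translation (\<alpha> i) (\<lambda>r. of_int (t r)) \<circ> central_int (\<lambda>(r, s). t r * t s) \<in> H"
proof -
  have "translation (\<alpha> i) (\<lambda>r. if r \<le> p then of_int (t r) else 0) \<circ>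
      central_int (\<lambda>(r, s). if s \<le> p then t r * t s else 0) \<in> H" if "p \<le> \<nu>" for p
    using that
  proof (induction p)
    case 0
    have "translation (\<alpha> i) (\<lambda>r. if r \<le> 0 then of_int (t r) else 0) = id"
      using translation_cong[of "\<lambda>r. if r \<le> 0 then of_int (t r) else 0" "\<lambda>_. 0" "\<alpha> i"] by simp
    moreover have "central_int (\<lambda>(r, s). if s \<le> 0 then t r * t s else 0) = central_int (\<lambda>_. 0)"
      by (rule central_int_cong) (auto simp: index_pairs_def)
    ultimately show ?case
      using subgroup.one_closed[OF H] by (simp only: central_int_zero o_id bijection_group_simps)
  next
    case (Suc p)
    let ?T = "translation (\<alpha> i) (\<lambda>r. if r \<le> p then of_int (t r) else 0)"
    let ?T' = "translation (\<alpha> i) (\<lambda>q. if q = Suc p then of_int (t (Suc p)) else 0)"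
    let ?C = "central_int (\<lambda>(r, s). if s \<le> p then t r * t s else 0)"
    have "?T \<circ> ?C \<circ> ?T' \<in> H"
      using subgroup.m_closed[OF H Suc.IH steps[of "Suc p"]] Suc.prems
      by (simp only: bijection_group_simps atLeastAtMost_iff) simp
    also have "?T \<circ> ?C \<circ> ?T' = (?T \<circ> ?T') \<circ> ?C"
      by (simp add: comp_assoc central_int_def translation_def central_commute)
    also have "?T \<circ> ?T' = translation (\<alpha> i) (\<lambda>r. if r \<le> Suc p then of_int (t r) else 0) \<circ>
        central_int (\<lambda>(r, s). if s = Suc p then t r * t s else 0)"
      unfolding translation_add[OF simple_norm[OF i]] central_int_def
      by (intro arg_cong2[where f="(\<circ>)"] translation_cong central_cong) (auto simp: index_pairs_def)
    also have "\<dots> \<circ> ?C = translation (\<alpha> i) (\<lambda>r. if r \<le> Suc p then of_int (t r) else 0) \<circ>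
        central_int (\<lambda>(r, s). if s \<le> Suc p then t r * t s else 0)"
      unfolding comp_assoc central_int_add
      by (intro arg_cong2[where f="(\<circ>)"] central_int_cong) auto
    finally show ?case .
  qed
  from this[of \<nu>] have "translation (\<alpha> i) (\<lambda>r. if r \<le> \<nu> then of_int (t r) else 0) \<circ>
      central_int (\<lambda>(r, s). if s \<le> \<nu> then t r * t s else 0) \<in> H" by simp
  also have "translation (\<alpha> i) (\<lambda>r. if r \<le> \<nu> then of_int (t r) else 0) = translation (\<alpha> i) (\<lambda>r. of_int (t r))"
    by (rule translation_cong) simp
  also have "central_int (\<lambda>(r, s). if s \<le> \<nu> then t r * t s else 0) = central_int (\<lambda>(r, s). t r * t s)"
    by (rule central_int_cong) (auto simp: index_pairs_def)
  finally show ?thesis .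
qed

lemma subgroup_left_factor:
  assumes H: "subgroup H Sym" and fg: "f \<circ> g \<in> H" "f \<in> H" and g: "bij g"
  shows "g \<in> H"
proof -
  interpret Sym: group Sym by (rule group_bijection_group)
  have f: "f \<in> carrier Sym" using fg(2) subgroup.mem_carrier[OF H] by blast
  have "inv\<^bsub>Sym\<^esub> f \<otimes>\<^bsub>Sym\<^esub> (f \<otimes>\<^bsub>Sym\<^esub> g) \<in> H"
    using subgroup.m_closed[OF H subgroup.m_inv_closed[OF H fg(2)]] fg(1) by simp
  moreover have "inv\<^bsub>Sym\<^esub> f \<otimes>\<^bsub>Sym\<^esub> (f \<otimes>\<^bsub>Sym\<^esub> g) = g"
    using Sym.m_assoc[of "inv\<^bsub>Sym\<^esub> f" f g] Sym.l_inv[OF f] Sym.inv_closed[OF f] f g by simp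
  ultimately show ?thesis by simp
qed

lemma central_int_hom: "group_hom exponent_group Sym central_int"
  by (intro group_hom.intro group_hom_axioms.intro group_exponent_group group_bijection_group homI)
    (auto simp: central_int_def central_add)

lemma central_int_bij [simp]: "bij (central_int k)"
  by (simp add: central_int_def)

lemma z_exponent_in_weyl_full:
  assumes J: "J \<subseteq> {1..\<nu>}"
  shows "central_int (z_exponent D J) \<in> weyl_full"
proof -
  have one: "1 \<in> {1..l}" using rank_pos by simp
  have unit: "translation (\<alpha> 1) (\<lambda>q. if q = r then 1 else 0) \<in> weyl_full" if "r \<in> {1..\<nu>}" for r
  proof -
    have "lattice_point (\<lambda>q. if q = r then 1 else 0) = \<sigma> r"
      using that by (simp add: lattice_point_def if_distrib[of of_int] if_distrib[of "\<lambda>t. t *\<^sub>R _"] cong: if_cong)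
    then show ?thesis
      using translation_in_weyl_full[OF one, of "\<lambda>q. if q = r then 1 else 0"] sigma_S[OF that]
      by (simp add: if_distrib[of of_int] cong: if_cong)
  qed
  consider "J \<in> D" | "J \<notin> D" "card J = 2" | "J \<notin> D" "card J \<noteq> 2" by blast
  then show ?thesis
  proof cases
    case 1
    let ?t = "\<lambda>r. if r \<in> J then 1 else 0 :: int"
    have "translation (\<alpha> 1) (\<lambda>q. if q = r then of_int (?t r) else 0) \<in> weyl_full" if "r \<in> {1..\<nu>}" for r
    proof (cases "r \<in> J")
      case True
      then show ?thesis using unit[OF that] by (simp cong: if_cong)
    next
      case False
      then show ?thesis using subgroup.one_closed[OF weyl_full_subgroup] by (simp cong: if_cong)
    qed
    from translation_product[OF weyl_full_subgroup one this]
    have "translation (\<alpha> 1) (\<lambda>r. of_int (?t r)) \<circ> central_int (\<lambda>(r, s). ?t r * ?t s) \<in> weyl_full" .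
    moreover have "{r \<in> {1..\<nu>}. odd (?t r)} = J" using J by auto
    then have "translation (\<alpha> 1) (\<lambda>r. of_int (?t r)) \<in> weyl_full"
      using 1 lattice_point_in_S_iff[of ?t] by (intro translation_in_weyl_full one) simp
    ultimately have "central_int (\<lambda>(r, s). ?t r * ?t s) \<in> weyl_full"
      by (rule subgroup_left_factor[OF weyl_full_subgroup _ _ central_int_bij])
    moreover have "central_int (\<lambda>(r, s). ?t r * ?t s) = central_int (z_exponent D J)"
      using 1 by (intro central_int_cong) (auto simp: z_exponent_def index_pairs_def)
    ultimately show ?thesis by simp
  next
    case 2
    note pair = card_2_pair[OF 2(2) J]
    let ?r = "Min J" and ?s = "Max J"
    have rs: "?r \<in> {1..\<nu>}" "?s \<in> {1..\<nu>}" "?r < ?s" using pair(1) by (auto simp: index_pairs_def)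
    let ?T = "translation (\<alpha> 1) (\<lambda>q. if q = ?r then 1 else 0)"
    let ?T' = "translation (\<alpha> 1) (\<lambda>q. if q = ?s then 1 else 0)"
    let ?c = "central (\<lambda>(q, q'). 2 * ((if q = ?r then 1 else 0) * (if q' = ?s then 1 else 0) -
      (if q' = ?r then 1 else 0) * (if q = ?s then 1 else 0)))"
    have "?T \<circ> ?T' = ?T' \<circ> ?T \<circ> ?c"
      by (rule translation_commutator[OF simple_norm[OF one]])
    moreover have "?T \<circ> ?T' \<in> weyl_full" "?T' \<circ> ?T \<in> weyl_full"
      using subgroup.m_closed[OF weyl_full_subgroup unit[OF rs(1)] unit[OF rs(2)]]
        subgroup.m_closed[OF weyl_full_subgroup unit[OF rs(2)] unit[OF rs(1)]] by simp_all
    ultimately have "?c \<in> weyl_full"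
      using subgroup_left_factor[OF weyl_full_subgroup, of "?T' \<circ> ?T" ?c] by simp
    moreover have "?c = central_int (z_exponent D J)"
      unfolding central_int_def using 2 rs(3)
      by (intro central_cong) (auto simp: z_exponent_def unit_exponent_def index_pairs_def split: if_splits)
    ultimately show ?thesis by simp
  next
    case 3
    then show ?thesis
      using subgroup.one_closed[OF weyl_full_subgroup] by (simp add: z_exponent_def central_int_def)
  qed
qed

lemma F_exponents_in_weyl_full: "k \<in> F_exponents D \<Longrightarrow> central_int k \<in> weyl_full"
proof -
  interpret h: group_hom exponent_group Sym central_int by (rule central_int_hom)
  have "central_int ` F_exponents D = generate Sym (central_int ` z_exponent D ` Pow {1..\<nu>})"
    unfolding F_exponents_def by (rule h.generate_img[symmetric]) simp
  also have "\<dots> \<subseteq> weyl_full"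
    by (rule group.generate_subgroup_incl[OF group_bijection_group _ weyl_full_subgroup])
      (use z_exponent_in_weyl_full in auto)
  finally show "k \<in> F_exponents D \<Longrightarrow> central_int k \<in> weyl_full" by blast
qed

lemma even_in_F_exponents:
  assumes "\<And>p. even (k p)" "\<And>p. p \<notin> index_pairs \<nu> \<Longrightarrow> k p = 0"
  shows "k \<in> F_exponents D"
proof -
  interpret E: group exponent_group by (rule group_exponent_group)
  have unit: "unit_exponent r s (2 * n) \<in> F_exponents D" if "(r, s) \<in> index_pairs \<nu>" for r s n
  proof -
    have "unit_exponent r s (2 * 1) [^]\<^bsub>exponent_group\<^esub> n = unit_exponent r s (2 * n)"
      by (rule E.int_pow_one_parameter) (auto simp: unit_exponent_def)
    then show ?thesis
      using E.subgroup_int_pow_closed[OF subgroup_F_exponents two_in_F_exponents(1)[OF that], of n]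
      by simp
  qed
  have "(\<lambda>p. if p \<in> Q then k p else 0) \<in> F_exponents D" if "finite Q" "Q \<subseteq> index_pairs \<nu>" for Q
    using that
  proof (induction Q rule: finite_induct)
    case empty
    then show ?case using subgroup.one_closed[OF subgroup_F_exponents] by simp
  next
    case (insert q Q)
    obtain r s where q: "q = (r, s)" by fastforce
    have "unit_exponent r s (2 * (k q div 2)) \<in> F_exponents D" using unit insert.prems q by auto
    moreover have "(\<lambda>p. if p \<in> Q then k p else 0) \<in> F_exponents D" using insert by auto
    ultimately have "(\<lambda>p. unit_exponent r s (2 * (k q div 2)) p + (if p \<in> Q then k p else 0)) \<in> F_exponents D"
      using subgroup.m_closed[OF subgroup_F_exponents] by fastforce
    also have "(\<lambda>p. unit_exponent r s (2 * (k q div 2)) p + (if p \<in> Q then k p else 0)) =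
        (\<lambda>p. if p \<in> insert q Q then k p else 0)"
      using insert.hyps q assms(1) by (auto simp: unit_exponent_def fun_eq_iff)
    finally show ?case .
  qed
  from this[OF finite_index_pairs subset_refl]
  have "(\<lambda>p. if p \<in> index_pairs \<nu> then k p else 0) \<in> F_exponents D" .
  moreover have "(\<lambda>p. if p \<in> index_pairs \<nu> then k p else 0) = k"
    by (rule ext) (simp only: assms(2) if_cancel split: if_split, auto simp: assms(2))
  ultimately show ?thesis by simp
qed

lemma product_exponent_in_F:
  assumes "lattice_point t \<in> S"
  shows "(\<lambda>(r, s). if (r, s) \<in> index_pairs \<nu> then t r * t s else 0) \<in> F_exponents D"
proof -
  let ?J = "{r \<in> {1..\<nu>}. odd (t r)}"
  let ?k = "\<lambda>(r, s). if (r, s) \<in> index_pairs \<nu> then t r * t s else 0"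
  have J: "?J \<in> D" using assms lattice_point_in_S_iff by blast
  have z: "z_exponent D ?J \<in> F_exponents D"
    unfolding F_exponents_def by (intro generate.incl imageI) auto
  have "(\<lambda>p. ?k p - z_exponent D ?J p) \<in> F_exponents D"
  proof (rule even_in_F_exponents)
    fix p :: "nat \<times> nat"
    obtain r s where p: "p = (r, s)" by fastforce
    show "even (?k p - z_exponent D ?J p)"
      using J by (auto simp: p z_exponent_def index_pairs_def)
    show "p \<notin> index_pairs \<nu> \<Longrightarrow> ?k p - z_exponent D ?J p = 0"
      using J by (auto simp: p z_exponent_def index_pairs_def)
  qed
  from subgroup.m_closed[OF subgroup_F_exponents z this]
  have "(\<lambda>p. z_exponent D ?J p + (?k p - z_exponent D ?J p)) \<in> F_exponents D" by simp
  moreover have "(\<lambda>p. z_exponent D ?J p + (?k p - z_exponent D ?J p)) = ?k" by auto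
  ultimately show ?thesis by (simp only:)
qed

lemma refl_map_orbit:
  assumes H: "subgroup H Sym" and X: "\<And>i. i \<in> {1..l} \<Longrightarrow> X_map i \<in> H"
    and i: "i \<in> {1..l}" and s: "s \<in> S" and base: "refl_map b (\<alpha> i + s) \<in> H"
  shows "set js \<subseteq> {1..l} \<Longrightarrow> refl_map b (act js (\<alpha> i) + s) \<in> H"
proof (induction js)
  case Nil
  then show ?case using base by simp
next
  case (Cons j js)
  then have j: "j \<in> {1..l}" and IH: "refl_map b (act js (\<alpha> i) + s) \<in> H" by auto
  have "b (act js (\<alpha> i)) (act js (\<alpha> i)) = 2"
    using act_form[of js "\<alpha> i" "\<alpha> i"] Cons.prems simple_norm[OF i] by simp
  then have n: "b (act js (\<alpha> i) + s) (act js (\<alpha> i) + s) = 2"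
    using S_radical[OF s] form_sym[of "act js (\<alpha> i)" s] by (simp add: form_simps)
  have "reflection j (act js (\<alpha> i) + s) = act (j # js) (\<alpha> i) + s"
    using S_radical[OF s] by (simp add: reflection_def form_simps algebra_simps)
  then have "refl_map b (act (j # js) (\<alpha> i) + s) = X_map j \<circ> refl_map b (act js (\<alpha> i) + s) \<circ> X_map j"
    unfolding X_map_def refl_map_conjugate[OF j n] by simp
  also have "\<dots> \<in> H"
    using subgroup.m_closed[OF H subgroup.m_closed[OF H X[OF j] IH] X[OF j]] by simp
  finally show ?case .
qed

theorem generate_map_generators:
  assumes star: "star_condition b Vd S \<sigma>"
    and N: "\<And>r s. (r, s) \<in> index_pairs \<nu> \<Longrightarrow> N r s = n_exp b Vd S \<sigma> r s"
  shows "generate Sym (map_generators N) = weyl_full"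
proof
  interpret Sym: group Sym by (rule group_bijection_group)
  have Z: "Z_map N r s = central_int (unit_exponent r s (int (n_exp b Vd S \<sigma> r s)))" if "(r, s) \<in> index_pairs \<nu>" for r s
    unfolding Z_map_def central_int_def N[OF that] by (rule central_cong) (simp add: unit_exponent_def)
  show "generate Sym (map_generators N) \<subseteq> weyl_full"
  proof (rule Sym.generate_subgroup_incl[OF _ weyl_full_subgroup])
    have "X_map i \<in> weyl_full" if "i \<in> {1..l}" for i
      using refl_map_in_weyl_full[OF that zero_S] by (simp add: X_map_def)
    moreover have "Y_map i r \<in> weyl_full" if "i \<in> {1..l}" "r \<in> {1..\<nu>}" for i r
    proof -
      have "lattice_point (\<lambda>q. if q = r then 1 else 0) = \<sigma> r"
        using that by (simp add: lattice_point_def if_distrib[of of_int] if_distrib[of "\<lambda>t. t *\<^sub>R _"] cong: if_cong)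
      then show ?thesis
        using translation_in_weyl_full[OF that(1), of "\<lambda>q. if q = r then 1 else 0"] sigma_S[OF that(2)]
        by (simp add: Y_map_def if_distrib[of of_int] cong: if_cong)
    qed
    moreover have "Z_map N r s \<in> weyl_full" if "(r, s) \<in> index_pairs \<nu>" for r s
      unfolding Z[OF that] by (rule F_exponents_in_weyl_full[OF n_exp_properties(2)[OF that]])
    ultimately show "map_generators N \<subseteq> weyl_full" by (auto simp: map_generators_def)
  qed
  let ?H = "generate Sym (map_generators N)"
  have H: "subgroup ?H Sym"
    by (rule Sym.generate_is_subgroup) (auto simp: map_generators_def)
  have X: "X_map i \<in> ?H" if "i \<in> {1..l}" for i
    using that by (intro generate.incl) (auto simp: map_generators_def)
  have Y: "translation (\<alpha> i) (\<lambda>q. if q = r then of_int n else 0) \<in> ?H" if "i \<in> {1..l}" "r \<in> {1..\<nu>}" for i r n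
  proof -
    have "Y_map i r \<in> ?H" using that by (intro generate.incl) (auto simp: map_generators_def)
    then show ?thesis
      unfolding Y_map_pow[OF that(1), symmetric] by (rule Sym.subgroup_int_pow_closed[OF H])
  qed
  have F: "central_int k \<in> ?H" if k: "k \<in> F_exponents D" for k
  proof -
    interpret h: group_hom exponent_group Sym central_int by (rule central_int_hom)
    let ?u = "(\<lambda>(r, s). unit_exponent r s (int (n_exp b Vd S \<sigma> r s))) ` index_pairs \<nu>"
    obtain k' where k': "k' \<in> generate exponent_group ?u" "c_power k = c_power k'"
      using star k unfolding star_condition_eq by blast
    have "central_int k = central_int k'"
      using k'(2) unfolding c_power_eq_iff by (intro central_int_cong) blast
    also have "\<dots> \<in> central_int ` generate exponent_group ?u" using k'(1) by (rule imageI)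
    also have "\<dots> = generate Sym (central_int ` ?u)" by (rule h.generate_img[symmetric]) simp
    also have "\<dots> \<subseteq> ?H"
    proof (rule Sym.mono_generate)
      show "central_int ` ?u \<subseteq> map_generators N"
      proof
        fix w assume "w \<in> central_int ` ?u"
        then obtain r s where rs: "(r, s) \<in> index_pairs \<nu>"
          "w = central_int (unit_exponent r s (int (n_exp b Vd S \<sigma> r s)))" by auto
        then have "w = case_prod (Z_map N) (r, s)" using Z by simp
        then show "w \<in> map_generators N"
          unfolding map_generators_def using rs(1) by (intro UnI2 image_eqI)
      qed
    qed
    finally show ?thesis .
  qed
  have T: "refl_map b (\<alpha> i + s) \<in> ?H" if i: "i \<in> {1..l}" and s: "s \<in> S" for i s
  proof -
    obtain t where t: "s = lattice_point t" using S_int[OF s] by (auto simp: lattice_point_def)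
    let ?k = "\<lambda>(r, s). if (r, s) \<in> index_pairs \<nu> then t r * t s else 0"
    have "translation (\<alpha> i) (\<lambda>r. of_int (t r)) \<circ> central_int (\<lambda>(r, s). t r * t s) \<in> ?H"
      by (rule translation_product[OF H i]) (rule Y[OF i])
    moreover have "central_int (\<lambda>(r, s). t r * t s) = central_int ?k"
      by (rule central_int_cong) auto
    moreover have C: "central_int ?k \<in> ?H"
      using product_exponent_in_F s unfolding t by (intro F) blast
    ultimately have "central_int ?k \<circ> translation (\<alpha> i) (\<lambda>r. of_int (t r)) \<in> ?H"
      by (simp add: central_int_def translation_def central_commute)
    then have "translation (\<alpha> i) (\<lambda>r. of_int (t r)) \<in> ?H"
      by (rule subgroup_left_factor[OF H _ C bij_translation])
    then have "translation (\<alpha> i) (\<lambda>r. of_int (t r)) \<circ> X_map i \<in> ?H"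
      using subgroup.m_closed[OF H _ X[OF i]] by fastforce
    also have "translation (\<alpha> i) (\<lambda>r. of_int (t r)) \<circ> X_map i = refl_map b (\<alpha> i + s)"
      using X_map_square[OF i] by (simp add: translation_refl_map[OF i, symmetric] t X_map_def comp_assoc)
    finally show ?thesis .
  qed
  show "weyl_full \<subseteq> ?H"
  proof (rule Sym.generate_subgroup_incl[OF _ H])
    show "refl_map b ` nonisotropic b R \<subseteq> ?H"
    proof
      fix w assume "w \<in> refl_map b ` nonisotropic b R"
      then obtain \<beta> s where w: "w = refl_map b (\<beta> + s)" "\<beta> \<in> \<Phi>" "\<beta> \<noteq> 0" "s \<in> S"
        unfolding nonisotropic_R by auto
      obtain js i where "set js \<subseteq> {1..l}" "i \<in> {1..l}" "\<beta> = act js (\<alpha> i)"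
        using root_orbit[OF w(2,3)] by blast
      then show "w \<in> ?H" unfolding w(1) using refl_map_orbit[OF H X _ w(4) T[OF _ w(4)]] by simp
    qed
  qed
qed

lemma weyl_group_eq: "weyl_group b Vd R = subgroup_generated (GL Ext) (to_Ext ` refl_map b ` nonisotropic b R)"
  by (simp add: weyl_group_def to_Ext_def image_image)

lemma weyl_group_iso_full: "subgroup_generated Sym (refl_map b ` nonisotropic b R) \<cong> weyl_group b Vd R"
proof -
  have "refl_map b ` nonisotropic b R \<subseteq> restrictable"
    using refl_map_restrictable nonisotropic_norm by auto
  then show ?thesis unfolding weyl_group_eq by (rule is_isoI[OF iso_to_Ext])
qed

lemma group_weyl_group: "group (weyl_group b Vd R)"
  unfolding weyl_group_eq by (rule group.group_subgroup_generated[OF group_GL_Ext])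

text \<open>Surjectivity of \<open>h\<close> is the generation of the Weyl group; injectivity comes from the normal form in \<open>G\<close>
  and the independence of the translation part and the central part.\<close>

theorem weyl_group_iso_presented:
  assumes star: "star_condition b Vd S \<sigma>"
    and N: "\<And>r s. (r, s) \<in> index_pairs \<nu> \<Longrightarrow> N r s = n_exp b Vd S \<sigma> r s"
    and G: "central_weyl_relations G l \<nu> a N x y z"
    and a: "\<And>i j. i \<in> {1..l} \<Longrightarrow> j \<in> {1..l} \<Longrightarrow> of_int (a i j) = b (\<alpha> i) (\<alpha> j)"
    and h: "h \<in> hom G Sym" "\<And>i. i \<in> {1..l} \<Longrightarrow> h (x i) = X_map i"
      "\<And>i r. i \<in> {1..l} \<Longrightarrow> r \<in> {1..\<nu>} \<Longrightarrow> h (y i r) = Y_map i r"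
      "\<And>r s. (r, s) \<in> index_pairs \<nu> \<Longrightarrow> h (z r s) = Z_map N r s"
  shows "weyl_group b Vd R \<cong> G"
proof -
  interpret Sym: group Sym by (rule group_bijection_group)
  have N0: "N r s \<noteq> 0" if "(r, s) \<in> index_pairs \<nu>" for r s
    using N[OF that] n_exp_properties(1)[OF that, of S] by auto
  have "h \<in> iso G (subgroup_generated Sym (map_generators N))"
    by (rule iso_onto_generated[OF G a N0 h])
  also have "subgroup_generated Sym (map_generators N) = subgroup_generated Sym (refl_map b ` nonisotropic b R)"
  proof -
    have "map_generators N \<subseteq> carrier Sym" "refl_map b ` nonisotropic b R \<subseteq> carrier Sym"
      by (auto simp: map_generators_def bij_refl_map nonisotropic_norm)
    then show ?thesis
      using generate_map_generators[OF star N] by (simp add: subgroup_generated_def Int_absorb1)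
  qed
  finally have "G \<cong> subgroup_generated Sym (refl_map b ` nonisotropic b R)" by (rule is_isoI)
  moreover have "group G"
    using G by (simp add: central_weyl_relations_def weyl_relations_def)
  ultimately show ?thesis
    using weyl_group_iso_full iso_trans group.iso_sym by blast
qed

end

section \<open>The presentations of the Weyl group\<close>

lemma weyl_gens_iff [simp]:
  "GenX i \<in> weyl_gens l \<nu> \<longleftrightarrow> i \<in> {1..l}" "GenY i r \<in> weyl_gens l \<nu> \<longleftrightarrow> i \<in> {1..l} \<and> r \<in> {1..\<nu>}"
  "GenZ r s \<in> weyl_gens l \<nu> \<longleftrightarrow> (r, s) \<in> index_pairs \<nu>"
  by (auto simp: weyl_gens_def)

lemma rank1_gens_iff [simp]:
  "GenX1 \<in> rank1_gens \<nu>" "GenY1 r \<in> rank1_gens \<nu> \<longleftrightarrow> r \<in> {1..\<nu>}"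
  "GenZ1 r s \<in> rank1_gens \<nu> \<longleftrightarrow> (r, s) \<in> index_pairs \<nu>"
  by (auto simp: rank1_gens_def)

lemma image_weyl_gens:
  "f ` weyl_gens l \<nu> = (\<lambda>i. f (GenX i)) ` {1..l} \<union> case_prod (\<lambda>i r. f (GenY i r)) ` ({1..l} \<times> {1..\<nu>}) \<union>
     case_prod (\<lambda>r s. f (GenZ r s)) ` index_pairs \<nu>"
  by (force simp: weyl_gens_def image_iff)

lemma image_rank1_gens:
  "f ` rank1_gens \<nu> = (\<lambda>i. f GenX1) ` {1..1::nat} \<union> case_prod (\<lambda>i r. f (GenY1 r)) ` ({1..1::nat} \<times> {1..\<nu>}) \<union>
     case_prod (\<lambda>r s. f (GenZ1 r s)) ` index_pairs \<nu>"
  by (force simp: rank1_gens_def image_iff)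

lemma (in group) presented_group_hom_letters:
  assumes f: "f \<in> X \<rightarrow> carrier G" and rels: "rels \<subseteq> words X \<times> words X"
    "\<forall>p\<in>rels. word_value G f (fst p) = word_value G f (snd p)"
  obtains h where "h \<in> hom (presented_group X rels) G"
    "\<And>g. g \<in> X \<Longrightarrow> h (letter_class X rels g) = f g"
proof -
  obtain h where h: "h \<in> hom (presented_group X rels) G"
    "\<And>w. w \<in> words X \<Longrightarrow> h (word_class X rels w) = word_value G f w"
    using presented_group_hom[OF f rels(1)] rels(2) by (auto simp: case_prod_beta)
  have "h (letter_class X rels g) = f g" if "g \<in> X" for g
    using h(2)[of "[(g, True)]"] f that by (auto simp: letter_class_def Pi_iff)
  then show thesis using h(1) that by blast
qed

context simply_laced_frame begin

context
  fixes a :: "nat \<Rightarrow> nat \<Rightarrow> int" and N :: "nat \<Rightarrow> nat \<Rightarrow> nat"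
  assumes star: "star_condition b Vd S \<sigma>"
    and N: "\<And>r s. (r, s) \<in> index_pairs \<nu> \<Longrightarrow> N r s = n_exp b Vd S \<sigma> r s"
    and a: "\<And>i j. i \<in> {1..l} \<Longrightarrow> j \<in> {1..l} \<Longrightarrow> of_int (a i j) = b (\<alpha> i) (\<alpha> j)"
    and N_dvd: "\<And>i j r s. i \<in> {1..l} \<Longrightarrow> j \<in> {1..l} \<Longrightarrow> (r, s) \<in> index_pairs \<nu> \<Longrightarrow> int (N r s) dvd a i j"
begin

lemma cartan_sym: "i \<in> {1..l} \<Longrightarrow> j \<in> {1..l} \<Longrightarrow> a i j = a j i"
  using a[of i j] a[of j i] form_sym[of "\<alpha> i" "\<alpha> j"] by simp

lemma cartan_diag: "i \<in> {1..l} \<Longrightarrow> a i i = 2"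
  using a[of i i] simple_norm[of i] by simp

lemma presentation_iso:
  assumes rels: "weyl_rels l \<nu> a N \<subseteq> rels" "rels \<subseteq> weyl_rels l \<nu> a N \<union> xz_rels l \<nu>"
    and xz: "xz_rels l \<nu> \<subseteq> rels \<or>
      (\<forall>(r, s)\<in>index_pairs \<nu>. \<exists>i\<in>{1..l}. \<exists>j\<in>{1..l}. \<bar>a i j div int (N r s)\<bar> = 1)"
  shows "weyl_group b Vd R \<cong> presented_group (weyl_gens l \<nu>) rels"
proof -
  interpret Sym: group Sym by (rule group_bijection_group)
  let ?X = "weyl_gens l \<nu>" and ?P = "presented_group (weyl_gens l \<nu>) rels"
  let ?L = "letter_class ?X rels"
  interpret P: group ?P by (rule group_presented_group)
  have words: "rels \<subseteq> words ?X \<times> words ?X"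
    using rels(2) weyl_rels_words xz_rels_words by blast
  have L: "?L \<in> ?X \<rightarrow> carrier ?P" by auto
  have rel: "word_value ?P ?L (fst p) = word_value ?P ?L (snd p)" if "p \<in> rels" for p
    using presented_group_relation[OF words, of "fst p" "snd p"] that by simp
  have "weyl_relations ?P l \<nu> a N (\<lambda>i. ?L (GenX i)) (\<lambda>i r. ?L (GenY i r)) (\<lambda>r s. ?L (GenZ r s))"
    using P.weyl_relations_iff[OF L, of a N] rel rels(1) by blast
  then interpret W: weyl_relations ?P l \<nu> a N "\<lambda>i. ?L (GenX i)" "\<lambda>i r. ?L (GenY i r)" "\<lambda>r s. ?L (GenZ r s)" .
  have x_z: "?L (GenX i) \<otimes>\<^bsub>?P\<^esub> ?L (GenZ r s) = ?L (GenZ r s) \<otimes>\<^bsub>?P\<^esub> ?L (GenX i)"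
    if i: "i \<in> {1..l}" and rs: "(r, s) \<in> index_pairs \<nu>" for i r s
    using xz
  proof
    assume "xz_rels l \<nu> \<subseteq> rels"
    then have "\<forall>p\<in>xz_rels l \<nu>. word_value ?P ?L (fst p) = word_value ?P ?L (snd p)" using rel by blast
    then show ?thesis using P.xz_rels_iff[OF L] i rs by blast
  next
    assume "\<forall>(r, s)\<in>index_pairs \<nu>. \<exists>i\<in>{1..l}. \<exists>j\<in>{1..l}. \<bar>a i j div int (N r s)\<bar> = 1"
    then obtain p q where "p \<in> {1..l}" "q \<in> {1..l}" "\<bar>a p q div int (N r s)\<bar> = 1" using rs by blast
    then show ?thesis
      by (intro W.x_z_if_unit_commutator[OF cartan_sym cartan_diag N_dvd[OF _ _ rs] _ _ _ i rs])
  qed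
  have C: "central_weyl_relations ?P l \<nu> a N (\<lambda>i. ?L (GenX i)) (\<lambda>i r. ?L (GenY i r)) (\<lambda>r s. ?L (GenZ r s))"
    by (intro central_weyl_relations.intro W.weyl_relations_axioms central_weyl_relations_axioms.intro x_z
        presented_group_generated[of "weyl_gens l \<nu>" rels, unfolded image_weyl_gens])
  define f where "f g = (case g of GenX i \<Rightarrow> X_map i | GenY i r \<Rightarrow> Y_map i r | GenZ r s \<Rightarrow> Z_map N r s)" for g
  have f: "f \<in> ?X \<rightarrow> carrier Sym" by (auto simp: weyl_gens_def f_def)
  have "weyl_relations Sym l \<nu> a N (\<lambda>i. f (GenX i)) (\<lambda>i r. f (GenY i r)) (\<lambda>r s. f (GenZ r s))"
    unfolding f_def weyl_gen.case by (rule weyl_relations_maps) (simp_all add: a N_dvd)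
  then have "\<forall>p\<in>weyl_rels l \<nu> a N. word_value Sym f (fst p) = word_value Sym f (snd p)"
    using Sym.weyl_relations_iff[OF f] by blast
  moreover have "\<forall>p\<in>xz_rels l \<nu>. word_value Sym f (fst p) = word_value Sym f (snd p)"
    unfolding Sym.xz_rels_iff[OF f] by (auto simp: f_def X_Z)
  ultimately have "\<forall>p\<in>rels. word_value Sym f (fst p) = word_value Sym f (snd p)"
    using rels(2) by blast
  from Sym.presented_group_hom_letters[OF f words this]
  obtain h where h: "h \<in> hom ?P Sym" "\<And>g. g \<in> ?X \<Longrightarrow> h (?L g) = f g" by blast
  show ?thesis
    by (rule weyl_group_iso_presented[OF star N C a h(1)])
      (simp_all add: h(2) f_def)
qed

lemma rank1_presentation_iso:
  assumes l: "l = 1" and rels: "rank1_rels \<nu> N \<subseteq> rels" "rels \<subseteq> rank1_rels \<nu> N \<union> rank1_xz_rels \<nu>"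
    and xz: "rank1_xz_rels \<nu> \<subseteq> rels \<or> (\<forall>(r, s)\<in>index_pairs \<nu>. N r s = 2)"
  shows "weyl_group b Vd R \<cong> presented_group (rank1_gens \<nu>) rels"
proof -
  interpret Sym: group Sym by (rule group_bijection_group)
  let ?X = "rank1_gens \<nu>" and ?P = "presented_group (rank1_gens \<nu>) rels"
  let ?L = "letter_class ?X rels"
  interpret P: group ?P by (rule group_presented_group)
  have a11: "a 1 1 = 2" using cartan_diag l by simp
  have words: "rels \<subseteq> words ?X \<times> words ?X"
    using rels(2) rank1_rels_words rank1_xz_rels_words by blast
  have L: "?L \<in> ?X \<rightarrow> carrier ?P" by auto
  have rel: "word_value ?P ?L (fst p) = word_value ?P ?L (snd p)" if "p \<in> rels" for p
    using presented_group_relation[OF words, of "fst p" "snd p"] that by simp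
  have "weyl_relations ?P 1 \<nu> a N (\<lambda>i. ?L GenX1) (\<lambda>i r. ?L (GenY1 r)) (\<lambda>r s. ?L (GenZ1 r s))"
    using P.rank1_relations_iff[where a=a, OF L a11] rel rels(1) by blast
  then interpret W: weyl_relations ?P l \<nu> a N "\<lambda>i. ?L GenX1" "\<lambda>i r. ?L (GenY1 r)" "\<lambda>r s. ?L (GenZ1 r s)"
    unfolding l .
  have x_z: "?L GenX1 \<otimes>\<^bsub>?P\<^esub> ?L (GenZ1 r s) = ?L (GenZ1 r s) \<otimes>\<^bsub>?P\<^esub> ?L GenX1"
    if rs: "(r, s) \<in> index_pairs \<nu>" for r s
    using xz
  proof
    assume "rank1_xz_rels \<nu> \<subseteq> rels"
    then have "\<forall>p\<in>rank1_xz_rels \<nu>. word_value ?P ?L (fst p) = word_value ?P ?L (snd p)" using rel by blast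
    then show ?thesis using P.rank1_xz_rels_iff[OF L] rs by blast
  next
    assume "\<forall>(r, s)\<in>index_pairs \<nu>. N r s = 2"
    then have "\<bar>a 1 1 div int (N r s)\<bar> = 1" using rs a11 by auto
    moreover have "1 \<in> {1..l}" using l by simp
    ultimately show ?thesis
      using W.x_z_if_unit_commutator[OF cartan_sym cartan_diag N_dvd[OF _ _ rs] _ _ _ _ rs] by blast
  qed
  have C: "central_weyl_relations ?P l \<nu> a N (\<lambda>i. ?L GenX1) (\<lambda>i r. ?L (GenY1 r)) (\<lambda>r s. ?L (GenZ1 r s))"
    unfolding l
    by (intro central_weyl_relations.intro W.weyl_relations_axioms[unfolded l] central_weyl_relations_axioms.intro x_z
        presented_group_generated[of "rank1_gens \<nu>" rels, unfolded image_rank1_gens])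
  define f where "f g = (case g of GenX1 \<Rightarrow> X_map 1 | GenY1 r \<Rightarrow> Y_map 1 r | GenZ1 r s \<Rightarrow> Z_map N r s)" for g
  have one: "1 \<in> {1..l}" using l by simp
  have f: "f \<in> ?X \<rightarrow> carrier Sym" using bij_maps(1)[OF one] by (auto simp: rank1_gens_def f_def)
  have i1: "i = 1" if "i \<in> {1..l}" for i using that l by auto
  have "weyl_relations Sym l \<nu> a N X_map Y_map (Z_map N)"
    by (rule weyl_relations_maps) (simp_all add: a N_dvd)
  then interpret M: weyl_relations Sym l \<nu> a N X_map Y_map "Z_map N" .
  have "weyl_relations Sym l \<nu> a N (\<lambda>i. f GenX1) (\<lambda>i r. f (GenY1 r)) (\<lambda>r s. f (GenZ1 r s))"
    unfolding f_def rank1_gen.case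
  proof (unfold_locales, goal_cases)
    case (5 i j)
    then show ?case using i1 by blast
  next
    case (6 i j r)
    then show ?case using M.x_y_x[OF one one] i1[of i] i1[of j] by simp
  next
    case (10 i j r s)
    then show ?case using M.y_y[OF one one] i1[of i] i1[of j] by simp
  qed (use one in \<open>auto intro: M.x_square M.z_z M.y_z M.y_y_same simp: X_map_square M.z_z[simplified] M.y_z[OF one, simplified]\<close>)
  then have "\<forall>p\<in>rank1_rels \<nu> N. word_value Sym f (fst p) = word_value Sym f (snd p)"
    using Sym.rank1_relations_iff[where a=a, OF f a11] unfolding l by blast
  moreover have "\<forall>p\<in>rank1_xz_rels \<nu>. word_value Sym f (fst p) = word_value Sym f (snd p)"
    unfolding Sym.rank1_xz_rels_iff[OF f] using X_Z[OF one] by (auto simp: f_def)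
  ultimately have "\<forall>p\<in>rels. word_value Sym f (fst p) = word_value Sym f (snd p)"
    using rels(2) by blast
  from Sym.presented_group_hom_letters[OF f words this]
  obtain h where h: "h \<in> hom ?P Sym" "\<And>g. g \<in> ?X \<Longrightarrow> h (?L g) = f g" by blast
  show ?thesis
    by (rule weyl_group_iso_presented[OF star N C a h(1)])
      (simp_all add: h(2) f_def i1[simplified] l)
qed

end

end

section \<open>Simply laced extended affine root systems\<close>

lemma subspace_form_radical: "bilinear b \<Longrightarrow> subspace (form_radical b)"
  by (auto simp: subspace_def form_radical_def bilinear_ladd bilinear_lmul bilinear_lzero)

lemma lattice_basis_independent:
  fixes \<sigma> :: "nat \<Rightarrow> 'v::euclidean_space"
  assumes "subspace U" "dim U = n" "\<sigma> ` {1..n} \<subseteq> U" "U \<subseteq> span (\<sigma> ` {1..n})"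
    and zero: "(\<Sum>r\<in>{1..n}. c r *\<^sub>R \<sigma> r) = 0" "r \<in> {1..n}"
  shows "c r = 0"
proof -
  let ?B = "\<sigma> ` {1..n}"
  have "dim U \<le> card ?B" by (rule dim_le_card[OF assms(4)]) simp
  moreover have "card ?B \<le> n" using card_image_le[of "{1..n}" \<sigma>] by simp
  ultimately have card: "card ?B = n" using assms(2) by simp
  then have inj: "inj_on \<sigma> {1..n}" by (intro eq_card_imp_inj_on) auto
  have ind: "independent ?B"
    by (rule card_le_dim_spanning[OF assms(3,4)]) (use card assms(2) in auto)
  have "(\<Sum>v\<in>?B. c (the_inv_into {1..n} \<sigma> v) *\<^sub>R v) = (\<Sum>r\<in>{1..n}. c r *\<^sub>R \<sigma> r)"
    by (subst sum.reindex[OF inj]) (auto intro!: sum.cong simp: the_inv_into_f_f[OF inj])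
  then have "c (the_inv_into {1..n} \<sigma> (\<sigma> r)) = 0"
    using zero independentD[OF ind, of ?B "\<lambda>v. c (the_inv_into {1..n} \<sigma> v)"] by auto
  then show ?thesis using the_inv_into_f_f[OF inj zero(2)] by simp
qed

theorem simply_laced_frame_if_data:
  assumes data: "simply_laced_data b R Vd S X \<alpha> \<sigma>"
  shows "simply_laced_frame b Vd (finite_part b Vd R) (ade_rank X) \<alpha> \<sigma> (nullity b) S R"
proof -
  let ?\<Phi> = "finite_part b Vd R" and ?n = "nullity b" and ?l = "ade_rank X"
  have ears: "ears b R" and Vd: "subspace Vd" "{x + y | x y. x \<in> Vd \<and> y \<in> form_radical b} = UNIV"
    and type: "root_system_of_type b Vd ?\<Phi> X" and sl: "semilattice_in (form_radical b) S"
    and R: "R = {s + t | s t. s \<in> S \<and> t \<in> S} \<union> {\<beta> + s | \<beta> s. \<beta> \<in> ?\<Phi> \<and> s \<in> S}"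
    and fund: "fundamental_system ?\<Phi> ?l \<alpha>" "\<forall>i\<in>{1..?l}. b (\<alpha> i) (\<alpha> i) = 2"
    and \<sigma>: "\<sigma> ` {1..?n} \<subseteq> S" "int_basis (int_span S) ?n \<sigma>"
    using data unfolding simply_laced_data_def by auto
  have bil: "bilinear b" and sym: "\<And>x y. b x y = b y x" using ears by (auto simp: ears_def psd_form_def)
  have frs: "finite_root_system b Vd ?\<Phi>" and valid: "valid_ade X"
    using type by (auto simp: root_system_of_type_def)
  have spanS: "span S = form_radical b" using sl by (simp add: semilattice_in_def)
  have S_rad: "b s v = 0" if "s \<in> S" for s v
    using span_base[OF that] unfolding spanS by (simp add: form_radical_def)
  have S_int: "\<exists>k :: nat \<Rightarrow> int. s = (\<Sum>r\<in>{1..?n}. of_int (k r) *\<^sub>R \<sigma> r)" if "s \<in> S" for s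
  proof -
    have "s \<in> int_span S"
      unfolding int_span_def using that by (auto intro!: exI[of _ "{s}"] exI[of _ "\<lambda>_. 1"])
    then show ?thesis unfolding \<sigma>(2)[unfolded int_basis_def, THEN conjunct1] by (simp only: mem_Collect_eq simp_thms)
  qed
  have sub: "form_radical b \<subseteq> span (\<sigma> ` {1..?n})"
  proof -
    have "S \<subseteq> span (\<sigma> ` {1..?n})"
    proof
      fix s assume "s \<in> S"
      then obtain k :: "nat \<Rightarrow> int" where "s = (\<Sum>r\<in>{1..?n}. of_int (k r) *\<^sub>R \<sigma> r)" using S_int by blast
      then show "s \<in> span (\<sigma> ` {1..?n})" by (simp only:) (intro span_sum span_scale span_base imageI)
    qed
    then show ?thesis using span_mono span_span unfolding spanS[symmetric] by metis
  qed
  have ind: "c r = 0" if "(\<Sum>r\<in>{1..?n}. c r *\<^sub>R \<sigma> r) = 0" "r \<in> {1..?n}" for c r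
    by (rule lattice_basis_independent[OF subspace_form_radical[OF bil] nullity_def[symmetric] _ sub that])
      (use \<sigma>(1) spanS span_superset in auto)
  interpret simple_system b Vd ?\<Phi> ?l \<alpha>
    by unfold_locales (use bil sym frs fund in auto)
  show ?thesis
  proof (intro simply_laced_frame.intro ears_frame_nullity.intro ears_frame.intro simple_system_axioms
      ears_frame_axioms.intro ears_frame_nullity_axioms.intro simply_laced_frame_axioms.intro, goal_cases)
    case (1 r v)
    then have "\<sigma> r \<in> S" using \<sigma>(1) by blast
    then show ?case by (rule S_rad)
  next
    case (2 c r)
    then show ?case by (rule ind)
  next
    case (3 v)
    have "v \<in> {x + y | x y. x \<in> Vd \<and> y \<in> form_radical b}" unfolding Vd(2) by simp
    then obtain p q where "v = p + q" "p \<in> Vd" "q \<in> form_radical b" by blast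
    then show ?case by (intro bexI[of _ p]) (simp_all add: form_radical_def)
  next
    case 4
    show ?case by simp
  next
    case (5 s v)
    then show ?case by (rule S_rad)
  next
    case 6
    then show ?case using sl by (simp add: semilattice_in_def)
  next
    case (7 s t)
    then show ?case using sl by (simp add: semilattice_in_def)
  next
    case (8 s t)
    then show ?case using sl by (simp add: semilattice_in_def)
  next
    case (9 r)
    then show ?case using \<sigma>(1) by blast
  next
    case (10 s)
    then show ?case by (rule S_int)
  next
    case 11
    then show ?case using valid by (cases X) auto
  next
    case 12
    have iso: "b (s + t) (s + t) = 0" if "s \<in> S" "t \<in> S" for s t
      using S_rad[OF that(1)] S_rad[OF that(2)] by (simp add: form_simps)
    have norm: "b (\<beta> + s) (\<beta> + s) = b \<beta> \<beta>" if "s \<in> S" for \<beta> s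
      using S_rad[OF that] sym[of \<beta> s] by (simp add: form_simps)
    have pos: "b \<beta> \<beta> \<noteq> 0 \<longleftrightarrow> \<beta> \<noteq> 0" if "\<beta> \<in> ?\<Phi>" for \<beta>
      using form_pos[OF root_in_space[OF that]] by (cases "\<beta> = 0") (auto simp: form_simps)
    have "x \<in> nonisotropic b R \<longleftrightarrow> (\<exists>\<beta> s. x = \<beta> + s \<and> \<beta> \<in> ?\<Phi> \<and> \<beta> \<noteq> 0 \<and> s \<in> S)" for x
    proof
      assume x: "x \<in> nonisotropic b R"
      then have "x \<in> {s + t | s t. s \<in> S \<and> t \<in> S} \<union> {\<beta> + s | \<beta> s. \<beta> \<in> ?\<Phi> \<and> s \<in> S}" "b x x \<noteq> 0"
        unfolding nonisotropic_def using R by auto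
      then obtain \<beta> s where "x = \<beta> + s" "\<beta> \<in> ?\<Phi>" "s \<in> S" using iso by blast
      then show "\<exists>\<beta> s. x = \<beta> + s \<and> \<beta> \<in> ?\<Phi> \<and> \<beta> \<noteq> 0 \<and> s \<in> S"
        using norm pos \<open>b x x \<noteq> 0\<close> by metis
    next
      assume "\<exists>\<beta> s. x = \<beta> + s \<and> \<beta> \<in> ?\<Phi> \<and> \<beta> \<noteq> 0 \<and> s \<in> S"
      then obtain \<beta> s where x: "x = \<beta> + s" "\<beta> \<in> ?\<Phi>" "\<beta> \<noteq> 0" "s \<in> S" by blast
      then have "x \<in> R" using R by blast
      then show "x \<in> nonisotropic b R" using x norm pos by (simp add: nonisotropic_def)
    qed
    then show ?case by blast
  qed
qed

context simply_laced_frame begin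

lemma reflection_closed:
  assumes ears: "ears b R" and x: "x \<in> nonisotropic b R" and y: "y \<in> R"
  shows "y - b y (coroot b x) *\<^sub>R x \<in> R"
proof -
  have "\<forall>x\<in>nonisotropic b R. \<forall>y\<in>R. \<exists>d u :: nat.
      (\<forall>n :: int. y + of_int n *\<^sub>R x \<in> R \<longleftrightarrow> - int d \<le> n \<and> n \<le> int u) \<and>
      b y (coroot b x) = real d - real u"
    using ears unfolding ears_def by (elim conjE)
  from this[THEN bspec, OF x, THEN bspec, OF y]
  obtain d u :: nat where du: "\<forall>n :: int. y + of_int n *\<^sub>R x \<in> R \<longleftrightarrow> - int d \<le> n \<and> n \<le> int u"
    "b y (coroot b x) = real d - real u"
    by (elim exE conjE)
  have "y + of_int (int u - int d) *\<^sub>R x \<in> R"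
    by (rule du(1)[THEN spec, THEN iffD2]) simp
  moreover have "y + of_int (int u - int d) *\<^sub>R x = y - b y (coroot b x) *\<^sub>R x"
    by (simp add: du(2) algebra_simps)
  ultimately show ?thesis by simp
qed

text \<open>Otherwise the simple roots would be pairwise orthogonal, every root would be \<open>\<plusminus>\<alpha>\<^sub>i\<close>, and the root
  system would decompose.\<close>

lemma adjacent_simple_roots:
  assumes ears: "ears b R" and l: "1 < l"
  shows "\<exists>i\<in>{1..l}. \<exists>j\<in>{1..l}. b (\<alpha> i) (\<alpha> j) = - 1"
proof (rule ccontr)
  assume "\<not> ?thesis"
  then have orth: "b (\<alpha> i) (\<alpha> j) = 0" if "i \<in> {1..l}" "j \<in> {1..l}" "i \<noteq> j" for i j
    using simple_pairing_cases[OF that] that by blast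
  have refl: "reflection j (\<alpha> i) \<in> {\<alpha> i, - \<alpha> i}" if "i \<in> {1..l}" "j \<in> {1..l}" for i j
    using orth[OF that] reflection_simple[OF that(2)] by (cases "i = j") (auto simp: reflection_def)
  have act: "act js (\<alpha> i) \<in> {\<alpha> i, - \<alpha> i}" if "set js \<subseteq> {1..l}" "i \<in> {1..l}" for js i
    using that(1)
  proof (induction js)
    case (Cons j js)
    then have j: "j \<in> {1..l}" and IH: "act js (\<alpha> i) \<in> {\<alpha> i, - \<alpha> i}" by auto
    then show ?case using refl[OF that(2) j] linear_neg[OF linear_reflection, of j "\<alpha> i"] by auto
  qed simp
  have root: "\<exists>i\<in>{1..l}. \<exists>s\<in>S. x = \<alpha> i + s \<or> x = - \<alpha> i + s" if x_in: "x \<in> nonisotropic b R" for x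
  proof -
    obtain \<beta> s where x: "x = \<beta> + s" "\<beta> \<in> \<Phi>" "\<beta> \<noteq> 0" "s \<in> S"
      using x_in unfolding nonisotropic_R by blast
    obtain js i where js: "set js \<subseteq> {1..l}" "i \<in> {1..l}" "\<beta> = act js (\<alpha> i)" using root_orbit[OF x(2,3)] by blast
    show ?thesis
      by (rule bexI[OF _ js(2)], rule bexI[OF _ x(4)]) (use act[OF js(1,2)] x(1) js(3) in auto)
  qed
  have rad: "b s v = 0" "b v s = 0" if "s \<in> S" for s v
    using S_radical[OF that] form_sym[of v s] by auto
  define R1 where "R1 = {x \<in> nonisotropic b R. b x (\<alpha> 1) \<noteq> 0}"
  define R2 where "R2 = {x \<in> nonisotropic b R. b x (\<alpha> 1) = 0}"
  have in_R: "\<alpha> i \<in> nonisotropic b R" if "i \<in> {1..l}" for i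
    unfolding nonisotropic_R using simple_root[OF that] simple_nonzero[OF that] zero_S by force
  have 12: "1 \<in> {1..l}" "2 \<in> {1..l}" using l by auto
  have "\<alpha> 1 \<in> R1" "\<alpha> 2 \<in> R2"
    using in_R[OF 12(1)] in_R[OF 12(2)] simple_norm[OF 12(1)] orth[OF 12(2,1)] by (auto simp: R1_def R2_def)
  moreover have "nonisotropic b R = R1 \<union> R2" by (auto simp: R1_def R2_def)
  moreover have "b x y = 0" if xy: "x \<in> R1" "y \<in> R2" for x y
  proof -
    obtain i s where x: "i \<in> {1..l}" "s \<in> S" "x = \<alpha> i + s \<or> x = - \<alpha> i + s" using root[of x] xy(1) unfolding R1_def by blast
    obtain j t where y: "j \<in> {1..l}" "t \<in> S" "y = \<alpha> j + t \<or> y = - \<alpha> j + t" using root[of y] xy(2) unfolding R2_def by blast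
    have "i = 1"
    proof (rule ccontr)
      assume "i \<noteq> 1"
      then have "b x (\<alpha> 1) = 0" using x(3) rad[OF x(2)] orth[OF x(1) 12(1)] by (auto simp: form_simps)
      then show False using xy(1) by (simp add: R1_def)
    qed
    moreover have "j \<noteq> 1"
    proof
      assume "j = 1"
      then have "b y (\<alpha> 1) \<noteq> 0" using y(3) rad[OF y(2)] simple_norm[OF 12(1)] by (auto simp: form_simps)
      then show False using xy(2) by (simp add: R2_def)
    qed
    ultimately have "b (\<alpha> i) (\<alpha> j) = 0" using orth x y by auto
    then show ?thesis using x(3) y(3) rad[OF x(2)] rad[OF y(2)] by (auto simp: form_simps)
  qed
  ultimately have "\<exists>R1 R2. R1 \<noteq> {} \<and> R2 \<noteq> {} \<and> nonisotropic b R = R1 \<union> R2 \<and>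
      (\<forall>x\<in>R1. \<forall>y\<in>R2. b x y = 0)"
    by (intro exI[of _ R1] exI[of _ R2] conjI ballI) auto
  moreover have "\<not> (\<exists>R1 R2. R1 \<noteq> {} \<and> R2 \<noteq> {} \<and> nonisotropic b R = R1 \<union> R2 \<and>
      (\<forall>x\<in>R1. \<forall>y\<in>R2. b x y = 0))"
    using ears unfolding ears_def by (elim conjE)
  ultimately show False by (rule notE[rotated])
qed

text \<open>For adjacent simple roots the reflection in \<open>\<alpha>\<^sub>i + \<sigma>\<^sub>r\<close> maps \<open>\<alpha>\<^sub>j + \<sigma>\<^sub>s\<close> to
  \<open>\<alpha>\<^sub>i + \<alpha>\<^sub>j + \<sigma>\<^sub>r + \<sigma>\<^sub>s\<close>, which is a root only if the isotropic part is in \<open>S\<close>.\<close>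

lemma sums_in_S:
  assumes ears: "ears b R" and l: "1 < l" and rs: "r \<in> {1..\<nu>}" "s \<in> {1..\<nu>}"
  shows "\<sigma> r + \<sigma> s \<in> S"
proof -
  obtain i j where ij: "i \<in> {1..l}" "j \<in> {1..l}" "b (\<alpha> i) (\<alpha> j) = - 1"
    using adjacent_simple_roots[OF ears l] by blast
  let ?x = "\<alpha> i + \<sigma> r" and ?y = "\<alpha> j + \<sigma> s"
  have x: "?x \<in> nonisotropic b R" and y: "?y \<in> nonisotropic b R"
    unfolding nonisotropic_R using ij simple_root simple_nonzero sigma_S rs by blast+
  have "b ?y (coroot b ?x) = - 1"
    using rs ij nonisotropic_norm[OF x] form_sym[of "\<alpha> j" "\<alpha> i"] by (simp add: coroot_def form_simps)
  then have "?y + ?x \<in> R"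
    using reflection_closed[OF ears x, of ?y] y by (simp add: nonisotropic_def algebra_simps)
  moreover have "b (?y + ?x) (?y + ?x) = 2"
    using ij rs form_sym[of "\<alpha> j" "\<alpha> i"] simple_norm[OF ij(1)] simple_norm[OF ij(2)] by (simp add: form_simps)
  ultimately have "?y + ?x \<in> nonisotropic b R" by (simp add: nonisotropic_def)
  then obtain \<beta> t where \<beta>: "?y + ?x = \<beta> + t" "\<beta> \<in> \<Phi>" "t \<in> S" unfolding nonisotropic_R by blast
  let ?v = "\<alpha> i + \<alpha> j - \<beta>"
  have v: "?v = t - (\<sigma> r + \<sigma> s)" using \<beta>(1) by (simp add: algebra_simps)
  have "?v \<in> Vd"
    using root_in_space[OF simple_root] ij root_in_space[OF \<beta>(2)]
    by (intro subspace_diff[OF subspace_Vd] subspace_add[OF subspace_Vd]) auto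
  moreover have "b ?v ?v = 0"
    unfolding v using rs S_radical[OF \<beta>(3)] by (simp add: form_simps)
  ultimately have "?v = 0" using form_pos[of ?v] by (metis less_irrefl)
  then show ?thesis using v \<beta>(3) by simp
qed

end

section \<open>Normalization of semilattices of rank at most 3\<close>

lemma discrete_translation:
  fixes S :: "'v::real_normed_vector set"
  assumes "discrete S" shows "discrete ((\<lambda>s. s - \<tau>) ` S)"
proof (rule discreteI)
  fix x assume "x \<in> (\<lambda>s. s - \<tau>) ` S"
  then obtain s where s: "s \<in> S" "x = s - \<tau>" by auto
  obtain e where e: "e > 0" "\<forall>y\<in>S. dist s y < e \<longrightarrow> y = s"
    using discreteD[OF assms s(1)] by (auto simp: isolated_in_dist_Ex_iff)
  have "\<forall>y\<in>(\<lambda>s. s - \<tau>) ` S. dist x y < e \<longrightarrow> y = x"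
    using e(2) by (auto simp: s(2) dist_norm)
  then show "x isolated_in (\<lambda>s. s - \<tau>) ` S"
    using e(1) s by (auto simp: isolated_in_dist_Ex_iff)
qed

text \<open>In rank 1 the origin of the semilattice can be moved to any of its points \<open>\<tau>\<close>, because
  \<open>\<plusminus>\<alpha> + S = \<plusminus>(\<alpha> + \<tau>) + (S - \<tau>)\<close>. The complement of the radical moves along with the root.\<close>

theorem rank1_change_of_origin_and_basis:
  assumes data: "simply_laced_data b R Vd S X \<alpha> \<sigma>" and rank: "ade_rank X = 1"
    and \<tau>: "\<tau> \<in> S"
    and basis: "\<And>r. r \<in> {1..nullity b} \<Longrightarrow> \<sigma>' r + \<tau> \<in> S"
    and inverse: "\<And>r. r \<in> {1..nullity b} \<Longrightarrow>
      \<exists>k :: nat \<Rightarrow> int. \<sigma> r = (\<Sum>q\<in>{1..nullity b}. of_int (k q) *\<^sub>R \<sigma>' q)"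
  shows "simply_laced_data b R (span {\<alpha> 1 + \<tau>}) ((\<lambda>s. s - \<tau>) ` S) X (\<lambda>_. \<alpha> 1 + \<tau>) \<sigma>'"
    and "similar_in (form_radical b) S ((\<lambda>s. s - \<tau>) ` S)"
proof -
  let ?S = "(\<lambda>s. s - \<tau>) ` S" and ?n = "nullity b" and ?\<Phi> = "finite_part b Vd R"
  define \<alpha>' where "\<alpha>' = \<alpha> 1 + \<tau>"
  let ?Vd = "span {\<alpha>'}"
  have ears: "ears b R" and Vd: "{x + y | x y. x \<in> Vd \<and> y \<in> form_radical b} = UNIV"
    and type: "root_system_of_type b Vd ?\<Phi> X" and sl: "semilattice_in (form_radical b) S"
    and R_parts: "R = {s + t | s t. s \<in> S \<and> t \<in> S} \<union> {\<beta> + s | \<beta> s. \<beta> \<in> ?\<Phi> \<and> s \<in> S}"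
    using data unfolding simply_laced_data_def by auto
  interpret F: simply_laced_frame b Vd ?\<Phi> "ade_rank X" \<alpha> \<sigma> ?n S R
    by (rule simply_laced_frame_if_data[OF data])
  note form = F.form_simps
  have one: "1 \<in> {1..ade_rank X}" using rank by simp
  note norm1 = F.simple_norm[OF one]
  have rad: "b s v = 0" "b v s = 0" if "s \<in> S" for s v
    using F.S_radical[OF that] F.form_sym[of v s] by auto
  have S_shift: "s + 2 *\<^sub>R t \<in> S" "s - 2 *\<^sub>R t \<in> S" if "s \<in> S" "t \<in> S" for s t
    using F.S_shift that by auto
  have S_minus: "- s \<in> S" if "s \<in> S" for s
  proof -
    have "s - 2 *\<^sub>R s = - s" by (simp add: scaleR_2)
    then show ?thesis using S_shift(2)[OF that that] by simp
  qed
  have \<Phi>: "?\<Phi> = {0, \<alpha> 1, - \<alpha> 1}"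
  proof
    show "?\<Phi> \<subseteq> {0, \<alpha> 1, - \<alpha> 1}"
    proof
      fix \<beta> assume \<beta>: "\<beta> \<in> ?\<Phi>"
      obtain k :: "nat \<Rightarrow> int" where "\<beta> = (\<Sum>i\<in>{1..ade_rank X}. of_int (k i) *\<^sub>R \<alpha> i)"
        using F.fundamental \<beta> unfolding fundamental_system_def by metis
      then have k: "\<beta> = of_int (k 1) *\<^sub>R \<alpha> 1" using rank by simp
      show "\<beta> \<in> {0, \<alpha> 1, - \<alpha> 1}"
      proof (cases "k 1 = 0")
        case False
        then have "real_of_int (k 1) = 1 \<or> real_of_int (k 1) = - 1"
          using F.root_multiple[OF F.simple_root[OF one] F.simple_nonzero[OF one], of "of_int (k 1)"] \<beta> k by simp
        then show ?thesis using k by auto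
      qed (simp add: k)
    qed
    show "{0, \<alpha> 1, - \<alpha> 1} \<subseteq> ?\<Phi>"
      using F.simple_root[OF one] F.root_minus F.root_system by (auto simp: finite_root_system_def)
  qed
  note R = R_parts[unfolded \<Phi>]
  have normv: "b \<alpha>' \<alpha>' = 2" using norm1 rad[OF \<tau>] by (simp add: \<alpha>'_def form)
  have \<alpha>0: "\<alpha>' \<noteq> 0" using normv by (auto simp: form)
  have coroot: "coroot b \<alpha>' = \<alpha>'" by (simp add: coroot_def normv)
  have in_span: "x \<in> ?Vd \<longleftrightarrow> (\<exists>c. x = c *\<^sub>R \<alpha>')" for x
    by (simp add: span_singleton image_iff)
  have R_cases: "x = 0 \<or> x = \<alpha>' \<or> x = - \<alpha>'" if x: "x \<in> ?Vd" "x + \<rho> \<in> R" "\<rho> \<in> form_radical b" for x \<rho>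
  proof -
    obtain c where c: "x = c *\<^sub>R \<alpha>'" using x(1) in_span by blast
    have \<rho>: "b \<rho> v = 0" "b v \<rho> = 0" for v
      using x(3) F.form_sym[of v \<rho>] by (auto simp: form_radical_def)
    have bx: "b (x + \<rho>) (\<alpha> 1) = 2 * c" using c \<rho> norm1 rad[OF \<tau>] by (simp add: \<alpha>'_def form)
    have "c = 0 \<or> c = 1 \<or> c = -1"
      using x(2) unfolding R
    proof
      assume "x + \<rho> \<in> {s + t | s t. s \<in> S \<and> t \<in> S}"
      then obtain s t where "x + \<rho> = s + t" "s \<in> S" "t \<in> S" by blast
      then have "b (x + \<rho>) (\<alpha> 1) = 0" using rad by (simp add: form)
      then show ?thesis using bx by simp
    next
      assume "x + \<rho> \<in> {\<beta> + s | \<beta> s. \<beta> \<in> {0, \<alpha> 1, - \<alpha> 1} \<and> s \<in> S}"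
      then obtain \<beta> s where \<beta>: "x + \<rho> = \<beta> + s" "\<beta> \<in> {0, \<alpha> 1, - \<alpha> 1}" "s \<in> S" by blast
      then have "b (x + \<rho>) (\<alpha> 1) = b \<beta> (\<alpha> 1)" using rad by (simp add: form)
      then have "2 * c = b \<beta> (\<alpha> 1)" using bx by simp
      then show ?thesis using \<beta>(2) norm1 by (auto simp: form)
    qed
    then show ?thesis using c by auto
  qed
  have zeroR: "0 \<in> R" using F.zero_S unfolding R by force
  have \<alpha>R: "\<alpha>' \<in> R" "- \<alpha>' \<in> R"
  proof -
    show "\<alpha>' \<in> R" unfolding R \<alpha>'_def using \<tau> by blast
    have "- \<alpha>' = - \<alpha> 1 + - \<tau>" by (simp add: \<alpha>'_def)
    then show "- \<alpha>' \<in> R" unfolding R using S_minus[OF \<tau>] by blast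
  qed
  have zero_rad: "0 \<in> form_radical b" by (simp add: form_radical_def form)
  have \<Phi>': "finite_part b ?Vd R = {0, \<alpha>', - \<alpha>'}"
  proof
    show "finite_part b ?Vd R \<subseteq> {0, \<alpha>', - \<alpha>'}"
      using R_cases unfolding finite_part_def by blast
    have "0 \<in> ?Vd" "\<alpha>' \<in> ?Vd" "- \<alpha>' \<in> ?Vd"
      using span_zero span_base[of \<alpha>' "{\<alpha>'}"] span_neg by auto
    then show "{0, \<alpha>', - \<alpha>'} \<subseteq> finite_part b ?Vd R"
      unfolding finite_part_def using \<alpha>R zeroR zero_rad by force
  qed
  have pos: "0 < b x x" if x: "x \<in> ?Vd" "x \<noteq> 0" for x
  proof -
    obtain c where c: "x = c *\<^sub>R \<alpha>'" using x(1) unfolding in_span by (rule exE)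
    then have "b x x = 2 * (c * c)" using normv by (simp add: form)
    moreover have "c * c > 0" using x(2) c by (auto simp: zero_less_mult_iff linorder_neq_iff)
    ultimately show ?thesis by simp
  qed
  have frs: "finite_root_system b ?Vd {0, \<alpha>', - \<alpha>'}"
    unfolding finite_root_system_def
  proof (intro conjI)
    show "\<forall>x\<in>?Vd. x \<noteq> 0 \<longrightarrow> 0 < b x x" using pos by blast
    have "- \<alpha>' \<in> ?Vd" using span_neg[OF span_base[of \<alpha>' "{\<alpha>'}"]] by simp
    then have "{0, \<alpha>', - \<alpha>'} \<subseteq> ?Vd" using span_zero span_base[of \<alpha>' "{\<alpha>'}"] by simp
    then show "span {0, \<alpha>', - \<alpha>'} = ?Vd"
      using span_mono[of "{\<alpha>'}" "{0, \<alpha>', - \<alpha>'}"] span_minimal[OF _ subspace_span] by blast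
    have nc: "coroot b (- \<alpha>') = - \<alpha>'"
      using normv by (simp add: coroot_def form)
    have bb: "b \<alpha>' (- \<alpha>') = -2" "b (- \<alpha>') \<alpha>' = -2" "b (- \<alpha>') (- \<alpha>') = 2" "b 0 v = 0" for v
      using normv by (simp_all add: form)
    show "\<forall>\<gamma>\<in>{0, \<alpha>', - \<alpha>'} - {0}. \<forall>\<beta>\<in>{0, \<alpha>', - \<alpha>'}.
        \<beta> - b \<beta> (coroot b \<gamma>) *\<^sub>R \<gamma> \<in> {0, \<alpha>', - \<alpha>'} \<and> b \<beta> (coroot b \<gamma>) \<in> \<int>"
    proof (intro ballI)
      fix \<gamma> \<beta> assume "\<gamma> \<in> {0, \<alpha>', - \<alpha>'} - {0}" "\<beta> \<in> {0, \<alpha>', - \<alpha>'}"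
      then have "\<gamma> = \<alpha>' \<or> \<gamma> = - \<alpha>'" "\<beta> = 0 \<or> \<beta> = \<alpha>' \<or> \<beta> = - \<alpha>'" by auto
      then show "\<beta> - b \<beta> (coroot b \<gamma>) *\<^sub>R \<gamma> \<in> {0, \<alpha>', - \<alpha>'} \<and> b \<beta> (coroot b \<gamma>) \<in> \<int>"
        by (elim disjE) (simp_all only: coroot nc bb normv, simp_all add: scaleR_2)
    qed
    show "\<forall>\<gamma>\<in>{0, \<alpha>', - \<alpha>'} - {0}. \<forall>t. t *\<^sub>R \<gamma> \<in> {0, \<alpha>', - \<alpha>'} - {0} \<longrightarrow> t = 1 \<or> t = - 1"
    proof (intro ballI allI impI)
      fix \<gamma> t assume \<gamma>: "\<gamma> \<in> {0, \<alpha>', - \<alpha>'} - {0}" and t: "t *\<^sub>R \<gamma> \<in> {0, \<alpha>', - \<alpha>'} - {0}"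
      have "\<gamma> = \<alpha>' \<or> \<gamma> = - \<alpha>'" using \<gamma> by auto
      then have "b \<gamma> \<gamma> = 2" using normv bb(3) by auto
      moreover have "t *\<^sub>R \<gamma> = \<alpha>' \<or> t *\<^sub>R \<gamma> = - \<alpha>'" using t by auto
      then have "b (t *\<^sub>R \<gamma>) (t *\<^sub>R \<gamma>) = 2" using normv bb(3) by auto
      ultimately have "t * t = 1" by (simp add: form)
      then show "t = 1 \<or> t = - 1" by (simp add: square_eq_1_iff)
    qed
  qed auto
  have fund: "fundamental_system {0, \<alpha>', - \<alpha>'} (ade_rank X) (\<lambda>_. \<alpha>')"
    unfolding fundamental_system_def rank
  proof (intro conjI ballI)
    have img: "(\<lambda>_. \<alpha>') ` {1..1::nat} = {\<alpha>'}" by auto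
    show "inj_on (\<lambda>_. \<alpha>') {1..1::nat}" by simp
    show "(\<lambda>_. \<alpha>') ` {1..1::nat} \<subseteq> {0, \<alpha>', - \<alpha>'}" by simp
    show "independent ((\<lambda>_. \<alpha>') ` {1..1::nat})" unfolding img using \<alpha>0 by (simp add: independent_insert)
    fix \<beta> assume \<beta>: "\<beta> \<in> {0, \<alpha>', - \<alpha>'}"
    define c :: int where "c = (if \<beta> = 0 then 0 else if \<beta> = \<alpha>' then 1 else - 1)"
    have "\<beta> = of_int c *\<^sub>R \<alpha>'" using \<beta> by (auto simp: c_def)
    then show "\<exists>k :: nat \<Rightarrow> int. \<beta> = (\<Sum>i\<in>{1..1}. of_int (k i) *\<^sub>R \<alpha>') \<and>
        ((\<forall>i\<in>{1..1}. 0 \<le> k i) \<or> (\<forall>i\<in>{1..1}. k i \<le> 0))"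
      by (intro exI[of _ "\<lambda>_. c"]) auto
  qed
  have type': "root_system_of_type b ?Vd {0, \<alpha>', - \<alpha>'} X"
    unfolding root_system_of_type_def
    using type frs fund by (auto simp: root_system_of_type_def rank coroot normv ade_cartan_def intro!: exI[of _ "\<lambda>_. \<alpha>'"])
  have spanS: "span S = form_radical b" using sl by (simp add: semilattice_in_def)
  have \<tau>': "\<tau> \<in> ?S"
  proof -
    have "0 + 2 *\<^sub>R \<tau> \<in> S" using S_shift(1)[OF F.zero_S \<tau>] .
    then show ?thesis by (intro image_eqI[of _ _ "0 + 2 *\<^sub>R \<tau>"]) (simp_all add: scaleR_2)
  qed
  have spanS': "span ?S = form_radical b"
  proof
    show "span ?S \<subseteq> form_radical b"
      unfolding spanS[symmetric] by (rule span_minimal) (use span_diff[OF span_base span_base, of _ S \<tau>] \<tau> in auto)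
    have "S \<subseteq> span ?S"
    proof
      fix s assume "s \<in> S"
      then have "s - \<tau> \<in> span ?S" "\<tau> \<in> span ?S" using span_base[of _ ?S] \<tau>' by auto
      then show "s \<in> span ?S" using span_add[of "s - \<tau>" ?S \<tau>] by simp
    qed
    then show "form_radical b \<subseteq> span ?S" unfolding spanS[symmetric] using span_minimal[OF _ subspace_span] by blast
  qed
  have S': "semilattice_in (form_radical b) ?S"
    unfolding semilattice_in_def
  proof (intro conjI ballI spanS' discrete_translation)
    show "discrete S" using sl by (simp add: semilattice_in_def)
    show "0 \<in> ?S" using \<tau> by force
    fix x y assume "x \<in> ?S" "y \<in> ?S"
    then obtain s t where st: "x = s - \<tau>" "y = t - \<tau>" "s \<in> S" "t \<in> S" by auto
    have "(s + 2 *\<^sub>R t) - 2 *\<^sub>R \<tau> \<in> S" "(s - 2 *\<^sub>R t) + 2 *\<^sub>R \<tau> \<in> S" using S_shift st \<tau> by blast+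
    then show "x + 2 *\<^sub>R y \<in> ?S" "x - 2 *\<^sub>R y \<in> ?S"
      unfolding st(1,2) by (force simp: algebra_simps)+
  qed
  have R': "R = {s + t | s t. s \<in> ?S \<and> t \<in> ?S} \<union> {\<beta> + s | \<beta> s. \<beta> \<in> {0, \<alpha>', - \<alpha>'} \<and> s \<in> ?S}"
  proof
    show "R \<subseteq> {s + t | s t. s \<in> ?S \<and> t \<in> ?S} \<union> {\<beta> + s | \<beta> s. \<beta> \<in> {0, \<alpha>', - \<alpha>'} \<and> s \<in> ?S}"
    proof
      fix x assume "x \<in> R"
      then consider s t where "x = s + t" "s \<in> S" "t \<in> S" | s where "x = \<alpha> 1 + s" "s \<in> S" | s where "x = - \<alpha> 1 + s" "s \<in> S"
        unfolding R using F.zero_S by force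
      then show "x \<in> {s + t | s t. s \<in> ?S \<and> t \<in> ?S} \<union> {\<beta> + s | \<beta> s. \<beta> \<in> {0, \<alpha>', - \<alpha>'} \<and> s \<in> ?S}"
      proof cases
        case 1
        have "x = (s + 2 *\<^sub>R \<tau> - \<tau>) + (t - \<tau>)" using 1 by (simp add: scaleR_2)
        then show ?thesis using 1 S_shift(1)[OF 1(2) \<tau>] by blast
      next
        case 2
        have "x = \<alpha>' + (s - \<tau>)" using 2 by (simp add: \<alpha>'_def)
        then show ?thesis using 2 by blast
      next
        case 3
        have "x = - \<alpha>' + (s + 2 *\<^sub>R \<tau> - \<tau>)" using 3 by (simp add: \<alpha>'_def scaleR_2)
        then show ?thesis using S_shift(1)[OF 3(2) \<tau>] by blast
      qed
    qed
    show "{s + t | s t. s \<in> ?S \<and> t \<in> ?S} \<union> {\<beta> + s | \<beta> s. \<beta> \<in> {0, \<alpha>', - \<alpha>'} \<and> s \<in> ?S} \<subseteq> R"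
    proof
      have sums: "(s - \<tau>) + (t - \<tau>) \<in> R" if "s \<in> S" "t \<in> S" for s t
      proof -
        have "(s - \<tau>) + (t - \<tau>) = (s - 2 *\<^sub>R \<tau>) + t" by (simp add: scaleR_2)
        then show ?thesis using S_shift(2)[OF that(1) \<tau>] that(2) unfolding R by blast
      qed
      fix x assume "x \<in> {s + t | s t. s \<in> ?S \<and> t \<in> ?S} \<union> {\<beta> + s | \<beta> s. \<beta> \<in> {0, \<alpha>', - \<alpha>'} \<and> s \<in> ?S}"
      then consider s t where "x = (s - \<tau>) + (t - \<tau>)" "s \<in> S" "t \<in> S" | s where "x = s - \<tau>" "s \<in> S"
        | s where "x = \<alpha>' + (s - \<tau>)" "s \<in> S" | s where "x = - \<alpha>' + (s - \<tau>)" "s \<in> S" by force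
      then show "x \<in> R"
      proof cases
        case 1
        then show ?thesis using sums by simp
      next
        case 2
        then show ?thesis using sums[OF 2(2) \<tau>] by simp
      next
        case 3
        then have "x = \<alpha> 1 + s" by (simp add: \<alpha>'_def)
        then show ?thesis using 3(2) \<Phi> unfolding R by blast
      next
        case 4
        then have "x = - \<alpha> 1 + (s - 2 *\<^sub>R \<tau>)" by (simp add: \<alpha>'_def scaleR_2)
        then show ?thesis using S_shift(2)[OF 4(2) \<tau>] \<Phi> unfolding R by blast
      qed
    qed
  qed
  let ?comb = "\<lambda>k :: nat \<Rightarrow> int. \<Sum>r\<in>{1..?n}. of_int (k r) *\<^sub>R \<sigma>' r"
  have comb_add: "\<exists>k''. ?comb k + ?comb k' = ?comb k''" for k k'
    by (rule exI[of _ "\<lambda>r. k r + k' r"]) (simp add: scaleR_add_left sum.distrib)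
  have comb_scale: "\<exists>k''. of_int c *\<^sub>R ?comb k = ?comb k''" for k and c :: int
    by (rule exI[of _ "\<lambda>r. c * k r"]) (simp add: scaleR_sum_right)
  have comb_sum: "\<exists>k. (\<Sum>x\<in>Q. g x) = ?comb k" if "finite Q" "\<And>x. x \<in> Q \<Longrightarrow> \<exists>k. g x = ?comb k" for Q :: "'z set" and g
    using that
  proof (induction Q rule: finite_induct)
    case empty
    show ?case by (rule exI[of _ "\<lambda>_. 0"]) simp
  next
    case (insert x Q)
    obtain k where k: "g x = ?comb k" using insert.prems[of x] by blast
    obtain k' where k': "(\<Sum>x\<in>Q. g x) = ?comb k'" using insert by blast
    show ?case unfolding sum.insert[OF insert.hyps] k k' by (rule comb_add)
  qed
  have S_comb: "\<exists>k. s = ?comb k" if s: "s \<in> S" for s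
  proof -
    obtain c :: "nat \<Rightarrow> int" where c: "s = (\<Sum>r\<in>{1..?n}. of_int (c r) *\<^sub>R \<sigma> r)" using F.S_int[OF s] by blast
    show ?thesis unfolding c
    proof (rule comb_sum)
      fix r assume "r \<in> {1..?n}"
      then obtain k where "\<sigma> r = ?comb k" using inverse by blast
      then show "\<exists>k. of_int (c r) *\<^sub>R \<sigma> r = ?comb k" using comb_scale[of "c r" k] by simp
    qed simp
  qed
  have \<sigma>'S: "\<sigma>' r \<in> ?S" if "r \<in> {1..?n}" for r
    using basis[OF that] by (intro image_eqI[of _ _ "\<sigma>' r + \<tau>"]) auto
  have S'_comb: "\<exists>k. x = ?comb k" if x: "x \<in> ?S" for x
  proof -
    obtain s where s: "s \<in> S" "x = s - \<tau>" using x by auto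
    obtain k k' where k: "s = ?comb k" "\<tau> = ?comb k'" using S_comb[OF s(1)] S_comb[OF \<tau>] by blast
    have "x = ?comb (\<lambda>r. k r - k' r)"
      unfolding s(2) k by (simp add: scaleR_diff_left sum_subtractf)
    then show "\<exists>k. x = ?comb k" by (intro exI[of _ "\<lambda>r. k r - k' r"])
  qed
  have ib: "int_basis (int_span ?S) ?n \<sigma>'"
    unfolding int_basis_def
  proof (intro conjI allI impI ballI)
    show "int_span ?S = {\<Sum>r\<in>{1..?n}. of_int (k r) *\<^sub>R \<sigma>' r | k :: nat \<Rightarrow> int. True}"
    proof
      show "int_span ?S \<subseteq> {\<Sum>r\<in>{1..?n}. of_int (k r) *\<^sub>R \<sigma>' r | k :: nat \<Rightarrow> int. True}"
      proof
        fix x assume "x \<in> int_span ?S"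
        then obtain Q and c :: "'a \<Rightarrow> int" where Q: "x = (\<Sum>y\<in>Q. of_int (c y) *\<^sub>R y)" "finite Q" "Q \<subseteq> ?S"
          unfolding int_span_def by blast
        have "\<exists>k. (\<Sum>y\<in>Q. of_int (c y) *\<^sub>R y) = ?comb k"
        proof (rule comb_sum[OF Q(2)])
          fix y assume "y \<in> Q"
          then obtain k where k: "y = ?comb k" using Q(3) S'_comb by blast
          show "\<exists>k. of_int (c y) *\<^sub>R y = ?comb k" using comb_scale[of "c y" k] k by simp
        qed
        then show "x \<in> {\<Sum>r\<in>{1..?n}. of_int (k r) *\<^sub>R \<sigma>' r | k :: nat \<Rightarrow> int. True}" unfolding Q(1) by blast
      qed
    next
      have "?comb k \<in> int_span ?S" for k
      proof -
        have scale: "\<exists>Q c. of_int i *\<^sub>R y = (\<Sum>y\<in>Q. of_int (c y) *\<^sub>R y) \<and> finite Q \<and> Q \<subseteq> ?S" if "y \<in> ?S" for i :: int and y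
          using that by (intro exI[of _ "{y}"] exI[of _ "\<lambda>_. i"]) auto
        have "(\<Sum>r\<in>P. of_int (k r) *\<^sub>R \<sigma>' r) \<in> int_span ?S" if "finite P" "P \<subseteq> {1..?n}" for P
          using that
        proof (induction P rule: finite_induct)
          case empty
          show ?case unfolding int_span_def by (auto intro!: exI[of _ "{}"])
        next
          case (insert r P)
          obtain Q and c :: "'a \<Rightarrow> int" where Q: "(\<Sum>r\<in>P. of_int (k r) *\<^sub>R \<sigma>' r) = (\<Sum>y\<in>Q. of_int (c y) *\<^sub>R y)"
            "finite Q" "Q \<subseteq> ?S"
            using insert unfolding int_span_def by blast
          let ?c = "\<lambda>y. (if y \<in> Q then c y else 0) + (if y = \<sigma>' r then k r else 0)"
          have "(\<Sum>y\<in>insert (\<sigma>' r) Q. of_int (?c y) *\<^sub>R y) =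
              (\<Sum>y\<in>insert (\<sigma>' r) Q. (if y \<in> Q then of_int (c y) *\<^sub>R y else 0)) +
              (\<Sum>y\<in>insert (\<sigma>' r) Q. (if y = \<sigma>' r then of_int (k r) *\<^sub>R \<sigma>' r else 0))"
            unfolding sum.distrib[symmetric] by (intro sum.cong) (auto simp: scaleR_add_left)
          also have "(\<Sum>y\<in>insert (\<sigma>' r) Q. (if y \<in> Q then of_int (c y) *\<^sub>R y else 0)) = (\<Sum>y\<in>Q. of_int (c y) *\<^sub>R y)"
            using Q(2) by (intro sum.mono_neutral_cong_right) auto
          also have "(\<Sum>y\<in>insert (\<sigma>' r) Q. (if y = \<sigma>' r then of_int (k r) *\<^sub>R \<sigma>' r else 0)) = of_int (k r) *\<^sub>R \<sigma>' r"
            using Q(2) by (subst sum.delta) auto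
          finally have "(\<Sum>r\<in>insert r P. of_int (k r) *\<^sub>R \<sigma>' r) = (\<Sum>y\<in>insert (\<sigma>' r) Q. of_int (?c y) *\<^sub>R y)"
            using insert.hyps Q(1) by (simp add: add.commute)
          moreover have "insert (\<sigma>' r) Q \<subseteq> ?S" using Q(3) \<sigma>'S[of r] insert.prems by blast
          ultimately show ?case
            unfolding int_span_def mem_Collect_eq using Q(2)
            by (intro exI[of _ "insert (\<sigma>' r) Q"] exI[of _ ?c] conjI) (assumption | simp)+
        qed
        then show ?thesis by blast
      qed
      then show "{\<Sum>r\<in>{1..?n}. of_int (k r) *\<^sub>R \<sigma>' r | k :: nat \<Rightarrow> int. True} \<subseteq> int_span ?S" by blast
    qed
  next
    fix k :: "nat \<Rightarrow> int" and r
    assume zero: "?comb k = 0" and r: "r \<in> {1..?n}"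
    have bil: "bilinear b" using ears by (simp add: ears_def psd_form_def)
    have "form_radical b \<subseteq> span (\<sigma>' ` {1..?n})"
      unfolding spanS[symmetric]
    proof (rule span_minimal[OF _ subspace_span], rule subsetI)
      fix s assume "s \<in> S"
      then obtain k where "s = ?comb k" using S_comb by blast
      then show "s \<in> span (\<sigma>' ` {1..?n})" by (simp only:) (intro span_sum span_scale span_base imageI)
    qed
    moreover have "\<sigma>' ` {1..?n} \<subseteq> form_radical b" using \<sigma>'S span_base unfolding spanS'[symmetric] by blast
    ultimately have "real_of_int (k r) = 0"
      using lattice_basis_independent[OF subspace_form_radical[OF bil] nullity_def[symmetric], of \<sigma>' "\<lambda>r. of_int (k r)" r]
        zero r by blast
    then show "k r = 0" by simp
  qed
  show "simply_laced_data b R (span {\<alpha> 1 + \<tau>}) ?S X (\<lambda>_. \<alpha> 1 + \<tau>) \<sigma>'"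
    unfolding simply_laced_data_def \<alpha>'_def[symmetric] \<Phi>'
  proof (intro conjI ears subspace_span type' S' R' fund ballI normv ib)
    show "?Vd \<inter> form_radical b = {0}"
      using pos span_zero zero_rad by (force simp: form_radical_def)
    have "v \<in> {x + y | x y. x \<in> ?Vd \<and> y \<in> form_radical b}" for v
    proof -
      have "v \<in> {x + y | x y. x \<in> Vd \<and> y \<in> form_radical b}" unfolding Vd by simp
      then obtain p q where pq: "v = p + q" "p \<in> Vd" "q \<in> form_radical b" by blast
      have "p \<in> span (\<alpha> ` {1..1})" using pq(2) F.span_simple rank by simp
      then have "p \<in> span {\<alpha> 1}" by simp
      then obtain c where c: "p = c *\<^sub>R \<alpha> 1" by (auto simp: span_singleton)
      have "v = c *\<^sub>R \<alpha>' + (q - c *\<^sub>R \<tau>)" using pq(1) c by (simp add: \<alpha>'_def algebra_simps)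
      moreover have "c *\<^sub>R \<alpha>' \<in> ?Vd" using in_span by blast
      moreover have "q - c *\<^sub>R \<tau> \<in> form_radical b"
        using pq(3) rad[OF \<tau>] by (simp add: form_radical_def form)
      ultimately show ?thesis by blast
    qed
    then show "{x + y | x y. x \<in> ?Vd \<and> y \<in> form_radical b} = UNIV" by blast
    show "\<sigma>' ` {1..?n} \<subseteq> ?S" using \<sigma>'S by blast
  qed
  show "similar_in (form_radical b) S ?S"
    unfolding similar_in_def
  proof (intro exI[of _ id] conjI linear_id bexI[OF _ \<tau>'])
    show "id ` S = (\<lambda>s. s + \<tau>) ` ?S" by (simp add: image_image)
  qed simp
qed

lemma subset_123_eq_iff:
  assumes "J \<subseteq> {1, 2, 3 :: nat}" "K \<subseteq> {1, 2, 3}"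
  shows "J = K \<longleftrightarrow> (1 \<in> J \<longleftrightarrow> 1 \<in> K) \<and> (2 \<in> J \<longleftrightarrow> 2 \<in> K) \<and> (3 \<in> J \<longleftrightarrow> 3 \<in> K)"
  (is "_ \<longleftrightarrow> ?eq")
proof (intro iffI)
  assume ?eq
  then have "x \<in> J \<longleftrightarrow> x \<in> K" if "x \<in> {1, 2, 3}" for x using that by auto
  then show "J = K" using assms by blast
qed blast+

lemma Pow_123: "Pow {1, 2, 3 :: nat} = {{}, {1}, {2}, {3}, {1, 2}, {1, 3}, {2, 3}, {1, 2, 3}}" (is "_ = ?P")
proof
  show "?P \<subseteq> Pow {1, 2, 3}" by simp
  show "Pow {1, 2, 3} \<subseteq> ?P"
  proof
    fix J assume "J \<in> Pow {1, 2, 3 :: nat}"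
    then have "J \<subseteq> {1, 2, 3}" by simp
    then show "J \<in> ?P"
      by (cases "1 \<in> J"; cases "2 \<in> J"; cases "3 \<in> J") (simp_all add: subset_123_eq_iff)
  qed
qed

lemma sum_Pow_123:
  fixes f :: "nat set \<Rightarrow> nat"
  shows "sum f (Pow {1, 2, 3}) = f {} + (f {1} + (f {2} + (f {3} + (f {1, 2} + (f {1, 3} + (f {2, 3} + f {1, 2, 3}))))))"
  unfolding Pow_123 by (simp add: subset_123_eq_iff)

text \<open>The index as a sum over the subsets, so that it can be computed from the list of the members of \<open>D\<close>.\<close>

lemma card_family_123:
  assumes "D \<subseteq> Pow {1, 2, 3 :: nat}"
  shows "card D = of_bool ({} \<in> D) + (of_bool ({1} \<in> D) + (of_bool ({2} \<in> D) + (of_bool ({3} \<in> D) +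
    (of_bool ({1, 2} \<in> D) + (of_bool ({1, 3} \<in> D) + (of_bool ({2, 3} \<in> D) + of_bool ({1, 2, 3} \<in> D)))))))"
proof -
  have "card D = (\<Sum>J\<in>Pow {1, 2, 3 :: nat}. of_bool (J \<in> D))"
    using assms by (simp add: sum_of_bool_eq Int_absorb1)
  then show ?thesis unfolding sum_Pow_123 .
qed

lemma standard_supp_class_cases:
  assumes "standard_supp_class n m D"
  obtains "n = 0" "m = 0" "D = {{}}" | "n = 1" "m = 1" "D = {{}, {1}}"
    | "n = 2" "m = 2" "D = {{}, {1}, {2}}" | "n = 2" "m = 3" "D = {{}, {1}, {2}, {1, 2}}"
    | "n = 3" "m = 3" "D = {{}, {1}, {2}, {3}}" | "n = 3" "m = 4" "D = {{}, {1}, {2}, {3}, {2, 3}}"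
    | "n = 3" "m = 5" "D = {{}, {1}, {2}, {3}, {1, 3}, {2, 3}}"
    | "n = 3" "m = 6" "D = {{}, {1}, {2}, {3}, {1, 2}, {1, 3}, {2, 3}}"
    | "n = 3" "m = 7" "D = {{}, {1}, {2}, {3}, {1, 2}, {1, 3}, {2, 3}, {1, 2, 3}}"
  using assms unfolding standard_supp_class_def Pow_123 insert_iff prod.inject empty_iff
  by (elim disjE conjE) simp_all

lemma index_pairs_small:
  "index_pairs 0 = {}" "index_pairs 1 = {}" "index_pairs 2 = {(1, 2)}" "index_pairs 3 = {(1, 2), (1, 3), (2, 3)}"
  by (auto simp: index_pairs_def)

lemma standard_supp_class_pairs:
  assumes "standard_supp_class n m D" "J \<in> D" "r \<in> J" "s \<in> J" "r < s"
  shows "{r, s} \<in> D"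
proof -
  from assms(1) have "\<forall>J\<in>D. \<forall>r\<in>J. \<forall>s\<in>J. r < s \<longrightarrow> {r, s} \<in> D"
    by (cases rule: standard_supp_class_cases) simp_all
  then show ?thesis using assms(2-) by blast
qed

lemma standard_supp_class_n_table:
  assumes "standard_supp_class n m D" "(r, s) \<in> index_pairs n"
  shows "n_table n m r s = (if {r, s} \<in> D then 1 else 2)"
proof -
  from assms(1) have "\<forall>p\<in>index_pairs n. n_table n m (fst p) (snd p) = (if {fst p, snd p} \<in> D then 1 else 2)"
    by (cases rule: standard_supp_class_cases) (simp_all add: index_pairs_small n_table_def subset_123_eq_iff)
  then show ?thesis using assms(2) by fastforce
qed

lemma card_standard_supp_class:
  assumes "standard_supp_class n m D" shows "card D = m + 1"
  using assms by (cases rule: standard_supp_class_cases) (simp_all add: card_insert_if subset_123_eq_iff)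

lemma standard_supp_class_3_subset: "standard_supp_class 3 m D \<Longrightarrow> D \<subseteq> Pow {1, 2, 3}"
  by (erule standard_supp_class_cases) simp_all

lemma standard_supp_class_3:
  "standard_supp_class 3 3 {{}, {1}, {2}, {3}}"
  "standard_supp_class 3 4 {{}, {1}, {2}, {3}, {2, 3}}"
  "standard_supp_class 3 5 {{}, {1}, {2}, {3}, {1, 3}, {2, 3}}"
  "standard_supp_class 3 6 {{}, {1}, {2}, {3}, {1, 2}, {1, 3}, {2, 3}}"
  "standard_supp_class 3 7 {{}, {1}, {2}, {3}, {1, 2}, {1, 3}, {2, 3}, {1, 2, 3}}"
  unfolding standard_supp_class_def Pow_123 by ((rule insertI1 | rule insertI2)+)+

definition parity_set :: "(nat \<Rightarrow> int) \<Rightarrow> nat set" where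
  "parity_set k = (if odd (k 1) then insert 1 else id) ((if odd (k 2) then insert 2 else id)
     (if odd (k 3) then {3} else {}))"

definition triple :: "'a \<Rightarrow> 'a \<Rightarrow> 'a \<Rightarrow> nat \<Rightarrow> 'a" where
  "triple p q r i = (if i = 1 then p else if i = 2 then q else r)"

lemma triple_simps [simp]: "triple p q r 1 = p" "triple p q r 2 = q" "triple p q r 3 = r"
  by (simp_all add: triple_def)


text \<open>Every family of subsets of \<open>{1, 2, 3}\<close> that contains the empty set and the singletons is, up to an
  affine bijection modulo 2, one of the standard ones. The matrix \<open>x\<close> of the bijection is integral with inverse
  \<open>y\<close>, and \<open>t\<close> is its translation part.\<close>

lemma affine_normal_form_123:
  assumes D_sub: "D \<subseteq> Pow {1, 2, 3 :: nat}" and mem: "{} \<in> D" "{1} \<in> D" "{2} \<in> D" "{3} \<in> D"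
  obtains x y t E where
    "\<forall>r\<in>{1, 2, 3}. \<forall>q\<in>{1, 2, 3}. (\<Sum>p\<in>{1, 2, 3}. y r p * x p q) = (if r = q then 1 else (0 :: int))"
    "parity_set t \<in> D" "\<forall>r\<in>{1, 2, 3}. parity_set (\<lambda>q. x r q + t q) \<in> D"
    "\<forall>J\<in>Pow {1, 2, 3}. parity_set (\<lambda>q. (\<Sum>r\<in>J. x r q) + t q) \<in> D \<longleftrightarrow> J \<in> E"
    "standard_supp_class 3 (card D - 1) E"
proof -
  note normal = that
  note normalize_simps = Pow_123 parity_set_def mem card_family_123[OF D_sub] standard_supp_class_3
    subset_123_eq_iff
  have case1: thesis if "{1, 2} \<notin> D" "{1, 3} \<notin> D" "{2, 3} \<notin> D" "{1, 2, 3} \<notin> D"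
    by (rule normal[where t = "triple 0 0 0" and x = "triple (triple 1 0 0) (triple 0 1 0) (triple 0 0 1)"
          and y = "triple (triple 1 0 0) (triple 0 1 0) (triple 0 0 1)" and E = "{{}, {1}, {2}, {3}}"])
      (simp_all add: normalize_simps that)
  have case2: thesis if "{1, 2} \<in> D" "{1, 3} \<notin> D" "{2, 3} \<notin> D" "{1, 2, 3} \<notin> D"
    by (rule normal[where t = "triple 0 0 0" and x = "triple (triple 0 0 1) (triple 0 1 0) (triple 1 0 0)"
          and y = "triple (triple 0 0 1) (triple 0 1 0) (triple 1 0 0)" and E = "{{}, {1}, {2}, {3}, {2, 3}}"])
      (simp_all add: normalize_simps that)
  have case3: thesis if "{1, 2} \<notin> D" "{1, 3} \<in> D" "{2, 3} \<notin> D" "{1, 2, 3} \<notin> D"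
    by (rule normal[where t = "triple 0 0 0" and x = "triple (triple 0 1 0) (triple 1 0 0) (triple 0 0 1)"
          and y = "triple (triple 0 1 0) (triple 1 0 0) (triple 0 0 1)" and E = "{{}, {1}, {2}, {3}, {2, 3}}"])
      (simp_all add: normalize_simps that)
  have case4: thesis if "{1, 2} \<notin> D" "{1, 3} \<notin> D" "{2, 3} \<in> D" "{1, 2, 3} \<notin> D"
    by (rule normal[where t = "triple 0 0 0" and x = "triple (triple 1 0 0) (triple 0 1 0) (triple 0 0 1)"
          and y = "triple (triple 1 0 0) (triple 0 1 0) (triple 0 0 1)" and E = "{{}, {1}, {2}, {3}, {2, 3}}"])
      (simp_all add: normalize_simps that)
  have case5: thesis if "{1, 2} \<notin> D" "{1, 3} \<notin> D" "{2, 3} \<notin> D" "{1, 2, 3} \<in> D"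
    by (rule normal[where t = "triple 1 0 0" and x = "triple (triple 1 0 0) (triple 0 1 1) (triple 1 0 1)"
          and y = "triple (triple 1 0 0) (triple 1 1 (-1)) (triple (-1) 0 1)" and E = "{{}, {1}, {2}, {3}, {2, 3}}"])
      (simp_all add: normalize_simps that)
  have case6: thesis if "{1, 2} \<in> D" "{1, 3} \<in> D" "{2, 3} \<notin> D" "{1, 2, 3} \<notin> D"
    by (rule normal[where t = "triple 0 0 0" and x = "triple (triple 1 0 1) (triple 0 1 0) (triple 1 0 0)"
          and y = "triple (triple 0 0 1) (triple 0 1 0) (triple 1 0 (-1))" and E = "{{}, {1}, {2}, {3}, {1, 3}, {2, 3}}"])
      (simp_all add: normalize_simps that)
  have case7: thesis if "{1, 2} \<in> D" "{1, 3} \<notin> D" "{2, 3} \<in> D" "{1, 2, 3} \<notin> D"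
    by (rule normal[where t = "triple 0 0 0" and x = "triple (triple 1 0 0) (triple 0 1 1) (triple 0 1 0)"
          and y = "triple (triple 1 0 0) (triple 0 0 1) (triple 0 1 (-1))" and E = "{{}, {1}, {2}, {3}, {1, 3}, {2, 3}}"])
      (simp_all add: normalize_simps that)
  have case8: thesis if "{1, 2} \<in> D" "{1, 3} \<notin> D" "{2, 3} \<notin> D" "{1, 2, 3} \<in> D"
    by (rule normal[where t = "triple 0 0 0" and x = "triple (triple 0 0 1) (triple 0 1 0) (triple 1 1 0)"
          and y = "triple (triple 0 (-1) 1) (triple 0 1 0) (triple 1 0 0)" and E = "{{}, {1}, {2}, {3}, {1, 3}, {2, 3}}"])
      (simp_all add: normalize_simps that)
  have case9: thesis if "{1, 2} \<notin> D" "{1, 3} \<in> D" "{2, 3} \<in> D" "{1, 2, 3} \<notin> D"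
    by (rule normal[where t = "triple 0 0 0" and x = "triple (triple 1 0 0) (triple 0 1 0) (triple 0 0 1)"
          and y = "triple (triple 1 0 0) (triple 0 1 0) (triple 0 0 1)" and E = "{{}, {1}, {2}, {3}, {1, 3}, {2, 3}}"])
      (simp_all add: normalize_simps that)
  have case10: thesis if "{1, 2} \<notin> D" "{1, 3} \<in> D" "{2, 3} \<notin> D" "{1, 2, 3} \<in> D"
    by (rule normal[where t = "triple 0 0 0" and x = "triple (triple 1 0 0) (triple 0 1 0) (triple 1 0 1)"
          and y = "triple (triple 1 0 0) (triple 0 1 0) (triple (-1) 0 1)" and E = "{{}, {1}, {2}, {3}, {1, 3}, {2, 3}}"])
      (simp_all add: normalize_simps that)
  have case11: thesis if "{1, 2} \<notin> D" "{1, 3} \<notin> D" "{2, 3} \<in> D" "{1, 2, 3} \<in> D"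
    by (rule normal[where t = "triple 0 0 0" and x = "triple (triple 1 0 0) (triple 0 1 0) (triple 0 1 1)"
          and y = "triple (triple 1 0 0) (triple 0 1 0) (triple 0 (-1) 1)" and E = "{{}, {1}, {2}, {3}, {1, 3}, {2, 3}}"])
      (simp_all add: normalize_simps that)
  have case12: thesis if "{1, 2} \<in> D" "{1, 3} \<in> D" "{2, 3} \<in> D" "{1, 2, 3} \<notin> D"
    by (rule normal[where t = "triple 0 0 0" and x = "triple (triple 1 0 0) (triple 0 1 0) (triple 0 0 1)"
          and y = "triple (triple 1 0 0) (triple 0 1 0) (triple 0 0 1)" and E = "{{}, {1}, {2}, {3}, {1, 2}, {1, 3}, {2, 3}}"])
      (simp_all add: normalize_simps that)
  have case13: thesis if "{1, 2} \<in> D" "{1, 3} \<in> D" "{2, 3} \<notin> D" "{1, 2, 3} \<in> D"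
    by (rule normal[where t = "triple 0 0 0" and x = "triple (triple 1 0 0) (triple 0 1 0) (triple 1 0 1)"
          and y = "triple (triple 1 0 0) (triple 0 1 0) (triple (-1) 0 1)" and E = "{{}, {1}, {2}, {3}, {1, 2}, {1, 3}, {2, 3}}"])
      (simp_all add: normalize_simps that)
  have case14: thesis if "{1, 2} \<in> D" "{1, 3} \<notin> D" "{2, 3} \<in> D" "{1, 2, 3} \<in> D"
    by (rule normal[where t = "triple 0 0 0" and x = "triple (triple 1 0 0) (triple 0 1 0) (triple 0 1 1)"
          and y = "triple (triple 1 0 0) (triple 0 1 0) (triple 0 (-1) 1)" and E = "{{}, {1}, {2}, {3}, {1, 2}, {1, 3}, {2, 3}}"])
      (simp_all add: normalize_simps that)
  have case15: thesis if "{1, 2} \<notin> D" "{1, 3} \<in> D" "{2, 3} \<in> D" "{1, 2, 3} \<in> D"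
    by (rule normal[where t = "triple 0 0 0" and x = "triple (triple 1 0 0) (triple 0 1 1) (triple 0 0 1)"
          and y = "triple (triple 1 0 0) (triple 0 1 (-1)) (triple 0 0 1)" and E = "{{}, {1}, {2}, {3}, {1, 2}, {1, 3}, {2, 3}}"])
      (simp_all add: normalize_simps that)
  have case16: thesis if "{1, 2} \<in> D" "{1, 3} \<in> D" "{2, 3} \<in> D" "{1, 2, 3} \<in> D"
    by (rule normal[where t = "triple 0 0 0" and x = "triple (triple 1 0 0) (triple 0 1 0) (triple 0 0 1)"
          and y = "triple (triple 1 0 0) (triple 0 1 0) (triple 0 0 1)" and E = "{{}, {1}, {2}, {3}, {1, 2}, {1, 3}, {2, 3}, {1, 2, 3}}"])
      (simp_all add: normalize_simps that)
  show thesis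
    by (cases "{1, 2} \<in> D"; cases "{1, 3} \<in> D"; cases "{2, 3} \<in> D"; cases "{1, 2, 3} \<in> D";
      (rule case1 case2 case3 case4 case5 case6 case7 case8 case9 case10 case11 case12 case13 case14 case15 case16;
       assumption))
qed

context simply_laced_frame begin

lemma empty_in_D: "{} \<in> D" and singleton_in_D: "r \<in> {1..\<nu>} \<Longrightarrow> {r} \<in> D"
  using in_D_iff[of "{}"] in_D_iff[of "{r}"] zero_S sigma_S by auto

end

text \<open>A new origin \<open>t\<close> and a new basis \<open>x\<close> of the lattice, with inverse matrix \<open>y\<close>, change the supporting
  class by an affine map modulo 2.\<close>

lemma rank1_change_of_supp_class:
  assumes data: "simply_laced_data b R Vd S X \<alpha> \<sigma>" and rank: "ade_rank X = 1"
    and frame: "simply_laced_frame b Vd \<Phi> (ade_rank X) \<alpha> \<sigma> \<nu> S R"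
    and inverse: "\<And>r q. r \<in> {1..\<nu>} \<Longrightarrow> q \<in> {1..\<nu>} \<Longrightarrow>
      (\<Sum>p\<in>{1..\<nu>}. y r p * x p q) = (if r = q then 1 else (0 :: int))"
    and t: "{q \<in> {1..\<nu>}. odd (t q)} \<in> supp_class \<nu> \<sigma> S"
    and x: "\<And>r. r \<in> {1..\<nu>} \<Longrightarrow> {q \<in> {1..\<nu>}. odd (x r q + t q)} \<in> supp_class \<nu> \<sigma> S"
  obtains Vd' S' \<alpha>' \<sigma>' where "simply_laced_data b R Vd' S' X \<alpha>' \<sigma>'" "similar_in (form_radical b) S S'"
    "\<And>J. J \<subseteq> {1..\<nu>} \<Longrightarrow> J \<in> supp_class \<nu> \<sigma>' S' \<longleftrightarrow>
      {q \<in> {1..\<nu>}. odd ((\<Sum>r\<in>J. x r q) + t q)} \<in> supp_class \<nu> \<sigma> S"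
proof -
  interpret F: simply_laced_frame b Vd \<Phi> "ade_rank X" \<alpha> \<sigma> \<nu> S R by (rule frame)
  have n: "nullity b = \<nu>" by (rule F.nullity)
  define \<tau> where "\<tau> = F.lattice_point t"
  define \<sigma>' where "\<sigma>' r = F.lattice_point (x r)" for r
  have add: "F.lattice_point k + F.lattice_point k' = F.lattice_point (\<lambda>q. k q + k' q)" for k k'
    by (simp add: F.lattice_point_def scaleR_add_left sum.distrib)
  have sum: "(\<Sum>r\<in>J. F.lattice_point (f r)) = F.lattice_point (\<lambda>q. \<Sum>r\<in>J. f r q)" for J and f :: "nat \<Rightarrow> nat \<Rightarrow> int"
    unfolding F.lattice_point_def by (subst sum.swap) (simp add: scaleR_sum_left)
  have \<tau>: "\<tau> \<in> S" unfolding \<tau>_def F.lattice_point_in_S_iff by (rule t)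
  have basis: "\<sigma>' r + \<tau> \<in> S" if "r \<in> {1..nullity b}" for r
    unfolding \<sigma>'_def \<tau>_def add F.lattice_point_in_S_iff using x that n by simp
  have inv: "\<exists>k :: nat \<Rightarrow> int. \<sigma> r = (\<Sum>q\<in>{1..nullity b}. of_int (k q) *\<^sub>R \<sigma>' q)" if r: "r \<in> {1..nullity b}" for r
  proof (rule exI[of _ "y r"])
    have "(\<Sum>p\<in>{1..\<nu>}. of_int (y r p) *\<^sub>R \<sigma>' p) = (\<Sum>p\<in>{1..\<nu>}. F.lattice_point (\<lambda>q. y r p * x p q))"
      by (intro sum.cong refl) (simp add: \<sigma>'_def F.lattice_point_def scaleR_sum_right)
    also have "\<dots> = F.lattice_point (\<lambda>q. if r = q then 1 else 0)"
      unfolding sum F.lattice_point_eq_iff using inverse r n by simp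
    also have "\<dots> = \<sigma> r"
      using r n by (simp add: F.lattice_point_def if_distrib[of of_int] if_distrib[of "\<lambda>t. t *\<^sub>R _"] cong: if_cong)
    finally show "\<sigma> r = (\<Sum>q\<in>{1..nullity b}. of_int (y r q) *\<^sub>R \<sigma>' q)" by (simp add: n)
  qed
  note new = rank1_change_of_origin_and_basis[OF data rank \<tau> basis inv]
  let ?S = "(\<lambda>s. s - \<tau>) ` S"
  interpret F': simply_laced_frame b "span {\<alpha> 1 + \<tau>}" "finite_part b (span {\<alpha> 1 + \<tau>}) R" "ade_rank X"
    "\<lambda>_. \<alpha> 1 + \<tau>" \<sigma>' "nullity b" ?S R
    by (rule simply_laced_frame_if_data[OF new(1)])
  have "J \<in> supp_class \<nu> \<sigma>' ?S \<longleftrightarrow> {q \<in> {1..\<nu>}. odd ((\<Sum>r\<in>J. x r q) + t q)} \<in> supp_class \<nu> \<sigma> S"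
    if J: "J \<subseteq> {1..\<nu>}" for J
  proof -
    have "J \<in> supp_class \<nu> \<sigma>' ?S \<longleftrightarrow> (\<Sum>r\<in>J. \<sigma>' r) \<in> ?S"
      using F'.in_D_iff[of J] J n by simp
    also have "\<dots> \<longleftrightarrow> (\<Sum>r\<in>J. \<sigma>' r) + \<tau> \<in> S"
      by (metis (no_types, lifting) add_diff_cancel_right' diff_add_cancel image_iff)
    also have "(\<Sum>r\<in>J. \<sigma>' r) + \<tau> = F.lattice_point (\<lambda>q. (\<Sum>r\<in>J. x r q) + t q)"
      unfolding \<sigma>'_def \<tau>_def sum add ..
    finally show ?thesis unfolding F.lattice_point_in_S_iff .
  qed
  then show thesis using that[OF new] by blast
qed

text \<open>In nullity at most 2 the supporting class is already standard. In nullity 3 it becomes standard by a change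
  of origin and basis.\<close>

lemma rank1_normal_form:
  assumes data: "simply_laced_data b R Vd S X \<alpha> \<sigma>" and rank: "ade_rank X = 1"
    and \<nu>: "\<nu> = nullity b" "\<nu> \<le> 3" and m: "m = sl_index \<nu> \<sigma> S"
  shows "\<exists>Vd' S' \<alpha>' \<sigma>'. simply_laced_data b R Vd' S' X \<alpha>' \<sigma>' \<and> similar_in (form_radical b) S S' \<and>
    sl_index \<nu> \<sigma>' S' = m \<and> standard_supp_class \<nu> m (supp_class \<nu> \<sigma>' S')"
    (is "?normal")
proof -
  interpret F: simply_laced_frame b Vd "finite_part b Vd R" "ade_rank X" \<alpha> \<sigma> \<nu> S R
    unfolding \<nu> by (rule simply_laced_frame_if_data[OF data])
  let ?D = "supp_class \<nu> \<sigma> S"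
  have refl: "?normal" if std: "standard_supp_class \<nu> (card ?D - 1) ?D"
  proof -
    have sim: "similar_in (form_radical b) S S"
      unfolding similar_in_def
      by (intro exI[of _ id] conjI linear_id bexI[of _ 0] F.zero_S) simp_all
    have idx: "sl_index \<nu> \<sigma> S = m" using m by (rule sym)
    have "standard_supp_class \<nu> m ?D" unfolding m sl_index_def by (rule std)
    then show ?thesis
      by (intro exI[of _ Vd] exI[of _ S] exI[of _ \<alpha>] exI[of _ \<sigma>] conjI data sim idx)
  qed
  have sub: "?D \<subseteq> Pow {1..\<nu>}" using F.D_subset by blast
  have \<nu>_cases: "\<nu> = 0 \<or> \<nu> = 1 \<or> \<nu> = 2 \<or> \<nu> = 3" using \<nu>(2) by auto
  have 0: "{} \<in> ?D" by (rule F.empty_in_D)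
  have 1: "{r} \<in> ?D" if "1 \<le> r" "r \<le> \<nu>" for r using F.singleton_in_D that by simp
  from \<nu>_cases show ?thesis
  proof (elim disjE)
    assume v: "\<nu> = 0"
    have "?D \<subseteq> {{}}" using sub unfolding v by simp
    then have D: "?D = {{}}" using 0 by (intro subset_antisym) simp_all
    show ?thesis
    proof (rule refl)
      show "standard_supp_class \<nu> (card ?D - 1) ?D" unfolding D by (simp add: v standard_supp_class_def)
    qed
  next
    assume v: "\<nu> = 1"
    have "Pow {1..1} = {{}, {1 :: nat}}" by (simp add: Pow_insert insert_commute)
    with sub have "?D \<subseteq> {{}, {1}}" unfolding v by simp
    moreover have "{1} \<in> ?D" using 1[of 1] v by simp
    ultimately have D: "?D = {{}, {1}}" using 0 by (intro subset_antisym) simp_all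
    show ?thesis
    proof (rule refl)
      show "standard_supp_class \<nu> (card ?D - 1) ?D" unfolding D by (simp add: v standard_supp_class_def)
    qed
  next
    assume v: "\<nu> = 2"
    have set2: "{1..2} = {1, 2 :: nat}" by auto
    have subsets: "J \<in> {{}, {1}, {2}, {1, 2}}" if "J \<subseteq> {1, 2 :: nat}" for J
    proof -
      have "J \<subseteq> {1, 2, 3}" "3 \<notin> J" using that by auto
      then show ?thesis by (cases "1 \<in> J"; cases "2 \<in> J") (simp_all add: subset_123_eq_iff)
    qed
    have s: "?D \<subseteq> {{}, {1}, {2}, {1, 2}}"
    proof (rule subsetI)
      fix J assume "J \<in> ?D"
      then have "J \<in> Pow {1..\<nu>}" by (rule subsetD[OF sub])
      then have "J \<subseteq> {1, 2}" by (simp only: v set2 Pow_iff)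
      then show "J \<in> {{}, {1}, {2}, {1, 2}}" by (rule subsets)
    qed
    have mem: "{1} \<in> ?D" "{2} \<in> ?D" using 1[of 1] 1[of 2] v by simp_all
    have without: "E = {p, q, r}" if "E \<subseteq> {p, q, r, t}" "p \<in> E" "q \<in> E" "r \<in> E" "t \<notin> E"
      for E and p q r t :: "nat set" using that by blast
    have full: "E = {p, q, r, t}" if "E \<subseteq> {p, q, r, t}" "p \<in> E" "q \<in> E" "r \<in> E" "t \<in> E"
      for E and p q r t :: "nat set" using that by blast
    show ?thesis
    proof (cases "{1, 2} \<in> ?D")
      case False
      have D: "?D = {{}, {1}, {2}}" by (rule without[OF s 0 mem False])
      have c: "card {{}, {1}, {2 :: nat}} = 3" by (simp add: card_insert_if subset_123_eq_iff)
      show ?thesis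
      proof (rule refl)
        show "standard_supp_class \<nu> (card ?D - 1) ?D" unfolding D c by (simp add: v standard_supp_class_def)
      qed
    next
      case True
      have D: "?D = {{}, {1}, {2}, {1, 2}}" by (rule full[OF s 0 mem True])
      have c: "card {{}, {1}, {2}, {1, 2 :: nat}} = 4" by (simp add: card_insert_if subset_123_eq_iff)
      show ?thesis
      proof (rule refl)
        show "standard_supp_class \<nu> (card ?D - 1) ?D" unfolding D c by (simp add: v standard_supp_class_def)
      qed
    qed
  next
    assume v: "\<nu> = 3"
    define D where "D = ?D"
    have set3: "{1..3} = {1, 2, 3 :: nat}" by auto
    have D_sub: "D \<subseteq> Pow {1, 2, 3}" using sub v set3 by (simp add: D_def)
    have mem: "{} \<in> D" "{1} \<in> D" "{2} \<in> D" "{3} \<in> D" using 0 1 v by (simp_all add: D_def)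
    have par: "{q \<in> {1..\<nu>}. odd (k q)} = parity_set k" for k :: "nat \<Rightarrow> int"
      unfolding v set3 parity_set_def by (rule iffD2[OF subset_123_eq_iff]) (blast, simp_all)
    obtain x y :: "nat \<Rightarrow> nat \<Rightarrow> int" and t E where inverse:
        "\<forall>r\<in>{1, 2, 3}. \<forall>q\<in>{1, 2, 3}. (\<Sum>p\<in>{1, 2, 3}. y r p * x p q) = (if r = q then 1 else 0)"
      and t: "parity_set t \<in> D" and x: "\<forall>r\<in>{1, 2, 3}. parity_set (\<lambda>q. x r q + t q) \<in> D"
      and E: "\<forall>J\<in>Pow {1, 2, 3}. parity_set (\<lambda>q. (\<Sum>r\<in>J. x r q) + t q) \<in> D \<longleftrightarrow> J \<in> E"
        "standard_supp_class 3 (card D - 1) E"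
      by (rule affine_normal_form_123[OF D_sub mem])
    note change = rank1_change_of_supp_class[OF data rank F.simply_laced_frame_axioms, of y x t, unfolded par, folded D_def]
    obtain Vd' S' \<alpha>' \<sigma>' where new: "simply_laced_data b R Vd' S' X \<alpha>' \<sigma>'" "similar_in (form_radical b) S S'"
      "\<And>J. J \<subseteq> {1..\<nu>} \<Longrightarrow> J \<in> supp_class \<nu> \<sigma>' S' \<longleftrightarrow> parity_set (\<lambda>q. (\<Sum>r\<in>J. x r q) + t q) \<in> D"
    proof (rule change)
      show "(\<Sum>p\<in>{1..\<nu>}. y r p * x p q) = (if r = q then 1 else 0)" if "r \<in> {1..\<nu>}" "q \<in> {1..\<nu>}" for r q
        using inverse that unfolding v set3 by blast
      show "parity_set t \<in> D" by (rule t)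
      show "parity_set (\<lambda>q. x r q + t q) \<in> D" if "r \<in> {1..\<nu>}" for r
        using x that unfolding v set3 by blast
    qed (rule that)
    interpret F': simply_laced_frame b Vd' "finite_part b Vd' R" "ade_rank X" \<alpha>' \<sigma>' \<nu> S' R
      unfolding \<nu> by (rule simply_laced_frame_if_data[OF new(1)])
    have E_sub: "E \<subseteq> Pow {1, 2, 3}" by (rule standard_supp_class_3_subset[OF E(2)])
    have new_sub: "supp_class \<nu> \<sigma>' S' \<subseteq> Pow {1, 2, 3}" using F'.D_subset unfolding v set3 by blast
    have new_E: "J \<in> supp_class \<nu> \<sigma>' S' \<longleftrightarrow> J \<in> E" if J: "J \<in> Pow {1, 2, 3}" for J
    proof -
      have "J \<subseteq> {1..\<nu>}" using J by (simp add: v set3)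
      from new(3)[OF this] bspec[OF E(1) J] show ?thesis by (rule trans)
    qed
    have supp: "supp_class \<nu> \<sigma>' S' = E"
    proof (rule subset_antisym; rule subsetI)
      fix J assume J: "J \<in> supp_class \<nu> \<sigma>' S'"
      show "J \<in> E" by (rule iffD1[OF new_E[OF subsetD[OF new_sub J]] J])
    next
      fix J assume J: "J \<in> E"
      show "J \<in> supp_class \<nu> \<sigma>' S'" by (rule iffD2[OF new_E[OF subsetD[OF E_sub J]] J])
    qed
    have index: "m = card D - 1" unfolding m sl_index_def D_def ..
    have "card E = m + 1" using card_standard_supp_class[OF E(2)] unfolding index .
    then have card_E: "card E - 1 = m" by (simp only: diff_add_inverse2)
    have std_E: "standard_supp_class \<nu> m E" unfolding index v by (rule E(2))
    have std: "standard_supp_class \<nu> m (supp_class \<nu> \<sigma>' S')" "sl_index \<nu> \<sigma>' S' = m"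
      unfolding sl_index_def supp by (rule std_E, rule card_E)
    show ?thesis
      by (intro exI[of _ Vd'] exI[of _ S'] exI[of _ \<alpha>'] exI[of _ \<sigma>'] conjI new(1,2) std)
  qed
qed

text \<open>All two-dimensional coordinate faces of a member of a standard supporting class belong to the class, so that
  \<open>F(S)\<close> is generated by powers of the single \<open>c\<^sub>r\<^sub>s\<close>.\<close>

lemma standard_star_condition:
  assumes data: "simply_laced_data b R Vd S X \<alpha> \<sigma>" and \<nu>: "\<nu> = nullity b"
    and std: "standard_supp_class \<nu> m (supp_class \<nu> \<sigma> S)"
  shows "star_condition b Vd S \<sigma>"
    and "(r, s) \<in> index_pairs \<nu> \<Longrightarrow> n_exp b Vd S \<sigma> r s = n_table \<nu> m r s"
proof -
  interpret F: simply_laced_frame b Vd "finite_part b Vd R" "ade_rank X" \<alpha> \<sigma> \<nu> S R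
    unfolding \<nu> by (rule simply_laced_frame_if_data[OF data])
  show "star_condition b Vd S \<sigma>"
    by (rule F.star_condition_if_pairs(1)) (erule (3) standard_supp_class_pairs[OF std])
  assume rs: "(r, s) \<in> index_pairs \<nu>"
  have "n_exp b Vd S \<sigma> r s = (if {r, s} \<in> supp_class \<nu> \<sigma> S then 1 else 2)"
    by (rule F.star_condition_if_pairs(2)[OF _ rs]) (erule (3) standard_supp_class_pairs[OF std])
  then show "n_exp b Vd S \<sigma> r s = n_table \<nu> m r s"
    unfolding standard_supp_class_n_table[OF std rs] .
qed

text \<open>The exponents \<open>N\<close> are a parameter, so that both the values \<open>n(r, s)\<close> of the frame and the tabulated ones, which
  agree with them only for \<open>r < s\<close>, can be used.\<close>

lemma standard_rank1_presentation:
  assumes data: "simply_laced_data b R Vd S X \<alpha> \<sigma>" and \<nu>: "\<nu> = nullity b" and rank: "ade_rank X = 1"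
    and std: "standard_supp_class \<nu> m (supp_class \<nu> \<sigma> S)"
    and N: "\<And>r s. (r, s) \<in> index_pairs \<nu> \<Longrightarrow> N r s = n_table \<nu> m r s"
    and rels: "rank1_rels \<nu> N \<subseteq> rels" "rels \<subseteq> rank1_rels \<nu> N \<union> rank1_xz_rels \<nu>"
    and xz: "rank1_xz_rels \<nu> \<subseteq> rels \<or> (\<forall>(r, s)\<in>index_pairs \<nu>. N r s = 2)"
  shows "weyl_group b Vd R \<cong> presented_group (rank1_gens \<nu>) rels"
proof -
  interpret F: simply_laced_frame b Vd "finite_part b Vd R" "ade_rank X" \<alpha> \<sigma> \<nu> S R
    unfolding \<nu> by (rule simply_laced_frame_if_data[OF data])
  note n = standard_star_condition[OF data \<nu> std]
  have N_n: "N r s = n_exp b Vd S \<sigma> r s" if "(r, s) \<in> index_pairs \<nu>" for r s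
    using N[OF that] n(2)[OF that] by simp
  have a: "of_int 2 = b (\<alpha> i) (\<alpha> j)" if "i \<in> {1..ade_rank X}" "j \<in> {1..ade_rank X}" for i j
  proof -
    have "i = 1" "j = 1" using that rank by auto
    then show ?thesis using F.simple_norm[of 1] rank by simp
  qed
  have dvd: "int (N r s) dvd 2" if "(r, s) \<in> index_pairs \<nu>" for r s
    unfolding N_n[OF that]
    using F.n_exp_properties(1)[OF that, of S] by (elim insertE emptyE) simp_all
  show ?thesis
    by (rule F.rank1_presentation_iso[where N = N and a = "\<lambda>_ _. 2", OF n(1) _ _ _ rank rels xz])
      (use N_n a dvd in blast)+
qed

text \<open>The reflections of the full space \<open>V \<oplus> V\<^sup>*\<close> do not refer to the complement of the radical, and the group
  that they generate is isomorphic to the Weyl group for every choice of the complement.\<close>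

lemma weyl_group_independent_of_frame:
  assumes "simply_laced_data b R Vd S X \<alpha> \<sigma>" "simply_laced_data b R Vd' S' X \<alpha>' \<sigma>'"
  shows "weyl_group b Vd R \<cong> weyl_group b Vd' R"
proof -
  interpret F: simply_laced_frame b Vd "finite_part b Vd R" "ade_rank X" \<alpha> \<sigma> "nullity b" S R
    by (rule simply_laced_frame_if_data[OF assms(1)])
  interpret F': simply_laced_frame b Vd' "finite_part b Vd' R" "ade_rank X" \<alpha>' \<sigma>' "nullity b" S' R
    by (rule simply_laced_frame_if_data[OF assms(2)])
  show ?thesis
    by (rule iso_trans[OF group.iso_sym[OF group.group_subgroup_generated[OF group_bijection_group]
          F.weyl_group_iso_full] F'.weyl_group_iso_full])
qed

theorem theorem4p2:
  fixes b :: "'v::euclidean_space \<Rightarrow> 'v \<Rightarrow> real"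
    and R Vd S :: "'v set" and X :: ade_type and \<alpha> \<sigma> :: "nat \<Rightarrow> 'v"
    and l \<nu> m :: nat and a :: "nat \<Rightarrow> nat \<Rightarrow> int"
  assumes "simply_laced_data b R Vd S X \<alpha> \<sigma>"
    and "l = ade_rank X" and "\<nu> = nullity b" and "m = sl_index \<nu> \<sigma> S"
    and "\<forall>i\<in>{1..l}. \<forall>j\<in>{1..l}. of_int (a i j) = b (\<alpha> i) (\<alpha> j)"
  shows
    "(star_condition b Vd S \<sigma> \<longrightarrow>
        weyl_group b Vd R \<cong> presented_group (weyl_gens l \<nu>)
          (weyl_rels l \<nu> a (n_exp b Vd S \<sigma>) \<union> xz_rels l \<nu>) \<and>
        (l > 1 \<or> (\<forall>(r, s)\<in>index_pairs \<nu>. n_exp b Vd S \<sigma> r s = 2) \<longrightarrow>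
          weyl_group b Vd R \<cong> presented_group (weyl_gens l \<nu>)
            (weyl_rels l \<nu> a (n_exp b Vd S \<sigma>)))) \<and>
     (l > 1 \<longrightarrow>
        (\<forall>(r, s)\<in>index_pairs \<nu>. n_exp b Vd S \<sigma> r s = 1) \<and> star_condition b Vd S \<sigma>) \<and>
     (l = 1 \<and> \<nu> \<le> 3 \<longrightarrow>
        (\<exists>Vd' S' \<alpha>' \<sigma>'. simply_laced_data b R Vd' S' X \<alpha>' \<sigma>' \<and>
           similar_in (form_radical b) S S' \<and> sl_index \<nu> \<sigma>' S' = m \<and>
           standard_supp_class \<nu> m (supp_class \<nu> \<sigma>' S')) \<and>
        (standard_supp_class \<nu> m (supp_class \<nu> \<sigma> S) \<longrightarrow>
           star_condition b Vd S \<sigma> \<and>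
           (\<forall>(r, s)\<in>index_pairs \<nu>. n_exp b Vd S \<sigma> r s = n_table \<nu> m r s) \<and>
           presented_group (weyl_gens l \<nu>) (weyl_rels l \<nu> a (n_exp b Vd S \<sigma>) \<union> xz_rels l \<nu>)
             \<cong> presented_group (rank1_gens \<nu>)
                 (rank1_rels \<nu> (n_exp b Vd S \<sigma>) \<union> rank1_xz_rels \<nu>)) \<and>
        weyl_group b Vd R \<cong> presented_group (rank1_gens \<nu>)
          (rank1_rels \<nu> (n_table \<nu> m) \<union> rank1_xz_rels \<nu>) \<and>
        ((\<forall>(r, s)\<in>index_pairs \<nu>. n_table \<nu> m r s = 2) \<longrightarrow>
           weyl_group b Vd R \<cong> presented_group (rank1_gens \<nu>) (rank1_rels \<nu> (n_table \<nu> m))))"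
proof -
  note data = assms(1) and l = assms(2) and \<nu> = assms(3) and m = assms(4)
  let ?n = "n_exp b Vd S \<sigma>"
  have ears: "ears b R" using data by (simp add: simply_laced_data_def)
  interpret F: simply_laced_frame b Vd "finite_part b Vd R" l \<alpha> \<sigma> \<nu> S R
    unfolding l \<nu> by (rule simply_laced_frame_if_data[OF data])
  have a: "of_int (a i j) = b (\<alpha> i) (\<alpha> j)" if "i \<in> {1..l}" "j \<in> {1..l}" for i j
    using assms(5) that by blast
  have one: "(1 :: nat) \<in> {1..l}" using F.rank_pos by simp
  have "real_of_int (a 1 1) = real_of_int 2" using a[OF one one] F.simple_norm[OF one] by simp
  then have a11: "a 1 1 = 2" by (simp only: of_int_eq_iff)
  have bounds: "r \<in> {1..\<nu>}" "s \<in> {1..\<nu>}" "r < s" if "(r, s) \<in> index_pairs \<nu>" for r s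
    using that by (auto simp: index_pairs_def)
  have higher_rank: "star_condition b Vd S \<sigma>" "\<And>r s. (r, s) \<in> index_pairs \<nu> \<Longrightarrow> ?n r s = 1" if l1: "1 < l"
  proof -
    have D: "{r, s} \<in> supp_class \<nu> \<sigma> S" if "r \<in> {1..\<nu>}" "s \<in> {1..\<nu>}" "r < s" for r s
      using F.in_D_iff[of "{r, s}"] F.sums_in_S[OF ears l1 that(1,2)] that by simp
    have pairs: "{r, s} \<in> supp_class \<nu> \<sigma> S"
      if "J \<in> supp_class \<nu> \<sigma> S" "r \<in> J" "s \<in> J" "r < s" for J r s
      using D[OF _ _ that(4)] F.D_subset that(1-3) by blast
    show "star_condition b Vd S \<sigma>" by (rule F.star_condition_if_pairs(1)) (erule (3) pairs)
    show "?n r s = 1" if rs: "(r, s) \<in> index_pairs \<nu>" for r s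
    proof -
      have "?n r s = (if {r, s} \<in> supp_class \<nu> \<sigma> S then 1 else 2)"
        by (rule F.star_condition_if_pairs(2)[OF _ rs]) (erule (3) pairs)
      then show ?thesis using D[OF bounds[OF rs]] by simp
    qed
  qed
  have dvd: "int (?n r s) dvd a i j" if "i \<in> {1..l}" "j \<in> {1..l}" "(r, s) \<in> index_pairs \<nu>" for i j r s
  proof (cases "1 < l")
    case True
    then show ?thesis using higher_rank(2)[OF True that(3)] by simp
  next
    case False
    then have "i = 1" "j = 1" using that(1,2) by auto
    then have "a i j = 2" using a11 by simp
    moreover have "int (?n r s) dvd 2"
      using F.n_exp_properties(1)[OF that(3), of S] by (elim insertE emptyE) simp_all
    ultimately show ?thesis by (simp only:)
  qed
  have presentation: "weyl_group b Vd R \<cong> presented_group (weyl_gens l \<nu>) rels"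
    if star: "star_condition b Vd S \<sigma>"
      and rels: "weyl_rels l \<nu> a ?n \<subseteq> rels" "rels \<subseteq> weyl_rels l \<nu> a ?n \<union> xz_rels l \<nu>"
      and xz: "xz_rels l \<nu> \<subseteq> rels \<or>
        (\<forall>(r, s)\<in>index_pairs \<nu>. \<exists>i\<in>{1..l}. \<exists>j\<in>{1..l}. \<bar>a i j div int (?n r s)\<bar> = 1)" for rels
    by (rule F.presentation_iso[where N = ?n and a = a, OF star _ _ _ rels xz]) (rule refl, erule (1) a, erule (2) dvd)
  have unit: "\<forall>(r, s)\<in>index_pairs \<nu>. \<exists>i\<in>{1..l}. \<exists>j\<in>{1..l}. \<bar>a i j div int (?n r s)\<bar> = 1"
    if two: "1 < l \<or> (\<forall>(r, s)\<in>index_pairs \<nu>. ?n r s = 2)"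
  proof (cases "1 < l")
    case True
    obtain i j where ij: "i \<in> {1..l}" "j \<in> {1..l}" "b (\<alpha> i) (\<alpha> j) = - 1"
      using F.adjacent_simple_roots[OF ears True] by blast
    have "real_of_int (a i j) = real_of_int (- 1)" using a[OF ij(1,2)] ij(3) by simp
    then have "a i j = - 1" by (simp only: of_int_eq_iff)
    then have "\<bar>a i j div int (?n r s)\<bar> = 1" if "(r, s) \<in> index_pairs \<nu>" for r s
      using higher_rank(2)[OF True that] by simp
    then show ?thesis using ij(1,2) by fast
  next
    case False
    with two have all: "\<forall>(r, s)\<in>index_pairs \<nu>. ?n r s = 2" by blast
    have "\<bar>a 1 1 div int (?n r s)\<bar> = 1" if "(r, s) \<in> index_pairs \<nu>" for r s
      using bspec[OF all that] a11 by simp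
    then show ?thesis using one by fast
  qed
  have full: "weyl_group b Vd R \<cong> presented_group (weyl_gens l \<nu>) (weyl_rels l \<nu> a ?n \<union> xz_rels l \<nu>)"
    if "star_condition b Vd S \<sigma>"
    by (rule presentation[OF that Un_upper1 order_refl disjI1[OF Un_upper2]])
  have normal: "\<exists>Vd' S' \<alpha>' \<sigma>'. simply_laced_data b R Vd' S' X \<alpha>' \<sigma>' \<and>
      similar_in (form_radical b) S S' \<and> sl_index \<nu> \<sigma>' S' = m \<and>
      standard_supp_class \<nu> m (supp_class \<nu> \<sigma>' S')" if "l = 1 \<and> \<nu> \<le> 3"
    using rank1_normal_form[OF data _ \<nu> _ m] that l by simp
  have table: "weyl_group b Vd R \<cong> presented_group (rank1_gens \<nu>) rels"
    if rank: "l = 1 \<and> \<nu> \<le> 3"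
      and rels: "rank1_rels \<nu> (n_table \<nu> m) \<subseteq> rels" "rels \<subseteq> rank1_rels \<nu> (n_table \<nu> m) \<union> rank1_xz_rels \<nu>"
      and xz: "rank1_xz_rels \<nu> \<subseteq> rels \<or> (\<forall>(r, s)\<in>index_pairs \<nu>. n_table \<nu> m r s = 2)" for rels
  proof -
    obtain Vd' S' \<alpha>' \<sigma>' where new: "simply_laced_data b R Vd' S' X \<alpha>' \<sigma>'"
        "standard_supp_class \<nu> m (supp_class \<nu> \<sigma>' S')"
      using normal[OF rank] by (elim exE conjE)
    have X: "ade_rank X = 1" using rank l by simp
    show ?thesis
      by (rule iso_trans[OF weyl_group_independent_of_frame[OF data new(1)]
            standard_rank1_presentation[OF new(1) \<nu> X new(2) refl rels xz]])
  qed
  show ?thesis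
  proof (intro conjI impI)
    assume star: "star_condition b Vd S \<sigma>"
    show "weyl_group b Vd R \<cong> presented_group (weyl_gens l \<nu>) (weyl_rels l \<nu> a ?n \<union> xz_rels l \<nu>)"
      by (rule full[OF star])
    assume "l > 1 \<or> (\<forall>(r, s)\<in>index_pairs \<nu>. ?n r s = 2)"
    then show "weyl_group b Vd R \<cong> presented_group (weyl_gens l \<nu>) (weyl_rels l \<nu> a ?n)"
      by (rule presentation[OF star order_refl Un_upper1 disjI2[OF unit]])
  next
    assume l1: "l > 1"
    show "\<forall>(r, s)\<in>index_pairs \<nu>. ?n r s = 1" using higher_rank(2)[OF l1] by fast
    show "star_condition b Vd S \<sigma>" by (rule higher_rank(1)[OF l1])
  next
    assume rank: "l = 1 \<and> \<nu> \<le> 3" and std: "standard_supp_class \<nu> m (supp_class \<nu> \<sigma> S)"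
    note n = standard_star_condition[OF data \<nu> std]
    have X: "ade_rank X = 1" using rank l by simp
    show star: "star_condition b Vd S \<sigma>" by (rule n(1))
    show "\<forall>(r, s)\<in>index_pairs \<nu>. ?n r s = n_table \<nu> m r s" using n(2) by fast
    have "weyl_group b Vd R \<cong> presented_group (rank1_gens \<nu>) (rank1_rels \<nu> ?n \<union> rank1_xz_rels \<nu>)"
      by (rule standard_rank1_presentation[OF data \<nu> X std n(2) Un_upper1 order_refl disjI1[OF Un_upper2]])
    then show "presented_group (weyl_gens l \<nu>) (weyl_rels l \<nu> a ?n \<union> xz_rels l \<nu>)
        \<cong> presented_group (rank1_gens \<nu>) (rank1_rels \<nu> ?n \<union> rank1_xz_rels \<nu>)"
      by (rule iso_trans[OF group.iso_sym[OF F.group_weyl_group full[OF star]]])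
  next
    assume rank: "l = 1 \<and> \<nu> \<le> 3"
    show "\<exists>Vd' S' \<alpha>' \<sigma>'. simply_laced_data b R Vd' S' X \<alpha>' \<sigma>' \<and>
        similar_in (form_radical b) S S' \<and> sl_index \<nu> \<sigma>' S' = m \<and>
        standard_supp_class \<nu> m (supp_class \<nu> \<sigma>' S')"
      by (rule normal[OF rank])
    show "weyl_group b Vd R \<cong> presented_group (rank1_gens \<nu>) (rank1_rels \<nu> (n_table \<nu> m) \<union> rank1_xz_rels \<nu>)"
      by (rule table[OF rank Un_upper1 order_refl disjI1[OF Un_upper2]])
    assume "\<forall>(r, s)\<in>index_pairs \<nu>. n_table \<nu> m r s = 2"
    then show "weyl_group b Vd R \<cong> presented_group (rank1_gens \<nu>) (rank1_rels \<nu> (n_table \<nu> m))"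
      by (rule table[OF rank order_refl Un_upper1 disjI2])
  qed
qed

end
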